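(* For all $p,q\in\Bbbk^\times$, the algebra $H_{p,q}$ is Artin–Schelter regular of global dimension three and Gelfand–Kirillov (GK) dimension three.
   Context: $\Bbbk$ is an uncountable, algebraically closed field of characteristic zero. For $p,q\in\Bbbk^\times$, $H_{p,q}$ is the $\Bbbk$-algebra $$H_{p,q}=\Bbbk\langle x,y,z\mid zx-p^{-1}xz,\ zy-pyz,\ yx-qxy-z\rangle .$$ It is a connected graded algebra with $\deg x=\deg y=1$ and $\deg z=2$. *)

theory Defs
  imports
    "HOL-Algebra.Embedded_Algebras"
    "HOL-Algebra.QuotRing"
    "HOL-Algebra.Module"
    "HOL-Algebra.Algebraic_Closure_Type"
    "HOL-Library.Poly_Mapping"
    "HOL-Library.Extended_Nat"
    "HOL-Library.Extended_Real"
    "HOL-Library.FuncSet"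
    "HOL-Library.Countable_Set"
begin

section \<open>The algebra \<open>H\<^bsub>p,q\<^esub>\<close>\<close>

text \<open>
  The free algebra on \<open>x, y, z\<close> is the monoid algebra of the free monoid on these letters. The free
  monoid is written additively because convolution on \<^typ>\<open>'a \<Rightarrow>\<^sub>0 'b\<close> is defined for additive
  (here: noncommutative) monoids \<^typ>\<open>'a\<close>.
\<close>

datatype letter = Lx | Ly | Lz

datatype word = Word (letters: "letter list")

instantiation word :: monoid_add
begin

definition zero_word :: word where
  "0 = Word []"

definition plus_word :: "word \<Rightarrow> word \<Rightarrow> word" where
  "u + v = Word (letters u @ letters v)"

instance
  by standard (simp_all add: zero_word_def plus_word_def)

end

type_synonym 'k free_alg = "word \<Rightarrow>\<^sub>0 'k"

definition scalar :: "'k \<Rightarrow> 'k::field free_alg" where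
  "scalar c = Poly_Mapping.single 0 c"

definition gen :: "letter \<Rightarrow> 'k::field free_alg" where
  "gen a = Poly_Mapping.single (Word [a]) 1"

definition H_relations :: "'k::field \<Rightarrow> 'k \<Rightarrow> 'k free_alg set" where
  "H_relations p q =
     {gen Lz * gen Lx - scalar (inverse p) * gen Lx * gen Lz,
      gen Lz * gen Ly - scalar p * gen Ly * gen Lz,
      gen Ly * gen Lx - scalar q * gen Lx * gen Ly - gen Lz}"

definition H_ideal :: "'k::field \<Rightarrow> 'k \<Rightarrow> 'k free_alg set" where
  "H_ideal p q = genideal ring_of_type_algebra (H_relations p q)"

definition H :: "'k::field \<Rightarrow> 'k \<Rightarrow> 'k free_alg set ring" where
  "H p q = ring_of_type_algebra Quot H_ideal p q"

definition H_class :: "'k::field \<Rightarrow> 'k \<Rightarrow> 'k free_alg \<Rightarrow> 'k free_alg set" where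
  "H_class p q a = H_ideal p q +>\<^bsub>ring_of_type_algebra\<^esub> a"

text \<open>The copy of the ground field inside \<open>H\<^bsub>p,q\<^esub>\<close>.\<close>

definition H_scalars :: "'k::field \<Rightarrow> 'k \<Rightarrow> 'k free_alg set set" where
  "H_scalars p q = range (\<lambda>c. H_class p q (scalar c))"

fun letter_degree :: "letter \<Rightarrow> nat" where
  "letter_degree Lx = 1"
| "letter_degree Ly = 1"
| "letter_degree Lz = 2"

definition word_degree :: "word \<Rightarrow> nat" where
  "word_degree w = sum_list (map letter_degree (letters w))"

definition H_grading :: "'k::field \<Rightarrow> 'k \<Rightarrow> nat \<Rightarrow> 'k free_alg set set" where
  "H_grading p q n = H_class p q ` {a. \<forall>w \<in> Poly_Mapping.keys a. word_degree w = n}"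


section \<open>Modules over noncommutative rings\<close>

text \<open>
  The record \<^typ>\<open>('a, 'b) module\<close> of \<open>HOL-Algebra\<close> is reused, but its locale requires a commutative
  ring of scalars. As there, the fields \<open>mult\<close> and \<open>one\<close> of a module carry no information.
  Right \<open>R\<close>-modules are left modules over \<open>opposite R\<close>.
\<close>

locale left_module = R?: ring R + M?: abelian_group M
  for R :: "('a, 'r) ring_scheme" (structure)
  and M :: "('a, 'b, 'm) module_scheme" (structure) +
  assumes lsmult_closed: "\<lbrakk>a \<in> carrier R; x \<in> carrier M\<rbrakk> \<Longrightarrow> a \<odot>\<^bsub>M\<^esub> x \<in> carrier M"
    and lsmult_l_distr: "\<lbrakk>a \<in> carrier R; b \<in> carrier R; x \<in> carrier M\<rbrakk> \<Longrightarrow>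
      (a \<oplus>\<^bsub>R\<^esub> b) \<odot>\<^bsub>M\<^esub> x = a \<odot>\<^bsub>M\<^esub> x \<oplus>\<^bsub>M\<^esub> b \<odot>\<^bsub>M\<^esub> x"
    and lsmult_r_distr: "\<lbrakk>a \<in> carrier R; x \<in> carrier M; y \<in> carrier M\<rbrakk> \<Longrightarrow>
      a \<odot>\<^bsub>M\<^esub> (x \<oplus>\<^bsub>M\<^esub> y) = a \<odot>\<^bsub>M\<^esub> x \<oplus>\<^bsub>M\<^esub> a \<odot>\<^bsub>M\<^esub> y"
    and lsmult_assoc: "\<lbrakk>a \<in> carrier R; b \<in> carrier R; x \<in> carrier M\<rbrakk> \<Longrightarrow>
      (a \<otimes>\<^bsub>R\<^esub> b) \<odot>\<^bsub>M\<^esub> x = a \<odot>\<^bsub>M\<^esub> (b \<odot>\<^bsub>M\<^esub> x)"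
    and lsmult_one: "x \<in> carrier M \<Longrightarrow> \<one>\<^bsub>R\<^esub> \<odot>\<^bsub>M\<^esub> x = x"

definition opposite :: "'a ring \<Rightarrow> 'a ring" where
  "opposite R = \<lparr>carrier = carrier R, monoid.mult = (\<lambda>a b. b \<otimes>\<^bsub>R\<^esub> a), one = \<one>\<^bsub>R\<^esub>,
                 zero = \<zero>\<^bsub>R\<^esub>, add = add R\<rparr>"

definition regular_module :: "'a ring \<Rightarrow> ('a, 'a) module" where
  "regular_module R = \<lparr>carrier = carrier R, monoid.mult = monoid.mult R, one = \<one>\<^bsub>R\<^esub>,
                       zero = \<zero>\<^bsub>R\<^esub>, add = add R, module.smult = monoid.mult R\<rparr>"

text \<open>Homomorphisms are extensional, so that equal homomorphisms are equal functions.\<close>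

definition lmod_hom :: "'a ring \<Rightarrow> ('a, 'b) module \<Rightarrow> ('a, 'c) module \<Rightarrow> ('b \<Rightarrow> 'c) set" where
  "lmod_hom R M N = {f \<in> carrier M \<rightarrow>\<^sub>E carrier N.
     (\<forall>x \<in> carrier M. \<forall>y \<in> carrier M. f (x \<oplus>\<^bsub>M\<^esub> y) = f x \<oplus>\<^bsub>N\<^esub> f y) \<and>
     (\<forall>a \<in> carrier R. \<forall>x \<in> carrier M. f (a \<odot>\<^bsub>M\<^esub> x) = a \<odot>\<^bsub>N\<^esub> f x)}"

definition quotient_module :: "('a, 'b) module \<Rightarrow> 'b set \<Rightarrow> ('a, 'b set) module" where
  "quotient_module M N = \<lparr>carrier = a_rcosets\<^bsub>M\<^esub> N, monoid.mult = undefined, one = undefined,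
     zero = N, add = set_add M, module.smult = (\<lambda>a S. \<Union>x\<in>S. N +>\<^bsub>M\<^esub> (a \<odot>\<^bsub>M\<^esub> x))\<rparr>"


section \<open>Projective dimension and global dimension\<close>

text \<open>
  HOL cannot quantify over all types inside a definition. The type \<^typ>\<open>'u\<close> below plays the role of a
  universe: modules whose carrier is a subset of \<^typ>\<open>'u\<close> are the modules of cardinality at most
  that of \<^typ>\<open>'u\<close>. If \<^typ>\<open>'u\<close> is infinite and at least as large as \<open>R\<close>, these are closed under
  submodules, quotients and under forming the free module on a given module, so the notions are the
  usual ones; results should be stated for every such \<^typ>\<open>'u\<close>.
\<close>

definition projective :: "'a ring \<Rightarrow> ('a, 'u) module \<Rightarrow> bool" where
  "projective R P \<longleftrightarrow> left_module R P \<and>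
     (\<forall>(M :: ('a, 'u) module) (N :: ('a, 'u) module) g f.
        left_module R M \<and> left_module R N \<and>
        g \<in> lmod_hom R M N \<and> g ` carrier M = carrier N \<and> f \<in> lmod_hom R P N \<longrightarrow>
        (\<exists>h \<in> lmod_hom R P M. \<forall>x \<in> carrier P. g (h x) = f x))"

text \<open>An exact sequence \<open>\<dots> \<rightarrow> P 1 \<rightarrow> P 0 \<rightarrow> M \<rightarrow> 0\<close>, where \<open>d n\<close> maps \<open>P (Suc n)\<close> to \<open>P n\<close>.\<close>

definition projective_resolution ::
  "'a ring \<Rightarrow> ('a, 'm) module \<Rightarrow> (nat \<Rightarrow> ('a, 'u) module) \<Rightarrow> (nat \<Rightarrow> 'u \<Rightarrow> 'u) \<Rightarrow> ('u \<Rightarrow> 'm) \<Rightarrow> bool"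
where
  "projective_resolution R M P d e \<longleftrightarrow>
     (\<forall>n. projective R (P n)) \<and>
     (\<forall>n. d n \<in> lmod_hom R (P (Suc n)) (P n)) \<and>
     e \<in> lmod_hom R (P 0) M \<and>
     e ` carrier (P 0) = carrier M \<and>
     d 0 ` carrier (P 1) = {x \<in> carrier (P 0). e x = \<zero>\<^bsub>M\<^esub>} \<and>
     (\<forall>n. d (Suc n) ` carrier (P (Suc (Suc n))) =
            {x \<in> carrier (P (Suc n)). d n x = \<zero>\<^bsub>P n\<^esub>})"

text \<open>The infimum of the empty set is \<open>\<infinity>\<close>.\<close>

definition proj_dim :: "'u itself \<Rightarrow> 'a ring \<Rightarrow> ('a, 'm) module \<Rightarrow> enat" where
  "proj_dim U R M = Inf {enat n | n. \<exists>(P :: nat \<Rightarrow> ('a, 'u) module) d e.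
     projective_resolution R M P d e \<and> (\<forall>i > n. carrier (P i) = {\<zero>\<^bsub>P i\<^esub>})}"

definition left_gl_dim :: "'u itself \<Rightarrow> 'a ring \<Rightarrow> enat" where
  "left_gl_dim U R = Sup {proj_dim U R M | M :: ('a, 'u) module. left_module R M}"

definition right_gl_dim :: "'u itself \<Rightarrow> 'a ring \<Rightarrow> enat" where
  "right_gl_dim U R = left_gl_dim U (opposite R)"


section \<open>Gradings\<close>

definition is_decomposition ::
  "('b, 'r) ring_scheme \<Rightarrow> ('i \<Rightarrow> 'b set) \<Rightarrow> 'b \<Rightarrow> ('i \<Rightarrow> 'b) \<Rightarrow> bool" where
  "is_decomposition M D x f \<longleftrightarrow> (\<forall>i. f i \<in> D i) \<and> finite {i. f i \<noteq> \<zero>\<^bsub>M\<^esub>} \<and>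
     x = finsum M f {i. f i \<noteq> \<zero>\<^bsub>M\<^esub>}"

definition is_direct_sum :: "('b, 'r) ring_scheme \<Rightarrow> ('i \<Rightarrow> 'b set) \<Rightarrow> bool" where
  "is_direct_sum M D \<longleftrightarrow> (\<forall>i. additive_subgroup (D i) M) \<and>
     (\<forall>x \<in> carrier M. \<exists>!f. is_decomposition M D x f)"

definition component :: "('b, 'r) ring_scheme \<Rightarrow> ('i \<Rightarrow> 'b set) \<Rightarrow> 'b \<Rightarrow> 'i \<Rightarrow> 'b" where
  "component M D x = (THE f. is_decomposition M D x f)"

text \<open>A \<open>K\<close>-algebra is a ring together with a central subfield \<open>K\<close>.\<close>

definition connected_graded_algebra :: "'a set \<Rightarrow> 'a ring \<Rightarrow> (nat \<Rightarrow> 'a set) \<Rightarrow> bool" where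
  "connected_graded_algebra K A G \<longleftrightarrow>
     ring A \<and> subfield K A \<and>
     (\<forall>c \<in> K. \<forall>a \<in> carrier A. c \<otimes>\<^bsub>A\<^esub> a = a \<otimes>\<^bsub>A\<^esub> c) \<and>
     is_direct_sum A G \<and>
     (\<forall>i j. \<forall>a \<in> G i. \<forall>b \<in> G j. a \<otimes>\<^bsub>A\<^esub> b \<in> G (i + j)) \<and>
     G 0 = K"

definition int_grading :: "'a ring \<Rightarrow> (nat \<Rightarrow> 'a set) \<Rightarrow> int \<Rightarrow> 'a set" where
  "int_grading A G i = (if 0 \<le> i then G (nat i) else {\<zero>\<^bsub>A\<^esub>})"

definition graded_module ::
  "'a ring \<Rightarrow> (nat \<Rightarrow> 'a set) \<Rightarrow> ('a, 'b) module \<Rightarrow> (int \<Rightarrow> 'b set) \<Rightarrow> bool" where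
  "graded_module A G M D \<longleftrightarrow> left_module A M \<and> is_direct_sum M D \<and>
     (\<forall>i j. \<forall>a \<in> G i. \<forall>x \<in> D j. a \<odot>\<^bsub>M\<^esub> x \<in> D (int i + j))"

definition graded_iso ::
  "'a ring \<Rightarrow> ('a, 'b) module \<Rightarrow> (int \<Rightarrow> 'b set) \<Rightarrow> ('a, 'c) module \<Rightarrow> (int \<Rightarrow> 'c set) \<Rightarrow> bool" where
  "graded_iso R M D N E \<longleftrightarrow> (\<exists>f \<in> lmod_hom R M N.
     bij_betw f (carrier M) (carrier N) \<and> (\<forall>i. f ` D i = E i))"

text \<open>The shift \<open>M(l)\<close> of a graded module, \<open>M(l)\<^sub>i = M\<^sub>l\<^sub>+\<^sub>i\<close>.\<close>

definition shift :: "int \<Rightarrow> (int \<Rightarrow> 'b set) \<Rightarrow> int \<Rightarrow> 'b set" where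
  "shift l D i = D (l + i)"

text \<open>
  The trivial module \<open>A / A\<^sub>>\<^sub>0\<close> of a connected graded algebra, realised on \<open>A\<^sub>0 = K\<close>: an element of \<open>A\<close>
  acts through its component of degree \<open>0\<close>.
\<close>

definition trivial_module :: "'a ring \<Rightarrow> (nat \<Rightarrow> 'a set) \<Rightarrow> ('a, 'a) module" where
  "trivial_module A G = \<lparr>carrier = G 0, monoid.mult = monoid.mult A, one = \<one>\<^bsub>A\<^esub>,
     zero = \<zero>\<^bsub>A\<^esub>, add = add A, module.smult = (\<lambda>a c. component A G a 0 \<otimes>\<^bsub>A\<^esub> c)\<rparr>"

definition trivial_grading :: "'a ring \<Rightarrow> (nat \<Rightarrow> 'a set) \<Rightarrow> int \<Rightarrow> 'a set" where
  "trivial_grading A G i = (if i = 0 then G 0 else {\<zero>\<^bsub>A\<^esub>})"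

definition graded_projective_resolution ::
  "'a ring \<Rightarrow> (nat \<Rightarrow> 'a set) \<Rightarrow> ('a, 'm) module \<Rightarrow> (int \<Rightarrow> 'm set) \<Rightarrow>
   (nat \<Rightarrow> ('a, 'u) module) \<Rightarrow> (nat \<Rightarrow> int \<Rightarrow> 'u set) \<Rightarrow> (nat \<Rightarrow> 'u \<Rightarrow> 'u) \<Rightarrow> ('u \<Rightarrow> 'm) \<Rightarrow> bool"
where
  "graded_projective_resolution A G M E P D d e \<longleftrightarrow>
     projective_resolution A M P d e \<and>
     (\<forall>n. graded_module A G (P n) (D n)) \<and>
     (\<forall>n i. d n ` D (Suc n) i \<subseteq> D n i) \<and>
     (\<forall>i. e ` D 0 i \<subseteq> E i)"


section \<open>Graded \<open>Ext\<close> groups with values in \<open>A\<close>\<close>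

definition hom_degree ::
  "'a ring \<Rightarrow> (nat \<Rightarrow> 'a set) \<Rightarrow> ('a, 'u) module \<Rightarrow> (int \<Rightarrow> 'u set) \<Rightarrow> int \<Rightarrow> ('u \<Rightarrow> 'a) set" where
  "hom_degree A G P D j = {f \<in> lmod_hom A P (regular_module A).
     \<forall>i. f ` D i \<subseteq> int_grading A G (i + j)}"

text \<open>
  The graded dual of \<open>P\<close>, consisting of the finite sums of homogeneous homomorphisms \<open>P \<rightarrow> A\<close>. It is
  a right \<open>A\<close>-module via \<open>(f \<cdot> a)(x) = f(x) a\<close>, hence a left module over \<open>opposite A\<close>.
\<close>

definition graded_dual ::
  "'a ring \<Rightarrow> (nat \<Rightarrow> 'a set) \<Rightarrow> ('a, 'u) module \<Rightarrow> (int \<Rightarrow> 'u set) \<Rightarrow> ('a, 'u \<Rightarrow> 'a) module" where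
  "graded_dual A G P D = \<lparr>carrier = {f \<in> lmod_hom A P (regular_module A).
        \<exists>S h. finite S \<and> (\<forall>j \<in> S. h j \<in> hom_degree A G P D j) \<and>
          (\<forall>x \<in> carrier P. f x = finsum A (\<lambda>j. h j x) S)},
     monoid.mult = undefined, one = undefined,
     zero = (\<lambda>x \<in> carrier P. \<zero>\<^bsub>A\<^esub>),
     add = (\<lambda>f g. \<lambda>x \<in> carrier P. f x \<oplus>\<^bsub>A\<^esub> g x),
     module.smult = (\<lambda>a f. \<lambda>x \<in> carrier P. f x \<otimes>\<^bsub>A\<^esub> a)\<rparr>"

definition ext_cocycles ::
  "'a ring \<Rightarrow> (nat \<Rightarrow> 'a set) \<Rightarrow> (nat \<Rightarrow> ('a, 'u) module) \<Rightarrow> (nat \<Rightarrow> int \<Rightarrow> 'u set) \<Rightarrow>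
   (nat \<Rightarrow> 'u \<Rightarrow> 'u) \<Rightarrow> nat \<Rightarrow> ('u \<Rightarrow> 'a) set" where
  "ext_cocycles A G P D d n =
     {f \<in> carrier (graded_dual A G (P n) (D n)). \<forall>x \<in> carrier (P (Suc n)). f (d n x) = \<zero>\<^bsub>A\<^esub>}"

fun ext_coboundaries ::
  "'a ring \<Rightarrow> (nat \<Rightarrow> 'a set) \<Rightarrow> (nat \<Rightarrow> ('a, 'u) module) \<Rightarrow> (nat \<Rightarrow> int \<Rightarrow> 'u set) \<Rightarrow>
   (nat \<Rightarrow> 'u \<Rightarrow> 'u) \<Rightarrow> nat \<Rightarrow> ('u \<Rightarrow> 'a) set" where
  "ext_coboundaries A G P D d 0 = {\<zero>\<^bsub>graded_dual A G (P 0) (D 0)\<^esub>}"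
| "ext_coboundaries A G P D d (Suc n) =
     (\<lambda>g. \<lambda>x \<in> carrier (P (Suc n)). g (d n x)) ` carrier (graded_dual A G (P n) (D n))"

definition ext_module ::
  "'a ring \<Rightarrow> (nat \<Rightarrow> 'a set) \<Rightarrow> (nat \<Rightarrow> ('a, 'u) module) \<Rightarrow> (nat \<Rightarrow> int \<Rightarrow> 'u set) \<Rightarrow>
   (nat \<Rightarrow> 'u \<Rightarrow> 'u) \<Rightarrow> nat \<Rightarrow> ('a, ('u \<Rightarrow> 'a) set) module" where
  "ext_module A G P D d n =
     quotient_module (graded_dual A G (P n) (D n) \<lparr>carrier := ext_cocycles A G P D d n\<rparr>)
       (ext_coboundaries A G P D d n)"

definition ext_grading ::
  "'a ring \<Rightarrow> (nat \<Rightarrow> 'a set) \<Rightarrow> (nat \<Rightarrow> ('a, 'u) module) \<Rightarrow> (nat \<Rightarrow> int \<Rightarrow> 'u set) \<Rightarrow>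
   (nat \<Rightarrow> 'u \<Rightarrow> 'u) \<Rightarrow> nat \<Rightarrow> int \<Rightarrow> ('u \<Rightarrow> 'a) set set" where
  "ext_grading A G P D d n j =
     (\<lambda>f. ext_coboundaries A G P D d n +>\<^bsub>graded_dual A G (P n) (D n)\<^esub> f) `
       (ext_cocycles A G P D d n \<inter> hom_degree A G (P n) (D n) j)"

text \<open>
  The Gorenstein condition for left modules: \<open>Ext\<^sup>n(K, A)\<close> is \<open>0\<close> for \<open>n \<noteq> c\<close> and is \<open>K(l)\<close> as a graded
  right module for \<open>n = c\<close>. The groups \<open>Ext\<^sup>n(K, A)\<close> are computed from a graded projective
  resolution of \<open>K\<close>; up to isomorphism they do not depend on its choice.
\<close>

definition left_Gorenstein ::
  "'u itself \<Rightarrow> 'a ring \<Rightarrow> (nat \<Rightarrow> 'a set) \<Rightarrow> nat \<Rightarrow> int \<Rightarrow> bool" where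
  "left_Gorenstein U A G c l \<longleftrightarrow>
     (\<exists>(P :: nat \<Rightarrow> ('a, 'u) module) D d e.
        graded_projective_resolution A G (trivial_module A G) (trivial_grading A G) P D d e \<and>
        (\<forall>n. n \<noteq> c \<longrightarrow>
           carrier (ext_module A G P D d n) = {\<zero>\<^bsub>ext_module A G P D d n\<^esub>}) \<and>
        graded_iso (opposite A) (ext_module A G P D d c) (ext_grading A G P D d c)
          (trivial_module (opposite A) G) (shift l (trivial_grading (opposite A) G)))"


section \<open>Gelfand--Kirillov dimension and Artin--Schelter regularity\<close>

text \<open>
  The subspace \<open>K + V + V\<^sup>2 + \<dots> + V\<^sup>n\<close>. (In \<open>HOL-Algebra\<close>, \<^const>\<open>subalgebra\<close> is the notion of a
  \<open>K\<close>-subspace, with no closure under multiplication.)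
\<close>

definition power_span :: "'a set \<Rightarrow> 'a ring \<Rightarrow> 'a set \<Rightarrow> nat \<Rightarrow> 'a set" where
  "power_span K A V n = \<Inter>{W. subalgebra K W A \<and>
     {foldr (monoid.mult A) vs \<one>\<^bsub>A\<^esub> | vs. set vs \<subseteq> V \<and> length vs \<le> n} \<subseteq> W}"

definition GK_dim :: "'a set \<Rightarrow> 'a ring \<Rightarrow> ereal" where
  "GK_dim K A = (SUP V \<in> {V. subalgebra K V A \<and> ring.finite_dimension A K V}.
     limsup (\<lambda>n. ereal (log (real n) (real (ring.dim A K (power_span K A V n))))))"

definition AS_regular :: "'u itself \<Rightarrow> 'a set \<Rightarrow> 'a ring \<Rightarrow> (nat \<Rightarrow> 'a set) \<Rightarrow> bool" where
  "AS_regular U K A G \<longleftrightarrow>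
     connected_graded_algebra K A G \<and> GK_dim K A < \<infinity> \<and>
     (\<exists>c l. left_gl_dim U A = enat c \<and> right_gl_dim U A = enat c \<and>
        left_Gorenstein U A G c l \<and> left_Gorenstein U (opposite A) G c l)"

end

theory Submission
  imports Defs "HOL-Library.Function_Algebras"
begin

text \<open>
  Write \<open>A\<close> for \<open>H\<^bsub>p,q\<^esub>\<close>. With the relations read as rewriting rules, every word
  becomes a combination of ordered words \<open>x\<^sup>i z\<^sup>j y\<^sup>k\<close>. The left multiplications that this predicts on
  coefficient functions satisfy the relations, so that the free algebra acts on these functions and
  the ordered words are a basis of \<open>A\<close> (\<open>PBW_H\<close>). All further arguments concern a ring \<open>R\<close> with such
  a basis (locale \<open>PBW\<close>). Reversing words and exchanging \<open>x\<close> and \<open>y\<close> shows that \<open>R\<close> and its opposite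
  are both of this kind (\<open>PBW_opposite\<close>); hence it suffices to treat left modules.

  Global dimension. Every module \<open>V\<close> has a resolution
  \<open>0 \<rightarrow> A \<otimes> V \<rightarrow> (A \<otimes> V)\<^sup>3 \<rightarrow> (A \<otimes> V)\<^sup>3 \<rightarrow> A \<otimes> V \<rightarrow> V \<rightarrow> 0\<close>, of Koszul type: the three copies of \<open>A \<otimes> V\<close>
  stand for the generators and for the relations, the last one for the overlap \<open>z y x\<close> of the
  relations. Elements of \<open>A \<otimes> V\<close> are coefficient functions with values in \<open>V\<close>, and exactness is
  division with remainder in one variable at a time: for an operator \<open>T\<close> on \<open>V\<close>, the map \<open>t - T\<close> on
  \<open>V[t]\<close> is injective and its image is the kernel of the substitution of \<open>T\<close> for \<open>t\<close>. This is
  applied to \<open>y\<close>, then to \<open>z\<close> modulo \<open>y\<close>, then to \<open>x\<close> modulo both (\<open>ev3_kernel\<close>, \<open>D1_exact\<close>,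
  \<open>D2_exact\<close>). The terms are free, hence projective (\<open>lifting_FM\<close>), so all projective dimensions are
  at most \<open>3\<close>. For the trivial module, the entries of the last differential have no constant term.
  If a shorter resolution existed, then comparing it with this one would show that the identity in
  degree \<open>3\<close> factors through the last differential, which is impossible (\<open>no_retraction\<close>).

  Modules in the definitions have elements in a type \<open>'u\<close> that contains \<open>A\<close>. The field is
  uncountable, so \<open>'u\<close> is infinite, and it contains copies of all finitely supported functions that
  occur in the resolution of a module with elements in \<open>'u\<close> (\<open>finite_support_inj\<close>). Free modules are
  built from functions and moved into \<open>'u\<close> along such injections.

  Gorenstein condition. For the trivial module, the dual of the resolution is a complex of left
  multiplications by matrices in \<open>x\<close>, \<open>y\<close>, \<open>z\<close> on \<open>A\<close>. It is exact except in degree \<open>3\<close>, where its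
  cokernel is \<open>A / (x A + y A + z A)\<close>, the field, in degree \<open>-4\<close> (\<open>exactness\<close>, \<open>ext_top\<close>).

  Gelfand--Kirillov dimension. The number of ordered words of degree at most \<open>n\<close> grows like \<open>n\<^sup>3\<close>,
  which bounds the dimensions of the powers of a finite-dimensional subspace from above, and for the
  space of elements of degree at most \<open>2\<close> also from below (\<open>GK_dim_eq_3\<close>).
\<close>

section \<open>Polynomials with an operator substituted for the variable\<close>

text \<open>
  The value at an operator \<open>T\<close> of the polynomial with coefficients \<open>f k\<close> in the group: a left-sided
  substitution, \<open>\<Sum> T\<^sup>k (f k)\<close>.
\<close>

definition ev1 :: "('v \<Rightarrow> 'v) \<Rightarrow> (nat \<Rightarrow> 'v::ab_group_add) \<Rightarrow> 'v" where
  "ev1 T f = (\<Sum>k \<in> {k. f k \<noteq> 0}. (T ^^ k) (f k))"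

text \<open>
  On coefficients, this is multiplication by the variable.
\<close>

definition shft :: "(nat \<Rightarrow> 'v::zero) \<Rightarrow> nat \<Rightarrow> 'v" where
  "shft f = case_nat 0 f"

lemma shft_simps [simp]: "shft f 0 = 0" "shft f (Suc k) = f k"
  by (simp_all add: shft_def)

definition fin :: "(nat \<Rightarrow> 'v::zero) \<Rightarrow> bool" where
  "fin f \<longleftrightarrow> (\<exists>N. \<forall>k\<ge>N. f k = 0)"

lemma finI: "(\<And>k. k \<ge> N \<Longrightarrow> f k = 0) \<Longrightarrow> fin f"
  by (auto simp: fin_def)

lemma fin_shft: "fin f \<Longrightarrow> fin (shft f)"
  unfolding fin_def by (metis Suc_le_D Suc_le_mono shft_simps(2))

lemma fin_shift: "fin f \<Longrightarrow> fin (\<lambda>k. f (k + n))"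
  unfolding fin_def by (meson le_add1 le_trans)

lemma additive_funpow:
  fixes T :: "'v::ab_group_add \<Rightarrow> 'v"
  shows "additive T \<Longrightarrow> additive (T ^^ k)"
  by (induction k) (auto simp: additive_def)

lemma ev1_eq_sum:
  assumes "additive T" "\<And>k. k \<ge> N \<Longrightarrow> f k = 0"
  shows "ev1 T f = (\<Sum>k<N. (T ^^ k) (f k))"
proof -
  have "{k. f k \<noteq> 0} \<subseteq> {..<N}" using assms(2) by (metis (mono_tags) lessThan_iff mem_Collect_eq not_less subsetI)
  then show ?thesis
    unfolding ev1_def
    by (intro sum.mono_neutral_left) (auto simp: additive.zero[OF additive_funpow[OF assms(1)]])
qed

lemma ev1_zero [simp]: "ev1 T (\<lambda>k. 0) = 0"
  by (simp add: ev1_def)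

lemma ev1_single:
  assumes "additive T"
  shows "ev1 T (\<lambda>k. if k = a then v else 0) = (T ^^ a) v"
proof -
  have "ev1 T (\<lambda>k. if k = a then v else 0) = (\<Sum>k<Suc a. (T ^^ k) (if k = a then v else 0))"
    by (rule ev1_eq_sum[OF assms]) auto
  also have "\<dots> = (T ^^ a) v"
    by (simp add: additive.zero[OF additive_funpow[OF assms]])
  finally show ?thesis .
qed

lemma ev1_add:
  assumes "additive T" "fin f" "fin g"
  shows "ev1 T (\<lambda>k. f k + g k) = ev1 T f + ev1 T g"
proof -
  obtain N M where N: "\<forall>k\<ge>N. f k = 0" "\<forall>k\<ge>M. g k = 0" using assms unfolding fin_def by blast
  define L where "L = max N M"
  have L: "\<And>k. k \<ge> L \<Longrightarrow> f k = 0" "\<And>k. k \<ge> L \<Longrightarrow> g k = 0" using N by (auto simp: L_def)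
  have "\<And>k. k \<ge> L \<Longrightarrow> f k + g k = 0" using L by auto
  then show ?thesis
    using L by (simp add: ev1_eq_sum[OF assms(1), of L] additive.add[OF additive_funpow[OF assms(1)]] sum.distrib)
qed

lemma ev1_shft:
  assumes "additive T" "fin f"
  shows "ev1 T (shft f) = T (ev1 T f)"
proof -
  obtain N where N: "\<And>k. k \<ge> N \<Longrightarrow> f k = 0" using assms unfolding fin_def by blast
  have "ev1 T (shft f) = (\<Sum>k<Suc N. (T ^^ k) (shft f k))"
    by (rule ev1_eq_sum[OF assms(1)]) (metis N Suc_le_D Suc_le_mono shft_simps(2))
  also have "\<dots> = (\<Sum>k<N. T ((T ^^ k) (f k)))"
    by (simp add: sum.lessThan_Suc_shift del: sum.lessThan_Suc)
  also have "\<dots> = T (ev1 T f)"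
    by (simp add: ev1_eq_sum[OF assms(1), of N f] N additive.sum[OF assms(1)])
  finally show ?thesis .
qed

text \<open>
  One step of Horner's scheme.
\<close>

lemma ev1_unfold:
  assumes "additive T" "fin f"
  shows "ev1 T f = f 0 + T (ev1 T (\<lambda>k. f (Suc k)))"
proof -
  have f: "f = (\<lambda>k. (if k = 0 then f 0 else 0) + shft (\<lambda>k. f (Suc k)) k)"
  proof
    fix k show "f k = (if k = 0 then f 0 else 0) + shft (\<lambda>k. f (Suc k)) k" by (cases k) simp_all
  qed
  have fs: "fin (\<lambda>k. f (Suc k))" using fin_shift[OF assms(2), of 1] by simp
  have f0: "fin (\<lambda>k. if k = 0 then f 0 else 0)" by (rule finI[of 1]) simp
  have "ev1 T f = ev1 T (\<lambda>k. if k = 0 then f 0 else 0) + ev1 T (shft (\<lambda>k. f (Suc k)))"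
    using arg_cong[OF f, of "ev1 T"] ev1_add[OF assms(1) f0 fin_shft[OF fs]] by (rule trans)
  then show ?thesis
    by (simp add: ev1_single[OF assms(1)] ev1_shft[OF assms(1) fs])
qed

text \<open>
  An operator \<open>U\<close> with \<open>U T = T' U\<close> carries the substitution of \<open>T\<close> to the substitution of \<open>T'\<close>.
\<close>

lemma ev1_intertwine:
  assumes "additive T" "additive T'" "additive U" "fin f" "\<And>v. U (T v) = T' (U v)"
  shows "U (ev1 T f) = ev1 T' (\<lambda>k. U (f k))"
proof -
  obtain N where N: "\<And>k. k \<ge> N \<Longrightarrow> f k = 0" using assms unfolding fin_def by blast
  have pow: "U ((T ^^ k) v) = (T' ^^ k) (U v)" for k v
    by (induction k) (simp_all add: assms(5))
  have "U (f k) = 0" if "k \<ge> N" for k using N[OF that] additive.zero[OF assms(3)] by simp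
  then show ?thesis
    by (simp add: ev1_eq_sum[OF assms(1), of N f] ev1_eq_sum[OF assms(2), of N] N
        additive.sum[OF assms(3)] pow)
qed

lemma ev1_in:
  assumes "\<And>v. v \<in> S \<Longrightarrow> T v \<in> S" "0 \<in> S" "\<And>u v. u \<in> S \<Longrightarrow> v \<in> S \<Longrightarrow> u + v \<in> S" "\<And>k. f k \<in> S"
  shows "ev1 T f \<in> S"
proof -
  have "(T ^^ k) v \<in> S" if "v \<in> S" for k v
    using that by (induction k) (auto simp: assms(1))
  then have "sum (\<lambda>k. (T ^^ k) (f k)) A \<in> S" for A
    by (induction A rule: infinite_finite_induct) (auto simp: assms)
  then show ?thesis by (simp add: ev1_def)
qed

text \<open>
  The sequence \<open>0 \<rightarrow> V[t] \<rightarrow> V[t] \<rightarrow> V\<close> whose maps are \<open>t - T\<close> and the substitution of \<open>T\<close> for \<open>t\<close> is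
  exact. Injectivity of \<open>t - T\<close> compares top coefficients. For exactness in the middle, a polynomial
  in the kernel of the substitution is divided by \<open>t - T\<close> with Horner's scheme; the intermediate
  results of the scheme are the coefficients of the quotient, and its last result, the remainder, is
  the value at \<open>T\<close>.
\<close>

lemma shft_eq_imp_zero:
  assumes "fin f" "T 0 = 0" "\<And>k. shft f k = T (f k)"
  shows "f k = 0"
proof -
  obtain N where N: "\<forall>k\<ge>N. f k = 0" using assms unfolding fin_def by blast
  have "\<forall>k\<ge>N - n. f k = 0" for n
  proof (induction n)
    case (Suc n)
    show ?case
    proof (intro allI impI)
      fix k assume "N - Suc n \<le> k"
      then have "f (Suc k) = 0" using Suc by auto
      then show "f k = 0" using assms(2) assms(3)[of "Suc k"] by simp
    qed
  qed (use N in simp)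
  from this[of N] show ?thesis by simp
qed

definition horner :: "('v \<Rightarrow> 'v) \<Rightarrow> (nat \<Rightarrow> 'v::ab_group_add) \<Rightarrow> nat \<Rightarrow> 'v" where
  "horner T f = (\<lambda>k. ev1 T (\<lambda>m. f (m + Suc k)))"

lemma horner_divides:
  assumes "additive T" "fin f" "ev1 T f = 0"
  shows "f k = shft (horner T f) k - T (horner T f k)"
proof -
  have u: "ev1 T (\<lambda>m. f (m + k)) = f k + T (horner T f k)"
    using ev1_unfold[OF assms(1) fin_shift[OF assms(2), of k]] by (simp add: horner_def)
  show ?thesis
  proof (cases k)
    case 0
    then have "0 = f 0 + T (horner T f 0)" using u assms(3) by simp
    then show ?thesis using 0 by (simp add: eq_neg_iff_add_eq_0)
  next
    case (Suc k')
    then have "horner T f k' = f k + T (horner T f k)" using u by (simp add: horner_def)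
    then show ?thesis using Suc by simp
  qed
qed

lemma horner_bound:
  assumes "\<And>k. k \<ge> N \<Longrightarrow> f k = 0" "k \<ge> N"
  shows "horner T f k = 0"
proof -
  have "f (m + Suc k) = 0" for m by (rule assms(1)) (use assms(2) in simp)
  then show ?thesis by (simp only: horner_def ev1_zero)
qed

section \<open>Coefficient functions of the PBW basis\<close>

text \<open>
  The coefficients \<open>c\<^sub>n\<close> in \<open>y x\<^sup>n = q\<^sup>n x\<^sup>n y + c\<^sub>n x\<^sup>n\<^sup>-\<^sup>1 z\<close>, the rule that moves \<open>y\<close> to the right of
  \<open>x\<^sup>n\<close>.
\<close>

primrec qc :: "'k::field \<Rightarrow> 'k \<Rightarrow> nat \<Rightarrow> 'k" where
  "qc p q 0 = 0"
| "qc p q (Suc n) = q ^ n + inverse p * qc p q n"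

text \<open>
  The function \<open>f\<close> stands for \<open>\<Sum> x\<^sup>i z\<^sup>j y\<^sup>k \<otimes> f i j k\<close>. With values in the field these are the
  elements of the algebra, with values in a vector space \<open>V\<close> those of the free module \<open>A \<otimes> V\<close>.
\<close>

type_synonym 'v pbw = "nat \<Rightarrow> nat \<Rightarrow> nat \<Rightarrow> 'v"

definition Fin :: "'v::zero set \<Rightarrow> 'v pbw set" where
  "Fin S = {f. (\<forall>i j k. f i j k \<in> S) \<and> (\<exists>N. \<forall>i j k. N \<le> i + j + k \<longrightarrow> f i j k = 0)}"

definition single3 :: "nat \<Rightarrow> nat \<Rightarrow> nat \<Rightarrow> 'v::zero \<Rightarrow> 'v pbw" where
  "single3 a b c v = (\<lambda>i j k. if i = a \<and> j = b \<and> k = c then v else 0)"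

text \<open>
  Reversing the factors of a monomial and exchanging \<open>x\<close> and \<open>y\<close> maps the defining relations to each
  other, so this is an anti-automorphism of the algebra. It turns left multiplications into right
  multiplications.
\<close>

definition flip :: "'v pbw \<Rightarrow> 'v pbw" where
  "flip f = (\<lambda>i j k. f k j i)"

definition lift :: "('v \<Rightarrow> 'w) \<Rightarrow> 'v pbw \<Rightarrow> 'w pbw" where
  "lift T f = (\<lambda>i j k. T (f i j k))"

text \<open>
  The functions \<open>opx\<close>, \<open>opz\<close>, \<open>opy\<close> are the left multiplications by \<open>x\<close>, \<open>z\<close>, \<open>y\<close>: the new factor is
  moved to its place in \<open>x\<^sup>i z\<^sup>j y\<^sup>k\<close> with \<open>z x = p\<^sup>-\<^sup>1 x z\<close>, \<open>y z = p\<^sup>-\<^sup>1 z y\<close> and the rule for \<open>y x\<^sup>n\<close>.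
  The functions \<open>rx\<close>, \<open>ry\<close>, \<open>rz\<close> are the right multiplications.
\<close>

definition opx :: "'v::zero pbw \<Rightarrow> 'v pbw" where
  "opx f = (\<lambda>i j k. case i of 0 \<Rightarrow> 0 | Suc i' \<Rightarrow> f i' j k)"

definition opz :: "('k::field \<Rightarrow> 'v::zero \<Rightarrow> 'v) \<Rightarrow> 'k \<Rightarrow> 'v pbw \<Rightarrow> 'v pbw" where
  "opz sc p f = (\<lambda>i j k. case j of 0 \<Rightarrow> 0 | Suc j' \<Rightarrow> sc (inverse p ^ i) (f i j' k))"

definition opy :: "('k::field \<Rightarrow> 'v::ab_group_add \<Rightarrow> 'v) \<Rightarrow> 'k \<Rightarrow> 'k \<Rightarrow> 'v pbw \<Rightarrow> 'v pbw" where
  "opy sc p q f = (\<lambda>i j k.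
     (case k of 0 \<Rightarrow> 0 | Suc k' \<Rightarrow> sc (q ^ i * inverse p ^ j) (f i j k')) +
     (case j of 0 \<Rightarrow> 0 | Suc j' \<Rightarrow> sc (qc p q (Suc i)) (f (Suc i) j' k)))"

definition rx :: "('k::field \<Rightarrow> 'v::ab_group_add \<Rightarrow> 'v) \<Rightarrow> 'k \<Rightarrow> 'k \<Rightarrow> 'v pbw \<Rightarrow> 'v pbw" where
  "rx sc p q f = flip (opy sc p q (flip f))"

definition ry :: "'v::zero pbw \<Rightarrow> 'v pbw" where
  "ry f = flip (opx (flip f))"

definition rz :: "('k::field \<Rightarrow> 'v::ab_group_add \<Rightarrow> 'v) \<Rightarrow> 'k \<Rightarrow> 'v pbw \<Rightarrow> 'v pbw" where
  "rz sc p f = flip (opz sc p (flip f))"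

lemmas op_defs = opx_def opy_def opz_def rx_def ry_def rz_def flip_def

lemma FinI:
  "(\<And>i j k. f i j k \<in> S) \<Longrightarrow> (\<And>i j k. N \<le> i + j + k \<Longrightarrow> f i j k = 0) \<Longrightarrow> f \<in> Fin S"
  unfolding Fin_def by blast

lemma FinE:
  assumes "f \<in> Fin S"
  obtains N where "\<And>i j k. f i j k \<in> S" "\<And>i j k. N \<le> i + j + k \<Longrightarrow> f i j k = 0"
  using assms unfolding Fin_def by blast

lemma Fin_mem: "f \<in> Fin S \<Longrightarrow> f i j k \<in> S"
  unfolding Fin_def by blast

lemma flip_flip [simp]: "flip (flip f) = f" by (simp add: flip_def)

lemma flip_Fin [simp]: "flip f \<in> Fin S \<longleftrightarrow> f \<in> Fin S"
proof -
  have "flip f \<in> Fin S" if f: "f \<in> Fin S" for f :: "'a pbw"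
  proof -
    obtain N where N: "\<And>i j k. f i j k \<in> S" "\<And>i j k. N \<le> i + j + k \<Longrightarrow> f i j k = 0"
      using FinE[OF f] by metis
    show ?thesis by (rule FinI[of _ _ N]) (auto simp: flip_def N add_ac)
  qed
  from this[of f] this[of "flip f"] show ?thesis by auto
qed

lemma flip_add: "flip (f + g) = flip f + flip g"
  by (simp add: flip_def fun_eq_iff)

text \<open>
  By induction on the number of nonzero coefficients, an additive property needs to be checked on
  monomials only.
\<close>

lemma Fin_induct [consumes 1, case_names zero single add]:
  fixes f :: "'v::ab_group_add pbw"
  assumes f: "f \<in> Fin S" and S: "0 \<in> S"
    and zero: "P 0"
    and single: "\<And>a b c v. v \<in> S \<Longrightarrow> P (single3 a b c v)"
    and add: "\<And>f g. f \<in> Fin S \<Longrightarrow> g \<in> Fin S \<Longrightarrow> P f \<Longrightarrow> P g \<Longrightarrow> P (f + g)"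
  shows "P f"
proof -
  let ?s = "\<lambda>f :: 'v pbw. {(i,j,k). f i j k \<noteq> 0}"
  obtain N where N: "\<And>i j k. f i j k \<in> S" "\<And>i j k. N \<le> i + j + k \<Longrightarrow> f i j k = 0"
    using FinE[OF f] by metis
  have "?s f \<subseteq> {..<N} \<times> {..<N} \<times> {..<N}"
  proof clarsimp
    fix i j k assume "f i j k \<noteq> 0"
    then have "\<not> N \<le> i + j + k" using N(2) by blast
    then show "i < N \<and> j < N \<and> k < N" by simp
  qed
  then have fs: "finite (?s f)" by (rule finite_subset) auto
  have "P f" if "finite A" "?s f = A" "f \<in> Fin S" for A f
    using that
  proof (induction A arbitrary: f rule: finite_induct)
    case empty
    then have "f = 0" by (auto simp: fun_eq_iff)
    show ?case unfolding \<open>f = 0\<close> by (rule zero)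
  next
    case (insert x A)
    obtain a b c where x: "x = (a,b,c)" by (cases x)
    let ?v = "f a b c"
    let ?g = "\<lambda>i j k. if (i,j,k) = (a,b,c) then 0 else f i j k"
    have fg: "f = single3 a b c ?v + ?g" by (auto simp: single3_def fun_eq_iff)
    obtain N where N: "\<And>i j k. f i j k \<in> S" "\<And>i j k. N \<le> i + j + k \<Longrightarrow> f i j k = 0"
      using FinE[OF insert.prems(2)] by metis
    have g: "?g \<in> Fin S" by (rule FinI[of _ _ N]) (auto simp: N S)
    have "?s ?g = ?s f - {(a,b,c)}" by auto
    then have "?s ?g = A" using insert.prems(1) insert.hyps x by simp
    then have "P ?g" using g by (rule insert.IH)
    have "single3 a b c ?v \<in> Fin S"
      by (rule FinI[of _ _ "Suc (a + b + c)"]) (auto simp: single3_def N S)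
    then have "P (single3 a b c ?v + ?g)" by (rule add[OF _ g single[OF N(1)] \<open>P ?g\<close>])
    then show ?case by (rule subst[OF fg[symmetric], of P])
  qed
  from this[OF fs refl f] show ?thesis .
qed

locale qspace = vector_space sc
  for sc :: "'k::field \<Rightarrow> 'v::ab_group_add \<Rightarrow> 'v" (infixr "*s" 75) +
  fixes p q :: 'k
  assumes p0: "p \<noteq> 0" and q0: "q \<noteq> 0"
begin

abbreviation "LX \<equiv> (opx :: 'v pbw \<Rightarrow> 'v pbw)"
abbreviation "LY \<equiv> opy sc p q"
abbreviation "LZ \<equiv> opz sc p"
abbreviation "RX \<equiv> rx sc p q"
abbreviation "RY \<equiv> (ry :: 'v pbw \<Rightarrow> 'v pbw)"
abbreviation "RZ \<equiv> rz sc p"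
abbreviation "fsc c \<equiv> lift (sc c)"

text \<open>
  The recursion for \<open>c\<^sub>n\<close> obtained from moving \<open>y\<close> past the first factor of \<open>x\<^sup>n\<^sup>+\<^sup>1\<close>; its definition
  moves \<open>y\<close> past the last one.
\<close>

lemma qc_Suc': "qc p q (Suc n) = q * qc p q n + inverse p ^ n"
proof (induction n)
  case (Suc n)
  have "qc p q (Suc (Suc n)) = q ^ Suc n + inverse p * (q * qc p q n + inverse p ^ n)"
    by (subst qc.simps(2), subst Suc) (rule refl)
  also have "\<dots> = q * qc p q (Suc n) + inverse p ^ Suc n"
    by (simp add: algebra_simps)
  finally show ?case .
qed simp

text \<open>
  The multiplications on coefficients satisfy the defining relations. Together with the next lemma
  this is the consistency of the rewriting to the form \<open>x\<^sup>i z\<^sup>j y\<^sup>k\<close>.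
\<close>

lemma op_relations:
  "LZ (LX f) = fsc (inverse p) (LX (LZ f))"
  "LZ (LY f) = fsc p (LY (LZ f))"
  "LY (LX f) = fsc q (LX (LY f)) + LZ f"
proof -
  have [simp]: "p * (inverse p * u) = u" for u by (simp add: p0 mult.assoc[symmetric])
  show "LZ (LX f) = fsc (inverse p) (LX (LZ f))" "LZ (LY f) = fsc p (LY (LZ f))"
    "LY (LX f) = fsc q (LX (LY f)) + LZ f"
    by (auto simp: fun_eq_iff op_defs lift_def algebra_simps qc_Suc' simp del: qc.simps(2) split: nat.splits)
qed

lemma left_right_commute:
  "LX (RX f) = RX (LX f)" "LX (RY f) = RY (LX f)" "LX (RZ f) = RZ (LX f)"
  "LZ (RX f) = RX (LZ f)" "LZ (RY f) = RY (LZ f)" "LZ (RZ f) = RZ (LZ f)"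
  "LY (RX f) = RX (LY f)" "LY (RY f) = RY (LY f)" "LY (RZ f) = RZ (LY f)"
  using p0
  by (auto simp: fun_eq_iff op_defs lift_def algebra_simps split: nat.splits)

lemma op_add:
  "LX (f + g) = LX f + LX g" "LY (f + g) = LY f + LY g" "LZ (f + g) = LZ f + LZ g"
  "RX (f + g) = RX f + RX g" "RY (f + g) = RY f + RY g" "RZ (f + g) = RZ f + RZ g"
  by (auto simp: fun_eq_iff op_defs algebra_simps split: nat.splits)

lemma op_diff:
  "LX (f - g) = LX f - LX g" "LY (f - g) = LY f - LY g" "LZ (f - g) = LZ f - LZ g"
  "RX (f - g) = RX f - RX g" "RY (f - g) = RY f - RY g" "RZ (f - g) = RZ f - RZ g"
  by (auto simp: fun_eq_iff op_defs algebra_simps split: nat.splits)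

lemma op_scale:
  "LX (fsc c f) = fsc c (LX f)" "LY (fsc c f) = fsc c (LY f)" "LZ (fsc c f) = fsc c (LZ f)"
  "RX (fsc c f) = fsc c (RX f)" "RY (fsc c f) = fsc c (RY f)" "RZ (fsc c f) = fsc c (RZ f)"
  by (auto simp: fun_eq_iff op_defs lift_def algebra_simps split: nat.splits)

lemma op_zero: "LX 0 = 0" "LY 0 = 0" "LZ 0 = 0" "RX 0 = 0" "RY 0 = 0" "RZ 0 = 0"
  by (auto simp: fun_eq_iff op_defs split: nat.splits)

lemma op_lift:
  assumes "\<And>u v. T (u + v) = T u + T v" "\<And>c v. T (sc c v) = sc c (T v)"
  shows "LX (lift T f) = lift T (LX f)" "LY (lift T f) = lift T (LY f)" "LZ (lift T f) = lift T (LZ f)"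
    "RX (lift T f) = lift T (RX f)" "RY (lift T f) = lift T (RY f)" "RZ (lift T f) = lift T (RZ f)"
proof -
  have [simp]: "T 0 = 0" using assms(1)[of 0 0] by simp
  show "LX (lift T f) = lift T (LX f)" "LY (lift T f) = lift T (LY f)" "LZ (lift T f) = lift T (LZ f)"
    "RX (lift T f) = lift T (RX f)" "RY (lift T f) = lift T (RY f)" "RZ (lift T f) = lift T (RZ f)"
    by (auto simp: fun_eq_iff op_defs lift_def assms split: nat.splits)
qed

lemma op_single:
  "LX (single3 a b c v) = single3 (Suc a) b c v"
  "LZ (single3 a b c v) = single3 a (Suc b) c (inverse p ^ a *s v)"
  "LY (single3 a b c v) = single3 a b (Suc c) ((q ^ a * inverse p ^ b) *s v) +
     (case a of 0 \<Rightarrow> 0 | Suc a' \<Rightarrow> single3 a' (Suc b) c (qc p q a *s v))"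
  "RX (single3 a b c v) = single3 (Suc a) b c ((q ^ c * inverse p ^ b) *s v) +
     (case c of 0 \<Rightarrow> 0 | Suc c' \<Rightarrow> single3 a (Suc b) c' (qc p q c *s v))"
  "RY (single3 a b c v) = single3 a b (Suc c) v"
  "RZ (single3 a b c v) = single3 a (Suc b) c (inverse p ^ c *s v)"
  by (auto simp: fun_eq_iff op_defs single3_def split: nat.splits)

lemma vector_space_fsc: "vector_space fsc"
  by unfold_locales (auto simp: lift_def fun_eq_iff algebra_simps)

lemma Fin_op:
  assumes "subspace S" "f \<in> Fin S"
  shows "LX f \<in> Fin S" "LY f \<in> Fin S" "LZ f \<in> Fin S" "RX f \<in> Fin S" "RY f \<in> Fin S" "RZ f \<in> Fin S"
proof -
  have S: "0 \<in> S" "\<And>u v. u \<in> S \<Longrightarrow> v \<in> S \<Longrightarrow> u + v \<in> S" "\<And>c v. v \<in> S \<Longrightarrow> c *s v \<in> S"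
    using assms(1) by (auto simp: subspace_def)
  have *: "LX f \<in> Fin S \<and> LY f \<in> Fin S \<and> LZ f \<in> Fin S" if f: "f \<in> Fin S" for f
  proof -
    obtain N where N: "\<And>i j k. f i j k \<in> S" "\<And>i j k. N \<le> i + j + k \<Longrightarrow> f i j k = 0"
      using FinE[OF f] by metis
    show ?thesis
      by (intro conjI; rule FinI[of _ _ "Suc N"]) (auto simp: op_defs N S split: nat.splits)
  qed
  show "LX f \<in> Fin S" "LY f \<in> Fin S" "LZ f \<in> Fin S" using *[OF assms(2)] by auto
  show "RX f \<in> Fin S" "RY f \<in> Fin S" "RZ f \<in> Fin S"
    using *[of "flip f"] assms(2) by (auto simp: rx_def ry_def rz_def)
qed

lemma Fin_lift:
  assumes "T 0 = 0" "\<And>v. v \<in> S \<Longrightarrow> T v \<in> S" "f \<in> Fin S"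
  shows "lift T f \<in> Fin S"
proof -
  obtain N where N: "\<And>i j k. f i j k \<in> S" "\<And>i j k. N \<le> i + j + k \<Longrightarrow> f i j k = 0"
    using FinE[OF assms(3)] by metis
  show ?thesis by (rule FinI[of _ _ N]) (auto simp: lift_def N assms)
qed

lemma subspace_Fin:
  assumes "subspace S"
  shows "module.subspace fsc (Fin S)"
proof -
  interpret F: vector_space fsc by (rule vector_space_fsc)
  show ?thesis
  proof (rule F.subspaceI)
    show "0 \<in> Fin S" by (rule FinI[of _ _ 0]) (auto simp: subspace_0[OF assms])
  next
    fix f g assume fg: "f \<in> Fin S" "g \<in> Fin S"
    obtain N where N: "\<And>i j k. f i j k \<in> S" "\<And>i j k. N \<le> i + j + k \<Longrightarrow> f i j k = 0"
      using FinE[OF fg(1)] by metis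
    obtain M where M: "\<And>i j k. g i j k \<in> S" "\<And>i j k. M \<le> i + j + k \<Longrightarrow> g i j k = 0"
      using FinE[OF fg(2)] by metis
    show "f + g \<in> Fin S"
      by (rule FinI[of _ _ "max N M"]) (auto simp: N M subspace_add[OF assms])
  next
    fix c f assume "f \<in> Fin S"
    then show "fsc c f \<in> Fin S" by (intro Fin_lift) (auto simp: subspace_scale[OF assms])
  qed
qed

lemma Fin_closed:
  assumes "subspace S"
  shows "0 \<in> Fin S" "f \<in> Fin S \<Longrightarrow> g \<in> Fin S \<Longrightarrow> f + g \<in> Fin S"
    "f \<in> Fin S \<Longrightarrow> g \<in> Fin S \<Longrightarrow> f - g \<in> Fin S" "f \<in> Fin S \<Longrightarrow> fsc c f \<in> Fin S"
    "f \<in> Fin S \<Longrightarrow> - f \<in> Fin S"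
proof -
  interpret F: vector_space fsc by (rule vector_space_fsc)
  note s = subspace_Fin[OF assms]
  show "0 \<in> Fin S" "f \<in> Fin S \<Longrightarrow> g \<in> Fin S \<Longrightarrow> f + g \<in> Fin S"
    "f \<in> Fin S \<Longrightarrow> g \<in> Fin S \<Longrightarrow> f - g \<in> Fin S" "f \<in> Fin S \<Longrightarrow> fsc c f \<in> Fin S"
    "f \<in> Fin S \<Longrightarrow> - f \<in> Fin S"
    using F.subspace_0[OF s] F.subspace_add[OF s] F.subspace_diff[OF s] F.subspace_scale[OF s]
      F.subspace_neg[OF s] by auto
qed

lemma single3_Fin: "v \<in> S \<Longrightarrow> 0 \<in> S \<Longrightarrow> single3 a b c v \<in> Fin S"
  by (rule FinI[of _ _ "Suc (a + b + c)"]) (auto simp: single3_def)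

end

text \<open>
  A module, given by operators on a vector space that satisfy the relations on the whole space. The
  module itself is the invariant subspace \<open>S\<close>; the ambient space makes the operators total
  functions, for which the relations hold without side conditions.
\<close>

locale qmod = qspace sc p q
  for sc :: "'k::field \<Rightarrow> 'v::ab_group_add \<Rightarrow> 'v" (infixr "*s" 75) and p q :: 'k +
  fixes ax ay az :: "'v \<Rightarrow> 'v" and S :: "'v set"
  assumes add: "ax (u + v) = ax u + ax v" "ay (u + v) = ay u + ay v" "az (u + v) = az u + az v"
    and scale: "ax (c *s v) = c *s ax v" "ay (c *s v) = c *s ay v" "az (c *s v) = c *s az v"
    and ZX: "az (ax v) = inverse p *s ax (az v)"
    and ZY: "az (ay v) = p *s ay (az v)"
    and YX: "ay (ax v) = q *s ax (ay v) + az v"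
    and subS: "subspace S"
    and inS: "v \<in> S \<Longrightarrow> ax v \<in> S" "v \<in> S \<Longrightarrow> ay v \<in> S" "v \<in> S \<Longrightarrow> az v \<in> S"
begin

lemma additives: "additive ax" "additive ay" "additive az"
  "additive (\<lambda>v. c *s ax v)" "additive (\<lambda>v. c *s ay v)" "additive (\<lambda>v. c *s az v)"
  by (simp_all add: additive_def add algebra_simps)

lemmas zeros [simp] = additives(1-3)[THEN additive.zero]
lemma YZ: "ay (az v) = inverse p *s az (ay v)"
  by (simp add: ZY p0)

lemma S0: "0 \<in> S" and Sadd: "u \<in> S \<Longrightarrow> v \<in> S \<Longrightarrow> u + v \<in> S" and Ssc: "v \<in> S \<Longrightarrow> c *s v \<in> S"
  using subS by (auto simp: subspace_def)

lemma pow_scale: "(ax ^^ n) (c *s v) = c *s (ax ^^ n) v" "(ay ^^ n) (c *s v) = c *s (ay ^^ n) v"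
  "(az ^^ n) (c *s v) = c *s (az ^^ n) v"
  by (induction n) (simp_all add: scale)

lemma pow_add: "(ax ^^ n) (u + v) = (ax ^^ n) u + (ax ^^ n) v"
  "(ay ^^ n) (u + v) = (ay ^^ n) u + (ay ^^ n) v" "(az ^^ n) (u + v) = (az ^^ n) u + (az ^^ n) v"
  by (induction n) (simp_all add: add)

lemma pow_zero [simp]: "(ax ^^ n) 0 = 0" "(ay ^^ n) 0 = 0" "(az ^^ n) 0 = 0"
  by (induction n) simp_all

lemma pow_sc: "((\<lambda>v. c *s ay v) ^^ n) v = c ^ n *s (ay ^^ n) v" "((\<lambda>v. c *s az v) ^^ n) v = c ^ n *s (az ^^ n) v"
  by (induction n) (simp_all add: scale mult.commute)

lemma ZpowX: "(az ^^ j) (ax v) = inverse p ^ j *s ax ((az ^^ j) v)"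
  by (induction j) (simp_all add: scale ZX mult.commute)

lemma ZXpow: "az ((ax ^^ i) v) = inverse p ^ i *s (ax ^^ i) (az v)"
  by (induction i) (simp_all add: scale ZX mult.commute)

lemma YpowZ: "(ay ^^ k) (az v) = inverse p ^ k *s az ((ay ^^ k) v)"
  by (induction k) (simp_all add: scale YZ mult.commute)

lemma YZpow: "ay ((az ^^ k) v) = inverse p ^ k *s (az ^^ k) (ay v)"
  by (induction k) (simp_all add: scale YZ mult.commute)

text \<open>
  The rule for \<open>y x\<^sup>n\<close> and its mirror image for \<open>y\<^sup>k x\<close>, for operators.
\<close>

lemma YpowX: "(ay ^^ k) (ax v) = q ^ k *s ax ((ay ^^ k) v) +
   (case k of 0 \<Rightarrow> 0 | Suc k' \<Rightarrow> qc p q k *s az ((ay ^^ k') v))"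
proof (induction k)
  case (Suc k)
  then show ?case
    by (cases k) (simp_all add: scale add YX YZ algebra_simps)
qed simp

lemma YXpow: "ay ((ax ^^ i) v) = q ^ i *s (ax ^^ i) (ay v) +
   (case i of 0 \<Rightarrow> 0 | Suc i' \<Rightarrow> qc p q i *s (ax ^^ i') (az v))"
proof (induction i)
  case (Suc i)
  then show ?case
    by (cases i) (simp_all add: scale add YX ZX ZXpow qc_Suc' algebra_simps del: qc.simps(2))
qed simp

text \<open>
  Substitution of multiples of the operators for \<open>y\<close> and \<open>z\<close> only. The multiples \<open>c\<close>, \<open>d\<close> account
  for the factors that appear when \<open>y\<close> and \<open>z\<close> are moved past \<open>x\<close>.
\<close>

definition ev2 :: "'k \<Rightarrow> 'k \<Rightarrow> 'v pbw \<Rightarrow> nat \<Rightarrow> 'v" where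
  "ev2 c d f i = ev1 (\<lambda>v. d *s az v) (\<lambda>j. ev1 (\<lambda>v. c *s ay v) (f i j))"

text \<open>
  The evaluation \<open>A \<otimes> V \<rightarrow> V\<close>, \<open>a \<otimes> v \<mapsto> a v\<close>.
\<close>

definition ev3 :: "'v pbw \<Rightarrow> 'v" where
  "ev3 f = ev1 ax (\<lambda>i. ev1 az (\<lambda>j. ev1 ay (f i j)))"

lemma ev3_ev2: "ev3 f = ev1 ax (ev2 1 1 f)"
  by (simp add: ev3_def ev2_def[abs_def])

lemma Fin_fin:
  assumes "f \<in> Fin S'"
  shows "fin (f i j)" "fin (\<lambda>j. ev1 T (f i j))" "fin (\<lambda>i. ev1 U (\<lambda>j. ev1 T (f i j)))"
proof -
  obtain N where N: "\<And>i j k. N \<le> i + j + k \<Longrightarrow> f i j k = 0"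
    using FinE[OF assms] by metis
  have z: "N \<le> i + j \<Longrightarrow> f i j = (\<lambda>k. 0)" for i j by (rule ext) (simp add: N)
  show "fin (f i j)" by (rule finI[of N]) (simp add: N)
  show "fin (\<lambda>j. ev1 T (f i j))" by (rule finI[of N]) (simp add: z)
  show "fin (\<lambda>i. ev1 U (\<lambda>j. ev1 T (f i j)))" by (rule finI[of N]) (simp add: z)
qed

lemma ev2_add: "f \<in> Fin S' \<Longrightarrow> g \<in> Fin S' \<Longrightarrow> ev2 c d (f + g) i = ev2 c d f i + ev2 c d g i"
  unfolding ev2_def plus_fun_def
  by (subst ev1_add[OF additives(5)], (rule Fin_fin; assumption)+,
      subst ev1_add[OF additives(6)], (rule Fin_fin; assumption)+, rule refl)

lemma ev2_add': "f \<in> Fin S' \<Longrightarrow> g \<in> Fin S' \<Longrightarrow> ev2 c d (f + g) = (\<lambda>i. ev2 c d f i + ev2 c d g i)"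
  by (rule ext) (rule ev2_add)

lemma ev3_add:
  assumes "f \<in> Fin S'" "g \<in> Fin S'"
  shows "ev3 (f + g) = ev3 f + ev3 g"
proof -
  have "ev2 1 1 (f + g) = (\<lambda>i. ev2 1 1 f i + ev2 1 1 g i)"
    by (rule ext) (rule ev2_add[OF assms])
  moreover have "fin (ev2 1 1 h)" if "h \<in> Fin S'" for h
    unfolding ev2_def[abs_def] by (rule Fin_fin[OF that])
  ultimately show ?thesis
    unfolding ev3_ev2 using ev1_add[OF additives(1)] assms by simp
qed

lemma ev2_zero [simp]: "ev2 c d 0 i = 0"
  by (simp add: ev2_def zero_fun_def)

lemma ev3_zero [simp]: "ev3 0 = 0"
  by (simp add: ev3_def zero_fun_def)

lemma ev2_diff:
  assumes "f \<in> Fin S" "g \<in> Fin S"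
  shows "ev2 c d (f - g) i = ev2 c d f i - ev2 c d g i"
  using ev2_add[of "f - g" S g c d i] assms Fin_closed[OF subS] by simp

lemma ev3_diff:
  assumes "f \<in> Fin S" "g \<in> Fin S"
  shows "ev3 (f - g) = ev3 f - ev3 g"
  using ev3_add[of "f - g" S g] assms Fin_closed[OF subS] by simp

lemma ev2_single: "ev2 x d (single3 a b c v) i = (if i = a then (d ^ b * x ^ c) *s (az ^^ b) ((ay ^^ c) v) else 0)"
proof -
  have 1: "ev1 (\<lambda>v. x *s ay v) (single3 a b c v i j) = (if j = b then (if i = a then x ^ c *s (ay ^^ c) v else 0) else 0)" for j
  proof (cases "i = a \<and> j = b")
    case True
    then show ?thesis
      by (simp add: single3_def ev1_single[OF additives(5)] pow_sc)
  next
    case False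
    then have "single3 a b c v i j = (\<lambda>k. 0)" by (auto simp: single3_def fun_eq_iff)
    then show ?thesis using False by simp
  qed
  show ?thesis
    unfolding ev2_def 1 by (simp add: ev1_single[OF additives(6)] pow_sc pow_scale)
qed

lemma ev3_single: "ev3 (single3 a b c v) = (ax ^^ a) ((az ^^ b) ((ay ^^ c) v))"
  unfolding ev3_ev2 ev2_single by (simp add: ev1_single[OF additives(1)])

lemma lift_single: "T 0 = 0 \<Longrightarrow> lift T (single3 a b c v) = single3 a b c (T v)"
  by (auto simp: lift_def single3_def fun_eq_iff)

lemma lift_add: "(\<And>u v. T (u + v) = T u + T v) \<Longrightarrow> lift T (f + g) = lift T f + lift T g"
  by (simp add: lift_def fun_eq_iff)

lemma ev3_in: "f \<in> Fin S \<Longrightarrow> ev3 f \<in> S"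
  unfolding ev3_def by (intro ev1_in) (auto simp: inS S0 Sadd Fin_mem)

lemma subUNIV: "subspace UNIV" by simp

lemmas F0 = Fin_closed[OF subUNIV] Fin_op[OF subUNIV] single3_Fin[of _ UNIV, simplified]

lemma Fin_eqI:
  fixes \<Phi> \<Psi> :: "'v pbw \<Rightarrow> 'w::ab_group_add"
  assumes f: "f \<in> Fin UNIV" and "\<And>a b c v. \<Phi> (single3 a b c v) = \<Psi> (single3 a b c v)"
    and \<Phi>: "\<And>f g. f \<in> Fin UNIV \<Longrightarrow> g \<in> Fin UNIV \<Longrightarrow> \<Phi> (f + g) = \<Phi> f + \<Phi> g"
    and \<Psi>: "\<And>f g. f \<in> Fin UNIV \<Longrightarrow> g \<in> Fin UNIV \<Longrightarrow> \<Psi> (f + g) = \<Psi> f + \<Psi> g"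
  shows "\<Phi> f = \<Psi> f"
proof (rule Fin_induct[OF f, of "\<lambda>f. \<Phi> f = \<Psi> f"])
  show "\<Phi> 0 = \<Psi> 0" using \<Phi>[of 0 0] \<Psi>[of 0 0] F0 by simp
qed (use assms in auto)

text \<open>
  The evaluation is linear over the algebra.
\<close>

lemma ev3_op:
  assumes "f \<in> Fin S'"
  shows "ev3 (LX f) = ax (ev3 f)" "ev3 (LY f) = ay (ev3 f)" "ev3 (LZ f) = az (ev3 f)"
    "ev3 (fsc c f) = c *s ev3 f"
proof -
  have f: "f \<in> Fin UNIV" using assms by (simp add: Fin_def)
  note ev3_add = ev3_add[of _ UNIV]
  show "ev3 (LX f) = ax (ev3 f)"
    by (rule Fin_eqI[OF f, of "\<lambda>f. ev3 (LX f)" "\<lambda>f. ax (ev3 f)"])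
       (simp_all add: op_single ev3_single op_add add ev3_add F0)
  show "ev3 (LY f) = ay (ev3 f)"
    by (rule Fin_eqI[OF f, of "\<lambda>f. ev3 (LY f)" "\<lambda>f. ay (ev3 f)"])
       (simp_all add: op_single ev3_single op_add add ev3_add F0 pow_scale pow_add YXpow YZpow scale
         split: nat.splits)
  show "ev3 (LZ f) = az (ev3 f)"
    by (rule Fin_eqI[OF f, of "\<lambda>f. ev3 (LZ f)" "\<lambda>f. az (ev3 f)"])
       (simp_all add: op_single ev3_single op_add add ev3_add F0 pow_scale ZXpow scale)
  show "ev3 (fsc c f) = c *s ev3 f"
    by (rule Fin_eqI[OF f, of "\<lambda>f. ev3 (fsc c f)" "\<lambda>f. c *s ev3 f"])
       (simp_all add: lift_single ev3_single lift_add scale_right_distrib ev3_add F0 pow_scale)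
qed

text \<open>
  The evaluation factors through the tensor product over the algebra.
\<close>

lemma ev3_balanced:
  assumes "f \<in> Fin S'"
  shows "ev3 (RX f) = ev3 (lift ax f)" "ev3 (RY f) = ev3 (lift ay f)" "ev3 (RZ f) = ev3 (lift az f)"
proof -
  have f: "f \<in> Fin UNIV" using assms by (simp add: Fin_def)
  note ev3_add = ev3_add[of _ UNIV]
  have L: "lift T g \<in> Fin UNIV" if "g \<in> Fin UNIV" "T 0 = 0" for T :: "'v \<Rightarrow> 'v" and g :: "'v pbw"
    using Fin_lift[of T UNIV g] that by auto
  show "ev3 (RX f) = ev3 (lift ax f)"
    by (rule Fin_eqI[OF f, of "\<lambda>f. ev3 (RX f)" "\<lambda>f. ev3 (lift ax f)"])
       (simp_all add: op_single ev3_single op_add add ev3_add F0 L lift_single lift_add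
         pow_scale pow_add YpowX ZpowX scale funpow_swap1 del: qc.simps split: nat.splits)
  show "ev3 (RY f) = ev3 (lift ay f)"
    by (rule Fin_eqI[OF f, of "\<lambda>f. ev3 (RY f)" "\<lambda>f. ev3 (lift ay f)"])
       (simp_all add: op_single ev3_single op_add add ev3_add F0 L lift_single lift_add funpow_swap1)
  show "ev3 (RZ f) = ev3 (lift az f)"
    by (rule Fin_eqI[OF f, of "\<lambda>f. ev3 (RZ f)" "\<lambda>f. ev3 (lift az f)"])
       (simp_all add: op_single ev3_single op_add add ev3_add F0 L lift_single lift_add
         pow_scale YpowZ funpow_swap1 scale)
qed

text \<open>
  For the partial substitutions, right multiplication by \<open>z\<close> and \<open>x\<close> is a shift of the remaining
  variable together with a change of the multiples \<open>c\<close>, \<open>d\<close>. This reduces statements on three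
  noncommuting variables to statements on polynomials in one variable.
\<close>

definition evY :: "'k \<Rightarrow> 'v pbw \<Rightarrow> nat \<Rightarrow> nat \<Rightarrow> 'v" where
  "evY c f i j = ev1 (\<lambda>v. c *s ay v) (f i j)"

lemma ev2_evY: "ev2 c d f i = ev1 (\<lambda>v. d *s az v) (evY c f i)"
  by (simp add: ev2_def evY_def[abs_def])

lemma evY_single: "evY x (single3 a b c v) i j = (if i = a \<and> j = b then x ^ c *s (ay ^^ c) v else 0)"
proof (cases "i = a \<and> j = b")
  case True
  then show ?thesis
    by (simp add: evY_def single3_def ev1_single[OF additives(5)] pow_sc)
next
  case False
  then have "single3 a b c v i j = (\<lambda>k. 0)" by (auto simp: single3_def fun_eq_iff)
  then show ?thesis using False by (auto simp add: evY_def)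
qed

lemma evY_add: "f \<in> Fin S' \<Longrightarrow> g \<in> Fin S' \<Longrightarrow> evY c (f + g) i j = evY c f i j + evY c g i j"
  unfolding evY_def plus_fun_def
  by (subst ev1_add[OF additives(5)], (rule Fin_fin; assumption)+, rule refl)

lemma evY_add': "f \<in> Fin S' \<Longrightarrow> g \<in> Fin S' \<Longrightarrow> evY c (f + g) i = (\<lambda>j. evY c f i j + evY c g i j)"
  by (rule ext) (rule evY_add)

lemma evY_diff: "f \<in> Fin S \<Longrightarrow> g \<in> Fin S \<Longrightarrow> evY c (f - g) i j = evY c f i j - evY c g i j"
  using evY_add[of "f - g" S g c i j] Fin_closed[OF subS] by simp

lemma shft_add: "shft (\<lambda>j. f j + g j) j = shft f j + (shft g j :: 'v)"
  by (cases j) simp_all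

lemma evY_z:
  assumes "f \<in> Fin S'"
  shows "evY c (RZ f) i j = shft (evY (c * inverse p) f i) j"
    "evY c (lift (\<lambda>v. d *s az v) f) i j = d *s az (evY (c * inverse p) f i j)"
    "evY c (RY f) i j = evY c (lift (\<lambda>v. c *s ay v) f) i j"
proof -
  have f: "f \<in> Fin UNIV" using assms by (simp add: Fin_def)
  note evY_add = evY_add[of _ UNIV] and evY_add' = evY_add'[of _ UNIV]
  have L: "lift T g \<in> Fin UNIV" if "g \<in> Fin UNIV" "T 0 = 0" for T :: "'v \<Rightarrow> 'v" and g :: "'v pbw"
    using Fin_lift[of T UNIV g] that by auto
  show "evY c (RZ f) i j = shft (evY (c * inverse p) f i) j"
    by (rule Fin_eqI[OF f, of "\<lambda>f. evY c (RZ f) i j" "\<lambda>f. shft (evY (c * inverse p) f i) j"])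
       (auto simp: op_single op_add F0 evY_single evY_add evY_add' shft_add pow_scale power_mult_distrib
          shft_def split: nat.splits)
  show "evY c (lift (\<lambda>v. d *s az v) f) i j = d *s az (evY (c * inverse p) f i j)"
    by (rule Fin_eqI[OF f, of "\<lambda>f. evY c (lift (\<lambda>v. d *s az v) f) i j" "\<lambda>f. d *s az (evY (c * inverse p) f i j)"])
       (auto simp: lift_single lift_add L F0 evY_single evY_add pow_scale power_mult_distrib YpowZ scale add
         scale_right_distrib mult.commute)
  show "evY c (RY f) i j = evY c (lift (\<lambda>v. c *s ay v) f) i j"
    by (rule Fin_eqI[OF f, of "\<lambda>f. evY c (RY f) i j" "\<lambda>f. evY c (lift (\<lambda>v. c *s ay v) f) i j"])
       (auto simp: op_single op_add lift_single lift_add L F0 evY_single evY_add pow_scale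
         funpow_swap1 add scale_right_distrib mult.commute)
qed

lemma ev2_x:
  assumes "f \<in> Fin S"
  shows "ev2 1 1 (RX f - lift ax f) i = shft (ev2 q (inverse p) f) i - ax (ev2 q (inverse p) f i)"
proof -
  have f: "f \<in> Fin UNIV" using assms by (simp add: Fin_def)
  note ev2_add = ev2_add[of _ UNIV] and ev2_add' = ev2_add'[of _ UNIV]
  have L: "lift T g \<in> Fin UNIV" if "g \<in> Fin UNIV" "T 0 = 0" for T :: "'v \<Rightarrow> 'v" and g :: "'v pbw"
    using Fin_lift[of T UNIV g] that by auto
  have "ev2 1 1 (RX f) i + ax (ev2 q (inverse p) f i) = ev2 1 1 (lift ax f) i + shft (ev2 q (inverse p) f) i"
    by (rule Fin_eqI[OF f, of "\<lambda>f. ev2 1 1 (RX f) i + ax (ev2 q (inverse p) f i)" "\<lambda>f. ev2 1 1 (lift ax f) i + shft (ev2 q (inverse p) f) i"])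
       (auto simp: op_single op_add lift_single lift_add L F0 ev2_single ev2_add ev2_add' shft_add shft_def pow_scale pow_add
         scale add YpowX ZpowX funpow_swap1 mult.commute simp del: qc.simps split: nat.splits)
  moreover have "ev2 1 1 (RX f - lift ax f) i = ev2 1 1 (RX f) i - ev2 1 1 (lift ax f) i"
    by (rule ev2_diff) (auto intro!: Fin_op[OF subS] Fin_lift assms simp: inS)
  moreover have "a - b = c' - d" if "a + d = b + c'" for a b c' d :: 'v
    using that by (metis add_diff_cancel add_diff_cancel_left' diff_diff_eq diff_add_cancel add.commute)
  ultimately show ?thesis by metis
qed

end

context qmod begin

lemma RY_shft: "RY g i j k = shft (g i j) k"
  by (simp add: ry_def flip_def opx_def shft_def)

lemma one_scale: "(\<lambda>v. 1 *s ay v) = ay" "(\<lambda>v. 1 *s az v) = az"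
  by (simp_all add: fun_eq_iff)

lemma Fin_Y: "f \<in> Fin S \<Longrightarrow> lift (\<lambda>v. c *s ay v) f \<in> Fin S"
  and Fin_Z: "f \<in> Fin S \<Longrightarrow> lift (\<lambda>v. c *s az v) f \<in> Fin S"
  and Fin_X: "f \<in> Fin S \<Longrightarrow> lift (\<lambda>v. c *s ax v) f \<in> Fin S"
  and Fin_X': "f \<in> Fin S \<Longrightarrow> lift ax f \<in> Fin S"
  and Fin_Y': "f \<in> Fin S \<Longrightarrow> lift ay f \<in> Fin S"
  and Fin_Z': "f \<in> Fin S \<Longrightarrow> lift az f \<in> Fin S"
  by (auto intro!: Fin_lift simp: inS Ssc)

lemmas FinS = Fin_closed[OF subS] Fin_op[OF subS] Fin_X Fin_Y Fin_Z Fin_X' Fin_Y' Fin_Z'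

text \<open>
  The map \<open>a \<otimes> v \<mapsto> a y \<otimes> v - c (a \<otimes> y v)\<close> is \<open>t - T\<close> in the variable \<open>y\<close>, hence injective.
\<close>

lemma RY_inj:
  assumes "f \<in> Fin S'" "RY f = lift (\<lambda>v. c *s ay v) f"
  shows "f = 0"
proof -
  have "f i j k = 0" for i j k
  proof (rule shft_eq_imp_zero[of "f i j" "\<lambda>v. c *s ay v"])
    show "fin (f i j)" by (rule Fin_fin[OF assms(1)])
    fix k
    have "RY f i j k = lift (\<lambda>v. c *s ay v) f i j k" by (simp only: assms(2))
    then show "shft (f i j) k = c *s ay (f i j k)" by (simp add: RY_shft lift_def)
  qed simp
  then show ?thesis by (simp add: fun_eq_iff)
qed

text \<open>
  Division by \<open>y - c Y\<close> in the variable \<open>y\<close>.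
\<close>

lemma RY_kernel:
  assumes f: "f \<in> Fin S" and "\<And>i j. evY c f i j = 0"
  shows "\<exists>g \<in> Fin S. f = RY g - lift (\<lambda>v. c *s ay v) g"
proof
  let ?T = "\<lambda>v. c *s ay v"
  let ?g = "\<lambda>i j. horner ?T (f i j)"
  obtain N where N: "\<And>i j k. f i j k \<in> S" "\<And>i j k. N \<le> i + j + k \<Longrightarrow> f i j k = 0"
    using FinE[OF f] by metis
  show "?g \<in> Fin S"
  proof (rule FinI[of _ _ N])
    show "?g i j k \<in> S" for i j k
      unfolding horner_def by (rule ev1_in) (auto simp: inS Ssc S0 Sadd N)
    show "?g i j k = 0" if "N \<le> i + j + k" for i j k
      by (rule horner_bound[of k]) (use that N in auto)
  qed
  show "f = RY ?g - lift ?T ?g"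
    using horner_divides[OF additives(5) Fin_fin(1)[OF f] assms(2)[unfolded evY_def]]
    by (simp add: fun_eq_iff RY_shft lift_def)
qed

text \<open>
  Modulo the image of \<open>y - c Y\<close>, which is the kernel of the substitution for \<open>y\<close>, the map \<open>z - d Z\<close>
  becomes \<open>t - T\<close> in the variable \<open>z\<close>, hence injective. Moving \<open>z\<close> past \<open>y\<close> replaces \<open>c\<close> by \<open>c p\<^sup>-\<^sup>1\<close>.
\<close>

lemma RZ_regular:
  assumes f: "f \<in> Fin S" and h: "h \<in> Fin S"
    and eq: "RZ f - lift (\<lambda>v. d *s az v) f = RY h - lift (\<lambda>v. c *s ay v) h"
  shows "\<exists>g \<in> Fin S. f = RY g - lift (\<lambda>v. (c * inverse p) *s ay v) g"
proof (rule RY_kernel[OF f])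
  fix i j
  show "evY (c * inverse p) f i j = 0"
  proof (rule shft_eq_imp_zero[of "evY (c * inverse p) f i" "\<lambda>v. d *s az v"])
    show "fin (evY (c * inverse p) f i)" unfolding evY_def[abs_def] by (rule Fin_fin[OF f])
    fix j
    have "evY c (RZ f - lift (\<lambda>v. d *s az v) f) i j = evY c (RY h - lift (\<lambda>v. c *s ay v) h) i j"
      by (simp only: eq)
    then show "shft (evY (c * inverse p) f i) j = d *s az (evY (c * inverse p) f i j)"
      using f h by (simp add: evY_diff FinS evY_z)
  qed simp
qed

lemma ev2_image_zero:
  assumes "g \<in> Fin S" "h \<in> Fin S"
  shows "ev2 c d (RZ g - lift (\<lambda>v. d *s az v) g) i = 0" "ev2 c d (RY h - lift (\<lambda>v. c *s ay v) h) i = 0"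
proof -
  have fin: "fin (evY x g i)" for x unfolding evY_def[abs_def] by (rule Fin_fin[OF assms(1)])
  have "ev1 (\<lambda>v. d *s az v) (\<lambda>j. d *s az (evY (c * inverse p) g i j)) =
    d *s az (ev1 (\<lambda>v. d *s az v) (evY (c * inverse p) g i))"
    by (rule ev1_intertwine[symmetric]) (auto simp: additives fin)
  moreover have "ev2 c d (RZ g - lift (\<lambda>v. d *s az v) g) i =
      ev2 c d (RZ g) i - ev2 c d (lift (\<lambda>v. d *s az v) g) i"
    using assms by (intro ev2_diff FinS)
  moreover have "evY c (RZ g) i = shft (evY (c * inverse p) g i)"
    by (rule ext) (rule evY_z[OF assms(1)])
  ultimately show "ev2 c d (RZ g - lift (\<lambda>v. d *s az v) g) i = 0"
    by (simp add: ev2_evY evY_z[OF assms(1), abs_def] ev1_shft[OF additives(6) fin])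
  have "evY c (RY h - lift (\<lambda>v. c *s ay v) h) i = (\<lambda>j. 0)"
    using assms by (simp add: fun_eq_iff evY_diff FinS evY_z)
  then show "ev2 c d (RY h - lift (\<lambda>v. c *s ay v) h) i = 0"
    by (simp add: ev2_evY)
qed

text \<open>
  The substitution for \<open>y\<close> yields a polynomial in \<open>z\<close> that is divisible by \<open>z - d Z\<close>. The quotient,
  regarded as an element without \<open>y\<close>, has the same substitutions for \<open>y\<close> with every multiple \<open>c\<close>;
  subtracting its image leaves an element that vanishes under the substitution for \<open>y\<close>.
\<close>

lemma RZ_RY_kernel:
  assumes f: "f \<in> Fin S" and z: "\<And>i. ev2 c d f i = 0"
  shows "\<exists>g \<in> Fin S. \<exists>h \<in> Fin S.
    f = (RZ g - lift (\<lambda>v. d *s az v) g) + (RY h - lift (\<lambda>v. c *s ay v) h)"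
proof -
  obtain N where N: "\<And>i j k. f i j k \<in> S" "\<And>i j k. N \<le> i + j + k \<Longrightarrow> f i j k = 0"
    using FinE[OF f] by metis
  let ?T = "\<lambda>v. d *s az v"
  let ?H = "\<lambda>i. horner ?T (evY c f i)"
  let ?g = "\<lambda>i j k. if k = 0 then ?H i j else 0"
  have finY: "fin (evY c f i)" for i unfolding evY_def[abs_def] by (rule Fin_fin[OF f])
  have inY: "evY c f i j \<in> S" for i j
    unfolding evY_def by (rule ev1_in) (auto simp: inS Ssc S0 Sadd N)
  have g: "?g \<in> Fin S"
  proof (rule FinI[of _ _ N])
    show "?g i j k \<in> S" for i j k
      unfolding horner_def by (auto intro!: ev1_in simp: inS Ssc S0 Sadd inY)
    have "evY c f i j = 0" if "N \<le> i + j" for i j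
    proof -
      have "f i j = (\<lambda>k. 0)" by (rule ext, rule N(2)) (use that in simp)
      then show ?thesis by (simp add: evY_def)
    qed
    then show "?g i j k = 0" if "N \<le> i + j + k" for i j k
      using that by (auto intro!: horner_bound[of j])
  qed
  have gY: "evY x ?g i j = ?H i j" for x i j
  proof -
    have "evY x ?g i j = ev1 (\<lambda>v. x *s ay v) (\<lambda>k. if k = 0 then ?H i j else 0)" by (simp add: evY_def)
    also have "\<dots> = ?H i j" by (subst ev1_single[OF additives(5)]) simp
    finally show ?thesis .
  qed
  define G :: "'v pbw" where "G = ?g"
  have G: "G \<in> Fin S" "evY x G i j = ?H i j" for x i j unfolding G_def by (rule g, rule gY)
  have "evY c (f - (RZ G - lift ?T G)) i j = 0" for i j
  proof -
    have "evY c (f - (RZ G - lift ?T G)) i j = evY c f i j - (evY c (RZ G) i j - evY c (lift ?T G) i j)"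
      using f G(1) by (simp add: evY_diff FinS)
    also have "\<dots> = evY c f i j - (shft (?H i) j - ?T (?H i j))"
      unfolding evY_z(1,2)[OF G(1)] G(2) by (cases j) (simp_all add: G(2))
    also have "\<dots> = 0"
      using horner_divides[OF additives(6) finY z[unfolded ev2_evY], of i j] by simp
    finally show ?thesis .
  qed
  moreover have "f - (RZ G - lift ?T G) \<in> Fin S" using f G(1) by (intro FinS)
  ultimately obtain h where h: "h \<in> Fin S" "f - (RZ G - lift ?T G) = RY h - lift (\<lambda>v. c *s ay v) h"
    using RY_kernel[of "f - (RZ G - lift ?T G)" c] by blast
  then have "f = (RZ G - lift ?T G) + (RY h - lift (\<lambda>v. c *s ay v) h)" unfolding diff_eq_eq by (simp only: add.commute)
  then show ?thesis using G(1) h(1) by blast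
qed

text \<open>
  As for \<open>z\<close> modulo \<open>y\<close>: modulo the images of the maps for \<open>y\<close> and \<open>z\<close>, the map \<open>x - X\<close> becomes
  \<open>t - T\<close> in the variable \<open>x\<close>.
\<close>

lemma RX_regular:
  assumes f: "f \<in> Fin S" and g: "g \<in> Fin S" and h: "h \<in> Fin S"
    and eq: "(RX f - lift ax f) + (RY h - lift ay h) + (RZ g - lift az g) = 0"
  shows "\<exists>u \<in> Fin S. \<exists>v \<in> Fin S. f = (RY u - lift (\<lambda>v. q *s ay v) u) +
    (RZ v - lift (\<lambda>v. inverse p *s az v) v)"
proof -
  have "ev2 1 1 ((RX f - lift ax f) + (RY h - lift ay h) + (RZ g - lift az g)) i = ev2 1 1 (RX f - lift ax f) i" for i
    using f g h ev2_image_zero[OF g h, of 1 1]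
    by (simp add: ev2_add[of _ S] FinS one_scale)
  then have x: "ev2 1 1 (RX f - lift ax f) i = 0" for i
    unfolding eq by simp
  have "ev2 q (inverse p) f i = 0" for i
  proof (rule shft_eq_imp_zero[of "ev2 q (inverse p) f" ax])
    show "fin (ev2 q (inverse p) f)" unfolding ev2_def[abs_def] by (rule Fin_fin[OF f])
    show "shft (ev2 q (inverse p) f) k = ax (ev2 q (inverse p) f k)" for k
      using x[of k] by (simp add: ev2_x[OF f])
  qed simp
  from RZ_RY_kernel[OF f this] show ?thesis by (metis add.commute)
qed

text \<open>
  The tensor product of \<open>A\<close> and \<open>V\<close> over \<open>A\<close> is \<open>V\<close>: the kernel of the evaluation is spanned by the
  differences \<open>a x \<otimes> v - a \<otimes> x v\<close> and their analogues for \<open>y\<close> and \<open>z\<close>. The division by \<open>x - X\<close>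
  reduces this to the kernel of the substitutions for \<open>y\<close> and \<open>z\<close>.
\<close>

lemma ev3_kernel:
  assumes f: "f \<in> Fin S" and z: "ev3 f = 0"
  shows "\<exists>u \<in> Fin S. \<exists>v \<in> Fin S. \<exists>w \<in> Fin S.
    f = (RX u - lift ax u) + (RY v - lift ay v) + (RZ w - lift az w)"
proof -
  obtain N where N: "\<And>i j k. f i j k \<in> S" "\<And>i j k. N \<le> i + j + k \<Longrightarrow> f i j k = 0"
    using FinE[OF f] by metis
  let ?H = "horner ax (ev2 1 1 f)"
  let ?u = "\<lambda>i j k. if j = 0 \<and> k = 0 then ?H i else 0"
  have fin2: "fin (ev2 1 1 f)" unfolding ev2_def[abs_def] by (rule Fin_fin[OF f])
  have in2: "ev2 1 1 f i \<in> S" for i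
    unfolding ev2_def by (intro ev1_in) (auto simp: inS Ssc S0 Sadd N)
  have u: "?u \<in> Fin S"
  proof (rule FinI[of _ _ N])
    show "?u i j k \<in> S" for i j k
      unfolding horner_def by (auto intro!: ev1_in simp: inS Ssc S0 Sadd in2)
    have "ev2 1 1 f i = 0" if "N \<le> i" for i
    proof -
      have "f i j = (\<lambda>k. 0)" for j by (rule ext, rule N(2)) (use that in simp)
      then show ?thesis by (simp add: ev2_def)
    qed
    then show "?u i j k = 0" if "N \<le> i + j + k" for i j k
      using that by (auto intro!: horner_bound)
  qed
  have u2: "ev2 x y ?u i = ?H i" for x y i
  proof -
    have "evY x ?u i j = (if j = 0 then ?H i else 0)" for j
    proof (cases "j = 0")
      case True
      have "evY x ?u i j = ev1 (\<lambda>v. x *s ay v) (\<lambda>k. if k = 0 then ?H i else 0)" using True by (simp add: evY_def)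
      also have "\<dots> = ?H i" by (subst ev1_single[OF additives(5)]) simp
      finally show ?thesis using True by simp
    qed (simp add: evY_def)
    then have "ev2 x y ?u i = ev1 (\<lambda>v. y *s az v) (\<lambda>j. if j = 0 then ?H i else 0)" by (simp add: ev2_evY[abs_def] cong: ev1_def)
    also have "\<dots> = ?H i" by (subst ev1_single[OF additives(6)]) simp
    finally show ?thesis .
  qed
  define U :: "'v pbw" where "U = ?u"
  have U: "U \<in> Fin S" "ev2 x y U i = ?H i" for x y i unfolding U_def by (rule u, rule u2)
  have "ev2 1 1 (f - (RX U - lift ax U)) i = 0" for i
  proof -
    have "ev2 1 1 (f - (RX U - lift ax U)) i = ev2 1 1 f i - ev2 1 1 (RX U - lift ax U) i"
      using f U(1) by (intro ev2_diff FinS)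
    also have "\<dots> = ev2 1 1 f i - (shft ?H i - ax (?H i))"
      unfolding ev2_x[OF U(1)] U(2) by (cases i) (simp_all add: U(2))
    also have "\<dots> = 0"
      using horner_divides[OF additives(1) fin2 z[unfolded ev3_ev2], of i] by simp
    finally show ?thesis .
  qed
  moreover have "f - (RX U - lift ax U) \<in> Fin S" using f U(1) by (intro FinS)
  ultimately obtain w v where wv: "w \<in> Fin S" "v \<in> Fin S"
    "f - (RX U - lift ax U) = (RZ w - lift az w) + (RY v - lift ay v)"
    using RZ_RY_kernel[of "f - (RX U - lift ax U)" 1 1] unfolding one_scale by blast
  then have "f = (RX U - lift ax U) + (RY v - lift ay v) + (RZ w - lift az w)"
    unfolding diff_eq_eq by (simp only: add_ac)
  then show ?thesis using U(1) wv(1,2) by blast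
qed

section \<open>The resolution of a module\<close>

text \<open>
  The differentials of the resolution \<open>0 \<rightarrow> A \<otimes> V \<rightarrow> (A \<otimes> V)\<^sup>3 \<rightarrow> (A \<otimes> V)\<^sup>3 \<rightarrow> A \<otimes> V\<close>. The three copies in
  degree \<open>1\<close> belong to the generators \<open>x\<close>, \<open>y\<close>, \<open>z\<close> and those in degree \<open>2\<close> to the defining
  relations, in the order \<open>y x\<close>, \<open>z x\<close>, \<open>z y\<close>. A relation \<open>\<Sum> g h\<close> in the generators contributes
  terms \<open>a g \<otimes> v\<close> in the copy of \<open>h\<close> and \<open>a \<otimes> h v\<close> in the copy of \<open>g\<close>, and a linear term \<open>g\<close>
  contributes \<open>a \<otimes> v\<close> in the copy of \<open>g\<close>. The copy in degree \<open>3\<close> is the overlap \<open>z y x\<close> of the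
  relations.
\<close>

definition "D0 a b c = (RX a - lift ax a) + (RY b - lift ay b) + (RZ c - lift az c)"
definition "D1x u v = (RY u - lift (\<lambda>v. q *s ay v) u) + (RZ v - lift (\<lambda>v. inverse p *s az v) v)"
definition "D1y u w = (lift ax u - fsc q (RX u)) + (RZ w - lift (\<lambda>v. p *s az v) w)"
definition "D1z u v w = - u + (lift ax v - fsc (inverse p) (RX v)) + (lift ay w - fsc p (RY w))"
definition "D2a f = RZ f - lift az f"
definition "D2b f = lift (\<lambda>v. q *s ay v) f - fsc p (RY f)"
definition "D2c f = fsc (q * inverse p) (RX f) - lift ax f"

lemmas D_defs = D0_def D1x_def D1y_def D1z_def D2a_def D2b_def D2c_def

lemma right_op_relations:
  "RX (RY f) = fsc q (RY (RX f)) + RZ f" "RY (RZ f) = fsc p (RZ (RY f))"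
  "RX (RZ f) = fsc (inverse p) (RZ (RX f))"
  using op_relations[of "flip f"] p0
  by (auto simp: rx_def ry_def rz_def fun_eq_iff flip_def lift_def)

lemma lift_linear:
  assumes "\<And>u v. T (u + v) = T u + T v" "\<And>c v. T (c *s v) = c *s T v"
  shows "lift T (f + g) = lift T f + lift T g" "lift T (f - g) = lift T f - lift T g"
    "lift T (- f) = - lift T f" "lift T (fsc c f) = fsc c (lift T f)" "lift T 0 = 0"
proof -
  have a: "additive T" by (simp add: additive_def assms)
  show "lift T (f + g) = lift T f + lift T g" "lift T (f - g) = lift T f - lift T g"
    "lift T (- f) = - lift T f" "lift T (fsc c f) = fsc c (lift T f)" "lift T 0 = 0"
    by (auto simp: lift_def fun_eq_iff assms additive.diff[OF a] additive.minus[OF a] additive.zero[OF a])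
qed

lemmas lift_ops = lift_linear[of ax, OF add(1) scale(1)] lift_linear[of ay, OF add(2) scale(2)]
  lift_linear[of az, OF add(3) scale(3)]
lemmas op_lifts = op_lift[of ax, OF add(1) scale(1)] op_lift[of ay, OF add(2) scale(2)]
  op_lift[of az, OF add(3) scale(3)]

lemma op_minus: "RX (- f) = - RX f" "RY (- f) = - RY f" "RZ (- f) = - RZ f"
  using op_diff[of 0 f] by (simp_all add: op_zero)

lemma lift_scale: "lift (\<lambda>v. c *s ax v) f = fsc c (lift ax f)"
  "lift (\<lambda>v. c *s ay v) f = fsc c (lift ay f)" "lift (\<lambda>v. c *s az v) f = fsc c (lift az f)"
  by (simp_all add: lift_def)

lemma fsc_linear: "fsc c (f + g) = fsc c f + fsc c g" "fsc c (f - g) = fsc c f - fsc c g"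
  "fsc c (- f) = - fsc c f" "fsc c (fsc d f) = fsc (c * d) f" "fsc c 0 = 0"
  by (simp_all add: lift_def fun_eq_iff algebra_simps)

lemma lift_relations:
  "lift ay (lift ax f) = fsc q (lift ax (lift ay f)) + lift az f"
  "lift az (lift ax f) = fsc (inverse p) (lift ax (lift az f))"
  "lift ay (lift az f) = fsc (inverse p) (lift az (lift ay f))"
  by (simp_all add: lift_def fun_eq_iff YX ZX YZ)

lemmas D_simps = D_defs lift_scale op_add op_diff op_minus op_scale op_zero op_lifts lift_ops fsc_linear
  right_op_relations lift_relations

lemma D_D:
  "D0 (D1x u v) (D1y u w) (D1z u v w) = 0"
  "D1x (D2a f) (D2b f) = 0" "D1y (D2a f) (D2c f) = 0" "D1z (D2a f) (D2b f) (D2c f) = 0"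
proof -
  have 1 [simp]: "p * (inverse p * u) = u" "inverse p * (p * u) = u" "p * (u * inverse p) = u" "p * inverse p = 1" "inverse p * p = 1" for u
    by (simp_all add: p0 field_simps)
  have 2: "fsc 1 f = f" for f by (simp add: lift_def fun_eq_iff)
  show "D0 (D1x u v) (D1y u w) (D1z u v w) = 0"
    "D1x (D2a f) (D2b f) = 0" "D1y (D2a f) (D2c f) = 0" "D1z (D2a f) (D2b f) (D2c f) = 0"
    unfolding D_simps by (simp_all add: algebra_simps 2)
qed

lemma ev3_D0:
  assumes "a \<in> Fin S" "b \<in> Fin S" "c \<in> Fin S"
  shows "ev3 (D0 a b c) = 0"
  using assms by (simp add: D0_def ev3_add[of _ S] ev3_diff FinS ev3_balanced)

lemma D_linear:
  "D0 (a - a') (b - b') (c - c') = D0 a b c - D0 a' b' c'"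
  "D1x (a - a') (b - b') = D1x a b - D1x a' b'"
  "D1y (a - a') (b - b') = D1y a b - D1y a' b'"
  "D1z (a - a') (b - b') (c - c') = D1z a b c - D1z a' b' c'"
  "D0 0 0 0 = 0"
  unfolding D_simps by (simp_all add: algebra_simps)

lemma D_Fin:
  "a \<in> Fin S \<Longrightarrow> b \<in> Fin S \<Longrightarrow> c \<in> Fin S \<Longrightarrow> D0 a b c \<in> Fin S"
  "a \<in> Fin S \<Longrightarrow> b \<in> Fin S \<Longrightarrow> D1x a b \<in> Fin S"
  "a \<in> Fin S \<Longrightarrow> b \<in> Fin S \<Longrightarrow> D1y a b \<in> Fin S"
  "a \<in> Fin S \<Longrightarrow> b \<in> Fin S \<Longrightarrow> c \<in> Fin S \<Longrightarrow> D1z a b c \<in> Fin S"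
  "a \<in> Fin S \<Longrightarrow> D2a a \<in> Fin S" "a \<in> Fin S \<Longrightarrow> D2b a \<in> Fin S" "a \<in> Fin S \<Longrightarrow> D2c a \<in> Fin S"
  unfolding D_defs by (intro FinS; assumption)+

text \<open>
  A cycle is reduced to zero by boundaries, one component at a time: regularity of \<open>x - X\<close> handles
  the component of \<open>x\<close>, regularity of \<open>z - Z\<close> that of \<open>z\<close>, and \<open>y - Y\<close> is injective on what remains.
  The next lemma is proved in the same way.
\<close>

lemma D1_exact:
  assumes "a \<in> Fin S" "b \<in> Fin S" "c \<in> Fin S" and z: "D0 a b c = 0"
  shows "\<exists>u \<in> Fin S. \<exists>v \<in> Fin S. \<exists>w \<in> Fin S. a = D1x u v \<and> b = D1y u w \<and> c = D1z u v w"
proof -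
  have 0: "0 \<in> Fin S" by (rule FinS)
  obtain u v where uv: "u \<in> Fin S" "v \<in> Fin S" "a = D1x u v"
    using RX_regular[OF assms(1,3,2) z[unfolded D0_def]] unfolding D1x_def by blast
  \<comment> \<open>subtracting the boundary of \<open>(u, v, 0)\<close> removes the component of \<open>x\<close>\<close>
  define b' c' where "b' = b - D1y u 0" and "c' = c - D1z u v 0"
  have in': "b' \<in> Fin S" "c' \<in> Fin S"
    unfolding b'_def c'_def using assms uv 0 by (auto intro!: FinS D_Fin)
  have "D0 (a - a) b' c' = 0"
    using z D_D(1)[of u v 0] uv(3) unfolding b'_def c'_def D_linear(1) by simp
  then have z': "(RY b' - lift ay b') + (RZ c' - lift az c') = 0"
    unfolding D0_def by (simp add: op_zero lift_ops)
  then have "RZ c' - lift (\<lambda>v. 1 *s az v) c' = RY (- b') - lift (\<lambda>v. 1 *s ay v) (- b')"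
    unfolding one_scale op_minus lift_ops by (simp add: algebra_simps eq_neg_iff_add_eq_0)
  then obtain g where g: "g \<in> Fin S" "c' = RY g - lift (\<lambda>v. inverse p *s ay v) g"
    using RZ_regular[OF in'(2), of "- b'" 1 1] in' FinS by auto
  \<comment> \<open>the boundary of \<open>(0, 0, w)\<close> removes the component of \<open>z\<close>\<close>
  define w where "w = - fsc (inverse p) g"
  have w: "w \<in> Fin S" unfolding w_def using g by (intro FinS)
  have cw: "c' = D1z 0 0 w"
    unfolding D1z_def w_def g(2) by (simp add: D_simps p0) (simp add: lift_def fun_eq_iff)
  define b'' where "b'' = b' - D1y 0 w"
  have "D0 (0 - D1x 0 0) (b' - D1y 0 w) (c' - D1z 0 0 w) = 0"
    unfolding D_linear(1) D_D using z' by (simp add: D0_def op_zero lift_ops)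
  then have "RY b'' = lift (\<lambda>v. 1 *s ay v) b''"
    unfolding cw b''_def[symmetric] one_scale D0_def D1x_def by (simp add: op_zero lift_ops lift_scale fsc_linear)
  moreover have "b'' \<in> Fin S" unfolding b''_def using in' w 0 by (auto intro!: FinS D_Fin)
  ultimately have "b'' = 0" by (intro RY_inj)
  then have "b = D1y u 0 + D1y 0 w" unfolding b''_def b'_def by (simp add: algebra_simps)
  moreover have "c = D1z u v 0 + D1z 0 0 w" using cw unfolding c'_def by (simp add: algebra_simps)
  ultimately have "b = D1y u w" "c = D1z u v w"
    by (simp_all add: D1y_def D1z_def op_zero lift_ops lift_scale fsc_linear)
  then show ?thesis using uv w by blast
qed

lemma D2_exact:
  assumes "u \<in> Fin S" "v \<in> Fin S" "w \<in> Fin S"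
    and z: "D1x u v = 0" "D1y u w = 0" "D1z u v w = 0"
  shows "\<exists>f \<in> Fin S. u = D2a f \<and> v = D2b f \<and> w = D2c f"
proof -
  have "RZ v - lift (\<lambda>v. inverse p *s az v) v = RY (- u) - lift (\<lambda>v. q *s ay v) (- u)"
    using z(1) unfolding D1x_def lift_scale op_minus lift_ops fsc_linear
    by (simp add: algebra_simps eq_neg_iff_add_eq_0)
  then obtain g where g: "g \<in> Fin S" "v = RY g - lift (\<lambda>v. (q * inverse p) *s ay v) g"
    using RZ_regular[OF assms(2), of "- u" "inverse p" q] assms FinS by auto
  define f where "f = - fsc (inverse p) g"
  have f: "f \<in> Fin S" unfolding f_def using g by (intro FinS)
  have v: "v = D2b f"
    unfolding D2b_def f_def g(2) by (simp add: D_simps p0) (simp add: lift_def fun_eq_iff)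
  have "D1x (u - D2a f) (v - D2b f) = 0" unfolding D_linear D_D z by simp
  then have "RY (u - D2a f) = lift (\<lambda>v. q *s ay v) (u - D2a f)"
    unfolding v D1x_def by (simp add: op_zero lift_ops lift_scale fsc_linear)
  moreover have "u - D2a f \<in> Fin S" using assms f by (auto intro!: FinS D_Fin)
  ultimately have u: "u - D2a f = 0" by (intro RY_inj)
  have "D1z (u - D2a f) (v - D2b f) (w - D2c f) = 0" unfolding D_linear D_D z by simp
  then have "lift ay (w - D2c f) = fsc p (RY (w - D2c f))"
    unfolding v u D1z_def by (simp add: op_zero lift_ops lift_scale fsc_linear)
  then have "RY (w - D2c f) = lift (\<lambda>v. inverse p *s ay v) (w - D2c f)"
    unfolding lift_scale by (simp add: fsc_linear(4) p0) (simp add: lift_def)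
  moreover have "w - D2c f \<in> Fin S" using assms f by (auto intro!: FinS D_Fin)
  ultimately have "w - D2c f = 0" by (intro RY_inj)
  then show ?thesis using u v f by auto
qed

lemma D2_inj:
  assumes "f \<in> Fin S" "D2b f = 0"
  shows "f = 0"
proof (rule RY_inj[OF assms(1)])
  have "fsc (inverse p) (fsc p (RY f)) = fsc (inverse p) (lift (\<lambda>v. q *s ay v) f)"
    using assms(2) by (simp add: D2b_def)
  then show "RY f = lift (\<lambda>v. (inverse p * q) *s ay v) f"
    unfolding lift_scale by (simp add: fsc_linear(4) p0) (simp add: lift_def)
qed

end

section \<open>Algebras with the PBW basis\<close>

text \<open>
  A ring with a bijection \<open>\<phi>\<close> to the coefficient functions under which left multiplications by the
  generators \<open>gx\<close>, \<open>gy\<close>, \<open>gz\<close> and the scalars \<open>\<kappa> c\<close> are the expected operators. Both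
  \<open>H\<^bsub>p,q\<^esub>\<close> and its opposite are instances, so that everything proved here for left
  modules also holds for right modules.
\<close>

locale PBW =
  fixes R :: "'a ring" (structure) and \<phi> :: "'a \<Rightarrow> 'k::field pbw" and p q :: 'k
    and gx gy gz :: 'a and \<kappa> :: "'k \<Rightarrow> 'a"
  assumes ring_R: "ring R" and p_nz: "p \<noteq> 0" and q_nz: "q \<noteq> 0"
    and \<phi>_bij: "bij_betw \<phi> (carrier R) (Fin UNIV)"
    and \<phi>_add: "a \<in> carrier R \<Longrightarrow> b \<in> carrier R \<Longrightarrow> \<phi> (a \<oplus> b) = \<phi> a + \<phi> b"
    and \<phi>_one: "\<phi> \<one> = single3 0 0 0 1"
    and gens [simp]: "gx \<in> carrier R" "gy \<in> carrier R" "gz \<in> carrier R" "\<kappa> c \<in> carrier R"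
    and \<phi>_x: "a \<in> carrier R \<Longrightarrow> \<phi> (gx \<otimes> a) = opx (\<phi> a)"
    and \<phi>_y: "a \<in> carrier R \<Longrightarrow> \<phi> (gy \<otimes> a) = opy (*) p q (\<phi> a)"
    and \<phi>_z: "a \<in> carrier R \<Longrightarrow> \<phi> (gz \<otimes> a) = opz (*) p (\<phi> a)"
    and \<phi>_\<kappa>: "a \<in> carrier R \<Longrightarrow> \<phi> (\<kappa> c \<otimes> a) = lift ((*) c) (\<phi> a)"
begin

sublocale R: ring R by (rule ring_R)

sublocale K: qspace "(*) :: 'k \<Rightarrow> 'k \<Rightarrow> 'k" p q
  by unfold_locales (simp_all add: algebra_simps p_nz q_nz)

lemma \<phi>_Fin: "a \<in> carrier R \<Longrightarrow> \<phi> a \<in> Fin UNIV"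
  using \<phi>_bij by (auto simp: bij_betw_def)

lemma \<phi>_inj: "a \<in> carrier R \<Longrightarrow> b \<in> carrier R \<Longrightarrow> \<phi> a = \<phi> b \<longleftrightarrow> a = b"
  using \<phi>_bij by (auto simp: bij_betw_def inj_on_def)

definition \<psi> :: "'k pbw \<Rightarrow> 'a" where "\<psi> f = inv_into (carrier R) \<phi> f"

lemma \<psi>: "f \<in> Fin UNIV \<Longrightarrow> \<psi> f \<in> carrier R" "f \<in> Fin UNIV \<Longrightarrow> \<phi> (\<psi> f) = f"
  "a \<in> carrier R \<Longrightarrow> \<psi> (\<phi> a) = a"
  unfolding \<psi>_def using \<phi>_bij
  by (auto simp: bij_betw_def intro: inv_into_into f_inv_into_f inv_into_f_f)

lemma \<phi>_zero: "\<phi> \<zero> = 0"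
  using \<phi>_add[of \<zero> \<zero>] by simp

lemma \<phi>_minus: "a \<in> carrier R \<Longrightarrow> \<phi> (\<ominus> a) = - \<phi> a"
  using \<phi>_add[of a "\<ominus> a"] by (simp add: R.r_neg \<phi>_zero eq_neg_iff_add_eq_0 add.commute)

lemma \<phi>_sub: "a \<in> carrier R \<Longrightarrow> b \<in> carrier R \<Longrightarrow> \<phi> (a \<ominus> b) = \<phi> a - \<phi> b"
  by (simp add: R.minus_eq \<phi>_add \<phi>_minus)

definition mon :: "nat \<Rightarrow> nat \<Rightarrow> nat \<Rightarrow> 'a" where
  "mon i j k = (((\<otimes>) gx) ^^ i) ((((\<otimes>) gz) ^^ j) ((((\<otimes>) gy) ^^ k) \<one>))"

lemma mon: "mon i j k \<in> carrier R" "\<phi> (mon i j k) = single3 i j k 1"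
proof -
  have 1: "(((\<otimes>) gy) ^^ k) \<one> \<in> carrier R \<and> \<phi> ((((\<otimes>) gy) ^^ k) \<one>) = single3 0 0 k 1" for k
    by (induction k) (auto simp: \<phi>_y \<phi>_one K.op_single)
  have 2: "(((\<otimes>) gz) ^^ j) ((((\<otimes>) gy) ^^ k) \<one>) \<in> carrier R \<and>
    \<phi> ((((\<otimes>) gz) ^^ j) ((((\<otimes>) gy) ^^ k) \<one>)) = single3 0 j k 1" for j
    using 1 by (induction j) (auto simp: \<phi>_z K.op_single)
  have "mon i j k \<in> carrier R \<and> \<phi> (mon i j k) = single3 i j k 1"
    unfolding mon_def using 2 by (induction i) (auto simp: \<phi>_x K.op_single)
  then show "mon i j k \<in> carrier R" "\<phi> (mon i j k) = single3 i j k 1" by auto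
qed

text \<open>
  The monomials are products of generators.
\<close>

lemma R_induct [consumes 1, case_names one add x y z scalar]:
  assumes a: "a \<in> carrier R" and one: "P \<one>"
    and add: "\<And>a b. a \<in> carrier R \<Longrightarrow> b \<in> carrier R \<Longrightarrow> P a \<Longrightarrow> P b \<Longrightarrow> P (a \<oplus> b)"
    and x: "\<And>a. a \<in> carrier R \<Longrightarrow> P a \<Longrightarrow> P (gx \<otimes> a)"
    and y: "\<And>a. a \<in> carrier R \<Longrightarrow> P a \<Longrightarrow> P (gy \<otimes> a)"
    and z: "\<And>a. a \<in> carrier R \<Longrightarrow> P a \<Longrightarrow> P (gz \<otimes> a)"
    and scalar: "\<And>c a. a \<in> carrier R \<Longrightarrow> P a \<Longrightarrow> P (\<kappa> c \<otimes> a)"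
  shows "P a"
proof -
  have m: "P (mon i j k)" for i j k
  proof -
    have 1: "(((\<otimes>) gy) ^^ k) \<one> \<in> carrier R \<and> P ((((\<otimes>) gy) ^^ k) \<one>)" for k
      by (induction k) (auto simp: one y)
    have 2: "(((\<otimes>) gz) ^^ j) ((((\<otimes>) gy) ^^ k) \<one>) \<in> carrier R \<and> P ((((\<otimes>) gz) ^^ j) ((((\<otimes>) gy) ^^ k) \<one>))" for j
      using 1 by (induction j) (auto simp: z)
    have "mon i j k \<in> carrier R \<and> P (mon i j k)"
      unfolding mon_def using 2 by (induction i) (auto simp: x)
    then show ?thesis by simp
  qed
  have s: "P (\<psi> (single3 i j k v))" for i j k v
  proof -
    have "\<psi> (single3 i j k v) = \<kappa> v \<otimes> mon i j k"
    proof (subst \<phi>_inj[symmetric])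
      show "\<phi> (\<psi> (single3 i j k v)) = \<phi> (\<kappa> v \<otimes> mon i j k)"
        by (auto simp: \<phi>_\<kappa> mon \<psi> K.single3_Fin) (auto simp: single3_def lift_def fun_eq_iff)
    qed (auto simp: \<psi> K.single3_Fin mon)
    then show ?thesis using scalar[OF mon(1) m] by simp
  qed
  have c: "\<psi> (f + g) = \<psi> f \<oplus> \<psi> g" if "f \<in> Fin UNIV" "g \<in> Fin UNIV" for f g
    using that K.Fin_closed[of UNIV] by (subst \<phi>_inj[symmetric]) (auto simp: \<phi>_add \<psi>)
  have "\<kappa> 0 \<otimes> \<one> = \<zero>"
    by (subst \<phi>_inj[symmetric]) (auto simp: \<phi>_\<kappa> \<phi>_zero lift_def fun_eq_iff simp del: R.r_one)
  then have P0: "P \<zero>" using scalar[OF R.one_closed one] by metis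
  have z0: "\<psi> 0 = \<zero>" using \<psi>(3)[of \<zero>] by (simp add: \<phi>_zero)
  have "P (\<psi> (\<phi> a))"
  proof (rule Fin_induct[OF \<phi>_Fin[OF a], of "\<lambda>f. P (\<psi> f)"])
    show "P (\<psi> 0)" using P0 z0 by simp
  qed (auto simp: s c add \<psi>)
  then show ?thesis using \<psi>(3)[OF a] by simp
qed

text \<open>
  Right multiplication by a generator and the corresponding operator on coefficients both commute
  with left multiplications, and they agree on \<open>\<one>\<close>.
\<close>

lemma \<phi>_right:
  assumes "a \<in> carrier R"
  shows "\<phi> (a \<otimes> gx) = rx (*) p q (\<phi> a)" "\<phi> (a \<otimes> gy) = ry (\<phi> a)" "\<phi> (a \<otimes> gz) = rz (*) p (\<phi> a)"
    "\<phi> (a \<otimes> \<kappa> c) = lift ((*) c) (\<phi> a)"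
proof -
  have m: "lift ((*) c) (opx f) = opx (lift ((*) c) f)" "lift ((*) c) (opy (*) p q f) = opy (*) p q (lift ((*) c) f)"
    "lift ((*) c) (opz (*) p f) = opz (*) p (lift ((*) c) f)"
    "lift ((*) c) (f + g) = lift ((*) c) f + lift ((*) c) g" for f g :: "'k pbw"
    by (auto simp: K.op_scale) (simp add: lift_def fun_eq_iff algebra_simps)
  have g1: "\<phi> g = \<phi> (g \<otimes> \<one>)" if "g \<in> carrier R" for g using that by simp
  show "\<phi> (a \<otimes> gx) = rx (*) p q (\<phi> a)"
    using assms
  proof (induction rule: R_induct)
    case one
    show ?case by (simp add: g1[of gx] \<phi>_x \<phi>_one K.op_single del: R.r_one)
  next
    case (add a b)
    then show ?case by (simp only: R.l_distr gens R.m_closed \<phi>_add K.op_add)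
  qed (simp_all add: R.l_distr R.m_assoc \<phi>_add \<phi>_x \<phi>_y \<phi>_z \<phi>_\<kappa> K.op_add K.left_right_commute K.op_scale)
  show "\<phi> (a \<otimes> gy) = ry (\<phi> a)"
    using assms
  proof (induction rule: R_induct)
    case one
    show ?case by (simp add: g1[of gy] \<phi>_y \<phi>_one K.op_single del: R.r_one)
  next
    case (add a b)
    then show ?case by (simp only: R.l_distr gens R.m_closed \<phi>_add K.op_add)
  qed (simp_all add: R.l_distr R.m_assoc \<phi>_add \<phi>_x \<phi>_y \<phi>_z \<phi>_\<kappa> K.op_add K.left_right_commute K.op_scale)
  show "\<phi> (a \<otimes> gz) = rz (*) p (\<phi> a)"
    using assms
  proof (induction rule: R_induct)
    case one
    show ?case by (simp add: g1[of gz] \<phi>_z \<phi>_one K.op_single del: R.r_one)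
  next
    case (add a b)
    then show ?case by (simp only: R.l_distr gens R.m_closed \<phi>_add K.op_add)
  qed (simp_all add: R.l_distr R.m_assoc \<phi>_add \<phi>_x \<phi>_y \<phi>_z \<phi>_\<kappa> K.op_add K.left_right_commute K.op_scale)
  show "\<phi> (a \<otimes> \<kappa> c) = lift ((*) c) (\<phi> a)"
    using assms
  proof (induction rule: R_induct)
    case one
    show ?case by (simp add: g1[of "\<kappa> c"] \<phi>_\<kappa> \<phi>_one del: R.r_one)
  next
    case (add a b)
    then show ?case by (simp only: R.l_distr gens R.m_closed \<phi>_add m)
  next
    case (scalar d a)
    then show ?case by (simp add: R.m_assoc \<phi>_\<kappa>) (simp add: lift_def fun_eq_iff mult.left_commute)
  qed (simp_all add: R.m_assoc \<phi>_x \<phi>_y \<phi>_z m)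
qed

lemma \<kappa>_central: "a \<in> carrier R \<Longrightarrow> \<kappa> c \<otimes> a = a \<otimes> \<kappa> c"
  by (subst \<phi>_inj[symmetric]) (auto simp: \<phi>_\<kappa> \<phi>_right)

lemma \<phi>_gens: "\<phi> gx = single3 1 0 0 1" "\<phi> gy = single3 0 0 1 1" "\<phi> gz = single3 0 1 0 1"
  "\<phi> (\<kappa> c) = single3 0 0 0 c"
  using \<phi>_x[of \<one>] \<phi>_y[of \<one>] \<phi>_z[of \<one>] \<phi>_\<kappa>[of \<one> c]
  by (simp_all add: \<phi>_one K.op_single) (auto simp: lift_def single3_def fun_eq_iff)

lemma \<kappa>_ring:
  "\<kappa> (c + d) = \<kappa> c \<oplus> \<kappa> d" "\<kappa> (c * d) = \<kappa> c \<otimes> \<kappa> d" "\<kappa> 1 = \<one>" "\<kappa> 0 = \<zero>" "\<kappa> (- c) = \<ominus> \<kappa> c"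
  by (subst \<phi>_inj[symmetric]; auto simp: \<phi>_add \<phi>_minus \<phi>_\<kappa> \<phi>_gens \<phi>_one \<phi>_zero; auto simp: lift_def single3_def fun_eq_iff)+

lemma \<kappa>_inj: "\<kappa> c = \<kappa> d \<longleftrightarrow> c = d"
proof
  assume "\<kappa> c = \<kappa> d"
  then have "single3 0 0 0 c 0 0 0 = (single3 0 0 0 d 0 0 0 :: 'k)" using \<phi>_gens(4) by metis
  then show "c = d" by (simp add: single3_def)
qed simp

lemma relations:
  "gz \<otimes> gx = \<kappa> (inverse p) \<otimes> (gx \<otimes> gz)" "gz \<otimes> gy = \<kappa> p \<otimes> (gy \<otimes> gz)"
  "gy \<otimes> gx = \<kappa> q \<otimes> (gx \<otimes> gy) \<oplus> gz"
  by (subst \<phi>_inj[symmetric]; auto simp: \<phi>_add \<phi>_\<kappa> \<phi>_x \<phi>_y \<phi>_z \<phi>_gens p_nz K.op_single;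
      auto simp: lift_def single3_def fun_eq_iff p_nz)+

end

subsection \<open>The opposite algebra\<close>

lemma opposite_simps [simp]:
  "carrier (opposite R) = carrier R" "a \<otimes>\<^bsub>opposite R\<^esub> b = b \<otimes>\<^bsub>R\<^esub> a" "\<one>\<^bsub>opposite R\<^esub> = \<one>\<^bsub>R\<^esub>"
  "\<zero>\<^bsub>opposite R\<^esub> = \<zero>\<^bsub>R\<^esub>" "add (opposite R) = add R"
  by (simp_all add: opposite_def)

lemma add_monoid_opposite: "add_monoid (opposite R) = add_monoid R"
  by (simp add: opposite_def)

lemma ring_opposite:
  assumes "ring R" shows "ring (opposite R)"
proof -
  interpret ring R by fact
  show ?thesis
  proof (rule ring.intro)
    show "abelian_group (opposite R)"
      using abelian_group_axioms
      by (simp add: abelian_group_def abelian_monoid_def abelian_group_axioms_def add_monoid_opposite)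
    show "Group.monoid (opposite R)" by (rule monoidI) (auto simp: m_assoc)
    show "ring_axioms (opposite R)" by (rule ring_axioms.intro) (auto simp: l_distr r_distr)
  qed
qed

text \<open>
  The anti-automorphism \<open>flip\<close> exchanges the operators of left and right multiplication; \<open>gx\<close> and
  \<open>gy\<close> change places.
\<close>

lemma (in PBW) PBW_opposite: "PBW (opposite R) (flip \<circ> \<phi>) p q gy gx gz \<kappa>"
proof (rule PBW.intro)
  show "ring (opposite R)" by (rule ring_opposite[OF ring_R])
  have "bij_betw flip (Fin UNIV) (Fin UNIV :: 'k pbw set)"
    by (rule bij_betwI[of _ _ _ flip]) auto
  then show "bij_betw (flip \<circ> \<phi>) (carrier (opposite R)) (Fin UNIV)"
    using bij_betw_trans[OF \<phi>_bij] by simp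
qed (auto simp: p_nz q_nz \<phi>_add flip_add \<phi>_one \<phi>_right rx_def ry_def rz_def,
     auto simp: flip_def single3_def lift_def fun_eq_iff)

section \<open>Modules as vector spaces with operators\<close>

definition op_module :: "('a \<Rightarrow> 'v \<Rightarrow> 'v) \<Rightarrow> 'v::ab_group_add set \<Rightarrow> ('a, 'v) module" where
  "op_module act S = \<lparr>carrier = S, monoid.mult = undefined, one = undefined, zero = 0, add = (+),
     module.smult = act\<rparr>"

lemma op_module_simps [simp]:
  "carrier (op_module act S) = S" "\<zero>\<^bsub>op_module act S\<^esub> = 0" "u \<oplus>\<^bsub>op_module act S\<^esub> v = u + v"
  "a \<odot>\<^bsub>op_module act S\<^esub> v = act a v"
  by (simp_all add: op_module_def)

lemma abelian_group_op_module:
  assumes "0 \<in> S" "\<And>u v. u \<in> S \<Longrightarrow> v \<in> S \<Longrightarrow> u + v \<in> S" "\<And>u. u \<in> S \<Longrightarrow> - u \<in> S"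
  shows "abelian_group (op_module act S)"
proof (rule abelian_groupI)
  fix u assume "u \<in> carrier (op_module act S)"
  then show "\<exists>v \<in> carrier (op_module act S). v \<oplus>\<^bsub>op_module act S\<^esub> u = \<zero>\<^bsub>op_module act S\<^esub>"
    using assms(3) by (intro bexI[of _ "- u"]) auto
qed (use assms in \<open>auto simp: add_ac\<close>)

lemma lmod_homD:
  assumes "f \<in> lmod_hom R M N"
  shows "x \<in> carrier M \<Longrightarrow> f x \<in> carrier N"
    "x \<in> carrier M \<Longrightarrow> y \<in> carrier M \<Longrightarrow> f (x \<oplus>\<^bsub>M\<^esub> y) = f x \<oplus>\<^bsub>N\<^esub> f y"
    "a \<in> carrier R \<Longrightarrow> x \<in> carrier M \<Longrightarrow> f (a \<odot>\<^bsub>M\<^esub> x) = a \<odot>\<^bsub>N\<^esub> f x"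
  using assms by (auto simp: lmod_hom_def)

lemma lmod_hom_restrictI:
  assumes "left_module R M" "\<And>x. x \<in> carrier M \<Longrightarrow> f x \<in> carrier N"
    "\<And>x y. x \<in> carrier M \<Longrightarrow> y \<in> carrier M \<Longrightarrow> f (x \<oplus>\<^bsub>M\<^esub> y) = f x \<oplus>\<^bsub>N\<^esub> f y"
    "\<And>a x. a \<in> carrier R \<Longrightarrow> x \<in> carrier M \<Longrightarrow> f (a \<odot>\<^bsub>M\<^esub> x) = a \<odot>\<^bsub>N\<^esub> f x"
  shows "restrict f (carrier M) \<in> lmod_hom R M N"
proof -
  interpret left_module R M by fact
  show ?thesis
    unfolding lmod_hom_def using assms lsmult_closed by auto
qed

lemma lmod_hom_comp:
  assumes "left_module R M" "f \<in> lmod_hom R M N" "g \<in> lmod_hom R N L"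
  shows "(\<lambda>x \<in> carrier M. g (f x)) \<in> lmod_hom R M L"
  by (rule lmod_hom_restrictI[OF assms(1)]) (auto simp: lmod_homD[OF assms(2)] lmod_homD[OF assms(3)])

context left_module begin

lemma lsmult_zero: "a \<in> carrier R \<Longrightarrow> a \<odot>\<^bsub>M\<^esub> \<zero>\<^bsub>M\<^esub> = \<zero>\<^bsub>M\<^esub>"
  using lsmult_r_distr[of a "\<zero>\<^bsub>M\<^esub>" "\<zero>\<^bsub>M\<^esub>"] lsmult_closed[of a "\<zero>\<^bsub>M\<^esub>"]
  by (metis M.add.l_cancel_one' M.zero_closed M.l_zero)

lemma zero_lsmult: "v \<in> carrier M \<Longrightarrow> \<zero>\<^bsub>R\<^esub> \<odot>\<^bsub>M\<^esub> v = \<zero>\<^bsub>M\<^esub>"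
  using lsmult_l_distr[of "\<zero>\<^bsub>R\<^esub>" "\<zero>\<^bsub>R\<^esub>" v] lsmult_closed[of "\<zero>\<^bsub>R\<^esub>" v]
  by (metis M.add.l_cancel_one' R.zero_closed R.l_zero)

lemma lsmult_finsum:
  assumes "finite A" "a \<in> carrier R" "f \<in> A \<rightarrow> carrier M"
  shows "a \<odot>\<^bsub>M\<^esub> finsum M f A = finsum M (\<lambda>i. a \<odot>\<^bsub>M\<^esub> f i) A"
  using assms(1,3)
proof (induction A rule: finite_induct)
  case empty
  then show ?case by (simp add: lsmult_zero assms(2))
next
  case (insert i A)
  then have f: "f \<in> A \<rightarrow> carrier M" "f i \<in> carrier M" by auto
  then have g: "(\<lambda>i. a \<odot>\<^bsub>M\<^esub> f i) \<in> A \<rightarrow> carrier M" "a \<odot>\<^bsub>M\<^esub> f i \<in> carrier M"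
    using lsmult_closed[OF assms(2)] by auto
  show ?case
    using insert f g by (simp add: M.finsum_insert lsmult_r_distr assms(2) M.finsum_closed)
qed

end

text \<open>
  Scalar multiplication on formal linear combinations, the vector space with basis \<open>'i\<close>.
\<close>

definition psc :: "'k::field \<Rightarrow> ('i \<Rightarrow>\<^sub>0 'k) \<Rightarrow> 'i \<Rightarrow>\<^sub>0 'k" where
  "psc c v = Poly_Mapping.map ((*) c) v"

lemma lookup_psc [simp]: "Poly_Mapping.lookup (psc c v) i = c * Poly_Mapping.lookup v i"
  by (simp add: psc_def Poly_Mapping.map.rep_eq when_def)

lemma vector_space_psc: "vector_space psc"
  by unfold_locales (auto intro!: poly_mapping_eqI simp: lookup_add algebra_simps)

text \<open>
  The kernel of \<open>g\<close> is \<open>W\<close>; its image is a complement of \<open>W\<close>.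
\<close>

lemma exists_projection_along:
  fixes sc :: "'k::field \<Rightarrow> 'v::ab_group_add \<Rightarrow> 'v"
  assumes "vector_space sc" "module.subspace sc W"
  shows "\<exists>g. (\<forall>u v. g (u + v) = g u + g v) \<and> (\<forall>c v. g (sc c v) = sc c (g v)) \<and>
    (\<forall>w \<in> W. g w = 0) \<and> (\<forall>v. v - g v \<in> W)"
proof -
  interpret vector_space sc by fact
  interpret vector_space_pair sc sc ..
  obtain B where B: "B \<subseteq> W" "independent B" "W \<subseteq> span B"
    using maximal_independent_subset by metis
  obtain C where C: "B \<subseteq> C" "independent C" "UNIV \<subseteq> span C"
    using maximal_independent_subset_extend[of B UNIV] B(2) by auto
  obtain g where g: "Vector_Spaces.linear sc sc g" "\<forall>x \<in> C. g x = (if x \<in> B then 0 else x)"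
    using linear_independent_extend[OF C(2), of "\<lambda>x. if x \<in> B then 0 else x"] by blast
  have add: "g (u + v) = g u + g v" and sc: "g (sc c v) = sc c (g v)" for u v c
    using g(1) by (auto simp: Vector_Spaces.linear_iff)
  have g0: "g 0 = 0" using add[of 0 0] by simp
  have "subspace {w. g w = 0}" by (rule subspaceI) (auto simp: add sc g0)
  moreover have "B \<subseteq> {w. g w = 0}" using g(2) C(1) by auto
  ultimately have "span B \<subseteq> {w. g w = 0}" by (rule span_minimal[rotated])
  then have 1: "\<forall>w \<in> W. g w = 0" using B(3) by auto
  have "subspace {v. v - g v \<in> W}"
  proof (rule subspaceI)
    fix u v assume "u \<in> {v. v - g v \<in> W}" "v \<in> {v. v - g v \<in> W}"
    then have "(u - g u) + (v - g v) \<in> W" using subspace_add[OF assms(2)] by simp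
    then show "u + v \<in> {v. v - g v \<in> W}" by (simp add: add algebra_simps)
  next
    fix c v assume "v \<in> {v. v - g v \<in> W}"
    then have "sc c (v - g v) \<in> W" using subspace_scale[OF assms(2)] by simp
    then show "sc c v \<in> {v. v - g v \<in> W}" by (simp add: sc algebra_simps)
  qed (simp add: g0 subspace_0[OF assms(2)])
  moreover have "C \<subseteq> {v. v - g v \<in> W}"
    using g(2) B(1) subspace_0[OF assms(2)] by auto
  ultimately have "span C \<subseteq> {v. v - g v \<in> W}" by (rule span_minimal[rotated])
  then have "\<forall>v. v - g v \<in> W" using C(3) by auto
  then show ?thesis using add sc 1 by blast
qed

context PBW begin

text \<open>
  The ring is generated by \<open>gx\<close>, \<open>gy\<close>, \<open>gz\<close> and the scalars, so that linearity needs to be checked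
  on these only.
\<close>

lemma lmod_homI:
  assumes M: "left_module R M" and N: "left_module R N"
    and "\<And>v. v \<in> carrier M \<Longrightarrow> f v \<in> carrier N"
    and "\<And>u v. u \<in> carrier M \<Longrightarrow> v \<in> carrier M \<Longrightarrow> f (u \<oplus>\<^bsub>M\<^esub> v) = f u \<oplus>\<^bsub>N\<^esub> f v"
    and "\<And>v. v \<in> carrier M \<Longrightarrow> f (gx \<odot>\<^bsub>M\<^esub> v) = gx \<odot>\<^bsub>N\<^esub> f v"
    and "\<And>v. v \<in> carrier M \<Longrightarrow> f (gy \<odot>\<^bsub>M\<^esub> v) = gy \<odot>\<^bsub>N\<^esub> f v"
    and "\<And>v. v \<in> carrier M \<Longrightarrow> f (gz \<odot>\<^bsub>M\<^esub> v) = gz \<odot>\<^bsub>N\<^esub> f v"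
    and "\<And>c v. v \<in> carrier M \<Longrightarrow> f (\<kappa> c \<odot>\<^bsub>M\<^esub> v) = \<kappa> c \<odot>\<^bsub>N\<^esub> f v"
  shows "restrict f (carrier M) \<in> lmod_hom R M N"
proof (rule lmod_hom_restrictI[OF M])
  interpret M: left_module R M by fact
  interpret N: left_module R N by fact
  fix a v assume a: "a \<in> carrier R" and v: "v \<in> carrier M"
  show "f (a \<odot>\<^bsub>M\<^esub> v) = a \<odot>\<^bsub>N\<^esub> f v"
    using a
    by (induction rule: R_induct)
       (simp_all add: assms v M.lsmult_one N.lsmult_one M.lsmult_l_distr N.lsmult_l_distr
          M.lsmult_assoc N.lsmult_assoc M.lsmult_closed)
qed (use assms in auto)

end

locale PBW_mod = PBW R \<phi> p q gx gy gz \<kappa> + qmod sc p q ax ay az S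
  for R :: "'a ring" (structure) and \<phi> :: "'a \<Rightarrow> 'k::field pbw" and p q gx gy gz \<kappa>
    and sc :: "'k \<Rightarrow> 'v::ab_group_add \<Rightarrow> 'v" (infixr "*s" 75) and ax ay az S
begin

definition tens :: "'k pbw \<Rightarrow> 'v \<Rightarrow> 'v pbw" where
  "tens f v = (\<lambda>i j k. f i j k *s v)"

text \<open>
  The action of the ring on \<open>S\<close> that extends the given operators: \<open>tens\<close> forms \<open>a \<otimes> v\<close>, which is
  then evaluated.
\<close>

definition act :: "'a \<Rightarrow> 'v \<Rightarrow> 'v" where
  "act a v = ev3 (tens (\<phi> a) v)"

abbreviation "TM \<equiv> op_module act S"

lemma tens_op:
  "tens (opx f) v = LX (tens f v)" "tens (opy (*) p q f) v = LY (tens f v)"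
  "tens (opz (*) p f) v = LZ (tens f v)" "tens (lift ((*) c) f) v = fsc c (tens f v)"
  "tens (f + g) v = tens f v + tens g v" "tens f (u + v) = tens f u + tens f v"
  "tens f (c *s v) = fsc c (tens f v)"
  "tens (single3 i j k 1) v = single3 i j k v"
proof -
  have case_sc: "(case n of 0 \<Rightarrow> 0 | Suc m \<Rightarrow> h m) *s v = (case n of 0 \<Rightarrow> 0 | Suc m \<Rightarrow> h m *s v)" for n h
    by (cases n) simp_all
  show "tens (opx f) v = LX (tens f v)" "tens (opy (*) p q f) v = LY (tens f v)"
    "tens (opz (*) p f) v = LZ (tens f v)"
    unfolding tens_def opx_def opy_def opz_def by (simp_all only: scale_left_distrib case_sc scale_scale)
  show "tens (lift ((*) c) f) v = fsc c (tens f v)"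
    "tens (f + g) v = tens f v + tens g v" "tens f (u + v) = tens f u + tens f v"
    by (simp_all add: tens_def fun_eq_iff lift_def scale_left_distrib scale_right_distrib)
  show "tens f (c *s v) = fsc c (tens f v)"
    by (simp add: tens_def lift_def mult.commute)
  show "tens (single3 i j k 1) v = single3 i j k v"
    by (auto simp: tens_def single3_def fun_eq_iff)
qed

lemma tens_Fin: "f \<in> Fin UNIV \<Longrightarrow> v \<in> S \<Longrightarrow> tens f v \<in> Fin S" "f \<in> Fin UNIV \<Longrightarrow> tens f v \<in> Fin UNIV"
  by (auto simp: Fin_def tens_def Ssc)

lemma act_simps:
  "act \<one> v = v"
  "a \<in> carrier R \<Longrightarrow> b \<in> carrier R \<Longrightarrow> act (a \<oplus> b) v = act a v + act b v"
  "a \<in> carrier R \<Longrightarrow> act (gx \<otimes> a) v = ax (act a v)"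
  "a \<in> carrier R \<Longrightarrow> act (gy \<otimes> a) v = ay (act a v)"
  "a \<in> carrier R \<Longrightarrow> act (gz \<otimes> a) v = az (act a v)"
  "a \<in> carrier R \<Longrightarrow> act (\<kappa> c \<otimes> a) v = c *s (act a v)"
  "a \<in> carrier R \<Longrightarrow> act a (u + v) = act a u + act a v"
  "a \<in> carrier R \<Longrightarrow> act a (c *s v) = c *s act a v"
  "a \<in> carrier R \<Longrightarrow> v \<in> S \<Longrightarrow> act a v \<in> S"
  unfolding act_def
  by (simp_all add: \<phi>_one \<phi>_add \<phi>_x \<phi>_y \<phi>_z \<phi>_\<kappa> tens_op ev3_single ev3_add[of _ UNIV] ev3_op[of _ UNIV]
      tens_Fin \<phi>_Fin ev3_in)

lemma act_gens: "act gx v = ax v" "act gy v = ay v" "act gz v = az v" "act (\<kappa> c) v = c *s v"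
  using act_simps(3-5)[of \<one> v] act_simps(6)[of \<one> c v] by (simp_all add: act_simps(1))

lemma act_assoc: "a \<in> carrier R \<Longrightarrow> b \<in> carrier R \<Longrightarrow> act (a \<otimes> b) v = act a (act b v)"
  by (induction rule: R_induct) (simp_all add: act_simps R.l_distr R.m_assoc)

lemma abelian_group_TM: "abelian_group TM"
  by (rule abelian_group_op_module) (auto simp: S0 Sadd subspace_neg[OF subS])

lemma left_module_TM: "left_module R TM"
proof -
  interpret abelian_group TM by (rule abelian_group_TM)
  show ?thesis
    by unfold_locales (auto simp: act_simps act_assoc)
qed

end

text \<open>
  Every module is isomorphic to an invariant subspace of the space of formal linear combinations of
  its elements. The subspace is a complement of the kernel of the evaluation of formal combinations
  in \<open>M\<close>, and the operators first evaluate, then act in \<open>M\<close>, then return to the complement; so they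
  satisfy the relations on the whole space.
\<close>

lemma (in PBW) module_as_operators:
  fixes M :: "('a, 'u) module"
  assumes "left_module R M"
  obtains s :: "'u \<Rightarrow> 'u \<Rightarrow>\<^sub>0 'k" and ax ay az S where
    "qmod psc p q ax ay az S" "bij_betw s (carrier M) S"
    "\<And>m n. m \<in> carrier M \<Longrightarrow> n \<in> carrier M \<Longrightarrow> s (m \<oplus>\<^bsub>M\<^esub> n) = s m + s n"
    "\<And>m. m \<in> carrier M \<Longrightarrow> s (gx \<odot>\<^bsub>M\<^esub> m) = ax (s m)"
    "\<And>m. m \<in> carrier M \<Longrightarrow> s (gy \<odot>\<^bsub>M\<^esub> m) = ay (s m)"
    "\<And>m. m \<in> carrier M \<Longrightarrow> s (gz \<odot>\<^bsub>M\<^esub> m) = az (s m)"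
    "\<And>m c. m \<in> carrier M \<Longrightarrow> s (\<kappa> c \<odot>\<^bsub>M\<^esub> m) = psc c (s m)"
proof -
  interpret M: left_module R M by fact
  interpret V: vector_space "psc :: 'k \<Rightarrow> ('u \<Rightarrow>\<^sub>0 'k) \<Rightarrow> _" by (rule vector_space_psc)
  define t where "t = (\<lambda>(v :: 'u \<Rightarrow>\<^sub>0 'k) u. \<kappa> (Poly_Mapping.lookup v u) \<odot>\<^bsub>M\<^esub> u)"
  \<comment> \<open>evaluation of formal linear combinations in \<open>M\<close>; the part outside the carrier of \<open>M\<close> counts as zero\<close>
  define ev where "ev = (\<lambda>v :: 'u \<Rightarrow>\<^sub>0 'k. finsum M (t v) (Poly_Mapping.keys v \<inter> carrier M))"
  have t: "t v \<in> A \<rightarrow> carrier M" if "A \<subseteq> carrier M" for v A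
    using that by (auto simp: t_def M.lsmult_closed)
  have ev_eq: "ev v = finsum M (t v) A"
    if "finite A" "A \<subseteq> carrier M" "Poly_Mapping.keys v \<inter> carrier M \<subseteq> A" for v A
    unfolding ev_def
  proof (rule M.add.finprod_mono_neutral_cong_left[OF that(1,3)])
    fix u assume "u \<in> A - Poly_Mapping.keys v \<inter> carrier M"
    then have "Poly_Mapping.lookup v u = 0" "u \<in> carrier M" using that(2) by (auto simp: in_keys_iff)
    then show "t v u = \<zero>\<^bsub>M\<^esub>" by (simp add: t_def \<kappa>_ring M.zero_lsmult)
  qed (use t[OF that(2)] in auto)
  have ev_in [simp]: "ev v \<in> carrier M" for v
    unfolding ev_def by (rule M.finsum_closed) (rule t, simp)
  have ev_add: "ev (u + v) = ev u \<oplus>\<^bsub>M\<^esub> ev v" for u v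
  proof -
    let ?A = "(Poly_Mapping.keys u \<union> Poly_Mapping.keys v) \<inter> carrier M"
    have A: "finite ?A" "?A \<subseteq> carrier M" by auto
    have k: "Poly_Mapping.keys (u + v) \<inter> carrier M \<subseteq> ?A" using Poly_Mapping.keys_add[of u v] by blast
    have "ev (u + v) = finsum M (\<lambda>i. t u i \<oplus>\<^bsub>M\<^esub> t v i) ?A"
      unfolding ev_eq[OF A k]
      by (rule M.finsum_cong') (auto simp: t_def lookup_add \<kappa>_ring M.lsmult_l_distr M.lsmult_closed)
    also have "\<dots> = finsum M (t u) ?A \<oplus>\<^bsub>M\<^esub> finsum M (t v) ?A"
      using t[OF A(2)] by (intro M.finsum_addf)
    also have "\<dots> = ev u \<oplus>\<^bsub>M\<^esub> ev v" by (subst (1 2) ev_eq[OF A]) auto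
    finally show ?thesis .
  qed
  have ev_sc: "ev (psc c v) = \<kappa> c \<odot>\<^bsub>M\<^esub> ev v" for c v
  proof -
    let ?A = "Poly_Mapping.keys v \<inter> carrier M"
    have A: "finite ?A" "?A \<subseteq> carrier M" by auto
    have k: "Poly_Mapping.keys (psc c v) \<inter> carrier M \<subseteq> ?A" by (auto simp: in_keys_iff)
    have "ev (psc c v) = finsum M (\<lambda>i. \<kappa> c \<odot>\<^bsub>M\<^esub> t v i) ?A"
      unfolding ev_eq[OF A k]
      by (rule M.finsum_cong') (auto simp: t_def \<kappa>_ring M.lsmult_assoc M.lsmult_closed)
    also have "\<dots> = \<kappa> c \<odot>\<^bsub>M\<^esub> ev v"
      unfolding ev_def by (rule M.lsmult_finsum[symmetric]) (use t[OF A(2)] in auto)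
    finally show ?thesis .
  qed
  have ev_single: "ev (Poly_Mapping.single m 1) = m" if m: "m \<in> carrier M" for m
  proof -
    have "ev (Poly_Mapping.single m 1) = finsum M (t (Poly_Mapping.single m 1)) {m}"
      using m by (intro ev_eq) auto
    also have "\<dots> = m" using m by (simp add: t_def \<kappa>_ring M.lsmult_one)
    finally show ?thesis .
  qed
  have ev_diff: "ev (u - v) = \<zero>\<^bsub>M\<^esub> \<longleftrightarrow> ev u = ev v" for u v
  proof -
    have e: "ev u = ev (u - v) \<oplus>\<^bsub>M\<^esub> ev v" using ev_add[of "u - v" v] by simp
    show ?thesis
    proof
      assume "ev (u - v) = \<zero>\<^bsub>M\<^esub>" then show "ev u = ev v" using e by simp
    next
      assume "ev u = ev v"
      then have "ev (u - v) \<oplus>\<^bsub>M\<^esub> ev v = ev v" using e by metis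
      then show "ev (u - v) = \<zero>\<^bsub>M\<^esub>" by (metis M.add.r_cancel_one ev_in)
    qed
  qed
  define W where "W = {v. ev v = \<zero>\<^bsub>M\<^esub>}"
  have ev0: "ev 0 = \<zero>\<^bsub>M\<^esub>" using ev_diff[of 0 0] by simp
  have W: "V.subspace W"
    unfolding W_def by (rule V.subspaceI) (auto simp: ev_add ev_sc ev0 M.lsmult_zero)
  obtain g where g: "\<And>u v. g (u + v) = g u + g v" "\<And>c v. g (psc c v) = psc c (g v)"
    "\<And>w. w \<in> W \<Longrightarrow> g w = 0" "\<And>v. v - g v \<in> W"
    using exists_projection_along[OF vector_space_psc W] by metis
  define s where "s = (\<lambda>m. g (Poly_Mapping.single m 1))"
  have evg: "ev (g v) = ev v" for v using g(4)[of v] by (simp add: W_def ev_diff)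
  have ev_s: "ev (s m) = m" if "m \<in> carrier M" for m
    using that by (simp add: s_def evg ev_single)
  have g_diff: "g (u - v) = g u - g v" for u v using g(1)[of "u - v" v] by simp
  have g_s: "g v = s (ev v)" for v
  proof -
    have "v - Poly_Mapping.single (ev v) 1 \<in> W" by (simp add: W_def ev_diff ev_single)
    from g(3)[OF this] show ?thesis by (simp add: s_def g_diff)
  qed
  have gs: "g (s m) = s m" if "m \<in> carrier M" for m using g_s[of "s m"] ev_s[OF that] by simp
  have s_add: "s (m \<oplus>\<^bsub>M\<^esub> n) = s m + s n" if "m \<in> carrier M" "n \<in> carrier M" for m n
    using g_s[of "s m + s n"] that by (simp add: g gs ev_add ev_s)
  have s_sc: "s (\<kappa> c \<odot>\<^bsub>M\<^esub> m) = psc c (s m)" if "m \<in> carrier M" for m c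
    using g_s[of "psc c (s m)"] that by (simp add: g gs ev_sc ev_s)
  have s0: "s \<zero>\<^bsub>M\<^esub> = 0" using s_add[of "\<zero>\<^bsub>M\<^esub>" "\<zero>\<^bsub>M\<^esub>"] by simp
  define S where "S = s ` carrier M"
  \<comment> \<open>evaluate, act in \<open>M\<close>, return to the complement\<close>
  define A where "A = (\<lambda>h v. s (h \<odot>\<^bsub>M\<^esub> ev v))"
  have A_add: "A h (u + v) = A h u + A h v" if "h \<in> carrier R" for h u v
    using that by (simp add: A_def ev_add M.lsmult_r_distr M.lsmult_closed s_add)
  have comm: "h \<odot>\<^bsub>M\<^esub> (\<kappa> c \<odot>\<^bsub>M\<^esub> m) = \<kappa> c \<odot>\<^bsub>M\<^esub> (h \<odot>\<^bsub>M\<^esub> m)"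
    if "h \<in> carrier R" "m \<in> carrier M" for h c m
    using that by (simp add: M.lsmult_assoc[symmetric] \<kappa>_central)
  have A_sc: "A h (psc c v) = psc c (A h v)" if "h \<in> carrier R" for h c v
    using that by (simp add: A_def ev_sc comm s_sc M.lsmult_closed)
  have A_A: "A h (A h' v) = s ((h \<otimes> h') \<odot>\<^bsub>M\<^esub> ev v)" if "h \<in> carrier R" "h' \<in> carrier R" for h h' v
    using that by (simp add: A_def ev_s M.lsmult_closed M.lsmult_assoc)
  have A_in: "A h v \<in> S" if "h \<in> carrier R" for h v
    using that by (auto simp: A_def S_def M.lsmult_closed)
  have subS: "V.subspace S"
  proof (rule V.subspaceI)
    show "0 \<in> S" unfolding S_def using s0[symmetric] by (rule image_eqI) simp
    fix u v assume "u \<in> S" "v \<in> S"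
    then obtain m n where "m \<in> carrier M" "n \<in> carrier M" "u = s m" "v = s n" by (auto simp: S_def)
    then show "u + v \<in> S" unfolding S_def by (intro image_eqI[of _ _ "m \<oplus>\<^bsub>M\<^esub> n"]) (auto simp: s_add)
  next
    fix c v assume "v \<in> S"
    then obtain m where "m \<in> carrier M" "v = s m" by (auto simp: S_def)
    then show "psc c v \<in> S"
      unfolding S_def by (intro image_eqI[of _ _ "\<kappa> c \<odot>\<^bsub>M\<^esub> m"]) (auto simp: s_sc M.lsmult_closed)
  qed
  show thesis
  proof (rule that[of "A gx" "A gy" "A gz" S s])
    interpret qspace "psc :: 'k \<Rightarrow> ('u \<Rightarrow>\<^sub>0 'k) \<Rightarrow> _" p q
      by unfold_locales (rule p_nz, rule q_nz)
    show "qmod psc p q (A gx) (A gy) (A gz) S"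
    proof (unfold_locales, goal_cases)
      case (7 v) show ?case
        by (simp add: A_A relations M.lsmult_assoc M.lsmult_closed s_sc)
    next
      case (8 v) show ?case
        by (simp add: A_A relations M.lsmult_assoc M.lsmult_closed s_sc)
    next
      case (9 v) show ?case
        by (simp add: A_A relations M.lsmult_assoc M.lsmult_closed M.lsmult_l_distr s_sc s_add) (simp add: A_def)
    qed (simp_all add: A_add A_sc A_in subS)
    show "bij_betw s (carrier M) S"
      unfolding bij_betw_def S_def using ev_s by (auto intro: inj_on_inverseI)
  qed (auto simp: s_add s_sc A_def ev_s)
qed

section \<open>Transport of modules along injections\<close>

text \<open>
  Projective modules and their resolutions are defined for modules with elements of a given type
  \<open>'u\<close>, whereas the free modules constructed here consist of coefficient functions. They are moved
  along an injection \<open>\<iota>\<close> with left inverse \<open>\<tau>\<close>.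
\<close>

definition transported :: "('w \<Rightarrow> 'u) \<Rightarrow> ('u \<Rightarrow> 'w) \<Rightarrow> ('a, 'w) module \<Rightarrow> ('a, 'u) module" where
  "transported \<iota> \<tau> M = \<lparr>carrier = \<iota> ` carrier M, monoid.mult = undefined, one = undefined, zero = \<iota> \<zero>\<^bsub>M\<^esub>,
     add = (\<lambda>u v. \<iota> (\<tau> u \<oplus>\<^bsub>M\<^esub> \<tau> v)), module.smult = (\<lambda>a u. \<iota> (a \<odot>\<^bsub>M\<^esub> \<tau> u))\<rparr>"

lemma transported_simps [simp]:
  "carrier (transported \<iota> \<tau> M) = \<iota> ` carrier M" "\<zero>\<^bsub>transported \<iota> \<tau> M\<^esub> = \<iota> \<zero>\<^bsub>M\<^esub>"
  "u \<oplus>\<^bsub>transported \<iota> \<tau> M\<^esub> v = \<iota> (\<tau> u \<oplus>\<^bsub>M\<^esub> \<tau> v)" "a \<odot>\<^bsub>transported \<iota> \<tau> M\<^esub> u = \<iota> (a \<odot>\<^bsub>M\<^esub> \<tau> u)"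
  by (simp_all add: transported_def)

locale transport = left_module R M
  for R :: "'a ring" (structure) and M :: "('a, 'w) module" +
  fixes \<iota> :: "'w \<Rightarrow> 'u" and \<tau> :: "'u \<Rightarrow> 'w"
  assumes \<tau>\<iota>: "\<And>m. m \<in> carrier M \<Longrightarrow> \<tau> (\<iota> m) = m"
begin

abbreviation "T \<equiv> transported \<iota> \<tau> M"

lemma left_module_T: "left_module R T"
proof -
  have "abelian_group T"
  proof (rule abelian_groupI)
    fix u assume "u \<in> carrier T"
    then obtain m where m: "m \<in> carrier M" "u = \<iota> m" by auto
    then show "\<exists>v \<in> carrier T. v \<oplus>\<^bsub>T\<^esub> u = \<zero>\<^bsub>T\<^esub>"
      by (intro bexI[of _ "\<iota> (\<ominus>\<^bsub>M\<^esub> m)"]) (auto simp: \<tau>\<iota> M.l_neg)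
  qed (auto simp: \<tau>\<iota> M.a_ac)
  then interpret T: abelian_group T .
  show ?thesis
    by unfold_locales
       (auto simp: \<tau>\<iota> lsmult_closed lsmult_l_distr lsmult_r_distr lsmult_assoc lsmult_one)
qed

lemma to_T: "restrict \<iota> (carrier M) \<in> lmod_hom R M T"
  by (rule lmod_hom_restrictI) (auto simp: \<tau>\<iota> left_module_axioms)

lemma from_T: "restrict \<tau> (carrier T) \<in> lmod_hom R T M"
  by (rule lmod_hom_restrictI[OF left_module_T]) (auto simp: \<tau>\<iota> lsmult_closed)

lemma hom_from_T:
  assumes "f \<in> lmod_hom R M N"
  shows "(\<lambda>u \<in> carrier T. f (\<tau> u)) \<in> lmod_hom R T N"
  by (rule lmod_hom_restrictI[OF left_module_T]) (auto simp: \<tau>\<iota> lsmult_closed lmod_homD[OF assms])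

lemma hom_to_T:
  assumes "left_module R N" "f \<in> lmod_hom R N M"
  shows "(\<lambda>u \<in> carrier N. \<iota> (f u)) \<in> lmod_hom R N T"
  by (rule lmod_hom_restrictI[OF assms(1)]) (auto simp: \<tau>\<iota> lmod_homD[OF assms(2)])

end

text \<open>
  The lifting property in the definition of a projective module, for modules \<open>P\<close> whose elements have
  an arbitrary type.
\<close>

definition lifting :: "'u itself \<Rightarrow> 'a ring \<Rightarrow> ('a, 'w) module \<Rightarrow> bool" where
  "lifting U R P \<longleftrightarrow> (\<forall>(M :: ('a, 'u) module) (N :: ('a, 'u) module) g f.
        left_module R M \<and> left_module R N \<and>
        g \<in> lmod_hom R M N \<and> g ` carrier M = carrier N \<and> f \<in> lmod_hom R P N \<longrightarrow>
        (\<exists>h \<in> lmod_hom R P M. \<forall>x \<in> carrier P. g (h x) = f x))"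

lemma (in transport) projective_T:
  assumes "lifting TYPE('u) R M"
  shows "projective R T"
  unfolding projective_def
proof (intro conjI allI impI left_module_T)
  fix N L :: "('a, 'u) module" and g f
  assume *: "left_module R N \<and> left_module R L \<and> g \<in> lmod_hom R N L \<and> g ` carrier N = carrier L \<and> f \<in> lmod_hom R T L"
  let ?f = "\<lambda>m \<in> carrier M. f (restrict \<iota> (carrier M) m)"
  have f: "?f \<in> lmod_hom R M L"
    using * by (intro lmod_hom_comp[OF left_module_axioms to_T]) simp
  have "\<exists>h \<in> lmod_hom R M N. \<forall>m \<in> carrier M. g (h m) = ?f m"
    by (rule assms[unfolded lifting_def, rule_format, of N L g ?f], intro conjI f) (simp_all only: *)
  then obtain h where h: "h \<in> lmod_hom R M N" "\<And>m. m \<in> carrier M \<Longrightarrow> g (h m) = ?f m"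
    by blast
  show "\<exists>h \<in> lmod_hom R T N. \<forall>x \<in> carrier T. g (h x) = f x"
    by (rule bexI[OF _ hom_from_T[OF h(1)]]) (auto simp: h(2) \<tau>\<iota>)
qed

lemma transport_resolution:
  fixes \<iota> :: "'w \<Rightarrow> 'u"
  assumes P: "\<And>n. transport R (P n) \<iota> \<tau>" and lift: "\<And>n. lifting TYPE('u) R (P n)"
    and d: "\<And>n. d n \<in> lmod_hom R (P (Suc n)) (P n)" and e: "e \<in> lmod_hom R (P 0) M"
    and e_surj: "e ` carrier (P 0) = carrier M"
    and ex0: "d 0 ` carrier (P 1) = {x \<in> carrier (P 0). e x = \<zero>\<^bsub>M\<^esub>}"
    and ex: "\<And>n. d (Suc n) ` carrier (P (Suc (Suc n))) = {x \<in> carrier (P (Suc n)). d n x = \<zero>\<^bsub>P n\<^esub>}"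
  shows "projective_resolution R M (\<lambda>n. transported \<iota> \<tau> (P n))
    (\<lambda>n. \<lambda>u \<in> \<iota> ` carrier (P (Suc n)). \<iota> (d n (\<tau> u))) (\<lambda>u \<in> \<iota> ` carrier (P 0). e (\<tau> u))"
proof -
  note lm = transport.left_module_T[OF P]
  have \<tau>\<iota>: "\<tau> (\<iota> m) = m" if "m \<in> carrier (P n)" for m n by (rule transport.\<tau>\<iota>[OF P that])
  have lmP: "left_module R (P n)" for n using P[of n] by (simp add: transport_def)
  have z: "\<zero>\<^bsub>P n\<^esub> \<in> carrier (P n)" for n
  proof -
    interpret left_module R "P n" by (rule lmP)
    show ?thesis by simp
  qed
  have din: "d n m \<in> carrier (P n)" if "m \<in> carrier (P (Suc n))" for n m
    by (rule lmod_homD(1)[OF d that])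
  show ?thesis
    unfolding projective_resolution_def
  proof (intro conjI allI)
    fix n
    interpret A: left_module R "P (Suc n)" by (rule lmP)
    interpret B: left_module R "P n" by (rule lmP)
    note \<tau>\<iota>n = \<tau>\<iota>[of _ n] \<tau>\<iota>[of _ "Suc n"] \<tau>\<iota>[of _ "Suc (Suc n)"]
    have \<iota>_inj: "\<iota> m = \<iota> m' \<longleftrightarrow> m = m'" if "m \<in> carrier (P n)" "m' \<in> carrier (P n)" for m m'
    proof
      assume "\<iota> m = \<iota> m'"
      then have "\<tau> (\<iota> m) = \<tau> (\<iota> m')" by (rule arg_cong)
      then show "m = m'" unfolding \<tau>\<iota>n(1)[OF that(1)] \<tau>\<iota>n(1)[OF that(2)] .
    qed (rule arg_cong)
    have \<iota>_inj': "\<iota> m = \<iota> m' \<longleftrightarrow> m = m'" if "m \<in> carrier (P (Suc n))" "m' \<in> carrier (P (Suc n))" for m m'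
    proof
      assume "\<iota> m = \<iota> m'"
      then have "\<tau> (\<iota> m) = \<tau> (\<iota> m')" by (rule arg_cong)
      then show "m = m'" unfolding \<tau>\<iota>n(2)[OF that(1)] \<tau>\<iota>n(2)[OF that(2)] .
    qed (rule arg_cong)
    show "projective R (transported \<iota> \<tau> (P n))" by (rule transport.projective_T[OF P lift])
    have "(\<lambda>u \<in> carrier (transported \<iota> \<tau> (P (Suc n))). \<iota> (restrict (d n) (carrier (P (Suc n))) (\<tau> u)))
        \<in> lmod_hom R (transported \<iota> \<tau> (P (Suc n))) (transported \<iota> \<tau> (P n))"
      by (rule lmod_hom_restrictI[OF lm])
         (auto simp: \<tau>\<iota>n din lmod_homD[OF d] A.lsmult_closed)
    moreover have "(\<lambda>u \<in> carrier (transported \<iota> \<tau> (P (Suc n))). \<iota> (restrict (d n) (carrier (P (Suc n))) (\<tau> u))) =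
      (\<lambda>u \<in> \<iota> ` carrier (P (Suc n)). \<iota> (d n (\<tau> u)))"
      by (rule ext) (auto simp: restrict_def \<tau>\<iota>n)
    ultimately show "(\<lambda>u \<in> \<iota> ` carrier (P (Suc n)). \<iota> (d n (\<tau> u))) \<in> lmod_hom R (transported \<iota> \<tau> (P (Suc n))) (transported \<iota> \<tau> (P n))"
      by simp
    show "(\<lambda>u \<in> \<iota> ` carrier (P (Suc (Suc n))). \<iota> (d (Suc n) (\<tau> u))) ` carrier (transported \<iota> \<tau> (P (Suc (Suc n)))) =
         {x \<in> carrier (transported \<iota> \<tau> (P (Suc n))). (\<lambda>u \<in> \<iota> ` carrier (P (Suc n)). \<iota> (d n (\<tau> u))) x = \<zero>\<^bsub>transported \<iota> \<tau> (P n)\<^esub>}"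
      (is "?A = ?B")
    proof -
      have "?A = \<iota> ` (d (Suc n) ` carrier (P (Suc (Suc n))))"
        by (auto simp: \<tau>\<iota>n image_image)
      also have "\<dots> = ?B"
        unfolding ex by (auto simp: \<tau>\<iota>n \<iota>_inj \<iota>_inj' din z)
      finally show ?thesis .
    qed
  next
    note \<tau>\<iota>n = \<tau>\<iota>[of _ 0] \<tau>\<iota>[of _ "Suc 0"]
    have \<iota>_inj: "\<iota> m = \<iota> m' \<longleftrightarrow> m = m'" if "m \<in> carrier (P 0)" "m' \<in> carrier (P 0)" for m m'
    proof
      assume "\<iota> m = \<iota> m'"
      then have "\<tau> (\<iota> m) = \<tau> (\<iota> m')" by (rule arg_cong)
      then show "m = m'" unfolding \<tau>\<iota>n(1)[OF that(1)] \<tau>\<iota>n(1)[OF that(2)] .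
    qed (rule arg_cong)
    show "(\<lambda>u \<in> \<iota> ` carrier (P 0). e (\<tau> u)) \<in> lmod_hom R (transported \<iota> \<tau> (P 0)) M"
      using transport.hom_from_T[OF P e] by simp
    show "(\<lambda>u \<in> \<iota> ` carrier (P 0). e (\<tau> u)) ` carrier (transported \<iota> \<tau> (P 0)) = carrier M"
      unfolding e_surj[symmetric] transported_simps image_image
      by (rule image_cong) (simp_all add: \<tau>\<iota>n)
    have "(\<lambda>u \<in> \<iota> ` carrier (P (Suc 0)). \<iota> (d 0 (\<tau> u))) ` carrier (transported \<iota> \<tau> (P 1)) = \<iota> ` (d 0 ` carrier (P 1))"
      by (auto simp: \<tau>\<iota>n image_image)
    also have "\<dots> = {x \<in> carrier (transported \<iota> \<tau> (P 0)). (\<lambda>u \<in> \<iota> ` carrier (P 0). e (\<tau> u)) x = \<zero>\<^bsub>M\<^esub>}"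
      unfolding ex0 by (auto simp: \<tau>\<iota>n \<iota>_inj)
    finally show "(\<lambda>u \<in> \<iota> ` carrier (P (Suc 0)). \<iota> (d 0 (\<tau> u))) ` carrier (transported \<iota> \<tau> (P 1)) =
        {x \<in> carrier (transported \<iota> \<tau> (P 0)). (\<lambda>u \<in> \<iota> ` carrier (P 0). e (\<tau> u)) x = \<zero>\<^bsub>M\<^esub>}" .
  qed
qed

section \<open>Free modules have the lifting property\<close>

locale PBW_free = PBW R \<phi> p q gx gy gz \<kappa> + V: qspace sc p q
  for R :: "'a ring" (structure) and \<phi> :: "'a \<Rightarrow> 'k::field pbw" and p q gx gy gz \<kappa>
    and sc :: "'k \<Rightarrow> 'v::ab_group_add \<Rightarrow> 'v" +
  fixes S :: "'v set"
  assumes subS: "V.subspace S"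
begin

sublocale F: PBW_mod R \<phi> p q gx gy gz \<kappa> "lift \<circ> sc" opx "opy sc p q" "opz sc p" "Fin S"
proof -
  interpret F: vector_space "lift \<circ> sc" using V.vector_space_fsc by (simp add: comp_def)
  interpret qmod "lift \<circ> sc" p q opx "opy sc p q" "opz sc p" "Fin S"
    by unfold_locales
       (auto simp: V.op_add V.op_scale V.op_relations p_nz q_nz V.Fin_op[OF subS] V.subspace_Fin[OF subS] comp_def
          intro: V.subspace_Fin[OF subS, folded comp_def])
  show "PBW_mod R \<phi> p q gx gy gz \<kappa> (lift \<circ> sc) opx (opy sc p q) (opz sc p) (Fin S)"
    by unfold_locales
qed

abbreviation "FM \<equiv> op_module F.act (Fin S)"

lemma F_act_gens: "F.act gx f = opx f" "F.act gy f = opy sc p q f" "F.act gz f = opz sc p f"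
  "F.act (\<kappa> c) f = lift (sc c) f"
  using F.act_gens by (simp_all add: comp_def)

text \<open>
  The free module \<open>A \<otimes> S\<close> is generated by the elements \<open>1 \<otimes> v\<close>.
\<close>

lemma FM_hom_eqI:
  assumes "left_module R N" "f \<in> lmod_hom R FM N" "g \<in> lmod_hom R FM N"
    and eq: "\<And>v. v \<in> S \<Longrightarrow> f (single3 0 0 0 v) = g (single3 0 0 0 v)"
    and w: "w \<in> Fin S"
  shows "f w = g w"
proof -
  interpret N: left_module R N by fact
  note S = V.subspace_0[OF subS] V.subspace_scale[OF subS]
  have sF: "single3 i j k v \<in> Fin S" if "v \<in> S" for i j k v by (rule V.single3_Fin[OF that S(1)])
  have step: "f (F.act a w) = g (F.act a w)" if "a \<in> carrier R" "w \<in> Fin S" "f w = g w" for a w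
    using lmod_homD(3)[OF assms(2), of a w] lmod_homD(3)[OF assms(3), of a w] that by simp
  have 1: "f (single3 0 0 k v) = g (single3 0 0 k v)" if v: "v \<in> S" for k v
  proof (induction k)
    case (Suc k)
    have "F.act gy (single3 0 0 k v) = single3 0 0 (Suc k) v" by (simp add: F_act_gens V.op_single)
    then show ?case using step[of gy "single3 0 0 k v"] Suc sF[OF v] by simp
  qed (simp add: eq v)
  have 2: "f (single3 0 j k v) = g (single3 0 j k v)" if v: "v \<in> S" for j k v
  proof (induction j)
    case (Suc j)
    have "F.act gz (single3 0 j k v) = single3 0 (Suc j) k v" by (simp add: F_act_gens V.op_single)
    then show ?case using step[of gz "single3 0 j k v"] Suc sF[OF v] by simp
  qed (simp add: 1 v)
  have 3: "f (single3 i j k v) = g (single3 i j k v)" if v: "v \<in> S" for i j k v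
  proof (induction i)
    case (Suc i)
    have "F.act gx (single3 i j k v) = single3 (Suc i) j k v" by (simp add: F_act_gens V.op_single)
    then show ?case using step[of gx "single3 i j k v"] Suc sF[OF v] by simp
  qed (simp add: 2 v)
  show ?thesis
  proof (rule Fin_induct[OF w S(1), of "\<lambda>w. f w = g w"])
    have "single3 0 0 0 (0 :: 'v) = 0" by (simp add: single3_def fun_eq_iff)
    then show "f 0 = g 0" using eq[OF S(1)] by simp
    show "f (single3 i j k v) = g (single3 i j k v)" if "v \<in> S" for i j k v by (rule 3[OF that])
    show "f (u + w) = g (u + w)" if "u \<in> Fin S" "w \<in> Fin S" "f u = g u" "f w = g w" for u w
      using that lmod_homD(2)[OF assms(2), of u w] lmod_homD(2)[OF assms(3), of u w] by simp
  qed
qed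

text \<open>
  Over the field, the values on a basis of \<open>S\<close> can be lifted along a surjection. The lift extends
  linearly over the field to \<open>S\<close> and then, by evaluation, over the algebra to \<open>A \<otimes> S\<close>.
\<close>

theorem lifting_FM: "lifting TYPE('u) R FM"
  unfolding lifting_def
proof (intro allI impI)
  fix M N :: "('a, 'u) module" and g f
  assume *: "left_module R M \<and> left_module R N \<and> g \<in> lmod_hom R M N \<and> g ` carrier M = carrier N \<and>
    f \<in> lmod_hom R FM N"
  interpret M: left_module R M using * by blast
  interpret N: left_module R N using * by blast
  have g: "g \<in> lmod_hom R M N" "g ` carrier M = carrier N" and f: "f \<in> lmod_hom R FM N" using * by auto
  obtain s :: "'u \<Rightarrow> 'u \<Rightarrow>\<^sub>0 'k" and ax ay az SM where s: "qmod psc p q ax ay az SM" "bij_betw s (carrier M) SM"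
    "\<And>m n. m \<in> carrier M \<Longrightarrow> n \<in> carrier M \<Longrightarrow> s (m \<oplus>\<^bsub>M\<^esub> n) = s m + s n"
    "\<And>m. m \<in> carrier M \<Longrightarrow> s (gx \<odot>\<^bsub>M\<^esub> m) = ax (s m)"
    "\<And>m. m \<in> carrier M \<Longrightarrow> s (gy \<odot>\<^bsub>M\<^esub> m) = ay (s m)"
    "\<And>m. m \<in> carrier M \<Longrightarrow> s (gz \<odot>\<^bsub>M\<^esub> m) = az (s m)"
    "\<And>m c. m \<in> carrier M \<Longrightarrow> s (\<kappa> c \<odot>\<^bsub>M\<^esub> m) = psc c (s m)"
    by (rule module_as_operators[OF M.left_module_axioms]) (rule that)
  interpret Q: qmod psc p q ax ay az SM by (rule s(1))
  define r where "r = inv_into (carrier M) s"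
  have r: "r u \<in> carrier M" "s (r u) = u" if "u \<in> SM" for u
    using s(2) that by (auto simp: r_def bij_betw_def intro: inv_into_into f_inv_into_f)
  have rs: "r (s m) = m" if "m \<in> carrier M" for m
    using s(2) that by (simp add: r_def bij_betw_def)
  have sM: "s m \<in> SM" if "m \<in> carrier M" for m using s(2) that by (auto simp: bij_betw_def)
  have r_add: "r (u + v) = r u \<oplus>\<^bsub>M\<^esub> r v" if "u \<in> SM" "v \<in> SM" for u v
    using rs[of "r u \<oplus>\<^bsub>M\<^esub> r v"] that by (simp add: s(3) r)
  have r_op: "r (ax u) = gx \<odot>\<^bsub>M\<^esub> r u" "r (ay u) = gy \<odot>\<^bsub>M\<^esub> r u" "r (az u) = gz \<odot>\<^bsub>M\<^esub> r u"
    "r (psc c u) = \<kappa> c \<odot>\<^bsub>M\<^esub> r u" if "u \<in> SM" for u c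
    using rs[of "gx \<odot>\<^bsub>M\<^esub> r u"] rs[of "gy \<odot>\<^bsub>M\<^esub> r u"] rs[of "gz \<odot>\<^bsub>M\<^esub> r u"] rs[of "\<kappa> c \<odot>\<^bsub>M\<^esub> r u"] that
    by (simp_all add: s r M.lsmult_closed)
  have one: "single3 0 0 0 v \<in> Fin S" if "v \<in> S" for v
    using V.single3_Fin[OF that V.subspace_0[OF subS]] .
  define f0 where "f0 = (\<lambda>v. f (single3 0 0 0 v))"
  have f0_in: "f0 v \<in> carrier N" if "v \<in> S" for v
    unfolding f0_def using lmod_homD(1)[OF f, of "single3 0 0 0 v"] one[OF that] by simp
  have f0_add: "f0 (u + v) = f0 u \<oplus>\<^bsub>N\<^esub> f0 v" if "u \<in> S" "v \<in> S" for u v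
  proof -
    have "single3 0 0 0 (u + v) = single3 0 0 0 u + single3 0 0 0 v" by (auto simp: single3_def fun_eq_iff)
    then show ?thesis
      unfolding f0_def using lmod_homD(2)[OF f, of "single3 0 0 0 u" "single3 0 0 0 v"] one that by simp
  qed
  have f0_sc: "f0 (sc c v) = \<kappa> c \<odot>\<^bsub>N\<^esub> f0 v" if "v \<in> S" for c v
  proof -
    have "F.act (\<kappa> c) (single3 0 0 0 v) = single3 0 0 0 (sc c v)"
      by (auto simp: F_act_gens single3_def lift_def fun_eq_iff)
    then show ?thesis
      unfolding f0_def using lmod_homD(3)[OF f, of "\<kappa> c" "single3 0 0 0 v"] one that by simp
  qed
  have "\<forall>v \<in> S. \<exists>m \<in> carrier M. g m = f0 v" using f0_in g(2) by (metis imageE)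
  then obtain m where m: "\<And>v. v \<in> S \<Longrightarrow> m v \<in> carrier M" "\<And>v. v \<in> S \<Longrightarrow> g (m v) = f0 v" by metis
  obtain B where B: "B \<subseteq> S" "V.independent B" "S \<subseteq> V.span B" using V.maximal_independent_subset[of S] by blast
  interpret W: vector_space "psc :: 'k \<Rightarrow> ('u \<Rightarrow>\<^sub>0 'k) \<Rightarrow> _" by (rule vector_space_psc)
  interpret VP: vector_space_pair sc "psc :: 'k \<Rightarrow> ('u \<Rightarrow>\<^sub>0 'k) \<Rightarrow> _" ..
  obtain \<eta> where \<eta>: "Vector_Spaces.linear sc psc \<eta>" "\<forall>b \<in> B. \<eta> b = s (m b)"
    using VP.linear_independent_extend[OF B(2), of "\<lambda>b. s (m b)"] by blast
  have \<eta>_add: "\<eta> (u + v) = \<eta> u + \<eta> v" and \<eta>_sc: "\<eta> (sc c v) = psc c (\<eta> v)" for u v c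
    using \<eta>(1) by (auto simp: Vector_Spaces.linear_iff)
  have \<eta>0: "\<eta> 0 = 0" using \<eta>_add[of 0 0] by simp
  let ?G = "{v \<in> S. \<eta> v \<in> SM \<and> g (r (\<eta> v)) = f0 v}"
  have r0: "r 0 = \<zero>\<^bsub>M\<^esub>"
    using r_add[OF Q.S0 Q.S0] r(1)[OF Q.S0] by (metis M.add.l_cancel_one' add.right_neutral)
  have g0: "g \<zero>\<^bsub>M\<^esub> = \<zero>\<^bsub>N\<^esub>"
    using lmod_homD(2)[OF g(1), of "\<zero>\<^bsub>M\<^esub>" "\<zero>\<^bsub>M\<^esub>"] lmod_homD(1)[OF g(1), of "\<zero>\<^bsub>M\<^esub>"]
    by (metis M.zero_closed M.l_zero N.add.l_cancel_one')
  have f00: "f0 0 = \<zero>\<^bsub>N\<^esub>"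
    using f0_add[of 0 0] f0_in[of 0] V.subspace_0[OF subS] by (metis N.add.l_cancel_one' add.right_neutral)
  have "V.subspace ?G"
  proof (rule V.subspaceI)
    show "0 \<in> ?G" by (simp add: V.subspace_0[OF subS] \<eta>0 Q.S0 r0 g0 f00)
    show "u + v \<in> ?G" if "u \<in> ?G" "v \<in> ?G" for u v
      using that by (auto simp: V.subspace_add[OF subS] \<eta>_add Q.Sadd r_add r lmod_homD(2)[OF g(1)] f0_add)
    show "sc c v \<in> ?G" if "v \<in> ?G" for c v
      using that by (auto simp: V.subspace_scale[OF subS] \<eta>_sc Q.Ssc r_op r lmod_homD(3)[OF g(1)] f0_sc)
  qed
  moreover have "B \<subseteq> ?G" using B(1) \<eta>(2) m sM rs by auto
  ultimately have "V.span B \<subseteq> ?G" by (rule V.span_minimal[rotated])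
  then have G: "\<eta> v \<in> SM" "g (r (\<eta> v)) = f0 v" if "v \<in> S" for v using B(3) that by auto
  define h where "h = (\<lambda>w :: 'v pbw. r (Q.ev3 (lift \<eta> w)))"
  have L: "lift \<eta> w \<in> Fin SM" if w: "w \<in> Fin S" for w
  proof -
    obtain N where N: "\<And>i j k. w i j k \<in> S" "\<And>i j k. N \<le> i + j + k \<Longrightarrow> w i j k = 0"
      using FinE[OF w] by metis
    show ?thesis by (rule FinI[of _ _ N]) (auto simp: lift_def G N \<eta>0)
  qed
  have L_op: "lift \<eta> (opx w) = opx (lift \<eta> w)" "lift \<eta> (opy sc p q w) = opy psc p q (lift \<eta> w)"
    "lift \<eta> (opz sc p w) = opz psc p (lift \<eta> w)" "lift \<eta> (lift (sc c) w) = lift (psc c) (lift \<eta> w)"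
    "lift \<eta> (u + w) = lift \<eta> u + lift \<eta> w" for u w c
    by (auto simp: lift_def opx_def opy_def opz_def fun_eq_iff \<eta>_add \<eta>_sc \<eta>0 split: nat.splits)
  have h: "restrict h (carrier FM) \<in> lmod_hom R FM M"
    by (rule lmod_homI[OF F.left_module_TM M.left_module_axioms])
       (simp_all add: h_def F_act_gens L_op Q.ev3_op[OF L] Q.ev3_add[OF L L] r_op r_add r Q.ev3_in[OF L])
  have gh: "(\<lambda>w \<in> carrier FM. g (restrict h (carrier FM) w)) \<in> lmod_hom R FM N"
    by (rule lmod_hom_comp[OF F.left_module_TM h g(1)])
  have h1: "h (single3 0 0 0 v) = r (\<eta> v)" for v
  proof -
    have "lift \<eta> (single3 0 0 0 v) = single3 0 0 0 (\<eta> v)" by (auto simp: lift_def single3_def fun_eq_iff \<eta>0)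
    then show ?thesis by (simp add: h_def Q.ev3_single)
  qed
  have "(\<lambda>w \<in> carrier FM. g (restrict h (carrier FM) w)) w = f w" if "w \<in> Fin S" for w
    by (rule FM_hom_eqI[OF N.left_module_axioms gh f _ that]) (auto simp: one h1 G f0_def)
  then show "\<exists>h \<in> lmod_hom R FM M. \<forall>x \<in> carrier FM. g (h x) = f x"
    by (intro bexI[OF _ h]) auto
qed

end

section \<open>Injections of finitely supported functions\<close>

lemma infinite_inj_pair:
  assumes "infinite (UNIV :: 'u set)"
  shows "\<exists>\<pi> :: 'u \<times> 'u \<Rightarrow> 'u. inj \<pi>"
proof -
  have "ordLeq3 (card_of (UNIV \<times> UNIV :: ('u \<times> 'u) set)) (card_of (UNIV :: 'u set))"
    using card_of_Times_same_infinite[OF assms] by (rule ordIso_imp_ordLeq)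
  then show ?thesis unfolding card_of_ordLeq[symmetric] by auto
qed

lemma infinite_inj_finite_sets:
  assumes "infinite (UNIV :: 'u set)"
  shows "\<exists>h :: 'u set \<Rightarrow> 'u. inj_on h {A. finite A}"
proof -
  obtain \<pi> :: "'u \<times> 'u \<Rightarrow> 'u" where \<pi>: "inj \<pi>" using infinite_inj_pair[OF assms] by blast
  obtain f :: "nat \<Rightarrow> 'u" where f: "inj f" using infinite_countable_subset[OF assms] by blast
  define c where "c = (\<lambda>xs. foldr (\<lambda>a b. \<pi> (a, b)) xs (f 0))"
  have c: "c xs = c ys \<Longrightarrow> xs = ys" if "length xs = length ys" for xs ys
    using that by (induction xs ys rule: list_induct2) (auto simp: c_def dest: injD[OF \<pi>])
  define e where "e = (\<lambda>xs. \<pi> (f (length xs), c xs))"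
  have e: "xs = ys" if "e xs = e ys" for xs ys
  proof -
    have "(f (length xs), c xs) = (f (length ys), c ys)" using that unfolding e_def by (rule injD[OF \<pi>])
    then show ?thesis using c injD[OF f] by auto
  qed
  define l where "l = (\<lambda>A :: 'u set. SOME xs. set xs = A)"
  have l: "set (l A) = A" if "finite A" for A
    unfolding l_def by (rule someI_ex[OF finite_list[OF that]])
  have "inj_on (\<lambda>A. e (l A)) {A. finite A}"
  proof (rule inj_onI)
    fix A B assume fin: "A \<in> {A. finite A}" "B \<in> {A. finite A}" and eq: "e (l A) = e (l B)"
    have "set (l A) = set (l B)" using e[OF eq] by (rule arg_cong)
    moreover have "set (l A) = A" "set (l B) = B" using fin by (simp_all add: l)
    ultimately show "A = B" by simp
  qed
  then show ?thesis by blast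
qed

text \<open>
  A coefficient function with finitely many nonzero entries is determined by the finite set of its
  indices and entries, and an infinite type contains copies of its square and of the set of its
  finite subsets.
\<close>

lemma finite_support_inj:
  fixes j :: "'k::zero \<Rightarrow> 'u"
  assumes inf: "infinite (UNIV :: 'u set)" and j: "inj j"
  shows "\<exists>\<iota> :: (nat \<Rightarrow> 'u \<Rightarrow>\<^sub>0 'k) pbw \<Rightarrow> 'u. inj_on \<iota> {w. finite {(a, b, c, t, u). Poly_Mapping.lookup (w a b c t) u \<noteq> 0}}"
proof -
  obtain \<pi> :: "'u \<times> 'u \<Rightarrow> 'u" where \<pi>: "inj \<pi>" using infinite_inj_pair[OF inf] by blast
  obtain f :: "nat \<Rightarrow> 'u" where f: "inj f" using infinite_countable_subset[OF inf] by blast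
  obtain h :: "'u set \<Rightarrow> 'u" where h: "inj_on h {A. finite A}" using infinite_inj_finite_sets[OF inf] by blast
  \<comment> \<open>a code in \<open>'u\<close> for one entry of a coefficient function together with its index\<close>
  define E where "E = (\<lambda>(a, b, c, t, u, v). \<pi> (f a, \<pi> (f b, \<pi> (f c, \<pi> (f t, \<pi> (u, j v))))))"
  have E: "inj E"
    by (rule injI) (auto simp: E_def dest!: injD[OF \<pi>] injD[OF f] injD[OF j])
  define G where "G = (\<lambda>w :: (nat \<Rightarrow> 'u \<Rightarrow>\<^sub>0 'k) pbw.
    {(a, b, c, t, u, v). Poly_Mapping.lookup (w a b c t) u = v \<and> v \<noteq> 0})"
  have G: "w = w'" if eq: "G w = G w'" for w w'
  proof (intro ext poly_mapping_eqI)
    fix a b c t u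
    have *: "(a, b, c, t, u, v) \<in> G w \<longleftrightarrow> (a, b, c, t, u, v) \<in> G w'" for v using eq by simp
    show "Poly_Mapping.lookup (w a b c t) u = Poly_Mapping.lookup (w' a b c t) u"
      using *[of "Poly_Mapping.lookup (w a b c t) u"] *[of "Poly_Mapping.lookup (w' a b c t) u"]
      by (auto simp: G_def)
  qed
  have fG: "finite (G w)" if "finite {(a, b, c, t, u). Poly_Mapping.lookup (w a b c t) u \<noteq> 0}" for w
  proof -
    have "G w \<subseteq> (\<lambda>(a, b, c, t, u). (a, b, c, t, u, Poly_Mapping.lookup (w a b c t) u)) `
        {(a, b, c, t, u). Poly_Mapping.lookup (w a b c t) u \<noteq> 0}"
      by (auto simp: G_def image_iff)
    then show ?thesis using that finite_surj by blast
  qed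
  have "inj_on (\<lambda>w. h (E ` G w)) {w. finite {(a, b, c, t, u). Poly_Mapping.lookup (w a b c t) u \<noteq> 0}}"
  proof (rule inj_onI)
    fix w w' assume w: "w \<in> {w. finite {(a, b, c, t, u). Poly_Mapping.lookup (w a b c t) u \<noteq> 0}}"
      "w' \<in> {w. finite {(a, b, c, t, u). Poly_Mapping.lookup (w a b c t) u \<noteq> 0}}"
      and eq: "h (E ` G w) = h (E ` G w')"
    then have "E ` G w = E ` G w'" using fG by (intro inj_onD[OF h eq]) auto
    then have "G w = G w'" by (rule iffD1[OF inj_image_eq_iff[OF E]])
    then show "w = w'" by (rule G)
  qed
  then show ?thesis by blast
qed

section \<open>The resolution as a complex of free modules\<close>

text \<open>
  Tuples of length \<open>r \<le> 3\<close> are functions on the natural numbers that vanish from \<open>r\<close> on, so that all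
  terms of the resolution have elements of the same type; \<open>rk n\<close> is the length in degree \<open>n\<close>. A
  tuple of elements of \<open>A \<otimes> S\<close> is an element of \<open>A \<otimes> S\<^sup>r\<close>; \<open>cmp\<close> and \<open>mk3\<close> pass between the two
  views.
\<close>

definition cmp :: "nat \<Rightarrow> (nat \<Rightarrow> 'v) pbw \<Rightarrow> 'v pbw" where
  "cmp t w = (\<lambda>i j k. w i j k t)"

definition mk3 :: "'v::zero pbw \<Rightarrow> 'v pbw \<Rightarrow> 'v pbw \<Rightarrow> (nat \<Rightarrow> 'v) pbw" where
  "mk3 a b c = (\<lambda>i j k t. if t = 0 then a i j k else if t = 1 then b i j k else if t = 2 then c i j k else 0)"

definition rk :: "nat \<Rightarrow> nat" where
  "rk n = (if n = 0 \<or> n = 3 then 1 else if n = 1 \<or> n = 2 then 3 else 0)"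

definition sc4 :: "('k \<Rightarrow> 'v \<Rightarrow> 'v) \<Rightarrow> 'k \<Rightarrow> (nat \<Rightarrow> 'v) \<Rightarrow> nat \<Rightarrow> 'v" where
  "sc4 sc c v = (\<lambda>t. sc c (v t))"

definition SS :: "'v::zero set \<Rightarrow> nat \<Rightarrow> (nat \<Rightarrow> 'v) set" where
  "SS S r = {v. (\<forall>t<r. v t \<in> S) \<and> (\<forall>t\<ge>r. v t = 0)}"

lemma rk_simps [simp]: "rk 0 = 1" "rk (Suc 0) = 3" "rk 1 = 3" "rk 2 = 3" "rk 3 = 1" "rk (Suc (Suc 0)) = 3"
  "rk (Suc (Suc (Suc 0))) = 1" "n > 3 \<Longrightarrow> rk n = 0" "rk (Suc (Suc (Suc (Suc n)))) = 0"
  by (simp_all add: rk_def numeral_3_eq_3)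

lemma cmp_mk3 [simp]: "cmp 0 (mk3 a b c) = a" "cmp (Suc 0) (mk3 a b c) = b" "cmp 1 (mk3 a b c) = b" "cmp 2 (mk3 a b c) = c"
  "t > 2 \<Longrightarrow> cmp t (mk3 a b c) = 0"
  by (auto simp: cmp_def mk3_def fun_eq_iff)

lemma cmp_zero [simp]: "cmp t 0 = 0" by (simp add: cmp_def fun_eq_iff)

lemma cmp_eqI: "(\<And>t. cmp t w = cmp t w') \<Longrightarrow> w = w'"
  by (simp add: cmp_def fun_eq_iff)

lemma cmp_add: "cmp t (v + w) = cmp t v + cmp t w" by (simp add: cmp_def fun_eq_iff)

lemma Fin_SS: "w \<in> Fin (SS S r) \<longleftrightarrow> (\<forall>t<r. cmp t w \<in> Fin S) \<and> (\<forall>t\<ge>r. cmp t w = 0)"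
proof
  assume w: "w \<in> Fin (SS S r)"
  obtain N where N: "\<And>i j k. w i j k \<in> SS S r" "\<And>i j k. N \<le> i + j + k \<Longrightarrow> w i j k = 0"
    using FinE[OF w] by metis
  show "(\<forall>t<r. cmp t w \<in> Fin S) \<and> (\<forall>t\<ge>r. cmp t w = 0)"
  proof (intro conjI allI impI)
    show "cmp t w \<in> Fin S" if "t < r" for t
      by (rule FinI[of _ _ N]) (use N that in \<open>auto simp: cmp_def SS_def\<close>)
    show "cmp t w = 0" if "t \<ge> r" for t using N(1) that by (auto simp: cmp_def SS_def fun_eq_iff)
  qed
next
  assume *: "(\<forall>t<r. cmp t w \<in> Fin S) \<and> (\<forall>t\<ge>r. cmp t w = 0)"
  have "\<forall>t \<in> {..<r}. \<exists>N. \<forall>i j k. N \<le> i + j + k \<longrightarrow> w i j k t = 0"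
    using * by (auto simp: Fin_def cmp_def)
  then obtain N where N: "\<And>t i j k. t < r \<Longrightarrow> N t \<le> i + j + k \<Longrightarrow> w i j k t = 0"
    by (metis lessThan_iff)
  have wr: "w i j k t = 0" if "t \<ge> r" for i j k t
  proof -
    have "cmp t w i j k = 0" using * that by simp
    then show ?thesis by (simp add: cmp_def)
  qed
  show "w \<in> Fin (SS S r)"
  proof (rule FinI[of _ _ "\<Sum>t<r. N t"])
    show "w i j k \<in> SS S r" for i j k
      using * wr by (auto simp: SS_def Fin_def cmp_def)
    show "w i j k = 0" if "(\<Sum>t<r. N t) \<le> i + j + k" for i j k
    proof
      fix t
      show "w i j k t = 0 t"
      proof (cases "t < r")
        case True
        then have "N t \<le> (\<Sum>t<r. N t)" by (intro member_le_sum) auto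
        then show ?thesis using N[OF True, of i j k] that by simp
      qed (simp add: wr)
    qed
  qed
qed

lemma cmp_mk3_if: "cmp t (mk3 a b c) = (if t = 0 then a else if t = 1 then b else if t = 2 then c else 0)"
  by (auto simp: cmp_def mk3_def fun_eq_iff)

lemma Fin_SS3: "w \<in> Fin (SS S 3) \<longleftrightarrow>
    cmp 0 w \<in> Fin S \<and> cmp 1 w \<in> Fin S \<and> cmp 2 w \<in> Fin S \<and> (\<forall>t\<ge>3. cmp t w = 0)"
proof -
  have "(\<forall>t<3::nat. P t) \<longleftrightarrow> P 0 \<and> P 1 \<and> P 2" for P
    by (auto simp: less_Suc_eq numeral_3_eq_3 numeral_2_eq_2)
  then show ?thesis by (simp add: Fin_SS)
qed

lemma Fin_SS1: "w \<in> Fin (SS S (Suc 0)) \<longleftrightarrow> cmp 0 w \<in> Fin S \<and> (\<forall>t\<ge>1. cmp t w = 0)"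
  "w \<in> Fin (SS S 1) \<longleftrightarrow> cmp 0 w \<in> Fin S \<and> (\<forall>t\<ge>1. cmp t w = 0)"
  by (simp_all add: Fin_SS)

lemma Fin_SS0: "w \<in> Fin (SS S 0) \<longleftrightarrow> w = 0"
  by (auto simp: Fin_SS intro: cmp_eqI)

context qspace begin

lemma vector_space_sc4: "vector_space (sc4 sc)"
  by unfold_locales (auto simp: sc4_def fun_eq_iff algebra_simps)

lemma qspace_sc4: "qspace (sc4 sc) p q"
proof -
  interpret W: vector_space "sc4 sc" by (rule vector_space_sc4)
  show ?thesis by unfold_locales (rule p0, rule q0)
qed

lemma subspace_SS:
  assumes "subspace S" shows "module.subspace (sc4 sc) (SS S r)"
proof -
  interpret W: vector_space "sc4 sc" by (rule vector_space_sc4)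
  show ?thesis
    by (rule W.subspaceI)
       (auto simp: SS_def sc4_def subspace_0[OF assms] subspace_add[OF assms] subspace_scale[OF assms])
qed

lemma cmp_op:
  "cmp t (opx w) = opx (cmp t w)" "cmp t (opy (sc4 sc) p q w) = opy sc p q (cmp t w)"
  "cmp t (opz (sc4 sc) p w) = opz sc p (cmp t w)" "cmp t (lift (sc4 sc c) w) = lift (sc c) (cmp t w)"
  by (auto simp: cmp_def op_defs lift_def sc4_def fun_eq_iff split: nat.splits)

end

context qmod begin

text \<open>
  The differentials are built from right multiplications on \<open>A\<close> and operators on \<open>V\<close>, both of which
  commute with left multiplications on \<open>A\<close>.
\<close>

lemma D_equivariant:
  assumes L: "\<And>f g. L (f + g) = L f + L g"
    "\<And>f. L (RX f) = RX (L f)" "\<And>f. L (RY f) = RY (L f)" "\<And>f. L (RZ f) = RZ (L f)"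
    "\<And>f. L (lift ax f) = lift ax (L f)" "\<And>f. L (lift ay f) = lift ay (L f)" "\<And>f. L (lift az f) = lift az (L f)"
    "\<And>f c. L (fsc c f) = fsc c (L f)"
  shows "D0 (L a) (L b) (L c) = L (D0 a b c)" "D1x (L a) (L b) = L (D1x a b)" "D1y (L a) (L b) = L (D1y a b)"
    "D1z (L a) (L b) (L c) = L (D1z a b c)" "D2a (L a) = L (D2a a)" "D2b (L a) = L (D2b a)" "D2c (L a) = L (D2c a)"
proof -
  have a: "additive L" by (simp add: additive_def L)
  show "D0 (L a) (L b) (L c) = L (D0 a b c)" "D1x (L a) (L b) = L (D1x a b)" "D1y (L a) (L b) = L (D1y a b)"
    "D1z (L a) (L b) (L c) = L (D1z a b c)" "D2a (L a) = L (D2a a)" "D2b (L a) = L (D2b a)" "D2c (L a) = L (D2c a)"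
    by (simp_all add: D_defs lift_scale L additive.diff[OF a] additive.minus[OF a])
qed

lemmas D_LX = D_equivariant[of LX, OF op_add(1) left_right_commute(1,2,3) op_lifts(1,7,13) op_scale(1)]
lemmas D_LY = D_equivariant[of LY, OF op_add(2) left_right_commute(7,8,9) op_lifts(2,8,14) op_scale(2)]
lemmas D_LZ = D_equivariant[of LZ, OF op_add(3) left_right_commute(4,5,6) op_lifts(3,9,15) op_scale(3)]

lemma D_fsc:
  "D0 (fsc c a) (fsc c b) (fsc c d) = fsc c (D0 a b d)" "D1x (fsc c a) (fsc c b) = fsc c (D1x a b)"
  "D1y (fsc c a) (fsc c b) = fsc c (D1y a b)" "D1z (fsc c a) (fsc c b) (fsc c d) = fsc c (D1z a b d)"
  "D2a (fsc c a) = fsc c (D2a a)" "D2b (fsc c a) = fsc c (D2b a)" "D2c (fsc c a) = fsc c (D2c a)"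
  by (rule D_equivariant[of "fsc c"]; simp add: op_scale lift_ops fsc_linear mult.commute)+

lemma D_add:
  "D0 (a + a') (b + b') (c + c') = D0 a b c + D0 a' b' c'"
  "D1x (a + a') (b + b') = D1x a b + D1x a' b'"
  "D1y (a + a') (b + b') = D1y a b + D1y a' b'"
  "D1z (a + a') (b + b') (c + c') = D1z a b c + D1z a' b' c'"
  "D2a (a + a') = D2a a + D2a a'" "D2b (a + a') = D2b a + D2b a'" "D2c (a + a') = D2c a + D2c a'"
  unfolding D_simps by (simp_all add: algebra_simps)

definition dd :: "nat \<Rightarrow> (nat \<Rightarrow> 'v) pbw \<Rightarrow> (nat \<Rightarrow> 'v) pbw" where
  "dd n w = (let a = cmp 0 w; b = cmp 1 w; c = cmp 2 w in
     if n = 0 then mk3 (D0 a b c) 0 0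
     else if n = 1 then mk3 (D1x a b) (D1y a c) (D1z a b c)
     else if n = 2 then mk3 (D2a a) (D2b a) (D2c a) else 0)"

lemma mk3_add: "mk3 (a + a' :: 'v pbw) (b + b') (c + c') = mk3 a b c + mk3 a' b' c'"
  by (auto simp: mk3_def fun_eq_iff)

lemma mk3_op:
  "opx (mk3 a b c) = mk3 (opx a) (opx b) (opx c)"
  "opy (sc4 sc) p q (mk3 a b c) = mk3 (opy sc p q a) (opy sc p q b) (opy sc p q c)"
  "opz (sc4 sc) p (mk3 a b c) = mk3 (opz sc p a) (opz sc p b) (opz sc p c)"
  "lift (sc4 sc d) (mk3 a b c) = mk3 (lift (sc d) a) (lift (sc d) b) (lift (sc d) c)"
  by (auto simp: mk3_def op_defs lift_def sc4_def fun_eq_iff split: nat.splits)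

lemma opz0: "opx (0 :: 'w::ab_group_add pbw) = 0" "opy (sc4 sc) p q 0 = 0" "opz (sc4 sc) p 0 = 0"
   "lift (sc4 sc c) 0 = 0"
  by (auto simp: op_defs lift_def sc4_def fun_eq_iff split: nat.splits)

lemma dd_op:
  "dd n (opx w) = opx (dd n w)" "dd n (opy (sc4 sc) p q w) = opy (sc4 sc) p q (dd n w)"
  "dd n (opz (sc4 sc) p w) = opz (sc4 sc) p (dd n w)" "dd n (lift (sc4 sc c) w) = lift (sc4 sc c) (dd n w)"
  by (simp_all add: dd_def Let_def mk3_op cmp_op D_LX D_LY D_LZ D_fsc op_zero opz0 fsc_linear)

lemma dd_add: "dd n (v + w) = dd n v + dd n w"
  using mk3_add[of _ _ 0 0 0 0] by (auto simp: dd_def Let_def cmp_add D_add mk3_add)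

lemma mk3_Fin: "a \<in> Fin S \<Longrightarrow> b \<in> Fin S \<Longrightarrow> c \<in> Fin S \<Longrightarrow> mk3 a b c \<in> Fin (SS S 3)"
  "a \<in> Fin S \<Longrightarrow> mk3 a 0 0 \<in> Fin (SS S 1)"
  by (auto simp: Fin_SS3 Fin_SS1 cmp_mk3_if)

lemma dd_Fin:
  assumes w: "w \<in> Fin (SS S (rk (Suc n)))"
  shows "dd n w \<in> Fin (SS S (rk n))"
proof -
  consider "n = 0" | "n = 1" | "n = 2" | "n \<ge> 3" by linarith
  then show ?thesis
  proof cases
    case 1
    then have "w \<in> Fin (SS S 3)" using w by simp
    then have "mk3 (D0 (cmp 0 w) (cmp 1 w) (cmp 2 w)) 0 0 \<in> Fin (SS S 1)"
      unfolding Fin_SS3 by (intro mk3_Fin D_Fin) simp_all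
    then show ?thesis using 1 by (simp add: dd_def Let_def)
  next
    case 2
    then have "w \<in> Fin (SS S 3)" using w by simp
    then have "mk3 (D1x (cmp 0 w) (cmp 1 w)) (D1y (cmp 0 w) (cmp 2 w)) (D1z (cmp 0 w) (cmp 1 w) (cmp 2 w)) \<in> Fin (SS S 3)"
      unfolding Fin_SS3[of w] by (intro mk3_Fin D_Fin) simp_all
    then show ?thesis using 2 by (simp add: dd_def Let_def)
  next
    case 3
    then have "w \<in> Fin (SS S 1)" using w by simp
    then have "mk3 (D2a (cmp 0 w)) (D2b (cmp 0 w)) (D2c (cmp 0 w)) \<in> Fin (SS S 3)"
      unfolding Fin_SS1 by (intro mk3_Fin D_Fin) simp_all
    then show ?thesis using 3 by (simp add: dd_def Let_def)
  next
    case 4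
    then have "dd n w = 0" by (simp add: dd_def)
    then show ?thesis by (simp only:) (simp add: Fin_SS Fin_closed[OF subS])
  qed
qed

lemma mk3_eq_0 [simp]: "mk3 a b c = 0 \<longleftrightarrow> a = 0 \<and> b = 0 \<and> c = (0 :: 'v pbw)"
proof
  assume "mk3 a b c = 0"
  then have "cmp t (mk3 a b c) = 0" for t by simp
  from this[of 0] this[of 1] this[of 2] show "a = 0 \<and> b = 0 \<and> c = 0" by simp
next
  assume "a = 0 \<and> b = 0 \<and> c = 0"
  then show "mk3 a b c = 0" by (simp add: mk3_def fun_eq_iff)
qed

lemma Fin_SS_mk3: "w \<in> Fin (SS S 3) \<Longrightarrow> w = mk3 (cmp 0 w) (cmp 1 w) (cmp 2 w)"
  "w \<in> Fin (SS S 1) \<Longrightarrow> w = mk3 (cmp 0 w) 0 0"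
proof -
  have "t \<ge> 3" if "t \<noteq> 0" "t \<noteq> 1" "t \<noteq> 2" for t :: nat using that by linarith
  then show "w \<in> Fin (SS S 3) \<Longrightarrow> w = mk3 (cmp 0 w) (cmp 1 w) (cmp 2 w)"
    by (intro cmp_eqI) (simp add: Fin_SS3 cmp_mk3_if)
  show "w \<in> Fin (SS S 1) \<Longrightarrow> w = mk3 (cmp 0 w) 0 0"
    by (intro cmp_eqI) (simp add: Fin_SS1 cmp_mk3_if)
qed

lemma dd_exact0:
  "dd 0 ` Fin (SS S (rk 1)) = {w \<in> Fin (SS S (rk 0)). ev3 (cmp 0 w) = 0}"
proof (intro equalityI subsetI)
  fix w assume "w \<in> dd 0 ` Fin (SS S (rk 1))"
  then obtain u where u: "u \<in> Fin (SS S (rk 1))" "w = dd 0 u" by auto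
  then have "cmp 0 u \<in> Fin S" "cmp 1 u \<in> Fin S" "cmp 2 u \<in> Fin S" by (simp_all add: Fin_SS3)
  then show "w \<in> {w \<in> Fin (SS S (rk 0)). ev3 (cmp 0 w) = 0}"
    using u(2) dd_Fin[of u 0] u(1) by (simp add: dd_def Let_def ev3_D0)
next
  fix w assume "w \<in> {w \<in> Fin (SS S (rk 0)). ev3 (cmp 0 w) = 0}"
  then have w: "w \<in> Fin (SS S 1)" "ev3 (cmp 0 w) = 0" by auto
  then have "cmp 0 w \<in> Fin S" by (auto simp: Fin_SS)
  from ev3_kernel[OF this w(2)] obtain a b c where "a \<in> Fin S" "b \<in> Fin S" "c \<in> Fin S" "cmp 0 w = D0 a b c"
    unfolding D0_def by blast
  then show "w \<in> dd 0 ` Fin (SS S (rk 1))"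
    using Fin_SS_mk3(2)[OF w(1)] mk3_Fin(1)[of a b c] by (intro image_eqI[of _ _ "mk3 a b c"]) (auto simp: dd_def)
qed

lemma dd_exact:
  "dd (Suc n) ` Fin (SS S (rk (Suc (Suc n)))) = {w \<in> Fin (SS S (rk (Suc n))). dd n w = 0}"
proof -
  consider "n = 0" | "n = 1" | "n = 2" | "n \<ge> 3" by linarith
  then show ?thesis
  proof cases
    case 1
    show ?thesis
    proof (intro equalityI subsetI)
      fix w assume "w \<in> dd (Suc n) ` Fin (SS S (rk (Suc (Suc n))))"
      then obtain u where u: "u \<in> Fin (SS S (rk (Suc (Suc n))))" "w = dd (Suc n) u" by blast
      have "dd n w = 0" unfolding u(2) 1 by (simp add: dd_def Let_def D_D)
      then show "w \<in> {w \<in> Fin (SS S (rk (Suc n))). dd n w = 0}"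
        using dd_Fin[OF u(1)] u(2) by simp
    next
      fix w assume "w \<in> {w \<in> Fin (SS S (rk (Suc n))). dd n w = 0}"
      then have w: "w \<in> Fin (SS S 3)" "dd 0 w = 0" using 1 by auto
      then have "cmp 0 w \<in> Fin S" "cmp 1 w \<in> Fin S" "cmp 2 w \<in> Fin S" "D0 (cmp 0 w) (cmp 1 w) (cmp 2 w) = 0"
        by (simp_all add: Fin_SS3 dd_def Let_def)
      from D1_exact[OF this] obtain a b c where abc: "a \<in> Fin S" "b \<in> Fin S" "c \<in> Fin S"
        "cmp 0 w = D1x a b" "cmp 1 w = D1y a c" "cmp 2 w = D1z a b c" by blast
      have "w = dd 1 (mk3 a b c)"
        using Fin_SS_mk3(1)[OF w(1)] abc(4-) by (simp add: dd_def)
      then show "w \<in> dd (Suc n) ` Fin (SS S (rk (Suc (Suc n))))"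
        using mk3_Fin(1)[OF abc(1-3)] 1 by auto
    qed
  next
    case 2
    show ?thesis
    proof (intro equalityI subsetI)
      fix w assume "w \<in> dd (Suc n) ` Fin (SS S (rk (Suc (Suc n))))"
      then obtain u where u: "u \<in> Fin (SS S (rk (Suc (Suc n))))" "w = dd (Suc n) u" by blast
      have "dd n w = 0" unfolding u(2) 2 by (simp add: dd_def Let_def D_D)
      then show "w \<in> {w \<in> Fin (SS S (rk (Suc n))). dd n w = 0}"
        using dd_Fin[OF u(1)] u(2) by simp
    next
      fix w assume "w \<in> {w \<in> Fin (SS S (rk (Suc n))). dd n w = 0}"
      then have w: "w \<in> Fin (SS S 3)" "dd 1 w = 0" using 2 by auto
      then have "cmp 0 w \<in> Fin S" "cmp 1 w \<in> Fin S" "cmp 2 w \<in> Fin S" "D1x (cmp 0 w) (cmp 1 w) = 0"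
        "D1y (cmp 0 w) (cmp 2 w) = 0" "D1z (cmp 0 w) (cmp 1 w) (cmp 2 w) = 0"
        by (simp_all add: Fin_SS3 dd_def Let_def)
      from D2_exact[OF this] obtain a where a: "a \<in> Fin S"
        "cmp 0 w = D2a a" "cmp 1 w = D2b a" "cmp 2 w = D2c a" by blast
      have "w = dd 2 (mk3 a 0 0)"
        using Fin_SS_mk3(1)[OF w(1)] a(2-) by (simp add: dd_def)
      then show "w \<in> dd (Suc n) ` Fin (SS S (rk (Suc (Suc n))))"
        using mk3_Fin(2)[OF a(1)] 2 by (auto simp: numeral_2_eq_2)
    qed
  next
    case 3
    show ?thesis
    proof (intro equalityI subsetI)
      fix w assume "w \<in> dd (Suc n) ` Fin (SS S (rk (Suc (Suc n))))"
      then have "w = 0" using 3 by (auto simp: dd_def)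
      then show "w \<in> {w \<in> Fin (SS S (rk (Suc n))). dd n w = 0}"
        using dd_add[of n 0 0] by (auto simp: Fin_SS Fin_closed[OF subS])
    next
      fix w assume "w \<in> {w \<in> Fin (SS S (rk (Suc n))). dd n w = 0}"
      then have w: "w \<in> Fin (SS S 1)" "dd 2 w = 0" using 3 by auto
      then have "cmp 0 w \<in> Fin S" "D2b (cmp 0 w) = 0" by (simp_all add: Fin_SS1 dd_def Let_def)
      then have "cmp 0 w = 0" by (rule D2_inj)
      then have w0: "w = 0" using Fin_SS_mk3(2)[OF w(1)] by simp
      show "w \<in> dd (Suc n) ` Fin (SS S (rk (Suc (Suc n))))"
        using w0 3 by (intro image_eqI[of _ _ 0]) (auto simp: dd_def Fin_SS Fin_closed[OF subS])
    qed
  next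
    case 4
    then have r: "rk (Suc n) = 0" "rk (Suc (Suc n)) = 0" by (auto simp: rk_def)
    have z: "Fin (SS S 0) = {0}"
      by (auto simp only: Fin_SS0)
    show ?thesis unfolding r z using 4 by (auto simp: dd_def)
  qed
qed

end

section \<open>Lifting along exact sequences\<close>

lemma left_module_carrier:
  assumes "left_module R M"
  shows "\<zero>\<^bsub>M\<^esub> \<in> carrier M" "u \<in> carrier M \<Longrightarrow> v \<in> carrier M \<Longrightarrow> u \<oplus>\<^bsub>M\<^esub> v \<in> carrier M"
    "a \<in> carrier R \<Longrightarrow> u \<in> carrier M \<Longrightarrow> a \<odot>\<^bsub>M\<^esub> u \<in> carrier M"
proof -
  interpret left_module R M by fact
  show "\<zero>\<^bsub>M\<^esub> \<in> carrier M" "u \<in> carrier M \<Longrightarrow> v \<in> carrier M \<Longrightarrow> u \<oplus>\<^bsub>M\<^esub> v \<in> carrier M"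
    "a \<in> carrier R \<Longrightarrow> u \<in> carrier M \<Longrightarrow> a \<odot>\<^bsub>M\<^esub> u \<in> carrier M" by (auto simp: lsmult_closed)
qed

lemma lmod_hom_zero:
  assumes "left_module R M" "left_module R N" "f \<in> lmod_hom R M N"
  shows "f \<zero>\<^bsub>M\<^esub> = \<zero>\<^bsub>N\<^esub>"
proof -
  interpret M: left_module R M by fact
  interpret N: left_module R N by fact
  have "f \<zero>\<^bsub>M\<^esub> \<oplus>\<^bsub>N\<^esub> f \<zero>\<^bsub>M\<^esub> = f \<zero>\<^bsub>M\<^esub>"
    using lmod_homD(2)[OF assms(3), of "\<zero>\<^bsub>M\<^esub>" "\<zero>\<^bsub>M\<^esub>"] by simp
  then show ?thesis using lmod_homD(1)[OF assms(3), of "\<zero>\<^bsub>M\<^esub>"] by (simp add: N.add.l_cancel_one')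
qed

lemma left_module_image:
  assumes A: "left_module R A" and B: "left_module R B" and d: "d \<in> lmod_hom R A B"
  shows "left_module R (B\<lparr>carrier := d ` carrier A\<rparr>)"
proof -
  interpret A: left_module R A by fact
  interpret B: left_module R B by fact
  let ?B = "B\<lparr>carrier := d ` carrier A\<rparr>"
  note dd = lmod_homD[OF d]
  have dz: "d \<zero>\<^bsub>A\<^esub> = \<zero>\<^bsub>B\<^esub>" by (rule lmod_hom_zero[OF A B d])
  have "abelian_group ?B"
  proof (rule abelian_groupI)
    fix u assume "u \<in> carrier ?B"
    then obtain a where a: "a \<in> carrier A" "u = d a" by auto
    have "d (\<ominus>\<^bsub>A\<^esub> a) \<oplus>\<^bsub>B\<^esub> d a = \<zero>\<^bsub>B\<^esub>"
      using dd(2)[of "\<ominus>\<^bsub>A\<^esub> a" a] a by (simp add: A.M.l_neg dz)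
    then show "\<exists>v \<in> carrier ?B. v \<oplus>\<^bsub>?B\<^esub> u = \<zero>\<^bsub>?B\<^esub>"
      using a by (intro bexI[of _ "d (\<ominus>\<^bsub>A\<^esub> a)"]) auto
  next
    fix u v assume "u \<in> carrier ?B" "v \<in> carrier ?B"
    then obtain a b where ab: "a \<in> carrier A" "u = d a" "b \<in> carrier A" "v = d b" by auto
    then have "u \<oplus>\<^bsub>B\<^esub> v = d (a \<oplus>\<^bsub>A\<^esub> b)" by (simp add: dd)
    then show "u \<oplus>\<^bsub>?B\<^esub> v \<in> carrier ?B" using ab by auto
  next
    have "d \<zero>\<^bsub>A\<^esub> \<in> d ` carrier A" by (rule imageI) simp
    then show "\<zero>\<^bsub>?B\<^esub> \<in> carrier ?B" using dz by simp
  qed (auto simp: dd B.M.a_ac)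
  then interpret C: abelian_group ?B .
  have closed: "r \<odot>\<^bsub>B\<^esub> d a \<in> d ` carrier A" if "r \<in> carrier R" "a \<in> carrier A" for r a
    using that dd(3)[of r a] A.lsmult_closed by (metis imageI)
  show ?thesis
    by unfold_locales
       (auto simp: closed dd(1) B.lsmult_l_distr B.lsmult_r_distr B.lsmult_assoc B.lsmult_one)
qed

text \<open>
  The homomorphism \<open>f\<close> lifts along the surjection of \<open>A\<close> onto the image of \<open>d\<close>. The injections \<open>\<iota>A\<close>,
  \<open>\<iota>B\<close> ensure that this image and \<open>A\<close> are among the modules to which the lifting property applies.
\<close>

lemma lifting_exact:
  fixes \<iota>A :: "'x \<Rightarrow> 'u" and \<iota>B :: "'y \<Rightarrow> 'u"
  assumes P: "left_module R P" "lifting TYPE('u) R P"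
    and A: "left_module R A" "inj_on \<iota>A (carrier A)" and B: "left_module R B" "inj_on \<iota>B (carrier B)"
    and f: "f \<in> lmod_hom R P B" and d: "d \<in> lmod_hom R A B"
    and im: "\<And>x. x \<in> carrier P \<Longrightarrow> f x \<in> d ` carrier A"
  shows "\<exists>h \<in> lmod_hom R P A. \<forall>x \<in> carrier P. d (h x) = f x"
proof -
  define C where "C = B\<lparr>carrier := d ` carrier A\<rparr>"
  have C: "left_module R C" unfolding C_def by (rule left_module_image[OF A(1) B(1) d])
  have Cs: "carrier C = d ` carrier A" "u \<oplus>\<^bsub>C\<^esub> v = u \<oplus>\<^bsub>B\<^esub> v" "r \<odot>\<^bsub>C\<^esub> u = r \<odot>\<^bsub>B\<^esub> u" for u v r
    by (simp_all add: C_def)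
  have CB: "carrier C \<subseteq> carrier B" using lmod_homD(1)[OF d] by (auto simp: Cs)
  define \<tau>A \<tau>C where "\<tau>A = inv_into (carrier A) \<iota>A" and "\<tau>C = inv_into (carrier C) \<iota>B"
  have iC: "inj_on \<iota>B (carrier C)" by (rule inj_on_subset[OF B(2) CB])
  interpret TA: transport R A \<iota>A \<tau>A
    by (intro transport.intro transport_axioms.intro A(1)) (simp add: \<tau>A_def inv_into_f_f[OF A(2)])
  interpret TC: transport R C \<iota>B \<tau>C
    by (intro transport.intro transport_axioms.intro C) (simp add: \<tau>C_def inv_into_f_f[OF iC])
  have f': "f \<in> lmod_hom R P C"
    using f im unfolding lmod_hom_def Cs by (auto simp: PiE_iff)
  have d': "d \<in> lmod_hom R A C"
    using d unfolding lmod_hom_def Cs by (auto simp: PiE_iff)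
  define g where "g = (\<lambda>u \<in> carrier TA.T. (\<lambda>w \<in> carrier A. \<iota>B (d w)) (\<tau>A u))"
  have g: "g \<in> lmod_hom R TA.T TC.T"
    unfolding g_def by (rule TA.hom_from_T[OF TC.hom_to_T[OF A(1) d']])
  have g_eq: "g (\<iota>A a) = \<iota>B (d a)" if "a \<in> carrier A" for a
    using that by (simp add: g_def TA.\<tau>\<iota>)
  have "\<exists>h \<in> lmod_hom R P TA.T. \<forall>x \<in> carrier P. g (h x) = (\<lambda>u \<in> carrier P. \<iota>B (f u)) x"
  proof (rule P(2)[unfolded lifting_def, rule_format], intro conjI)
    show "g ` carrier TA.T = carrier TC.T"
      by (auto simp: Cs g_eq image_iff)
  qed (rule TA.left_module_T TC.left_module_T g TC.hom_to_T[OF P(1) f'])+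
  then obtain h where h: "h \<in> lmod_hom R P TA.T" "\<And>x. x \<in> carrier P \<Longrightarrow> g (h x) = \<iota>B (f x)" by auto
  define h' where "h' = (\<lambda>x \<in> carrier P. restrict \<tau>A (carrier TA.T) (h x))"
  have h': "h' \<in> lmod_hom R P A" unfolding h'_def by (rule lmod_hom_comp[OF P(1) h(1) TA.from_T])
  have "d (h' x) = f x" if x: "x \<in> carrier P" for x
  proof -
    obtain a where a: "a \<in> carrier A" "h x = \<iota>A a" using lmod_homD(1)[OF h(1) x] by auto
    have "\<iota>B (d a) = \<iota>B (f x)" using h(2)[OF x] a g_eq by simp
    then have "d a = f x"
      using iC lmod_homD(1)[OF d' a(1)] lmod_homD(1)[OF f' x] by (simp add: inj_on_eq_iff)
    then show ?thesis using a x by (simp add: h'_def TA.\<tau>\<iota>)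
  qed
  then show ?thesis using h' by blast
qed

text \<open>
  The comparison theorem: a complex of modules with the lifting property maps to every exact complex
  over the same module.
\<close>

lemma comparison:
  fixes \<iota>Q :: "nat \<Rightarrow> 'y \<Rightarrow> 'u" and \<iota>M :: "'m \<Rightarrow> 'u"
  assumes P: "\<And>n. left_module R (P n)" "\<And>n. lifting TYPE('u) R (P n)"
    and dP: "\<And>n. dP n \<in> lmod_hom R (P (Suc n)) (P n)" and eP: "eP \<in> lmod_hom R (P 0) M"
    and Pz: "\<And>x. x \<in> carrier (P 1) \<Longrightarrow> eP (dP 0 x) = \<zero>\<^bsub>M\<^esub>"
      "\<And>n x. x \<in> carrier (P (Suc (Suc n))) \<Longrightarrow> dP n (dP (Suc n) x) = \<zero>\<^bsub>P n\<^esub>"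
    and Q: "\<And>n. left_module R (Q n)" "\<And>n. inj_on (\<iota>Q n) (carrier (Q n))"
    and dQ: "\<And>n. dQ n \<in> lmod_hom R (Q (Suc n)) (Q n)" and eQ: "eQ \<in> lmod_hom R (Q 0) M"
    and Qe: "eQ ` carrier (Q 0) = carrier M"
      "\<And>y. y \<in> carrier (Q 0) \<Longrightarrow> eQ y = \<zero>\<^bsub>M\<^esub> \<Longrightarrow> y \<in> dQ 0 ` carrier (Q 1)"
      "\<And>n y. y \<in> carrier (Q (Suc n)) \<Longrightarrow> dQ n y = \<zero>\<^bsub>Q n\<^esub> \<Longrightarrow> y \<in> dQ (Suc n) ` carrier (Q (Suc (Suc n)))"
    and M: "left_module R M" "inj_on \<iota>M (carrier M)"
  shows "\<exists>\<phi>. (\<forall>n. \<phi> n \<in> lmod_hom R (P n) (Q n)) \<and> (\<forall>x \<in> carrier (P 0). eQ (\<phi> 0 x) = eP x) \<and>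
    (\<forall>n. \<forall>x \<in> carrier (P (Suc n)). dQ n (\<phi> (Suc n) x) = \<phi> n (dP n x))"
proof -
  let ?I = "\<lambda>n f. f \<in> lmod_hom R (P n) (Q n) \<and> (\<forall>x \<in> carrier (P (Suc n)). f (dP n x) \<in> dQ n ` carrier (Q (Suc n))) \<and>
    (n = 0 \<longrightarrow> (\<forall>x \<in> carrier (P 0). eQ (f x) = eP x))"
  let ?J = "\<lambda>n f f'. \<forall>x \<in> carrier (P (Suc n)). dQ n (f' x) = f (dP n x)"
  have dPin: "dP n x \<in> carrier (P n)" if "x \<in> carrier (P (Suc n))" for n x by (rule lmod_homD(1)[OF dP that])
  have "\<exists>\<phi>. \<forall>n. ?I n (\<phi> n) \<and> ?J n (\<phi> n) (\<phi> (Suc n))"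
  proof (rule dependent_nat_choice)
    have "\<exists>h \<in> lmod_hom R (P 0) (Q 0). \<forall>x \<in> carrier (P 0). eQ (h x) = eP x"
      by (rule lifting_exact[OF P Q M eP eQ]) (use lmod_homD(1)[OF eP] Qe(1) in auto)
    then obtain f where f: "f \<in> lmod_hom R (P 0) (Q 0)" "\<And>x. x \<in> carrier (P 0) \<Longrightarrow> eQ (f x) = eP x" by blast
    have "f (dP 0 x) \<in> dQ 0 ` carrier (Q (Suc 0))" if x: "x \<in> carrier (P (Suc 0))" for x
      using Qe(2)[of "f (dP 0 x)"] f(2)[OF dPin[OF x]] Pz(1) lmod_homD(1)[OF f(1) dPin[OF x]] x by simp
    then show "\<exists>f. ?I 0 f" using f by blast
  next
    fix f n assume f: "?I n f"
    have "(\<lambda>x \<in> carrier (P (Suc n)). f (dP n x)) \<in> lmod_hom R (P (Suc n)) (Q n)"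
      by (rule lmod_hom_comp[OF P(1) dP]) (use f in blast)
    from lifting_exact[OF P Q Q this dQ] f obtain f' where f':
      "f' \<in> lmod_hom R (P (Suc n)) (Q (Suc n))" "\<And>x. x \<in> carrier (P (Suc n)) \<Longrightarrow> dQ n (f' x) = f (dP n x)"
      by auto
    have "f' (dP (Suc n) x) \<in> dQ (Suc n) ` carrier (Q (Suc (Suc n)))" if x: "x \<in> carrier (P (Suc (Suc n)))" for x
    proof (rule Qe(3))
      show "f' (dP (Suc n) x) \<in> carrier (Q (Suc n))" by (rule lmod_homD(1)[OF f'(1) dPin[OF x]])
      show "dQ n (f' (dP (Suc n) x)) = \<zero>\<^bsub>Q n\<^esub>"
        using f'(2)[OF dPin[OF x]] Pz(2)[OF x] lmod_hom_zero[OF P(1) Q(1), of f n n] f by simp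
    qed
    then show "\<exists>f'. ?I (Suc n) f' \<and> ?J n f f'" using f' by blast
  qed
  then obtain \<phi> where \<phi>: "\<forall>n. ?I n (\<phi> n) \<and> ?J n (\<phi> n) (\<phi> (Suc n))" by (rule exE)
  have "\<phi> n \<in> lmod_hom R (P n) (Q n)" for n using spec[OF \<phi>, of n] by (elim conjE)
  moreover have "\<forall>x \<in> carrier (P 0). eQ (\<phi> 0 x) = eP x" using spec[OF \<phi>, of 0] by simp
  moreover have "?J n (\<phi> n) (\<phi> (Suc n))" for n using spec[OF \<phi>, of n] by (elim conjE)
  ultimately show ?thesis by (intro exI[of _ \<phi>] conjI allI)
qed

section \<open>Global dimension\<close>

context PBW_mod begin

lemma PBW_free_SS: "PBW_free R \<phi> p q gx gy gz \<kappa> (sc4 sc) (SS S r)"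
proof -
  interpret W: qspace "sc4 sc" p q by (rule qspace_sc4)
  show "PBW_free R \<phi> p q gx gy gz \<kappa> (sc4 sc) (SS S r)"
    by unfold_locales (rule subspace_SS[OF subS])
qed

interpretation P: PBW_free R \<phi> p q gx gy gz \<kappa> "sc4 sc" "SS S r" for r by (rule PBW_free_SS)

definition PP :: "nat \<Rightarrow> ('a, (nat \<Rightarrow> 'v) pbw) module" where
  "PP n = P.FM (rk n)"

lemma PP_simps [simp]: "carrier (PP n) = Fin (SS S (rk n))" "u \<oplus>\<^bsub>PP n\<^esub> v = u + v" "\<zero>\<^bsub>PP n\<^esub> = 0"
  by (simp_all add: PP_def)

lemma PP_smult [simp]: "gx \<odot>\<^bsub>PP n\<^esub> v = opx v" "gy \<odot>\<^bsub>PP n\<^esub> v = opy (sc4 sc) p q v"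
  "gz \<odot>\<^bsub>PP n\<^esub> v = opz (sc4 sc) p v" "\<kappa> c \<odot>\<^bsub>PP n\<^esub> v = lift (sc4 sc c) v"
  by (simp_all add: PP_def P.F_act_gens)

lemma left_module_PP: "left_module R (PP n)"
  unfolding PP_def by (rule P.F.left_module_TM)

lemma lifting_PP: "lifting TYPE('u) R (PP n)"
  unfolding PP_def by (rule P.lifting_FM)

definition dP :: "nat \<Rightarrow> (nat \<Rightarrow> 'v) pbw \<Rightarrow> (nat \<Rightarrow> 'v) pbw" where
  "dP n = restrict (dd n) (Fin (SS S (rk (Suc n))))"

definition eP :: "(nat \<Rightarrow> 'v) pbw \<Rightarrow> 'v" where
  "eP = restrict (\<lambda>w. ev3 (cmp 0 w)) (Fin (SS S (rk 0)))"

lemma dP_hom: "dP n \<in> lmod_hom R (PP (Suc n)) (PP n)"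
  unfolding dP_def PP_simps(1)[symmetric]
  by (rule lmod_homI[OF left_module_PP left_module_PP]) (simp_all add: dd_op dd_add dd_Fin)

lemma eP_hom: "eP \<in> lmod_hom R (PP 0) TM"
  unfolding eP_def PP_simps(1)[symmetric]
  by (rule lmod_homI[OF left_module_PP left_module_TM])
     (simp_all add: cmp_op cmp_add ev3_op[of _ S] ev3_add[of _ S] ev3_in act_gens Fin_SS1)

lemma eP_surj: "eP ` carrier (PP 0) = S"
proof (intro equalityI subsetI)
  fix v assume "v \<in> eP ` carrier (PP 0)"
  then show "v \<in> S" by (auto simp: eP_def ev3_in Fin_SS1)
next
  fix v assume v: "v \<in> S"
  have "mk3 (single3 0 0 0 v) 0 0 \<in> Fin (SS S 1)" by (rule mk3_Fin(2)[OF single3_Fin[OF v S0]])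
  moreover have "ev3 (single3 0 0 0 v) = v" by (simp add: ev3_single)
  ultimately show "v \<in> eP ` carrier (PP 0)"
    by (intro image_eqI[of _ _ "mk3 (single3 0 0 0 v) 0 0"]) (auto simp: eP_def)
qed

lemma dP_exact0: "dP 0 ` carrier (PP 1) = {w \<in> carrier (PP 0). eP w = 0}"
  using dd_exact0 by (auto simp: dP_def eP_def image_iff)

lemma dP_exact: "dP (Suc n) ` carrier (PP (Suc (Suc n))) = {w \<in> carrier (PP (Suc n)). dP n w = \<zero>\<^bsub>PP n\<^esub>}"
  using dd_exact[of n] by (auto simp: dP_def)

lemma PP_subset: "carrier (PP n) \<subseteq> Fin (SS UNIV 3)"
proof -
  have "rk n \<le> 3" by (simp add: rk_def)
  moreover have "0 \<in> S" by (rule S0)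
  ultimately have "SS S (rk n) \<subseteq> SS UNIV 3" by (auto simp: SS_def)
  then show ?thesis by (auto simp: Fin_def)
qed

lemma PP_zero: "n > 3 \<Longrightarrow> carrier (PP n) = {\<zero>\<^bsub>PP n\<^esub>}"
  by (simp add: Fin_SS0[abs_def]) (auto simp: Fin_SS0)

text \<open>
  The complex is a resolution of \<open>S\<close>; here it becomes one of a module isomorphic to \<open>S\<close>, with terms
  of the type \<open>'u\<close>.
\<close>

lemma resolution_in_universe:
  fixes \<iota> :: "(nat \<Rightarrow> 'v) pbw \<Rightarrow> 'u" and M :: "('a, 'm) module"
  assumes \<iota>: "inj_on \<iota> (Fin (SS UNIV 3))" and M: "left_module R M"
    and r: "r \<in> lmod_hom R TM M" "bij_betw r S (carrier M)"
  defines "\<tau> \<equiv> inv_into (Fin (SS UNIV 3)) \<iota>"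
  shows "projective_resolution R M (\<lambda>n. transported \<iota> \<tau> (PP n))
     (\<lambda>n. \<lambda>u \<in> \<iota> ` carrier (PP (Suc n)). \<iota> (dP n (\<tau> u)))
     (\<lambda>u \<in> \<iota> ` carrier (PP 0). (\<lambda>w \<in> carrier (PP 0). r (eP w)) (\<tau> u))"
proof (rule transport_resolution)
  fix n
  show "transport R (PP n) \<iota> \<tau>"
    by (intro transport.intro transport_axioms.intro left_module_PP)
       (use PP_subset[of n] in \<open>auto simp: \<tau>_def inv_into_f_f[OF \<iota>]\<close>)
  show "lifting TYPE('u) R (PP n)" by (rule lifting_PP)
  show "dP n \<in> lmod_hom R (PP (Suc n)) (PP n)" by (rule dP_hom)
  show "dP (Suc n) ` carrier (PP (Suc (Suc n))) = {x \<in> carrier (PP (Suc n)). dP n x = \<zero>\<^bsub>PP n\<^esub>}"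
    by (rule dP_exact)
next
  show "(\<lambda>w \<in> carrier (PP 0). r (eP w)) \<in> lmod_hom R (PP 0) M"
    by (rule lmod_hom_comp[OF left_module_PP eP_hom r(1)])
  have "(\<lambda>w \<in> carrier (PP 0). r (eP w)) ` carrier (PP 0) = r ` (eP ` carrier (PP 0))" by (auto simp: image_image)
  then show "(\<lambda>w \<in> carrier (PP 0). r (eP w)) ` carrier (PP 0) = carrier M"
    using r(2) eP_surj by (simp add: bij_betw_def)
  have "r v = \<zero>\<^bsub>M\<^esub> \<longleftrightarrow> v = 0" if "v \<in> S" for v
  proof -
    have "inj_on r S" using r(2) by (simp add: bij_betw_def)
    then have "r v = r 0 \<longleftrightarrow> v = 0" by (rule inj_on_eq_iff[OF _ that S0])
    then show ?thesis using lmod_hom_zero[OF left_module_TM M r(1)] by simp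
  qed
  then have "{w \<in> carrier (PP 0). (\<lambda>w \<in> carrier (PP 0). r (eP w)) w = \<zero>\<^bsub>M\<^esub>} = {w \<in> carrier (PP 0). eP w = 0}"
    using eP_surj by auto
  then show "dP 0 ` carrier (PP 1) = {w \<in> carrier (PP 0). (\<lambda>w \<in> carrier (PP 0). r (eP w)) w = \<zero>\<^bsub>M\<^esub>}"
    using dP_exact0 by simp
qed

lemma proj_dim_le_3:
  fixes \<iota> :: "(nat \<Rightarrow> 'v) pbw \<Rightarrow> 'u" and M :: "('a, 'm) module"
  assumes \<iota>: "inj_on \<iota> (Fin (SS UNIV 3))" and M: "left_module R M"
    and r: "r \<in> lmod_hom R TM M" "bij_betw r S (carrier M)"
  shows "proj_dim TYPE('u) R M \<le> 3"
proof -
  have "carrier (transported \<iota> \<tau> (PP i)) = {\<zero>\<^bsub>transported \<iota> \<tau> (PP i)\<^esub>}" if "i > 3" for \<tau> i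
    unfolding transported_simps(1,2) PP_zero[OF that] by simp
  then have "enat 3 \<in> {enat n | n. \<exists>(P :: nat \<Rightarrow> ('a, 'u) module) d e.
     projective_resolution R M P d e \<and> (\<forall>i > n. carrier (P i) = {\<zero>\<^bsub>P i\<^esub>})}"
    using resolution_in_universe[OF assms] by blast
  then have "proj_dim TYPE('u) R M \<le> enat 3" unfolding proj_dim_def by (rule Inf_lower)
  then show ?thesis by (simp add: numeral_eq_enat)
qed

end

context PBW_mod begin

lemma hom_diff_PP:
  assumes M: "left_module R M" and f: "f \<in> lmod_hom R M (PP n)" and g: "g \<in> lmod_hom R M (PP n)"
  shows "(\<lambda>w \<in> carrier M. f w - g w) \<in> lmod_hom R M (PP n)"
proof -
  interpret W: qspace "sc4 sc" p q by (rule qspace_sc4)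
  note ff = lmod_homD[OF f] and gg = lmod_homD[OF g]
  have lin: "lift (sc4 sc c) (u - v) = lift (sc4 sc c) u - lift (sc4 sc c) v" for c u v
    by (simp add: lift_def sc4_def fun_eq_iff scale_right_diff_distrib)
  show ?thesis
    by (rule lmod_homI[OF M left_module_PP])
       (use ff(1) gg(1) in \<open>simp_all add: ff gg W.op_diff lin W.Fin_closed[OF subspace_SS[OF subS]]\<close>)
qed

lemma id_hom_PP: "restrict (\<lambda>w. w) (carrier (PP n)) \<in> lmod_hom R (PP n) (PP n)"
  by (rule lmod_hom_restrictI[OF left_module_PP]) simp_all

lemma dP_inj:
  assumes "v \<in> carrier (PP 3)" "w \<in> carrier (PP 3)" "dP 2 v = dP 2 w"
  shows "v = w"
proof -
  have hom: "dP 2 \<in> lmod_hom R (PP 3) (PP 2)" using dP_hom[of 2] by (simp add: numeral_3_eq_3 numeral_2_eq_2)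
  have "(\<lambda>x \<in> carrier (PP 3). restrict (\<lambda>w. w) (carrier (PP 3)) x - restrict (\<lambda>w. w) (carrier (PP 3)) x) \<in> lmod_hom R (PP 3) (PP 3)"
    by (rule hom_diff_PP[OF left_module_PP id_hom_PP id_hom_PP])
  have sub: "v - w \<in> carrier (PP 3)"
  proof -
    interpret W: qspace "sc4 sc" p q by (rule qspace_sc4)
    show ?thesis using assms(1,2) W.Fin_closed[OF subspace_SS[OF subS]] by simp
  qed
  have "dP 2 (v - w) = 0"
    using lmod_homD(2)[OF hom sub assms(2)] assms(3) by simp
  moreover have e: "Suc 2 = 3" "Suc 3 = 4" by simp_all
  have "dP 3 ` carrier (PP 4) = {w \<in> carrier (PP 3). dP 2 w = \<zero>\<^bsub>PP 2\<^esub>}"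
    using dP_exact[of 2] by (simp only: e)
  ultimately have "v - w \<in> dP 3 ` carrier (PP 4)" using sub by simp
  moreover have "dP 3 ` carrier (PP 4) \<subseteq> {0}"
    by (auto simp: dP_def dd_def)
  ultimately show ?thesis by auto
qed

text \<open>
  A chain endomorphism of the resolution that covers the zero map is null-homotopic. As the complex
  ends in degree \<open>3\<close>, in that degree the homotopy is a factorization through the last differential.
\<close>

lemma last_factorization:
  fixes \<iota> :: "(nat \<Rightarrow> 'v) pbw \<Rightarrow> 'u"
  assumes \<iota>: "inj_on \<iota> (Fin (SS UNIV 3))"
    and \<delta>: "\<And>n. \<delta> n \<in> lmod_hom R (PP n) (PP n)"
      "\<And>w. w \<in> carrier (PP 0) \<Longrightarrow> eP (\<delta> 0 w) = 0"
      "\<And>n w. w \<in> carrier (PP (Suc n)) \<Longrightarrow> dP n (\<delta> (Suc n) w) = \<delta> n (dP n w)"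
  shows "\<exists>h \<in> lmod_hom R (PP 2) (PP 3). \<forall>w \<in> carrier (PP 3). \<delta> 3 w = h (dP 2 w)"
proof -
  have inj: "inj_on \<iota> (carrier (PP n))" for n by (rule inj_on_subset[OF \<iota> PP_subset])
  note lm = left_module_PP
  note lift = lifting_exact[OF lm lifting_PP lm inj lm inj]
  have din: "dP n w \<in> carrier (PP n)" if "w \<in> carrier (PP (Suc n))" for n w by (rule lmod_homD(1)[OF dP_hom that])
  have \<delta>in: "\<delta> n w \<in> carrier (PP n)" if "w \<in> carrier (PP n)" for n w by (rule lmod_homD(1)[OF \<delta>(1) that])
  have dz: "dP n (dP (Suc n) w) = 0" if "w \<in> carrier (PP (Suc (Suc n)))" for n w
    using dP_exact[of n] that by auto
  have ex: "w \<in> dP (Suc n) ` carrier (PP (Suc (Suc n)))" if "w \<in> carrier (PP (Suc n))" "dP n w = 0" for n w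
    using dP_exact[of n] that by simp
  have d_diff: "dP n (u - v) = dP n u - dP n v" if "u \<in> carrier (PP (Suc n))" "v \<in> carrier (PP (Suc n))"
     "u - v \<in> carrier (PP (Suc n))" for n u v
    using lmod_homD(2)[OF dP_hom that(3,2)] by simp
  have "\<exists>h \<in> lmod_hom R (PP 0) (PP (Suc 0)). \<forall>w \<in> carrier (PP 0). dP 0 (h w) = \<delta> 0 w"
  proof (rule lift[OF \<delta>(1) dP_hom])
    show "\<delta> 0 w \<in> dP 0 ` carrier (PP (Suc 0))" if "w \<in> carrier (PP 0)" for w
      using dP_exact0 \<delta>(2)[OF that] \<delta>in[OF that] by simp
  qed
  then obtain h0 where h0: "h0 \<in> lmod_hom R (PP 0) (PP (Suc 0))" "\<And>w. w \<in> carrier (PP 0) \<Longrightarrow> dP 0 (h0 w) = \<delta> 0 w"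
    by blast
  have step: "\<exists>h' \<in> lmod_hom R (PP (Suc n)) (PP (Suc (Suc n))). \<forall>w \<in> carrier (PP (Suc n)).
      dP (Suc n) (h' w) = \<delta> (Suc n) w - h (dP n w)"
    if h: "h \<in> lmod_hom R (PP n) (PP (Suc n))"
      and eq: "\<And>w. w \<in> carrier (PP (Suc n)) \<Longrightarrow> dP n (h (dP n w)) = \<delta> n (dP n w)" for n h
  proof -
    have c: "(\<lambda>w \<in> carrier (PP (Suc n)). h (dP n w)) \<in> lmod_hom R (PP (Suc n)) (PP (Suc n))"
      by (rule lmod_hom_comp[OF lm dP_hom h])
    have f: "(\<lambda>w \<in> carrier (PP (Suc n)). \<delta> (Suc n) w - (\<lambda>w \<in> carrier (PP (Suc n)). h (dP n w)) w)
        \<in> lmod_hom R (PP (Suc n)) (PP (Suc n))"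
      by (rule hom_diff_PP[OF lm \<delta>(1) c])
    have "\<exists>h' \<in> lmod_hom R (PP (Suc n)) (PP (Suc (Suc n))). \<forall>w \<in> carrier (PP (Suc n)).
      dP (Suc n) (h' w) = (\<lambda>w \<in> carrier (PP (Suc n)). \<delta> (Suc n) w - (\<lambda>w \<in> carrier (PP (Suc n)). h (dP n w)) w) w"
    proof (rule lift[OF f dP_hom])
      fix w assume w: "w \<in> carrier (PP (Suc n))"
      have i: "\<delta> (Suc n) w - h (dP n w) \<in> carrier (PP (Suc n))" using lmod_homD(1)[OF f w] w by simp
      have "dP n (\<delta> (Suc n) w - h (dP n w)) = 0"
        using d_diff[OF \<delta>in[OF w] lmod_homD(1)[OF h din[OF w]] i] \<delta>(3)[OF w] eq[OF w] by simp
      from ex[OF i this] show "(\<lambda>w \<in> carrier (PP (Suc n)). \<delta> (Suc n) w - (\<lambda>w \<in> carrier (PP (Suc n)). h (dP n w)) w) w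
          \<in> dP (Suc n) ` carrier (PP (Suc (Suc n)))"
        using w by simp
    qed
    then show ?thesis by simp
  qed
  have next_eq: "dP (Suc n) (h' (dP (Suc n) w)) = \<delta> (Suc n) (dP (Suc n) w)"
    if h: "h \<in> lmod_hom R (PP n) (PP (Suc n))" and h': "\<And>w. w \<in> carrier (PP (Suc n)) \<Longrightarrow> dP (Suc n) (h' w) = \<delta> (Suc n) w - h (dP n w)"
      and w: "w \<in> carrier (PP (Suc (Suc n)))" for n h h' w
    using h'[OF din[OF w]] dz[OF w] lmod_hom_zero[OF lm lm h] by simp
  obtain h1 where h1: "h1 \<in> lmod_hom R (PP (Suc 0)) (PP (Suc (Suc 0)))"
    "\<And>w. w \<in> carrier (PP (Suc 0)) \<Longrightarrow> dP (Suc 0) (h1 w) = \<delta> (Suc 0) w - h0 (dP 0 w)"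
    using step[OF h0(1) h0(2)[OF din]] by blast
  obtain h2 where h2: "h2 \<in> lmod_hom R (PP (Suc (Suc 0))) (PP (Suc (Suc (Suc 0))))"
    "\<And>w. w \<in> carrier (PP (Suc (Suc 0))) \<Longrightarrow> dP (Suc (Suc 0)) (h2 w) = \<delta> (Suc (Suc 0)) w - h1 (dP (Suc 0) w)"
    using step[OF h1(1) next_eq[OF h0(1) h1(2)]] by blast
  have "\<delta> 3 w = h2 (dP 2 w)" if w: "w \<in> carrier (PP 3)" for w
  proof (rule dP_inj)
    have w': "w \<in> carrier (PP (Suc (Suc (Suc 0))))" using w by (simp only: numeral_3_eq_3)
    show "\<delta> 3 w \<in> carrier (PP 3)" by (rule \<delta>in[OF w])
    show "h2 (dP 2 w) \<in> carrier (PP 3)"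
      using lmod_homD(1)[OF h2(1) din[OF w']] by (simp only: numeral_3_eq_3 numeral_2_eq_2)
    show "dP 2 (\<delta> 3 w) = dP 2 (h2 (dP 2 w))"
      using \<delta>(3)[OF w'] next_eq[OF h1(1) h2(2) w'] by (simp only: numeral_3_eq_3 numeral_2_eq_2)
  qed
  then show ?thesis using h2(1) by (intro bexI[of _ h2]) (simp_all only: numeral_3_eq_3 numeral_2_eq_2, blast)
qed

end

context PBW begin

text \<open>
  The relations hold for zero operators, and they make the field the trivial module.
\<close>

lemma trivial_PBW_mod: "PBW_mod R \<phi> p q gx gy gz \<kappa> (*) ((*) 0) ((*) 0) ((*) 0) (UNIV :: 'k set)"
proof -
  interpret qmod "(*) :: 'k \<Rightarrow> 'k \<Rightarrow> 'k" p q "(*) 0" "(*) 0" "(*) 0" UNIV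
    by unfold_locales simp_all
  show ?thesis by unfold_locales
qed

interpretation T: PBW_mod R \<phi> p q gx gy gz \<kappa> "(*)" "(*) 0" "(*) 0" "(*) 0" "UNIV :: 'k set"
  by (rule trivial_PBW_mod)

text \<open>
  On the trivial module the entries of the last differential are multiples of \<open>z\<close>, \<open>y\<close>, \<open>x\<close>.
  Therefore a composition \<open>h \<circ> d\<close> has values without constant term.
\<close>

lemma no_retraction:
  assumes h: "h \<in> lmod_hom R (T.PP 2) (T.PP 3)"
  shows "\<exists>w \<in> carrier (T.PP 3). h (T.dP 2 w) \<noteq> - w"
proof -
  let ?s = "\<lambda>c. single3 0 0 0 c :: 'k pbw"
  let ?w = "mk3 (?s 1) 0 0"
  let ?A = "mk3 (?s 1) 0 0" and ?B = "mk3 0 (?s (- p)) 0" and ?C = "mk3 0 0 (?s (q * inverse p))"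
  have s: "?s c \<in> Fin UNIV" for c by (rule K.single3_Fin) (rule UNIV_I)+
  have w: "?w \<in> carrier (T.PP 3)" using T.mk3_Fin(2)[OF s] by (simp only: T.PP_simps rk_simps)
  have z: "(0 :: 'k pbw) \<in> Fin UNIV" by (rule K.Fin_closed(1)[OF K.subspace_UNIV])
  have ABC: "?A \<in> carrier (T.PP 2)" "?B \<in> carrier (T.PP 2)" "?C \<in> carrier (T.PP 2)"
    unfolding T.PP_simps rk_simps by (rule T.mk3_Fin(1); rule s z)+
  have lift0: "lift ((*) 0) f = (0 :: 'k pbw)" for f :: "'k pbw" by (simp add: lift_def fun_eq_iff)
  have ABC': "opz (sc4 (*)) p ?A \<in> carrier (T.PP 2)" "opy (sc4 (*)) p q ?B \<in> carrier (T.PP 2)" "opx ?C \<in> carrier (T.PP 2)"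
    using left_module_carrier(3)[OF T.left_module_PP _ ABC(1), of gz] left_module_carrier(3)[OF T.left_module_PP _ ABC(2), of gy]
      left_module_carrier(3)[OF T.left_module_PP _ ABC(3), of gx] by (simp_all del: T.PP_simps)
  have "T.dP 2 ?w = mk3 (T.D2a (?s 1)) (T.D2b (?s 1)) (T.D2c (?s 1))"
    using w by (simp add: T.dP_def T.dd_def Let_def numeral_3_eq_3 numeral_2_eq_2)
  also have "\<dots> = opz (sc4 (*)) p ?A + (opy (sc4 (*)) p q ?B + opx ?C)"
    by (simp add: T.mk3_op K.op_single K.op_zero T.mk3_add[symmetric] T.D2a_def T.D2b_def T.D2c_def lift0)
       (auto simp: single3_def lift_def mk3_def fun_eq_iff)
  finally have "h (T.dP 2 ?w) = opz (sc4 (*)) p (h ?A) + (opy (sc4 (*)) p q (h ?B) + opx (h ?C))"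
    using lmod_homD(2)[OF h, of "opz (sc4 (*)) p ?A" "opy (sc4 (*)) p q ?B + opx ?C"]
      lmod_homD(2)[OF h, of "opy (sc4 (*)) p q ?B" "opx ?C"] left_module_carrier(2)[OF T.left_module_PP ABC'(2,3)]
      lmod_homD(3)[OF h _ ABC(1), of gz] lmod_homD(3)[OF h _ ABC(2), of gy] lmod_homD(3)[OF h _ ABC(3), of gx] ABC'
    by (simp del: T.PP_simps(1))
  then have "h (T.dP 2 ?w) 0 0 0 0 = 0"
    by (simp add: opx_def opy_def opz_def)
  moreover have "(- ?w) 0 0 0 0 = - 1" by (simp add: mk3_def single3_def)
  ultimately have "h (T.dP 2 ?w) \<noteq> - ?w" by (metis neg_equal_0_iff_equal zero_neq_one)
  then show ?thesis using w by blast
qed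

text \<open>
  Given a resolution \<open>Q\<close> of length less than \<open>3\<close>, the comparison theorem yields chain maps to \<open>Q\<close>
  and back, whose composition vanishes in degree \<open>3\<close>. Its difference from the identity covers the
  zero map, and so the negative of the identity would factor through the last differential.
\<close>

lemma trivial_proj_dim_ge_3:
  fixes \<iota> :: "(nat \<Rightarrow> 'k) pbw \<Rightarrow> 'u" and j :: "'k \<Rightarrow> 'u"
  assumes \<iota>: "inj_on \<iota> (Fin (SS UNIV 3))" and j: "inj j"
  defines "M \<equiv> transported j (inv_into UNIV j) T.TM"
  shows "left_module R M" "proj_dim TYPE('u) R M \<ge> 3"
proof -
  interpret J: transport R T.TM j "inv_into UNIV j"
    by (intro transport.intro transport_axioms.intro T.left_module_TM) (simp add: j)
  show M: "left_module R M" unfolding M_def by (rule J.left_module_T)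
  have False if Q: "projective_resolution R M Q d e" and z: "\<forall>i > n. carrier (Q i) = {\<zero>\<^bsub>Q i\<^esub>}" and n: "n < 3"
    for Q :: "nat \<Rightarrow> ('a, 'u) module" and d e n
  proof -
    note Q' = Q[unfolded projective_resolution_def]
    have Qm: "left_module R (Q n)" for n using Q' by (auto simp: projective_def)
    have Ql: "lifting TYPE('u) R (Q n)" for n using Q' by (auto simp: projective_def lifting_def)
    have dQ: "d n \<in> lmod_hom R (Q (Suc n)) (Q n)" for n using Q' by blast
    have eQ: "e \<in> lmod_hom R (Q 0) M" "e ` carrier (Q 0) = carrier M" using Q' by blast+
    have Q0: "d 0 ` carrier (Q 1) = {x \<in> carrier (Q 0). e x = \<zero>\<^bsub>M\<^esub>}" using Q' by blast
    have Qn: "d (Suc n) ` carrier (Q (Suc (Suc n))) = {x \<in> carrier (Q (Suc n)). d n x = \<zero>\<^bsub>Q n\<^esub>}" for n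
      using Q' by blast
    define eM where "eM = (\<lambda>w \<in> carrier (T.PP 0). restrict j (carrier T.TM) (T.eP w))"
    have eM: "eM \<in> lmod_hom R (T.PP 0) M"
      unfolding eM_def M_def by (rule lmod_hom_comp[OF T.left_module_PP T.eP_hom J.to_T])
    have eM_eq: "eM w = j (T.eP w)" if "w \<in> carrier (T.PP 0)" for w
      using that by (simp add: eM_def)
    have zM: "\<zero>\<^bsub>M\<^esub> = j 0" by (simp add: M_def)
    have eM0: "eM w = \<zero>\<^bsub>M\<^esub> \<longleftrightarrow> T.eP w = 0" if "w \<in> carrier (T.PP 0)" for w
      using that j by (simp add: eM_eq zM inj_eq)
    have eM_surj: "eM ` carrier (T.PP 0) = carrier M"
    proof -
      have "eM ` carrier (T.PP 0) = j ` (T.eP ` carrier (T.PP 0))" by (auto simp: eM_eq image_image)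
      then show ?thesis unfolding T.eP_surj by (simp add: M_def)
    qed
    have injP: "inj_on \<iota> (carrier (T.PP n))" for n by (rule inj_on_subset[OF \<iota> T.PP_subset])
    have din: "T.dP n w \<in> carrier (T.PP n)" if "w \<in> carrier (T.PP (Suc n))" for n w by (rule lmod_homD(1)[OF T.dP_hom that])
    have injM: "inj_on (\<lambda>u. u) (carrier M)" "inj_on (\<lambda>u. u) (carrier (Q n))" for n by simp_all
    obtain \<alpha> where \<alpha>: "\<forall>n. \<alpha> n \<in> lmod_hom R (T.PP n) (Q n)" "\<forall>x \<in> carrier (T.PP 0). e (\<alpha> 0 x) = eM x"
      "\<forall>n. \<forall>x \<in> carrier (T.PP (Suc n)). d n (\<alpha> (Suc n) x) = \<alpha> n (T.dP n x)"
    proof -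
      have "\<exists>\<phi>. (\<forall>n. \<phi> n \<in> lmod_hom R (T.PP n) (Q n)) \<and> (\<forall>x \<in> carrier (T.PP 0). e (\<phi> 0 x) = eM x) \<and>
          (\<forall>n. \<forall>x \<in> carrier (T.PP (Suc n)). d n (\<phi> (Suc n) x) = \<phi> n (T.dP n x))"
      proof (rule comparison[OF T.left_module_PP T.lifting_PP T.dP_hom eM _ _ Qm injM(2) dQ eQ _ _ M injM(1)])
        show "eM (T.dP 0 x) = \<zero>\<^bsub>M\<^esub>" if "x \<in> carrier (T.PP 1)" for x
        proof -
          have "T.dP 0 x \<in> {w \<in> carrier (T.PP 0). T.eP w = 0}" using T.dP_exact0 that by blast
          then show ?thesis using eM0 by blast
        qed
        show "T.dP n (T.dP (Suc n) x) = \<zero>\<^bsub>T.PP n\<^esub>" if "x \<in> carrier (T.PP (Suc (Suc n)))" for n x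
          using T.dP_exact[of n] that by blast
        show "y \<in> d 0 ` carrier (Q 1)" if "y \<in> carrier (Q 0)" "e y = \<zero>\<^bsub>M\<^esub>" for y
          using Q0 that by blast
        show "y \<in> d (Suc n) ` carrier (Q (Suc (Suc n)))" if "y \<in> carrier (Q (Suc n))" "d n y = \<zero>\<^bsub>Q n\<^esub>" for n y
          using Qn[of n] that by blast
      qed
      then show thesis using that by (elim exE conjE)
    qed
    obtain \<beta> where \<beta>: "\<forall>n. \<beta> n \<in> lmod_hom R (Q n) (T.PP n)" "\<forall>x \<in> carrier (Q 0). eM (\<beta> 0 x) = e x"
      "\<forall>n. \<forall>x \<in> carrier (Q (Suc n)). T.dP n (\<beta> (Suc n) x) = \<beta> n (d n x)"
    proof -
      have "\<exists>\<phi>. (\<forall>n. \<phi> n \<in> lmod_hom R (Q n) (T.PP n)) \<and> (\<forall>x \<in> carrier (Q 0). eM (\<phi> 0 x) = e x) \<and>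
          (\<forall>n. \<forall>x \<in> carrier (Q (Suc n)). T.dP n (\<phi> (Suc n) x) = \<phi> n (d n x))"
      proof (rule comparison[OF Qm Ql dQ eQ(1) _ _ T.left_module_PP injP T.dP_hom eM eM_surj _ _ M injM(1)])
        show "e (d 0 x) = \<zero>\<^bsub>M\<^esub>" if "x \<in> carrier (Q 1)" for x
          using Q0 that by blast
        show "d n (d (Suc n) x) = \<zero>\<^bsub>Q n\<^esub>" if "x \<in> carrier (Q (Suc (Suc n)))" for n x
          using Qn[of n] that by blast
        show "y \<in> T.dP 0 ` carrier (T.PP 1)" if "y \<in> carrier (T.PP 0)" "eM y = \<zero>\<^bsub>M\<^esub>" for y
          using T.dP_exact0 eM0 that by blast
        show "y \<in> T.dP (Suc n) ` carrier (T.PP (Suc (Suc n)))" if "y \<in> carrier (T.PP (Suc n))" "T.dP n y = \<zero>\<^bsub>T.PP n\<^esub>" for n y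
          using T.dP_exact[of n] that by blast
      qed
      then show thesis using that by (elim exE conjE)
    qed
    have \<alpha>in: "\<alpha> n x \<in> carrier (Q n)" if "x \<in> carrier (T.PP n)" for n x by (rule lmod_homD(1)[OF spec[OF \<alpha>(1)] that])
    have \<beta>in: "\<beta> n x \<in> carrier (T.PP n)" if "x \<in> carrier (Q n)" for n x by (rule lmod_homD(1)[OF spec[OF \<beta>(1)] that])
    define c where "c = (\<lambda>n. \<lambda>w \<in> carrier (T.PP n). \<beta> n (\<alpha> n w))"
    have c: "c n \<in> lmod_hom R (T.PP n) (T.PP n)" for n
      unfolding c_def by (rule lmod_hom_comp[OF T.left_module_PP spec[OF \<alpha>(1)] spec[OF \<beta>(1)]])
    define \<delta> where "\<delta> = (\<lambda>n. \<lambda>w \<in> carrier (T.PP n). c n w - restrict (\<lambda>w. w) (carrier (T.PP n)) w)"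
    have \<delta>: "\<delta> n \<in> lmod_hom R (T.PP n) (T.PP n)" for n
      unfolding \<delta>_def by (rule T.hom_diff_PP[OF T.left_module_PP c T.id_hom_PP])
    have \<delta>_eq: "\<delta> n w = \<beta> n (\<alpha> n w) - w" if "w \<in> carrier (T.PP n)" for n w
      using that by (simp add: \<delta>_def c_def)
    have \<delta>in: "\<beta> n (\<alpha> n w) - w \<in> carrier (T.PP n)" if "w \<in> carrier (T.PP n)" for n w
      using lmod_homD(1)[OF \<delta> that] \<delta>_eq[OF that] by simp
    have "\<exists>h \<in> lmod_hom R (T.PP 2) (T.PP 3). \<forall>w \<in> carrier (T.PP 3). \<delta> 3 w = h (T.dP 2 w)"
    proof (rule T.last_factorization[OF \<iota> \<delta>])
      fix w assume w: "w \<in> carrier (T.PP 0)"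
      have "eM (\<beta> 0 (\<alpha> 0 w)) = eM w" using \<alpha>(2) \<beta>(2) \<alpha>in[OF w] w by simp
      then have "T.eP (\<beta> 0 (\<alpha> 0 w)) = T.eP w"
        using j w \<beta>in[OF \<alpha>in[OF w]] by (simp add: eM_eq inj_eq del: T.PP_simps)
      then show "T.eP (\<delta> 0 w) = 0"
        using lmod_homD(2)[OF T.eP_hom \<delta>in[OF w] w] by (simp add: \<delta>_eq[OF w])
    next
      fix n w assume w: "w \<in> carrier (T.PP (Suc n))"
      have "T.dP n (\<beta> (Suc n) (\<alpha> (Suc n) w)) = \<beta> n (\<alpha> n (T.dP n w))"
        using \<alpha>(3) \<beta>(3) \<alpha>in[OF w] w by simp
      then show "T.dP n (\<delta> (Suc n) w) = \<delta> n (T.dP n w)"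
        using lmod_homD(2)[OF T.dP_hom \<delta>in[OF w] w] by (simp add: \<delta>_eq[OF w] \<delta>_eq[OF din[OF w]] algebra_simps)
    qed
    then obtain h where h: "h \<in> lmod_hom R (T.PP 2) (T.PP 3)" "\<And>w. w \<in> carrier (T.PP 3) \<Longrightarrow> \<delta> 3 w = h (T.dP 2 w)"
      by blast
    obtain w where w: "w \<in> carrier (T.PP 3)" "h (T.dP 2 w) \<noteq> - w" using no_retraction[OF h(1)] by blast
    have "\<alpha> 3 w = \<zero>\<^bsub>Q 3\<^esub>" using \<alpha>in[OF w(1)] z n by simp
    then have "\<beta> 3 (\<alpha> 3 w) = 0"
      using lmod_hom_zero[OF Qm T.left_module_PP spec[OF \<beta>(1)], of 3] by simp
    then show False using h(2)[OF w(1)] w(2) by (simp add: \<delta>_eq[OF w(1)])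
  qed
  then show "proj_dim TYPE('u) R M \<ge> 3"
    unfolding proj_dim_def by (intro Inf_greatest) (auto simp: numeral_eq_enat not_less[symmetric])
qed

end

lemma inj_free_universe:
  fixes j :: "'k::zero \<Rightarrow> 'u"
  assumes inf: "infinite (UNIV :: 'u set)" and j: "inj j"
  obtains \<iota> :: "(nat \<Rightarrow> 'u \<Rightarrow>\<^sub>0 'k) pbw \<Rightarrow> 'u" where "inj_on \<iota> (Fin (SS UNIV 3))"
proof -
  obtain \<iota> :: "(nat \<Rightarrow> 'u \<Rightarrow>\<^sub>0 'k) pbw \<Rightarrow> 'u" where
    \<iota>: "inj_on \<iota> {w. finite {(a, b, c, t, u). Poly_Mapping.lookup (w a b c t) u \<noteq> 0}}"
    using finite_support_inj[OF inf j] by blast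
  have fs: "finite {(a, b, c, t, u). Poly_Mapping.lookup (w a b c t) u \<noteq> 0}"
    if w: "w \<in> Fin (SS UNIV 3)" for w :: "(nat \<Rightarrow> 'u \<Rightarrow>\<^sub>0 'k) pbw"
  proof -
    obtain N where N: "\<And>i j k. w i j k \<in> SS UNIV 3" "\<And>i j k. N \<le> i + j + k \<Longrightarrow> w i j k = 0"
      using FinE[OF w] by metis
    have "{(a, b, c, t, u). Poly_Mapping.lookup (w a b c t) u \<noteq> 0} \<subseteq>
      (\<Union>a<N. \<Union>b<N. \<Union>c<N. \<Union>t<3. (\<lambda>u. (a, b, c, t, u)) ` Poly_Mapping.keys (w a b c t))"
    proof clarify
      fix a b c t u assume nz: "Poly_Mapping.lookup (w a b c t) u \<noteq> 0"
      then have "\<not> N \<le> a + b + c" using N(2)[of a b c] by auto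
      moreover have "t < 3"
      proof (rule ccontr)
        assume "\<not> t < 3"
        then have "w a b c t = 0" using N(1)[of a b c] by (simp add: SS_def)
        then show False using nz by simp
      qed
      ultimately have "a < N" "b < N" "c < N" "t < 3" "u \<in> Poly_Mapping.keys (w a b c t)"
        using nz by (auto simp: in_keys_iff)
      then show "(a, b, c, t, u) \<in> (\<Union>a<N. \<Union>b<N. \<Union>c<N. \<Union>t<3. (\<lambda>u. (a, b, c, t, u)) ` Poly_Mapping.keys (w a b c t))"
        by blast
    qed
    then show ?thesis by (rule finite_subset) simp
  qed
  have "inj_on \<iota> (Fin (SS UNIV 3))" by (rule inj_on_subset[OF \<iota>]) (use fs in blast)
  then show thesis by (rule that)
qed

lemma inj_free_field:
  fixes j :: "'k::zero \<Rightarrow> 'u"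
  assumes inf: "infinite (UNIV :: 'u set)" and j: "inj j"
  obtains \<iota> :: "(nat \<Rightarrow> 'k) pbw \<Rightarrow> 'u" where "inj_on \<iota> (Fin (SS UNIV 3))"
proof -
  obtain \<iota> :: "(nat \<Rightarrow> 'u \<Rightarrow>\<^sub>0 'k) pbw \<Rightarrow> 'u" where \<iota>: "inj_on \<iota> (Fin (SS UNIV 3))"
    by (rule inj_free_universe[OF inf j])
  obtain u0 :: 'u where True by simp
  \<comment> \<open>the field embeds into formal linear combinations by means of a single basis element\<close>
  define sg where "sg = (\<lambda>w :: (nat \<Rightarrow> 'k) pbw. \<lambda>a b c t. Poly_Mapping.single u0 (w a b c t))"
  have sg: "w = w'" if "sg w = sg w'" for w w'
  proof (intro ext)
    fix a b c t
    have "Poly_Mapping.lookup (sg w a b c t) u0 = Poly_Mapping.lookup (sg w' a b c t) u0" using that by simp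
    then show "w a b c t = w' a b c t" by (simp add: sg_def)
  qed
  have sgF: "sg w \<in> Fin (SS UNIV 3)" if w: "w \<in> Fin (SS UNIV 3)" for w
  proof -
    obtain N where N: "\<And>i j k. w i j k \<in> SS UNIV 3" "\<And>i j k. N \<le> i + j + k \<Longrightarrow> w i j k = 0"
      using FinE[OF w] by metis
    show ?thesis
      by (rule FinI[of _ _ N]) (use N in \<open>auto simp: sg_def SS_def fun_eq_iff\<close>)
  qed
  have "inj_on (\<iota> \<circ> sg) (Fin (SS UNIV 3))"
  proof (rule comp_inj_on)
    show "inj_on sg (Fin (SS UNIV 3))" by (rule inj_onI) (rule sg)
    show "inj_on \<iota> (sg ` Fin (SS UNIV 3))" by (rule inj_on_subset[OF \<iota>]) (use sgF in blast)
  qed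
  then show thesis by (rule that)
qed

text \<open>
  The bound by \<open>3\<close> holds because every module is an invariant subspace for some operators and has
  the resolution of length \<open>3\<close> constructed above; the trivial module attains it.
\<close>

theorem (in PBW) left_gl_dim_eq_3:
  fixes j :: "'k \<Rightarrow> 'u"
  assumes inf: "infinite (UNIV :: 'u set)" and j: "inj j"
  shows "left_gl_dim TYPE('u) R = 3"
proof -
  obtain \<iota>1 :: "(nat \<Rightarrow> 'u \<Rightarrow>\<^sub>0 'k) pbw \<Rightarrow> 'u" where \<iota>1: "inj_on \<iota>1 (Fin (SS UNIV 3))"
    by (rule inj_free_universe[OF inf j])
  obtain \<iota>2 :: "(nat \<Rightarrow> 'k) pbw \<Rightarrow> 'u" where \<iota>2: "inj_on \<iota>2 (Fin (SS UNIV 3))"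
    by (rule inj_free_field[OF inf j])
  have le: "proj_dim TYPE('u) R M \<le> 3" if M: "left_module R M" for M :: "('a, 'u) module"
  proof -
    interpret M: left_module R M by (rule M)
    obtain s :: "'u \<Rightarrow> 'u \<Rightarrow>\<^sub>0 'k" and ax ay az S where s: "qmod psc p q ax ay az S" "bij_betw s (carrier M) S"
      "\<And>m n. m \<in> carrier M \<Longrightarrow> n \<in> carrier M \<Longrightarrow> s (m \<oplus>\<^bsub>M\<^esub> n) = s m + s n"
      "\<And>m. m \<in> carrier M \<Longrightarrow> s (gx \<odot>\<^bsub>M\<^esub> m) = ax (s m)"
      "\<And>m. m \<in> carrier M \<Longrightarrow> s (gy \<odot>\<^bsub>M\<^esub> m) = ay (s m)"
      "\<And>m. m \<in> carrier M \<Longrightarrow> s (gz \<odot>\<^bsub>M\<^esub> m) = az (s m)"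
      "\<And>m c. m \<in> carrier M \<Longrightarrow> s (\<kappa> c \<odot>\<^bsub>M\<^esub> m) = psc c (s m)"
      by (rule module_as_operators[OF M]) (rule that)
    interpret Q: qmod psc p q ax ay az S by (rule s(1))
    interpret Q: PBW_mod R \<phi> p q gx gy gz \<kappa> psc ax ay az S by unfold_locales
    define r where "r = inv_into (carrier M) s"
    have r: "r u \<in> carrier M" "s (r u) = u" if "u \<in> S" for u
      using s(2) that by (auto simp: r_def bij_betw_def intro: inv_into_into f_inv_into_f)
    have rs: "r (s m) = m" if "m \<in> carrier M" for m
      using s(2) that by (simp add: r_def bij_betw_def)
    have r_add: "r (u + v) = r u \<oplus>\<^bsub>M\<^esub> r v" if "u \<in> S" "v \<in> S" for u v
      using rs[of "r u \<oplus>\<^bsub>M\<^esub> r v"] that by (simp add: s(3) r)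
    have r_op: "r (ax u) = gx \<odot>\<^bsub>M\<^esub> r u" "r (ay u) = gy \<odot>\<^bsub>M\<^esub> r u" "r (az u) = gz \<odot>\<^bsub>M\<^esub> r u"
      "r (psc c u) = \<kappa> c \<odot>\<^bsub>M\<^esub> r u" if "u \<in> S" for u c
      using rs[of "gx \<odot>\<^bsub>M\<^esub> r u"] rs[of "gy \<odot>\<^bsub>M\<^esub> r u"] rs[of "gz \<odot>\<^bsub>M\<^esub> r u"] rs[of "\<kappa> c \<odot>\<^bsub>M\<^esub> r u"] that
      by (simp_all add: s r M.lsmult_closed)
    have "restrict r (carrier Q.TM) \<in> lmod_hom R Q.TM M"
      by (rule lmod_homI[OF Q.left_module_TM M]) (simp_all add: r r_add r_op Q.act_gens)
    moreover have "bij_betw (restrict r (carrier Q.TM)) S (carrier M)"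
      using bij_betw_inv_into[OF s(2)] by (simp add: r_def cong: bij_betw_cong)
    ultimately show ?thesis by (rule Q.proj_dim_le_3[OF \<iota>1 M])
  qed
  note low = trivial_proj_dim_ge_3[OF \<iota>2 j]
  show ?thesis
    unfolding left_gl_dim_def
  proof (rule antisym)
    show "Sup {proj_dim TYPE('u) R M | M :: ('a, 'u) module. left_module R M} \<le> 3"
      by (rule Sup_least) (use le in blast)
    show "3 \<le> Sup {proj_dim TYPE('u) R M | M :: ('a, 'u) module. left_module R M}"
      by (rule order_trans[OF low(2)], rule Sup_upper) (use low(1) in blast)
  qed
qed

section \<open>Gradings by the degree of the coefficients\<close>

text \<open>
  The elements of \<open>M\<close> are, through \<open>\<psi>\<close>, families of coefficients with finitely many nonzero entries.
  A degree function on the indices then grades \<open>M\<close>, provided that \<open>M\<close> is closed under truncation.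
\<close>

locale support_grading = abelian_group M
  for M :: "('b, 'r) ring_scheme" (structure) +
  fixes \<psi> :: "'b \<Rightarrow> 'c \<Rightarrow> 'v::ab_group_add" and deg :: "'c \<Rightarrow> 'i"
  assumes \<psi>_inj: "inj_on \<psi> (carrier M)"
    and \<psi>_add: "m \<in> carrier M \<Longrightarrow> n \<in> carrier M \<Longrightarrow> \<psi> (m \<oplus> n) = \<psi> m + \<psi> n"
    and \<psi>_finite: "m \<in> carrier M \<Longrightarrow> finite {c. \<psi> m c \<noteq> 0}"
    and \<psi>_trunc: "m \<in> carrier M \<Longrightarrow> \<exists>m' \<in> carrier M. \<psi> m' = (\<lambda>c. if deg c = i then \<psi> m c else 0)"
begin

definition D :: "'i \<Rightarrow> 'b set" where
  "D i = {m \<in> carrier M. \<forall>c. \<psi> m c \<noteq> 0 \<longrightarrow> deg c = i}"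

definition tr :: "'i \<Rightarrow> 'b \<Rightarrow> 'b" where
  "tr i m = (SOME m'. m' \<in> carrier M \<and> \<psi> m' = (\<lambda>c. if deg c = i then \<psi> m c else 0))"

lemma tr: "m \<in> carrier M \<Longrightarrow> tr i m \<in> carrier M"
  "m \<in> carrier M \<Longrightarrow> \<psi> (tr i m) = (\<lambda>c. if deg c = i then \<psi> m c else 0)"
  using someI_ex[of "\<lambda>m'. m' \<in> carrier M \<and> \<psi> m' = (\<lambda>c. if deg c = i then \<psi> m c else 0)"] \<psi>_trunc[of m i]
  unfolding tr_def by blast+

lemma \<psi>_zero: "\<psi> \<zero> = 0"
  using \<psi>_add[of \<zero> \<zero>] by simp

lemma \<psi>_neg: "m \<in> carrier M \<Longrightarrow> \<psi> (\<ominus> m) = - \<psi> m"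
  using \<psi>_add[of m "\<ominus> m"] by (simp add: r_neg \<psi>_zero eq_neg_iff_add_eq_0 add.commute)

lemma \<psi>_eq: "m \<in> carrier M \<Longrightarrow> n \<in> carrier M \<Longrightarrow> \<psi> m = \<psi> n \<Longrightarrow> m = n"
  using \<psi>_inj by (auto simp: inj_on_def)

lemma \<psi>_finsum: "finite A \<Longrightarrow> f \<in> A \<rightarrow> carrier M \<Longrightarrow> \<psi> (finsum M f A) c = (\<Sum>i\<in>A. \<psi> (f i) c)"
proof (induction A rule: finite_induct)
  case empty
  then show ?case by (simp add: \<psi>_zero)
next
  case (insert i A)
  then have "f \<in> A \<rightarrow> carrier M" "f i \<in> carrier M" by auto
  then show ?case using insert by (simp add: finsum_insert \<psi>_add)
qed

lemma D_subset: "D i \<subseteq> carrier M" by (auto simp: D_def)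

lemma D_additive_subgroup: "additive_subgroup (D i) M"
proof (rule additive_subgroupI, rule subgroup.intro)
  show "D i \<subseteq> carrier (add_monoid M)" by (simp add: D_subset)
  show "\<one>\<^bsub>add_monoid M\<^esub> \<in> D i" by (simp add: D_def \<psi>_zero)
  show "inv\<^bsub>add_monoid M\<^esub> m \<in> D i" if "m \<in> D i" for m
    using that by (simp add: D_def \<psi>_neg a_inv_def[symmetric])
  show "m \<otimes>\<^bsub>add_monoid M\<^esub> n \<in> D i" if mn: "m \<in> D i" "n \<in> D i" for m n
  proof -
    have "deg c = i" if "\<psi> m c + \<psi> n c \<noteq> 0" for c
    proof -
      have "\<psi> m c \<noteq> 0 \<or> \<psi> n c \<noteq> 0" using that by auto
      then show ?thesis using mn by (auto simp: D_def)
    qed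
    then show ?thesis using mn by (simp add: D_def \<psi>_add)
  qed
qed

lemma tr_decomposition:
  assumes m: "m \<in> carrier M"
  shows "is_decomposition M D m (\<lambda>i. tr i m)"
proof -
  have nz: "{i. tr i m \<noteq> \<zero>} \<subseteq> deg ` {c. \<psi> m c \<noteq> 0}"
  proof
    fix i assume i: "i \<in> {i. tr i m \<noteq> \<zero>}"
    show "i \<in> deg ` {c. \<psi> m c \<noteq> 0}"
    proof (rule ccontr)
      assume "i \<notin> deg ` {c. \<psi> m c \<noteq> 0}"
      then have "\<psi> (tr i m) = \<psi> \<zero>" using m by (auto simp: tr \<psi>_zero fun_eq_iff)
      then show False using \<psi>_eq[OF tr(1)[OF m] zero_closed] i by simp
    qed
  qed
  have fin: "finite {i. tr i m \<noteq> \<zero>}" by (rule finite_subset[OF nz]) (use \<psi>_finite[OF m] in simp)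
  have "m = finsum M (\<lambda>i. tr i m) {i. tr i m \<noteq> \<zero>}"
  proof (rule \<psi>_eq[OF m])
    show "finsum M (\<lambda>i. tr i m) {i. tr i m \<noteq> \<zero>} \<in> carrier M" by (rule finsum_closed) (auto simp: tr m)
    show "\<psi> m = \<psi> (finsum M (\<lambda>i. tr i m) {i. tr i m \<noteq> \<zero>})"
    proof
      fix c
      have "\<psi> (finsum M (\<lambda>i. tr i m) {i. tr i m \<noteq> \<zero>}) c = (\<Sum>i\<in>{i. tr i m \<noteq> \<zero>}. if deg c = i then \<psi> m c else 0)"
        by (subst \<psi>_finsum[OF fin]) (auto simp: tr m)
      also have "\<dots> = (if tr (deg c) m \<noteq> \<zero> then \<psi> m c else 0)" using fin by simp
      also have "\<dots> = \<psi> m c"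
      proof -
        have "\<psi> m c = \<psi> (tr (deg c) m) c" by (simp add: tr m)
        then show ?thesis by (auto simp: \<psi>_zero)
      qed
      finally show "\<psi> m c = \<psi> (finsum M (\<lambda>i. tr i m) {i. tr i m \<noteq> \<zero>}) c" by simp
    qed
  qed
  then show ?thesis
    unfolding is_decomposition_def using fin m by (auto simp: D_def tr)
qed

lemma decomposition_unique:
  assumes m: "m \<in> carrier M" and f: "is_decomposition M D m f"
  shows "f = (\<lambda>i. tr i m)"
proof
  fix i
  have f': "\<And>i. f i \<in> D i" "finite {i. f i \<noteq> \<zero>}" "m = finsum M f {i. f i \<noteq> \<zero>}"
    using f by (auto simp: is_decomposition_def)
  have fc: "f i \<in> carrier M" for i using f'(1)[of i] by (simp add: D_def)
  show "f i = tr i m"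
  proof (rule \<psi>_eq[OF fc tr(1)[OF m]], rule ext)
    fix c
    have z: "\<psi> (f i) c = 0" if "deg c \<noteq> i" for i using f'(1)[of i] that by (auto simp: D_def)
    have "\<psi> m c = (\<Sum>i\<in>{i. f i \<noteq> \<zero>}. \<psi> (f i) c)"
      using \<psi>_finsum[OF f'(2), of f c] fc f'(3) by (metis Pi_I)
    also have "\<dots> = (\<Sum>i\<in>{i. f i \<noteq> \<zero>}. if i = deg c then \<psi> (f (deg c)) c else 0)"
      by (rule sum.cong) (auto simp: z)
    also have "\<dots> = \<psi> (f (deg c)) c"
      using f'(2) by (auto simp: \<psi>_zero)
    finally show "\<psi> (f i) c = \<psi> (tr i m) c" using z[of i] by (auto simp: tr m)
  qed
qed

lemma direct_sum: "is_direct_sum M D"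
  unfolding is_direct_sum_def
  using D_additive_subgroup tr_decomposition decomposition_unique by blast

lemma component_eq: "m \<in> carrier M \<Longrightarrow> component M D m = (\<lambda>i. tr i m)"
  unfolding component_def using tr_decomposition decomposition_unique by (intro the_equality)

end

context PBW begin

definition weight :: "nat \<times> nat \<times> nat \<Rightarrow> nat" where "weight = (\<lambda>(i, j, k). i + 2 * j + k)"

text \<open>
  The monomial \<open>x\<^sup>i z\<^sup>j y\<^sup>k\<close> has degree \<open>i + 2 j + k\<close>.
\<close>

definition Gr :: "nat \<Rightarrow> 'a set" where
  "Gr n = {a \<in> carrier R. \<forall>i j k. \<phi> a i j k \<noteq> 0 \<longrightarrow> i + 2 * j + k = n}"

lemma Fin_finite_support: "f \<in> Fin S \<Longrightarrow> finite {(i, j, k). f i j k \<noteq> 0}"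
proof -
  assume f: "f \<in> Fin S"
  obtain N where N: "\<And>i j k. f i j k \<in> S" "\<And>i j k. N \<le> i + j + k \<Longrightarrow> f i j k = 0"
    using FinE[OF f] by metis
  have "{(i, j, k). f i j k \<noteq> 0} \<subseteq> {..<N} \<times> {..<N} \<times> {..<N}"
  proof clarsimp
    fix i j k assume "f i j k \<noteq> 0"
    then have "\<not> N \<le> i + j + k" using N(2) by blast
    then show "i < N \<and> j < N \<and> k < N" by simp
  qed
  then show ?thesis by (rule finite_subset) simp
qed

lemma support_grading_R: "support_grading R (\<lambda>a (i, j, k). \<phi> a i j k) weight"
proof (unfold_locales, goal_cases)
  case 1
  show ?case
  proof (rule inj_onI)
    fix a b assume ab: "a \<in> carrier R" "b \<in> carrier R" and "(\<lambda>(i, j, k). \<phi> a i j k) = (\<lambda>(i, j, k). \<phi> b i j k)"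
    then have "\<phi> a i j k = \<phi> b i j k" for i j k by (metis old.prod.case)
    then have "\<phi> a = \<phi> b" by (simp add: fun_eq_iff)
    then show "a = b" using \<phi>_inj[OF ab] by simp
  qed
next
  case (2 a b) then show ?case by (auto simp: \<phi>_add)
next
  case (3 a)
  have "{c. (case c of (i, j, k) \<Rightarrow> \<phi> a i j k) \<noteq> 0} = {(i, j, k). \<phi> a i j k \<noteq> 0}" by auto
  then show ?case using Fin_finite_support[OF \<phi>_Fin[OF 3]] by simp
next
  case (4 a n)
  let ?f = "\<lambda>i j k. if i + 2 * j + k = n then \<phi> a i j k else 0"
  have "?f \<in> Fin UNIV" using \<phi>_Fin[OF 4] unfolding Fin_def by auto
  then show ?case
    by (intro bexI[of _ "\<psi> ?f"]) (auto simp: \<psi> weight_def fun_eq_iff)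
qed

sublocale G: support_grading R "\<lambda>a (i, j, k). \<phi> a i j k" weight
  by (rule support_grading_R)

lemma GD_eq: "G.D = Gr"
  by (rule ext) (auto simp add: G.D_def Gr_def, auto simp: weight_def)

lemma Gr_direct_sum: "is_direct_sum R Gr"
  using G.direct_sum unfolding GD_eq .

lemma \<phi>_component:
  assumes "a \<in> carrier R"
  shows "component R Gr a n \<in> carrier R" "\<phi> (component R Gr a n) = (\<lambda>i j k. if i + 2 * j + k = n then \<phi> a i j k else 0)"
proof -
  have e: "component R Gr a = (\<lambda>n. G.tr n a)" using G.component_eq[OF assms] unfolding GD_eq .
  show "component R Gr a n \<in> carrier R" unfolding e by (rule G.tr(1)[OF assms])
  have "(\<lambda>(i, j, k). \<phi> (G.tr n a) i j k) (i, j, k) = (if weight (i, j, k) = n then \<phi> a i j k else 0)" for i j k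
    unfolding G.tr(2)[OF assms] by simp
  then show "\<phi> (component R Gr a n) = (\<lambda>i j k. if i + 2 * j + k = n then \<phi> a i j k else 0)"
    unfolding e by (auto simp: fun_eq_iff weight_def)
qed

lemma Gr_0: "Gr 0 = range \<kappa>"
proof (intro equalityI subsetI)
  fix a assume a: "a \<in> Gr 0"
  then have "\<phi> a = \<phi> (\<kappa> (\<phi> a 0 0 0))" by (auto simp: \<phi>_gens single3_def Gr_def fun_eq_iff)
  then have "a = \<kappa> (\<phi> a 0 0 0)" using a \<phi>_inj[of a] by (simp add: Gr_def)
  then show "a \<in> range \<kappa>" by blast
qed (auto simp: Gr_def \<phi>_gens single3_def split: if_splits)

lemma component_0: "a \<in> carrier R \<Longrightarrow> component R Gr a 0 = \<kappa> (\<phi> a 0 0 0)"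
  using \<phi>_component[of a 0] by (subst \<phi>_inj[symmetric]) (auto simp: \<phi>_gens single3_def fun_eq_iff)

lemma subfield_\<kappa>: "subfield (range \<kappa>) R"
proof (rule R.subfieldI)
  have sr: "subring (range \<kappa>) R"
  proof (rule R.subringI)
    show "\<one> \<in> range \<kappa>" using \<kappa>_ring(3) by (metis rangeI)
    show "\<ominus> h \<in> range \<kappa>" if "h \<in> range \<kappa>" for h using that by (auto simp: \<kappa>_ring[symmetric])
  qed (auto simp: \<kappa>_ring[symmetric])
  show "subcring (range \<kappa>) R"
    by (rule R.subcringI[OF sr]) (auto intro: \<kappa>_central)
  show "Units (R\<lparr>carrier := range \<kappa>\<rparr>) = range \<kappa> - {\<zero>}"
  proof (intro equalityI subsetI)
    fix h assume "h \<in> Units (R\<lparr>carrier := range \<kappa>\<rparr>)"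
    then obtain c d where cd: "h = \<kappa> c" "\<kappa> d \<otimes> \<kappa> c = \<one>" by (auto simp: Units_def)
    then have "d * c = 1" by (simp add: \<kappa>_ring[symmetric] \<kappa>_inj)
    then have "c \<noteq> 0" by auto
    then show "h \<in> range \<kappa> - {\<zero>}" using cd(1) by (auto simp: \<kappa>_ring(4)[symmetric] \<kappa>_inj)
  next
    fix h assume "h \<in> range \<kappa> - {\<zero>}"
    then obtain c where c': "h = \<kappa> c" "\<kappa> c \<noteq> \<zero>" by blast
    have "c \<noteq> 0" using c'(2) \<kappa>_ring(4) by blast
    note c = c'(1) this
    then show "h \<in> Units (R\<lparr>carrier := range \<kappa>\<rparr>)"
      by (auto simp: Units_def \<kappa>_ring[symmetric] intro!: exI[of _ "inverse c"])
  qed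
qed

end

subsection \<open>Graded actions\<close>

text \<open>
  If the generators act with degrees \<open>1\<close>, \<open>1\<close>, \<open>2\<close> on a family of subspaces, then homogeneous
  elements act with their degree. This is seen on monomials.
\<close>

lemma (in PBW_mod) graded_act:
  fixes W :: "int \<Rightarrow> 'v set"
  assumes W0: "\<And>d. 0 \<in> W d" and Wadd: "\<And>d u v. u \<in> W d \<Longrightarrow> v \<in> W d \<Longrightarrow> u + v \<in> W d"
    and Wsc: "\<And>d c v. v \<in> W d \<Longrightarrow> c *s v \<in> W d"
    and Wx: "\<And>d v. v \<in> W d \<Longrightarrow> ax v \<in> W (d + 1)" and Wy: "\<And>d v. v \<in> W d \<Longrightarrow> ay v \<in> W (d + 1)"
    and Wz: "\<And>d v. v \<in> W d \<Longrightarrow> az v \<in> W (d + 2)"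
    and a: "a \<in> Gr n" and v: "v \<in> W d"
  shows "act a v \<in> W (int n + d)"
proof -
  have Wsum: "sum f A \<in> W e" if "\<And>i. i \<in> A \<Longrightarrow> f i \<in> W e" for f :: "nat \<Rightarrow> 'v" and A e
    using that by (induction A rule: infinite_finite_induct) (auto simp: W0 Wadd)
  have px: "(ax ^^ i) w \<in> W (e + int i)" if "w \<in> W e" for i w e
  proof (induction i)
    case (Suc i)
    from Wx[OF this] show ?case by (simp add: algebra_simps)
  qed (use that in simp)
  have py: "(ay ^^ i) w \<in> W (e + int i)" if "w \<in> W e" for i w e
  proof (induction i)
    case (Suc i)
    from Wy[OF this] show ?case by (simp add: algebra_simps)
  qed (use that in simp)
  have pz: "(az ^^ i) w \<in> W (e + 2 * int i)" if "w \<in> W e" for i w e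
  proof (induction i)
    case (Suc i)
    from Wz[OF this] show ?case by (simp add: algebra_simps)
  qed (use that in simp)
  let ?f = "tens (\<phi> a) v"
  have f: "?f i j k \<in> W d" for i j k by (simp add: tens_def Wsc v)
  have nz: "i + 2 * j + k = n" if "?f i j k \<noteq> 0" for i j k
    using a that by (auto simp: Gr_def tens_def)
  have 1: "ev1 ay (?f i j) \<in> W (int n + d - int i - 2 * int j)" for i j
    unfolding ev1_def
  proof (rule Wsum)
    fix k assume "k \<in> {k. ?f i j k \<noteq> 0}"
    then have "n = i + 2 * j + k" using nz by simp
    then have eq: "int n + d - int i - 2 * int j = d + int k" by simp
    show "(ay ^^ k) (?f i j k) \<in> W (int n + d - int i - 2 * int j)" unfolding eq by (rule py[OF f])
  qed
  have 2: "ev1 az (\<lambda>j. ev1 ay (?f i j)) \<in> W (int n + d - int i)" for i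
    unfolding ev1_def[of az]
  proof (rule Wsum)
    fix j
    show "(az ^^ j) (ev1 ay (?f i j)) \<in> W (int n + d - int i)" using pz[OF 1[of i j], of j] by simp
  qed
  show ?thesis
    unfolding act_def ev3_def ev1_def[of ax]
  proof (rule Wsum)
    fix i
    show "(ax ^^ i) (ev1 az (\<lambda>j. ev1 ay (?f i j))) \<in> W (int n + d)" using px[OF 2[of i], of i] by simp
  qed
qed

text \<open>
  Homogeneity with degrees in the integers, because the generators of the resolution and the
  elements of its dual have shifted degrees.
\<close>

definition homog :: "int \<Rightarrow> 'v::zero pbw \<Rightarrow> bool" where
  "homog d f \<longleftrightarrow> (\<forall>i j k. f i j k \<noteq> 0 \<longrightarrow> int (i + 2 * j + k) = d)"

lemma homog_zero: "homog d 0" by (simp add: homog_def)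

lemma homog_add: "homog d f \<Longrightarrow> homog d g \<Longrightarrow> homog d (f + g)" for f g :: "'v::ab_group_add pbw"
  unfolding homog_def by (metis add.right_neutral plus_fun_apply add.left_neutral)

lemma homog_flip: "homog d (flip f) \<longleftrightarrow> homog d f"
  unfolding homog_def flip_def by (metis add.commute add.left_commute)

lemma (in qspace) homog_op:
  assumes "homog d f"
  shows "homog (d + 1) (LX f)" "homog (d + 1) (LY f)" "homog (d + 2) (LZ f)" "homog d (fsc c f)"
    "homog (d + 1) (RX f)" "homog (d + 1) (RY f)" "homog (d + 2) (RZ f)"
proof -
  have *: "homog (d + 1) (LX f) \<and> homog (d + 1) (LY f) \<and> homog (d + 2) (LZ f)" if "homog d f" for f
  proof (intro conjI)
    have h: "f i j k = 0" if "int (i + 2 * j + k) \<noteq> d" for i j k using \<open>homog d f\<close> that by (auto simp: homog_def)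
    show "homog (d + 1) (LX f)"
      unfolding homog_def opx_def
    proof (intro allI impI)
      fix i j k assume nz: "(case i of 0 \<Rightarrow> 0 | Suc i' \<Rightarrow> f i' j k) \<noteq> 0"
      show "int (i + 2 * j + k) = d + 1"
      proof (cases i)
        case (Suc i') then show ?thesis using nz h[of i' j k] by fastforce
      qed (use nz in simp)
    qed
    show "homog (d + 2) (LZ f)"
      unfolding homog_def opz_def
    proof (intro allI impI)
      fix i j k assume nz: "(case j of 0 \<Rightarrow> 0 | Suc j' \<Rightarrow> (inverse p ^ i) *s f i j' k) \<noteq> 0"
      show "int (i + 2 * j + k) = d + 2"
      proof (cases j)
        case (Suc j') then show ?thesis using nz h[of i j' k] by fastforce
      qed (use nz in simp)
    qed
    show "homog (d + 1) (LY f)"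
      unfolding homog_def opy_def
    proof (intro allI impI, rule ccontr)
      fix i j k assume nz: "(case k of 0 \<Rightarrow> 0 | Suc k' \<Rightarrow> (q ^ i * inverse p ^ j) *s f i j k') +
        (case j of 0 \<Rightarrow> 0 | Suc j' \<Rightarrow> qc p q (Suc i) *s f (Suc i) j' k) \<noteq> 0" and ne: "int (i + 2 * j + k) \<noteq> d + 1"
      have "(case k of 0 \<Rightarrow> 0 | Suc k' \<Rightarrow> (q ^ i * inverse p ^ j) *s f i j k') = 0"
      proof (cases k)
        case (Suc k') then show ?thesis using ne h[of i j k'] by simp
      qed simp
      moreover have "(case j of 0 \<Rightarrow> 0 | Suc j' \<Rightarrow> qc p q (Suc i) *s f (Suc i) j' k) = 0"
      proof (cases j)
        case (Suc j') then show ?thesis using ne h[of "Suc i" j' k] by simp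
      qed simp
      ultimately show False using nz by simp
    qed
  qed
  show "homog (d + 1) (LX f)" "homog (d + 1) (LY f)" "homog (d + 2) (LZ f)" using *[OF assms] by auto
  show "homog d (fsc c f)" using assms by (auto simp: homog_def lift_def)
  show "homog (d + 1) (RX f)" "homog (d + 1) (RY f)" "homog (d + 2) (RZ f)"
    using *[of "flip f"] assms by (simp_all add: homog_flip rx_def ry_def rz_def)
qed

context PBW begin

lemma Gr_homog: "a \<in> Gr n \<longleftrightarrow> a \<in> carrier R \<and> homog (int n) (\<phi> a)"
  unfolding Gr_def homog_def of_nat_eq_iff by simp

text \<open>
  The product of the ring is the action on its free module of rank one, so that facts on actions
  apply to products.
\<close>

lemma rank_one: "PBW_free R \<phi> p q gx gy gz \<kappa> (*) (UNIV :: 'k set)"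
  by unfold_locales simp

interpretation E: PBW_free R \<phi> p q gx gy gz \<kappa> "(*)" "UNIV :: 'k set"
  by (rule rank_one)

lemma \<phi>_mult: "a \<in> carrier R \<Longrightarrow> b \<in> carrier R \<Longrightarrow> \<phi> (a \<otimes> b) = E.F.act a (\<phi> b)"
  by (induction rule: R_induct)
     (simp_all add: E.F.act_simps R.l_distr \<phi>_add R.m_assoc \<phi>_x \<phi>_y \<phi>_z \<phi>_\<kappa>)

lemma Gr_mult:
  assumes a: "a \<in> Gr i" and b: "b \<in> Gr j"
  shows "a \<otimes> b \<in> Gr (i + j)"
proof -
  have "E.F.act a (\<phi> b) \<in> {f. homog (int i + int j) f}"
    by (rule E.F.graded_act[of "\<lambda>d. {f. homog d f}", OF _ _ _ _ _ _ a])
       (use b in \<open>auto simp: homog_zero homog_add K.homog_op Gr_homog\<close>)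
  then show ?thesis using a b \<phi>_mult[of a b] by (simp add: Gr_homog)
qed

theorem connected_graded: "connected_graded_algebra (range \<kappa>) R Gr"
  unfolding connected_graded_algebra_def
proof (intro conjI ballI allI ring_R subfield_\<kappa> Gr_direct_sum Gr_0)
  show "c \<otimes> a = a \<otimes> c" if "c \<in> range \<kappa>" "a \<in> carrier R" for c a
    using that(1) \<kappa>_central[OF that(2)] by blast
qed (rule Gr_mult)

end

section \<open>Exactness of the dual complex\<close>

context qspace begin

text \<open>
  The dual of the resolution of the trivial module consists of left multiplications on right
  modules. Its exactness uses that \<open>x\<close> is regular, that \<open>z\<close> is regular modulo \<open>x A\<close>, and that \<open>y\<close> is
  regular modulo \<open>x A + z A\<close>. In the PBW basis this is visible: the right ideal \<open>x A\<close> consists of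
  the elements whose coefficients with \<open>i = 0\<close> vanish, and on the remaining coefficients \<open>z\<close> acts as
  a shift of \<open>j\<close>.
\<close>

lemma LX_inj: "LX f = LX g \<Longrightarrow> f = g"
proof (intro ext)
  fix i j k assume "LX f = LX g"
  then have "LX f (Suc i) j k = LX g (Suc i) j k" by simp
  then show "f i j k = g i j k" by (simp add: opx_def)
qed

text \<open>
  Division by \<open>x\<close> on the left.
\<close>

definition down :: "'v pbw \<Rightarrow> 'v pbw" where "down f = (\<lambda>i j k. f (Suc i) j k)"

lemma down_Fin: "f \<in> Fin S \<Longrightarrow> down f \<in> Fin S"
proof -
  assume f: "f \<in> Fin S"
  obtain N where N: "\<And>i j k. f i j k \<in> S" "\<And>i j k. N \<le> i + j + k \<Longrightarrow> f i j k = 0"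
    using FinE[OF f] by metis
  show ?thesis by (rule FinI[of _ _ N]) (auto simp: down_def N)
qed

lemma LX_down: "(\<And>j k. f 0 j k = 0) \<Longrightarrow> f = LX (down f)"
  by (auto simp: fun_eq_iff opx_def down_def split: nat.split)

lemma fsc_cancel: "c \<noteq> 0 \<Longrightarrow> fsc c f = fsc c g \<Longrightarrow> f = g"
  by (simp add: lift_def fun_eq_iff)

lemma fsc_fsc: "fsc c (fsc d f) = fsc (c * d) f" "fsc 1 f = f" "fsc c (f - g) = fsc c f - fsc c g"
  "fsc c (f + g) = fsc c f + fsc c g" "fsc c 0 = 0" "fsc (- c) f = - fsc c f"
  by (simp_all add: lift_def fun_eq_iff algebra_simps)

text \<open>
  The second equation shows that \<open>z W0\<close>, and hence \<open>W0\<close>, is in \<open>x A\<close>. The other components are then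
  found by cancelling \<open>x\<close>.
\<close>

lemma dual_exact1:
  assumes "W0 \<in> Fin S"
    and e0: "LY W0 - fsc q (LX W1) - W2 = 0" and e1: "LZ W0 - fsc (inverse p) (LX W2) = 0"
  shows "\<exists>A \<in> Fin S. W0 = LX A \<and> W1 = LY A \<and> W2 = LZ A"
proof (intro bexI conjI)
  define A :: "'v pbw" where "A = down W0"
  show "A \<in> Fin S" unfolding A_def by (rule down_Fin[OF assms(1)])
  have e1': "LZ W0 = fsc (inverse p) (LX W2)" using e1 by simp
  have "W0 0 j k = 0" for j k
  proof -
    have "LZ W0 0 (Suc j) k = fsc (inverse p) (LX W2) 0 (Suc j) k" by (simp only: e1')
    then show ?thesis by (simp add: opz_def opx_def lift_def)
  qed
  then show W0: "W0 = LX A" unfolding A_def by (rule LX_down)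
  have "LX W2 = LX (LZ A)"
  proof (rule fsc_cancel)
    show "inverse p \<noteq> 0" using p0 by simp
    show "fsc (inverse p) (LX W2) = fsc (inverse p) (LX (LZ A))"
      using e1' unfolding W0 op_relations(1) by (rule sym)
  qed
  then show W2: "W2 = LZ A" by (rule LX_inj)
  have "fsc q (LX W1) = fsc q (LX (LY A))"
    using e0 unfolding W0 op_relations(3) W2 by (simp add: algebra_simps)
  then show "W1 = LY A" by (rule LX_inj[OF fsc_cancel[OF q0]])
qed

text \<open>
  The boundary of \<open>A\<close> and \<open>C\<close> is chosen to remove \<open>W1\<close>: modulo \<open>x A\<close>, the equation shows that \<open>y W1\<close>
  is a multiple of \<open>z\<close>, hence so is \<open>W1\<close>. What remains of \<open>W0\<close> is in \<open>x A\<close> because \<open>z\<close> is regular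
  modulo \<open>x A\<close>, and this determines \<open>B\<close>.
\<close>

lemma dual_exact2:
  assumes W: "W0 \<in> Fin S" "W1 \<in> Fin S" "W2 \<in> Fin S" and S: "subspace S"
    and e: "LZ W0 - fsc p (LY W1) + fsc (q * inverse p) (LX W2) = 0"
  shows "\<exists>A \<in> Fin S. \<exists>B \<in> Fin S. \<exists>C \<in> Fin S. W0 = LY A - fsc q (LX B) - C \<and>
    W1 = LZ A - fsc (inverse p) (LX C) \<and> W2 = LZ B - fsc p (LY C)"
proof -
  note Fc = Fin_closed[OF S] Fin_op[OF S]
  obtain N where N: "\<And>i j k. W1 i j k \<in> S" "\<And>i j k. N \<le> i + j + k \<Longrightarrow> W1 i j k = 0"
    using FinE[OF W(2)] by metis
  define A :: "'v pbw" where "A = (\<lambda>i j k. if i = 0 then W1 0 (Suc j) k else 0)"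
  define C :: "'v pbw" where "C = fsc (- p) (down W1)"
  have A: "A \<in> Fin S" by (rule FinI[of _ _ N]) (auto simp: A_def N subspace_0[OF S])
  have C: "C \<in> Fin S" unfolding C_def by (intro Fc down_Fin W)
  have z: "W1 0 0 k = 0" for k
  proof -
    have "(LZ W0 - fsc p (LY W1) + fsc (q * inverse p) (LX W2)) 0 0 (Suc k) = 0" by (simp only: e zero_fun_apply)
    then show ?thesis using p0 by (simp add: opx_def opy_def opz_def lift_def)
  qed
  have W1: "W1 = LZ A - fsc (inverse p) (LX C)"
    using z p0 by (auto simp: fun_eq_iff A_def C_def opx_def opz_def down_def lift_def split: nat.split)
  define W0' :: "'v pbw" where "W0' = W0 - LY A + C"
  define W2' :: "'v pbw" where "W2' = W2 + fsc p (LY C)"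
  have in': "W0' \<in> Fin S" unfolding W0'_def by (intro Fc W A C)
  have "LZ W0' + fsc (q * inverse p) (LX W2') =
      (LZ W0 - fsc p (LY W1) + fsc (q * inverse p) (LX W2)) +
      (fsc p (LY W1) - LZ (LY A) + LZ C + fsc (q * inverse p) (LX (fsc p (LY C))))"
    unfolding W0'_def W2'_def op_add op_diff fsc_fsc by (simp add: algebra_simps)
  also have "fsc p (LY W1) - LZ (LY A) + LZ C + fsc (q * inverse p) (LX (fsc p (LY C))) = 0"
    unfolding W1 op_diff op_scale op_relations fsc_fsc using p0 by (simp add: fsc_fsc algebra_simps)
  finally have e': "LZ W0' + fsc (q * inverse p) (LX W2') = 0" by (simp only: e add_0_left)
  have z': "W0' 0 j k = 0" for j k
  proof -
    have "(LZ W0' + fsc (q * inverse p) (LX W2')) 0 (Suc j) k = 0" by (simp only: e' zero_fun_apply)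
    then show ?thesis by (simp add: opx_def opz_def lift_def)
  qed
  define B :: "'v pbw" where "B = fsc (- inverse q) (down W0')"
  have B: "B \<in> Fin S" unfolding B_def by (intro Fc down_Fin in')
  have W0': "W0' = - fsc q (LX B)"
  proof -
    have "W0' = LX (down W0')" by (rule LX_down) (rule z')
    moreover have "- fsc q (LX B) = LX (down W0')"
      unfolding B_def op_scale fsc_fsc(1) using q0 by (simp add: fsc_fsc)
    ultimately show ?thesis by simp
  qed
  have h: "LZ W0' = - fsc (q * inverse p) (LX (LZ B))"
    using op_diff(3)[of 0 "fsc q (LX B)"] unfolding W0' op_scale op_relations fsc_fsc by (simp add: op_zero)
  have e'': "- fsc (q * inverse p) (LX (LZ B)) + fsc (q * inverse p) (LX W2') = 0"
    using e' unfolding h .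
  from iffD2[OF neg_eq_iff_add_eq_0 this]
  have "fsc (q * inverse p) (LX W2') = fsc (q * inverse p) (LX (LZ B))" by (simp only: minus_minus)
  then have "W2' = LZ B"
    by (rule LX_inj[OF fsc_cancel[of "q * inverse p"], rotated]) (simp add: p0 q0)
  then have "W2 = LZ B - fsc p (LY C)" unfolding W2'_def by (simp add: algebra_simps)
  moreover have "W0 = LY A - fsc q (LX B) - C" using W0' unfolding W0'_def by (simp add: algebra_simps)
  ultimately show ?thesis using W1 A B C by blast
qed

text \<open>
  The monomials other than \<open>1\<close> start with \<open>x\<close>, \<open>z\<close> or \<open>y\<close>.
\<close>

lemma dual_coker:
  assumes W: "W \<in> Fin S" and S: "subspace S" and z: "W 0 0 0 = 0"
  shows "\<exists>A \<in> Fin S. \<exists>B \<in> Fin S. \<exists>C \<in> Fin S. W = LZ A - fsc p (LY B) + fsc (q * inverse p) (LX C)"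
proof -
  note Fc = Fin_closed[OF S] Fin_op[OF S]
  obtain N where N: "\<And>i j k. W i j k \<in> S" "\<And>i j k. N \<le> i + j + k \<Longrightarrow> W i j k = 0"
    using FinE[OF W] by metis
  define A :: "'v pbw" where "A = (\<lambda>i j k. if i = 0 then W 0 (Suc j) k else 0)"
  define B :: "'v pbw" where "B = fsc (- inverse p) (\<lambda>i j k. if i = 0 \<and> j = 0 then W 0 0 (Suc k) else 0)"
  define C :: "'v pbw" where "C = fsc (p * inverse q) (down W)"
  have "A \<in> Fin S" by (rule FinI[of _ _ N]) (auto simp: A_def N subspace_0[OF S])
  moreover have "B \<in> Fin S" unfolding B_def by (intro Fc, rule FinI[of _ _ N]) (auto simp: N subspace_0[OF S])
  moreover have "C \<in> Fin S" unfolding C_def by (intro Fc down_Fin W)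
  moreover have [simp]: "q * inverse p * (p * inverse q) = 1" using p0 q0 by (simp add: field_simps)
  have "W = LZ A - fsc p (LY B) + fsc (q * inverse p) (LX C)"
    using z p0 q0 by (auto simp: fun_eq_iff A_def B_def C_def opx_def opy_def opz_def down_def lift_def split: nat.split)
  ultimately show ?thesis by blast
qed

end

section \<open>The Gorenstein condition\<close>

context PBW begin

lemma left_module_regular: "left_module R (regular_module R)"
proof -
  have "abelian_group (regular_module R)"
  proof (rule abelian_groupI)
    fix u assume "u \<in> carrier (regular_module R)"
    then show "\<exists>v \<in> carrier (regular_module R). v \<oplus>\<^bsub>regular_module R\<^esub> u = \<zero>\<^bsub>regular_module R\<^esub>"
      by (intro bexI[of _ "\<ominus> u"]) (auto simp: regular_module_def R.l_neg)
  qed (auto simp: regular_module_def R.a_ac)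
  then interpret N: abelian_group "regular_module R" .
  show ?thesis
    by unfold_locales (auto simp: regular_module_def R.l_distr R.r_distr R.m_assoc)
qed

lemma regular_simps [simp]:
  "carrier (regular_module R) = carrier R" "a \<oplus>\<^bsub>regular_module R\<^esub> b = a \<oplus> b"
  "a \<odot>\<^bsub>regular_module R\<^esub> b = a \<otimes> b" "\<zero>\<^bsub>regular_module R\<^esub> = \<zero>"
  by (simp_all add: regular_module_def)

text \<open>
  The constant term is multiplicative, as products of generators with anything have no constant
  term.
\<close>

lemma augmentation_mult: "a \<in> carrier R \<Longrightarrow> b \<in> carrier R \<Longrightarrow> \<phi> (a \<otimes> b) 0 0 0 = \<phi> a 0 0 0 * \<phi> b 0 0 0"
  by (induction rule: R_induct)
     (simp_all add: R.l_distr \<phi>_add R.m_assoc \<phi>_x \<phi>_y \<phi>_z \<phi>_\<kappa> \<phi>_one opx_def opy_def opz_def lift_def single3_def distrib_right)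

lemma trivial_simps [simp]:
  "carrier (trivial_module R Gr) = range \<kappa>" "u \<oplus>\<^bsub>trivial_module R Gr\<^esub> v = u \<oplus> v" "\<zero>\<^bsub>trivial_module R Gr\<^esub> = \<zero>"
  "a \<in> carrier R \<Longrightarrow> a \<odot>\<^bsub>trivial_module R Gr\<^esub> \<kappa> c = \<kappa> (\<phi> a 0 0 0 * c)"
  by (simp_all add: trivial_module_def Gr_0 component_0 \<kappa>_ring)

lemma left_module_trivial: "left_module R (trivial_module R Gr)"
proof -
  have "abelian_group (trivial_module R Gr)"
  proof (rule abelian_groupI)
    fix u assume "u \<in> carrier (trivial_module R Gr)"
    then obtain c where "u = \<kappa> c" by auto
    then show "\<exists>v \<in> carrier (trivial_module R Gr). v \<oplus>\<^bsub>trivial_module R Gr\<^esub> u = \<zero>\<^bsub>trivial_module R Gr\<^esub>"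
      by (intro bexI[of _ "\<kappa> (- c)"]) (simp_all add: \<kappa>_ring(1,4)[symmetric])
  qed (auto simp: \<kappa>_ring[symmetric] add_ac)
  then interpret N: abelian_group "trivial_module R Gr" .
  show ?thesis
    by unfold_locales (auto simp: \<phi>_add \<phi>_one single3_def augmentation_mult \<kappa>_ring(1,2)[symmetric] distrib_left distrib_right)
qed

end

text \<open>
  The resolution of the trivial module is realised in a type \<open>'u\<close> that contains its terms.
\<close>

locale PBW_universe = PBW R \<phi> p q gx gy gz \<kappa>
  for R :: "'a ring" (structure) and \<phi> :: "'a \<Rightarrow> 'k::field pbw" and p q gx gy gz \<kappa> +
  fixes \<iota> :: "(nat \<Rightarrow> 'k) pbw \<Rightarrow> 'u"
  assumes \<iota>: "inj_on \<iota> (Fin (SS UNIV 3))"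
begin

interpretation T: PBW_mod R \<phi> p q gx gy gz \<kappa> "(*)" "(*) 0" "(*) 0" "(*) 0" "UNIV :: 'k set"
  by (rule trivial_PBW_mod)

definition \<tau> :: "'u \<Rightarrow> (nat \<Rightarrow> 'k) pbw" where "\<tau> = inv_into (Fin (SS UNIV 3)) \<iota>"

definition Pn :: "nat \<Rightarrow> ('a, 'u) module" where "Pn n = transported \<iota> \<tau> (T.PP n)"

definition dn :: "nat \<Rightarrow> 'u \<Rightarrow> 'u" where
  "dn n = (\<lambda>u \<in> \<iota> ` carrier (T.PP (Suc n)). \<iota> (T.dP n (\<tau> u)))"

definition en :: "'u \<Rightarrow> 'a" where
  "en = (\<lambda>u \<in> \<iota> ` carrier (T.PP 0). (\<lambda>w \<in> carrier (T.PP 0). \<kappa> (T.eP w)) (\<tau> u))"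

text \<open>
  The degrees of the generators of the resolution: \<open>0\<close>, then those of \<open>x\<close>, \<open>y\<close>, \<open>z\<close>, then those of
  the relations \<open>y x\<close>, \<open>z x\<close>, \<open>z y\<close>, and \<open>4\<close> for \<open>z y x\<close>.
\<close>

definition sh :: "nat \<Rightarrow> nat \<Rightarrow> int" where
  "sh n t = (if n = 0 then 0 else if n = 1 then (if t = 2 then 2 else 1)
     else if n = 2 then (if t = 0 then 2 else 3) else 4)"

definition Dn :: "nat \<Rightarrow> int \<Rightarrow> 'u set" where
  "Dn n i = {u \<in> carrier (Pn n). \<forall>t. homog (i - sh n t) (cmp t (\<tau> u))}"

lemma \<tau>\<iota>: "w \<in> Fin (SS UNIV (rk n)) \<Longrightarrow> \<tau> (\<iota> w) = w"
  using T.PP_subset[of n] by (auto simp: \<tau>_def inv_into_f_f[OF \<iota>])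

lemma transport_PP: "transport R (T.PP n) \<iota> \<tau>"
  by (intro transport.intro transport_axioms.intro T.left_module_PP) (simp add: \<tau>\<iota>)

lemma Pn_simps: "carrier (Pn n) = \<iota> ` Fin (SS UNIV (rk n))" "\<zero>\<^bsub>Pn n\<^esub> = \<iota> 0"
  "u \<oplus>\<^bsub>Pn n\<^esub> v = \<iota> (\<tau> u + \<tau> v)" "a \<odot>\<^bsub>Pn n\<^esub> u = \<iota> (a \<odot>\<^bsub>T.PP n\<^esub> \<tau> u)"
  by (simp_all add: Pn_def)

lemma left_module_Pn: "left_module R (Pn n)"
  unfolding Pn_def by (rule transport.left_module_T[OF transport_PP])

lemma \<tau>_in: "u \<in> carrier (Pn n) \<Longrightarrow> \<tau> u \<in> Fin (SS UNIV (rk n))" "u \<in> carrier (Pn n) \<Longrightarrow> \<iota> (\<tau> u) = u"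
  by (auto simp: Pn_simps \<tau>\<iota>)

lemma PP_closed: "v \<in> Fin (SS UNIV (rk n)) \<Longrightarrow> w \<in> Fin (SS UNIV (rk n)) \<Longrightarrow> v + w \<in> Fin (SS UNIV (rk n))"
  "a \<in> carrier R \<Longrightarrow> v \<in> Fin (SS UNIV (rk n)) \<Longrightarrow> a \<odot>\<^bsub>T.PP n\<^esub> v \<in> Fin (SS UNIV (rk n))"
  "(0 :: (nat \<Rightarrow> 'k) pbw) \<in> Fin (SS UNIV (rk n))"
  using left_module_carrier[OF T.left_module_PP[of n]] by simp_all

lemma \<tau>_op: "u \<in> carrier (Pn n) \<Longrightarrow> v \<in> carrier (Pn n) \<Longrightarrow> \<tau> (u \<oplus>\<^bsub>Pn n\<^esub> v) = \<tau> u + \<tau> v"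
  "a \<in> carrier R \<Longrightarrow> u \<in> carrier (Pn n) \<Longrightarrow> \<tau> (a \<odot>\<^bsub>Pn n\<^esub> u) = a \<odot>\<^bsub>T.PP n\<^esub> \<tau> u"
  by (simp_all add: Pn_simps(3,4) \<tau>\<iota>[of _ n] \<tau>_in PP_closed)

lemma trivial_hom: "restrict \<kappa> (carrier T.TM) \<in> lmod_hom R T.TM (trivial_module R Gr)"
  by (rule lmod_homI[OF T.left_module_TM left_module_trivial])
     (auto simp: \<kappa>_ring(1) T.act_gens \<phi>_gens single3_def)

lemma resolution: "projective_resolution R (trivial_module R Gr) Pn dn en"
proof -
  have b: "bij_betw (restrict \<kappa> (carrier T.TM)) UNIV (carrier (trivial_module R Gr))"
    by (auto simp: bij_betw_def inj_on_def \<kappa>_inj)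
  have eq: "(\<lambda>u \<in> \<iota> ` carrier (T.PP 0). (\<lambda>w \<in> carrier (T.PP 0). restrict \<kappa> (carrier T.TM) (T.eP w)) (\<tau> u)) = en"
    by (simp add: en_def)
  show ?thesis
    using T.resolution_in_universe[OF \<iota> left_module_trivial trivial_hom b]
    unfolding \<tau>_def[symmetric] eq dn_def[symmetric] Pn_def[symmetric, abs_def] by simp
qed

text \<open>
  The coordinates of an element of the free module \<open>Pn n\<close>, as elements of the ring.
\<close>

definition ct :: "nat \<Rightarrow> 'u \<Rightarrow> 'a" where "ct t u = \<psi> (cmp t (\<tau> u))"

lemma cmp_in: "w \<in> Fin (SS UNIV (rk n)) \<Longrightarrow> cmp t w \<in> Fin (UNIV :: 'k set)"
  using K.Fin_closed(1)[OF K.subspace_UNIV] by (cases "t < rk n") (auto simp: Fin_SS)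

lemma ct: "u \<in> carrier (Pn n) \<Longrightarrow> ct t u \<in> carrier R" "u \<in> carrier (Pn n) \<Longrightarrow> \<phi> (ct t u) = cmp t (\<tau> u)"
  "u \<in> carrier (Pn n) \<Longrightarrow> t \<ge> rk n \<Longrightarrow> ct t u = \<zero>"
proof -
  show 1: "ct t u \<in> carrier R" and 2: "\<phi> (ct t u) = cmp t (\<tau> u)" if "u \<in> carrier (Pn n)"
    unfolding ct_def using cmp_in[OF \<tau>_in(1)[OF that]] by (auto simp: \<psi>)
  show "ct t u = \<zero>" if "u \<in> carrier (Pn n)" "t \<ge> rk n"
    using 1[OF that(1)] 2[OF that(1)] \<tau>_in(1)[OF that(1)] that(2)
    by (subst \<phi>_inj[symmetric]) (auto simp: \<phi>_zero Fin_SS)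
qed

lemma ct_hom: "restrict (ct t) (carrier (Pn n)) \<in> lmod_hom R (Pn n) (regular_module R)"
proof (rule lmod_homI[OF left_module_Pn left_module_regular])
  note cl = left_module_carrier[OF left_module_Pn]
  fix u v c assume u: "u \<in> carrier (Pn n)"
  show "ct t u \<in> carrier (regular_module R)" by (simp add: ct[OF u])
  show "ct t (u \<oplus>\<^bsub>Pn n\<^esub> v) = ct t u \<oplus>\<^bsub>regular_module R\<^esub> ct t v" if v: "v \<in> carrier (Pn n)"
    using u v by (subst \<phi>_inj[symmetric]) (simp_all add: ct[of _ n] cl \<phi>_add \<tau>_op cmp_add)
  show "ct t (gx \<odot>\<^bsub>Pn n\<^esub> u) = gx \<odot>\<^bsub>regular_module R\<^esub> ct t u"
    using u by (subst \<phi>_inj[symmetric]) (simp_all add: ct[of _ n] cl \<phi>_x \<tau>_op K.cmp_op)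
  show "ct t (gy \<odot>\<^bsub>Pn n\<^esub> u) = gy \<odot>\<^bsub>regular_module R\<^esub> ct t u"
    using u by (subst \<phi>_inj[symmetric]) (simp_all add: ct[of _ n] cl \<phi>_y \<tau>_op K.cmp_op)
  show "ct t (gz \<odot>\<^bsub>Pn n\<^esub> u) = gz \<odot>\<^bsub>regular_module R\<^esub> ct t u"
    using u by (subst \<phi>_inj[symmetric]) (simp_all add: ct[of _ n] cl \<phi>_z \<tau>_op K.cmp_op)
  show "ct t (\<kappa> c \<odot>\<^bsub>Pn n\<^esub> u) = \<kappa> c \<odot>\<^bsub>regular_module R\<^esub> ct t u"
    using u by (subst \<phi>_inj[symmetric]) (simp_all add: ct[of _ n] cl \<phi>_\<kappa> \<tau>_op K.cmp_op)
qed

lemma ct_add: "u \<in> carrier (Pn n) \<Longrightarrow> v \<in> carrier (Pn n) \<Longrightarrow> ct t (u \<oplus>\<^bsub>Pn n\<^esub> v) = ct t u \<oplus> ct t v"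
  and ct_smult: "a \<in> carrier R \<Longrightarrow> u \<in> carrier (Pn n) \<Longrightarrow> ct t (a \<odot>\<^bsub>Pn n\<^esub> u) = a \<otimes> ct t u"
  using lmod_homD[OF ct_hom[of t n]] left_module_carrier[OF left_module_Pn] by simp_all

text \<open>
  Homomorphisms from a free module to the ring are given by tuples: the tuple \<open>w\<close> acts by
  \<open>u \<mapsto> \<Sum> u\<^sub>t w\<^sub>t\<close>. The sum extends to all three indices, as the coordinates from \<open>rk n\<close> on are zero.
\<close>

definition Hm :: "(nat \<Rightarrow> 'a) \<Rightarrow> 'u \<Rightarrow> 'a" where
  "Hm w u = ct 0 u \<otimes> w 0 \<oplus> ct 1 u \<otimes> w 1 \<oplus> ct 2 u \<otimes> w 2"

definition Hf :: "nat \<Rightarrow> (nat \<Rightarrow> 'a) \<Rightarrow> 'u \<Rightarrow> 'a" where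
  "Hf n w = restrict (Hm w) (carrier (Pn n))"

definition seqs :: "(nat \<Rightarrow> 'a) set" where "seqs = {w. \<forall>t. w t \<in> carrier R}"

lemma seqsD: "w \<in> seqs \<Longrightarrow> w t \<in> carrier R" by (simp add: seqs_def)

lemma Hm_closed: "w \<in> seqs \<Longrightarrow> u \<in> carrier (Pn n) \<Longrightarrow> Hm w u \<in> carrier R"
  by (simp add: Hm_def ct seqsD[of w])

lemma Hf_hom: "w \<in> seqs \<Longrightarrow> Hf n w \<in> lmod_hom R (Pn n) (regular_module R)"
  unfolding Hf_def
  by (rule lmod_hom_restrictI[OF left_module_Pn])
     (simp_all add: Hm_closed, simp_all add: Hm_def ct[of _ n] ct_add[of _ n] ct_smult[of _ _ n]
        R.l_distr R.r_distr R.m_assoc R.a_ac seqsD[of w])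

definition unit :: "nat \<Rightarrow> nat \<Rightarrow> 'k" where "unit t = (\<lambda>s. if s = t then 1 else 0)"

definition basis_elem :: "nat \<Rightarrow> 'u" where "basis_elem t = \<iota> (single3 0 0 0 (unit t))"

lemma single_SS: "v \<in> SS UNIV (rk n) \<Longrightarrow> single3 0 0 0 v \<in> Fin (SS UNIV (rk n))"
  by (rule FinI[of _ _ 1]) (auto simp: single3_def SS_def)

lemma gen_in: "t < rk n \<Longrightarrow> basis_elem t \<in> carrier (Pn n)"
  unfolding basis_elem_def Pn_simps by (rule imageI, rule single_SS) (auto simp: SS_def unit_def)

lemma ct_gen: "t < rk n \<Longrightarrow> ct s (basis_elem t) = (if s = t then \<one> else \<zero>)"
proof -
  assume t: "t < rk n"
  have "\<tau> (basis_elem t) = single3 0 0 0 (unit t)"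
    unfolding basis_elem_def by (rule \<tau>\<iota>[of _ n], rule single_SS) (use t in \<open>auto simp: SS_def unit_def\<close>)
  then have "cmp s (\<tau> (basis_elem t)) = single3 0 0 0 (if s = t then 1 else 0)"
    by (auto simp: cmp_def single3_def unit_def fun_eq_iff)
  then show ?thesis
    using ct[OF gen_in[OF t]] by (subst \<phi>_inj[symmetric]) (auto simp: \<phi>_one \<phi>_zero single3_def fun_eq_iff)
qed

lemma Hm_gen: "t < rk n \<Longrightarrow> w \<in> seqs \<Longrightarrow> Hm w (basis_elem t) = w t"
proof -
  assume t: "t < rk n" and w: "w \<in> seqs"
  then have "t = 0 \<or> t = 1 \<or> t = 2" by (auto simp: rk_def split: if_splits)
  then show ?thesis using seqsD[OF w] by (auto simp: Hm_def ct_gen[OF t])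
qed

text \<open>
  The tuple consists of the images of the basis.
\<close>

lemma hom_eq_Hf:
  assumes f: "f \<in> lmod_hom R (Pn n) (regular_module R)"
  obtains w where "w \<in> seqs" "f = Hf n w"
proof -
  define w where "w = (\<lambda>t. if t < rk n then f (basis_elem t) else \<zero>)"
  have w: "w \<in> seqs" using lmod_homD(1)[OF f gen_in] by (auto simp: seqs_def w_def)
  note g = Hf_hom[OF w, of n]
  interpret Tr: transport R "T.PP n" \<iota> \<tau> by (rule transport_PP)
  have toT: "restrict \<iota> (carrier (T.PP n)) \<in> lmod_hom R (T.PP n) (Pn n)" unfolding Pn_def by (rule Tr.to_T)
  have base: "f (\<iota> (single3 0 0 0 v)) = Hf n w (\<iota> (single3 0 0 0 v))" if "m \<le> rk n" "v \<in> SS UNIV m" for m v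
    using that
  proof (induction m arbitrary: v)
    case 0
    then have "v = 0" by (auto simp: SS_def fun_eq_iff)
    then have "single3 0 0 0 v = 0" by (simp add: single3_def fun_eq_iff)
    then have "\<iota> (single3 0 0 0 v) = \<zero>\<^bsub>Pn n\<^esub>" by (simp only: Pn_simps)
    then show ?case
      using lmod_hom_zero[OF left_module_Pn left_module_regular f] lmod_hom_zero[OF left_module_Pn left_module_regular g] by simp
  next
    case (Suc m)
    define v' where "v' = (\<lambda>t. if t = m then 0 else v t)"
    have v': "v' \<in> SS UNIV m" using Suc.prems by (auto simp: SS_def v'_def)
    have SSm: "SS UNIV m \<subseteq> SS (UNIV :: 'k set) (rk n)" using Suc.prems by (auto simp: SS_def)
    have a: "\<iota> (single3 0 0 0 v') \<in> carrier (Pn n)" unfolding Pn_simps by (rule imageI, rule single_SS) (use v' SSm in blast)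
    have m: "m < rk n" using Suc.prems by simp
    have b: "\<kappa> (v m) \<odot>\<^bsub>Pn n\<^esub> basis_elem m \<in> carrier (Pn n)"
      using left_module_carrier(3)[OF left_module_Pn _ gen_in[OF m]] by simp
    have \<tau>basis_elem: "\<tau> (basis_elem m) = single3 0 0 0 (unit m)"
      unfolding basis_elem_def by (rule \<tau>\<iota>[of _ n], rule single_SS) (use m in \<open>auto simp: SS_def unit_def\<close>)
    have \<tau>v': "\<tau> (\<iota> (single3 0 0 0 v')) = single3 0 0 0 v'"
      by (rule \<tau>\<iota>[of _ n], rule single_SS) (use v' SSm in blast)
    have "single3 0 0 0 v = single3 0 0 0 v' + lift (sc4 (*) (v m)) (single3 0 0 0 (unit m))"
      by (auto simp: single3_def v'_def unit_def lift_def sc4_def fun_eq_iff)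
    then have e: "\<iota> (single3 0 0 0 v) = \<iota> (single3 0 0 0 v') \<oplus>\<^bsub>Pn n\<^esub> \<kappa> (v m) \<odot>\<^bsub>Pn n\<^esub> basis_elem m"
      unfolding Pn_simps(3) using \<tau>_op(2)[OF _ gen_in[OF m], of "\<kappa> (v m)"] by (simp add: \<tau>basis_elem \<tau>v')
    have "Hf n w (basis_elem m) = f (basis_elem m)" using Hm_gen[OF m w] gen_in[OF m] m by (simp add: Hf_def w_def)
    then show ?case
      unfolding e using lmod_homD(2)[OF f a b] lmod_homD(2)[OF g a b] lmod_homD(3)[OF f _ gen_in[OF m]]
        lmod_homD(3)[OF g _ gen_in[OF m]] Suc.IH[OF _ v'] Suc.prems by simp
  qed
  interpret F: PBW_free R \<phi> p q gx gy gz \<kappa> "sc4 (*)" "SS (UNIV :: 'k set) (rk n)" by (rule T.PBW_free_SS)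
  have PPF: "T.PP n = F.FM" by (simp add: T.PP_def)
  have "f = Hf n w"
  proof
    fix u
    show "f u = Hf n w u"
    proof (cases "u \<in> carrier (Pn n)")
      case True
      then obtain v where v: "v \<in> Fin (SS UNIV (rk n))" "u = \<iota> v" by (auto simp: Pn_simps)
      have "(\<lambda>x \<in> carrier (T.PP n). f (restrict \<iota> (carrier (T.PP n)) x)) v =
        (\<lambda>x \<in> carrier (T.PP n). Hf n w (restrict \<iota> (carrier (T.PP n)) x)) v"
      proof (rule F.FM_hom_eqI[OF left_module_regular _ _ _ v(1), folded PPF])
        show "(\<lambda>x \<in> carrier (T.PP n). f (restrict \<iota> (carrier (T.PP n)) x)) \<in> lmod_hom R (T.PP n) (regular_module R)"
          by (rule lmod_hom_comp[OF T.left_module_PP toT f])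
        show "(\<lambda>x \<in> carrier (T.PP n). Hf n w (restrict \<iota> (carrier (T.PP n)) x)) \<in> lmod_hom R (T.PP n) (regular_module R)"
          by (rule lmod_hom_comp[OF T.left_module_PP toT g])
      qed (use base[OF order_refl] single_SS in auto)
      then show ?thesis using v by simp
    next
      case False
      then show ?thesis using f by (auto simp: Hf_def lmod_hom_def PiE_def extensional_def)
    qed
  qed
  then show thesis using that w by blast
qed

lemma Hf_zero_iff: "w \<in> seqs \<Longrightarrow> Hf n w = (\<lambda>u \<in> carrier (Pn n). \<zero>) \<longleftrightarrow> (\<forall>t<rk n. w t = \<zero>)"
proof
  assume w: "w \<in> seqs" and "Hf n w = (\<lambda>u \<in> carrier (Pn n). \<zero>)"
  then have "Hf n w (basis_elem t) = \<zero>" if "t < rk n" for t using gen_in[OF that] by simp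
  then show "\<forall>t<rk n. w t = \<zero>" using Hm_gen w gen_in by (auto simp: Hf_def)
next
  assume w: "w \<in> seqs" and z: "\<forall>t<rk n. w t = \<zero>"
  show "Hf n w = (\<lambda>u \<in> carrier (Pn n). \<zero>)"
  proof (rule ext)
    fix u
    have "ct t u \<otimes> w t = \<zero>" if "u \<in> carrier (Pn n)" for t
      using z ct[OF that] seqsD[OF w, of t] by (cases "t < rk n") auto
    then show "Hf n w u = (\<lambda>u \<in> carrier (Pn n). \<zero>) u" by (simp add: Hf_def Hm_def)
  qed
qed

end

context PBW begin

definition int_piece :: "int \<Rightarrow> 'a set" where "int_piece d = {a \<in> carrier R. homog d (\<phi> a)}"

lemma homog_negative: "d < 0 \<Longrightarrow> homog d f \<Longrightarrow> f = 0"
  unfolding homog_def by (intro ext) (metis of_nat_0_le_iff not_less zero_fun_apply)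

lemma int_grading_eq: "int_grading R Gr d = int_piece d"
proof (cases "0 \<le> d")
  case True
  then have "Gr (nat d) = int_piece d" by (auto simp: Gr_homog int_piece_def)
  then show ?thesis using True by (simp add: int_grading_def)
next
  case False
  then have d: "d < 0" by simp
  have "int_piece d = {\<zero>}"
  proof (intro equalityI subsetI)
    fix a assume a: "a \<in> int_piece d"
    then have "\<phi> a = 0" using homog_negative[OF d] by (auto simp: int_piece_def)
    then show "a \<in> {\<zero>}" using a \<phi>_inj[of a \<zero>] by (auto simp: int_piece_def \<phi>_zero)
  qed (auto simp: int_piece_def \<phi>_zero homog_zero)
  then show ?thesis using False by (simp add: int_grading_def)
qed

lemma int_piece_closed: "int_piece d \<subseteq> carrier R" "\<zero> \<in> int_piece d" "a \<in> int_piece d \<Longrightarrow> b \<in> int_piece d \<Longrightarrow> a \<oplus> b \<in> int_piece d"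
  by (auto simp: int_piece_def \<phi>_zero homog_zero \<phi>_add homog_add)

lemma int_piece_mult:
  assumes a: "a \<in> int_piece d" and b: "b \<in> int_piece e"
  shows "a \<otimes> b \<in> int_piece (d + e)"
proof -
  have c: "a \<in> carrier R" "b \<in> carrier R" using a b by (auto simp: int_piece_def)
  have z: "x = \<zero>" if "x \<in> int_piece f" "f < 0" for x f
    using that homog_negative \<phi>_inj[of x \<zero>] by (auto simp: int_piece_def \<phi>_zero)
  show ?thesis
  proof (cases "0 \<le> d \<and> 0 \<le> e")
    case True
    then have "a \<in> Gr (nat d)" "b \<in> Gr (nat e)" using a b by (auto simp: Gr_homog int_piece_def)
    then have "a \<otimes> b \<in> Gr (nat d + nat e)" by (rule Gr_mult)
    then show ?thesis using True by (auto simp: Gr_homog int_piece_def)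
  next
    case False
    then have "a = \<zero> \<or> b = \<zero>" using z[OF a] z[OF b] by auto
    then have "a \<otimes> b = \<zero>" using c by auto
    then show ?thesis by (simp only:) (rule int_piece_closed)
  qed
qed

lemma int_piece_gens: "gx \<in> int_piece 1" "gy \<in> int_piece 1" "gz \<in> int_piece 2" "\<kappa> c \<in> int_piece 0"
  by (auto simp: int_piece_def \<phi>_gens homog_def single3_def split: if_splits)

text \<open>
  The homogeneous component of degree \<open>d\<close>.
\<close>

definition truncation :: "int \<Rightarrow> 'a \<Rightarrow> 'a" where
  "truncation d a = \<psi> (\<lambda>i j k. if int (i + 2 * j + k) = d then \<phi> a i j k else 0)"

lemma truncation:
  assumes a: "a \<in> carrier R"
  shows "truncation d a \<in> int_piece d" "\<phi> (truncation d a) = (\<lambda>i j k. if int (i + 2 * j + k) = d then \<phi> a i j k else 0)"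
proof -
  have "(\<lambda>i j k. if int (i + 2 * j + k) = d then \<phi> a i j k else 0) \<in> Fin UNIV"
    using \<phi>_Fin[OF a] unfolding Fin_def by auto
  then show "\<phi> (truncation d a) = (\<lambda>i j k. if int (i + 2 * j + k) = d then \<phi> a i j k else 0)" "truncation d a \<in> int_piece d"
    unfolding truncation_def int_piece_def by (auto simp: \<psi> homog_def split: if_splits)
qed

lemma \<phi>_finsum: "finite A \<Longrightarrow> f \<in> A \<rightarrow> carrier R \<Longrightarrow> \<phi> (finsum R f A) i j k = (\<Sum>x\<in>A. \<phi> (f x) i j k)"
  using G.\<psi>_finsum[of A f "(i, j, k)"] by simp

lemma truncation_sum:
  assumes a: "a \<in> carrier R" and S: "finite S"
    and cover: "\<And>i j k. \<phi> a i j k \<noteq> 0 \<Longrightarrow> int (i + 2 * j + k) - s \<in> S"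
  shows "finsum R (\<lambda>d. truncation (d + s) a) S = a"
proof -
  have c: "(\<lambda>d. truncation (d + s) a) \<in> S \<rightarrow> carrier R" using truncation(1)[OF a] int_piece_closed(1) by blast
  have "\<phi> (finsum R (\<lambda>d. truncation (d + s) a) S) i j k = \<phi> a i j k" for i j k
  proof -
    have "\<phi> (finsum R (\<lambda>d. truncation (d + s) a) S) i j k =
        (\<Sum>d\<in>S. if int (i + 2 * j + k) = d + s then \<phi> a i j k else 0)"
      using \<phi>_finsum[OF S c] truncation(2)[OF a] by simp
    also have "\<dots> = (\<Sum>d\<in>S. if d = int (i + 2 * j + k) - s then \<phi> a i j k else 0)"
      by (rule sum.cong) auto
    also have "\<dots> = \<phi> a i j k" using S cover[of i j k] by auto
    finally show ?thesis .
  qed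
  then show ?thesis
    using \<phi>_inj[OF R.finsum_closed[OF c] a] by (simp add: fun_eq_iff)
qed

end

context PBW_universe begin

interpretation T: PBW_mod R \<phi> p q gx gy gz \<kappa> "(*)" "(*) 0" "(*) 0" "(*) 0" "UNIV :: 'k set"
  by (rule trivial_PBW_mod)

lemma Dn_ct: "Dn n i = {u \<in> carrier (Pn n). \<forall>t. ct t u \<in> int_piece (i - sh n t)}"
  by (auto simp: Dn_def int_piece_def ct[of _ n])

text \<open>
  The free modules are closed under truncation, as required for a grading by supports.
\<close>

lemma trunc_Fin:
  assumes w: "w \<in> Fin (SS UNIV r)"
  shows "(\<lambda>a b c t. if Q a b c t then w a b c t else 0) \<in> Fin (SS (UNIV :: 'k set) r)"
proof -
  obtain N where N: "\<And>i j k. w i j k \<in> SS UNIV r" "\<And>i j k. N \<le> i + j + k \<Longrightarrow> w i j k = 0"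
    using FinE[OF w] by metis
  show ?thesis by (rule FinI[of _ _ N]) (use N in \<open>auto simp: SS_def fun_eq_iff\<close>)
qed

lemma support_grading_Pn:
  "support_grading (Pn n) (\<lambda>u (a, b, c, t). \<tau> u a b c t) (\<lambda>(a, b, c, t). int (a + 2 * b + c) + sh n t)"
proof -
  interpret P: left_module R "Pn n" by (rule left_module_Pn)
  show ?thesis
  proof (unfold_locales, goal_cases)
    case 1
    show ?case
    proof (rule inj_onI)
      fix u v assume uv: "u \<in> carrier (Pn n)" "v \<in> carrier (Pn n)"
        and eq: "(\<lambda>(a, b, c, t). \<tau> u a b c t) = (\<lambda>(a, b, c, t). \<tau> v a b c t)"
      have pt: "\<tau> u a b c t = \<tau> v a b c t" for a b c t
        using fun_cong[OF eq, of "(a, b, c, t)"] unfolding prod.case .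
      have "\<tau> u = \<tau> v" by (rule ext, rule ext, rule ext, rule ext) (rule pt)
      then have "\<iota> (\<tau> u) = \<iota> (\<tau> v)" by (rule arg_cong)
      then show "u = v" unfolding \<tau>_in(2)[OF uv(1)] \<tau>_in(2)[OF uv(2)] .
    qed
  next
    case (2 u v) then show ?case by (auto simp: \<tau>_op)
  next
    case (3 u)
    obtain N where N: "\<And>i j k. \<tau> u i j k \<in> SS UNIV (rk n)" "\<And>i j k. N \<le> i + j + k \<Longrightarrow> \<tau> u i j k = 0"
      using FinE[OF \<tau>_in(1)[OF 3]] by metis
    have "{c. (case c of (a, b, c, t) \<Rightarrow> \<tau> u a b c t) \<noteq> 0} \<subseteq> {..<N} \<times> {..<N} \<times> {..<N} \<times> {..<rk n}"
    proof clarsimp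
      fix a b c t assume nz: "\<tau> u a b c t \<noteq> 0"
      have "\<not> N \<le> a + b + c" using N(2)[of a b c] nz by auto
      moreover have "t < rk n"
      proof (rule ccontr)
        assume "\<not> t < rk n" then show False using N(1)[of a b c] nz by (simp add: SS_def)
      qed
      ultimately show "a < N \<and> b < N \<and> c < N \<and> t < rk n" by simp
    qed
    then show ?case by (rule finite_subset) simp
  next
    case (4 u i)
    define w where "w = (\<lambda>a b c t. if int (a + 2 * b + c) + sh n t = i then \<tau> u a b c t else 0)"
    have w: "w \<in> Fin (SS UNIV (rk n))" unfolding w_def by (rule trunc_Fin[OF \<tau>_in(1)[OF 4]])
    show ?case
    proof (rule bexI[of _ "\<iota> w"])
      show "\<iota> w \<in> carrier (Pn n)" using w by (simp add: Pn_simps)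
      show "(\<lambda>(a, b, c, t). \<tau> (\<iota> w) a b c t) = (\<lambda>c. if (case c of (a, b, c, t) \<Rightarrow> int (a + 2 * b + c) + sh n t) = i
          then case c of (a, b, c, t) \<Rightarrow> \<tau> u a b c t else 0)"
        unfolding \<tau>\<iota>[OF w] by (auto simp: w_def fun_eq_iff)
    qed
  qed
qed

lemma Pn_direct_sum: "is_direct_sum (Pn n) (Dn n)"
proof -
  interpret S: support_grading "Pn n" "\<lambda>u (a, b, c, t). \<tau> u a b c t" "\<lambda>(a, b, c, t). int (a + 2 * b + c) + sh n t"
    by (rule support_grading_Pn)
  have "S.D = Dn n"
  proof (intro ext Set.set_eqI)
    fix i u show "u \<in> S.D i \<longleftrightarrow> u \<in> Dn n i"
      unfolding S.D_def Dn_def homog_def cmp_def by (auto simp: algebra_simps)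
  qed
  then show ?thesis using S.direct_sum by simp
qed

lemma Pn_graded_module: "graded_module R Gr (Pn n) (Dn n)"
  unfolding graded_module_def
proof (intro conjI allI ballI left_module_Pn Pn_direct_sum)
  fix i j a u assume a: "a \<in> Gr i" and u: "u \<in> Dn n j"
  have ac: "a \<in> carrier R" "a \<in> int_piece (int i)" using a by (auto simp: Gr_homog int_piece_def)
  have uc: "u \<in> carrier (Pn n)" using u by (simp add: Dn_def)
  have "a \<otimes> ct t u \<in> int_piece (int i + (j - sh n t))" for t
    by (rule int_piece_mult[OF ac(2)]) (use u in \<open>simp add: Dn_ct\<close>)
  then show "a \<odot>\<^bsub>Pn n\<^esub> u \<in> Dn n (int i + j)"
    using left_module_carrier(3)[OF left_module_Pn ac(1) uc] by (simp add: Dn_ct ct_smult[OF ac(1) uc] add_diff_eq)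
qed

text \<open>
  The matrices of the differentials: a coordinate of the image is \<open>\<Sum> u\<^sub>s M\<^sub>s\<^sub>t\<close>.
\<close>

definition Mx :: "nat \<Rightarrow> nat \<Rightarrow> nat \<Rightarrow> 'a" where
  "Mx n s t = (if n = 0 then (if t = 0 then if s = 0 then gx else if s = 1 then gy else if s = 2 then gz else \<zero> else \<zero>)
    else if n = 1 then
      (if s = 0 then if t = 0 then gy else if t = 1 then \<kappa> (- q) \<otimes> gx else if t = 2 then \<kappa> (- 1) else \<zero>
       else if s = 1 then if t = 0 then gz else if t = 2 then \<kappa> (- inverse p) \<otimes> gx else \<zero>
       else if s = 2 then if t = 1 then gz else if t = 2 then \<kappa> (- p) \<otimes> gy else \<zero>
       else \<zero>)
    else if n = 2 then
      (if s = 0 then if t = 0 then gz else if t = 1 then \<kappa> (- p) \<otimes> gy else if t = 2 then \<kappa> (q * inverse p) \<otimes> gx else \<zero>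
       else \<zero>)
    else \<zero>)"

lemma Mx_int_piece: "Mx n s t \<in> int_piece (sh (Suc n) s - sh n t)"
proof -
  have k: "\<kappa> c \<otimes> gx \<in> int_piece 1" "\<kappa> c \<otimes> gy \<in> int_piece 1" for c
    using int_piece_mult[OF int_piece_gens(4) int_piece_gens(1), of c] int_piece_mult[OF int_piece_gens(4) int_piece_gens(2), of c] by simp_all
  show ?thesis by (simp add: Mx_def sh_def int_piece_closed(2) int_piece_gens k)
qed

lemma Mx_closed [simp]: "Mx n s t \<in> carrier R"
  using Mx_int_piece int_piece_closed(1) by blast

lemma dn_in: "u \<in> carrier (Pn (Suc n)) \<Longrightarrow> dn n u \<in> carrier (Pn n)"
  "u \<in> carrier (Pn (Suc n)) \<Longrightarrow> \<tau> (dn n u) = T.dd n (\<tau> u)"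
proof -
  assume u: "u \<in> carrier (Pn (Suc n))"
  have 1: "\<tau> u \<in> Fin (SS UNIV (rk (Suc n)))" by (rule \<tau>_in(1)[OF u])
  have 2: "T.dd n (\<tau> u) \<in> Fin (SS UNIV (rk n))" by (rule T.dd_Fin[OF 1])
  have "u \<in> \<iota> ` carrier (T.PP (Suc n))" using u by (simp add: Pn_simps)
  then have 3: "dn n u = \<iota> (T.dd n (\<tau> u))" using 1 by (simp add: dn_def T.dP_def del: T.PP_simps)
  show "dn n u \<in> carrier (Pn n)" "\<tau> (dn n u) = T.dd n (\<tau> u)" unfolding 3 using 2 by (auto simp: Pn_simps \<tau>\<iota>)
qed

lemma ct_dn:
  assumes u: "u \<in> carrier (Pn (Suc n))"
  shows "ct t (dn n u) = ct 0 u \<otimes> Mx n 0 t \<oplus> ct 1 u \<otimes> Mx n 1 t \<oplus> ct 2 u \<otimes> Mx n 2 t"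
proof -
  note c = ct(1)[OF u] and cc = ct(2)[OF u] and d = ct[OF dn_in(1)[OF u]]
  have l0: "lift ((*) 0) f = (0 :: 'k pbw)" for f by (simp add: lift_def fun_eq_iff)
  have l0': "lift (\<lambda>_. 0) f = (0 :: 'k pbw)" for f :: "'k pbw" by (simp add: lift_def fun_eq_iff)
  have km: "a \<otimes> (\<kappa> e \<otimes> b) = (a \<otimes> \<kappa> e) \<otimes> b" if "a \<in> carrier R" "b \<in> carrier R" for a b e
    using that by (simp add: R.m_assoc)
  have lm: "lift ((*) (- e)) f = - lift ((*) e) f" "lift ((*) 1) f = f" for e and f :: "'k pbw"
    by (simp_all add: lift_def fun_eq_iff)
  have neg: "K.RX (- f) = - K.RX f" "K.RY (- f) = - K.RY f" for f
    using K.op_diff[of 0 f] by (simp_all add: K.op_zero)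
  have "\<phi> (ct t (dn n u)) = \<phi> (ct 0 u \<otimes> Mx n 0 t \<oplus> ct 1 u \<otimes> Mx n 1 t \<oplus> ct 2 u \<otimes> Mx n 2 t)"
  proof -
    consider "n = 0" | "n = 1" | "n = 2" | "n \<ge> 3" by linarith
    then show ?thesis
    proof cases
      case 1
      show ?thesis
        unfolding d(2) dn_in(2)[OF u] unfolding 1 T.dd_def Let_def Mx_def
        by (cases "t = 0") (simp_all add: cmp_mk3_if T.D0_def l0 c cc \<phi>_add \<phi>_right \<phi>_zero)
    next
      case 2
      consider "t = 0" | "t = 1" | "t = 2" | "t \<ge> 3" by linarith
      then show ?thesis
        unfolding d(2) dn_in(2)[OF u] unfolding 2 T.dd_def Let_def Mx_def
        by cases (simp_all add: cmp_mk3_if T.D1x_def T.D1y_def T.D1z_def l0 c cc \<phi>_add \<phi>_right \<phi>_zero km K.op_scale lm neg l0')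
    next
      case 3
      consider "t = 0" | "t = 1" | "t = 2" | "t \<ge> 3" by linarith
      then show ?thesis
        unfolding d(2) dn_in(2)[OF u] unfolding 3 T.dd_def Let_def Mx_def
        by cases (simp_all add: cmp_mk3_if T.D2a_def T.D2b_def T.D2c_def l0 c cc \<phi>_add \<phi>_right \<phi>_zero km K.op_scale lm neg l0')
    next
      case 4
      then show ?thesis
        unfolding d(2) dn_in(2)[OF u] T.dd_def Let_def Mx_def by (simp add: c \<phi>_zero)
    qed
  qed
  then show ?thesis
    using d(1) c by (subst \<phi>_inj[symmetric]) simp_all
qed

lemma dn_graded: "dn n ` Dn (Suc n) i \<subseteq> Dn n i"
proof
  fix v assume "v \<in> dn n ` Dn (Suc n) i"
  then obtain u where u: "u \<in> Dn (Suc n) i" "v = dn n u" by blast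
  have uc: "u \<in> carrier (Pn (Suc n))" using u(1) by (simp add: Dn_def)
  have "ct s u \<otimes> Mx n s t \<in> int_piece (i - sh n t)" for s t
    using int_piece_mult[OF _ Mx_int_piece, of "ct s u" "i - sh (Suc n) s" n s t] u(1) by (simp add: Dn_ct)
  then have "ct t v \<in> int_piece (i - sh n t)" for t
    unfolding u(2) ct_dn[OF uc] by (intro int_piece_closed)
  then show "v \<in> Dn n i" using dn_in(1)[OF uc] u(2) by (simp add: Dn_ct)
qed

text \<open>
  On the trivial module, the evaluation is the constant term.
\<close>

lemma T_ev3: "f \<in> Fin UNIV \<Longrightarrow> T.ev3 f = f 0 0 0"
proof -
  assume f: "f \<in> Fin UNIV"
  have pow0: "((*) 0 ^^ n) v = (if n = 0 then v else 0)" for n and v :: 'k by (cases n) simp_all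
  have s0: "single3 a b c v 0 0 0 = (if a = 0 \<and> b = 0 \<and> c = 0 then v else 0)" for a b c and v :: 'k
    by (auto simp: single3_def)
  show ?thesis
    by (rule T.Fin_eqI[OF f, of T.ev3 "\<lambda>f. f 0 0 0"])
       (auto simp: T.ev3_single pow0 s0 T.ev3_add[of _ UNIV])
qed

lemma en_eq: "u \<in> carrier (Pn 0) \<Longrightarrow> en u = \<kappa> (\<phi> (ct 0 u) 0 0 0)"
proof -
  assume u: "u \<in> carrier (Pn 0)"
  have w: "\<tau> u \<in> Fin (SS UNIV (rk 0))" by (rule \<tau>_in(1)[OF u])
  have "u \<in> \<iota> ` carrier (T.PP 0)" using u by (simp add: Pn_simps)
  then have "en u = \<kappa> (T.eP (\<tau> u))" using w by (simp add: en_def)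
  also have "T.eP (\<tau> u) = cmp 0 (\<tau> u) 0 0 0"
    using w cmp_in[OF w, of 0] by (simp add: T.eP_def T_ev3)
  finally show ?thesis by (simp add: ct(2)[OF u])
qed

lemma en_graded: "en ` Dn 0 i \<subseteq> trivial_grading R Gr i"
proof
  fix v assume "v \<in> en ` Dn 0 i"
  then obtain u where u: "u \<in> Dn 0 i" "v = en u" by blast
  have uc: "u \<in> carrier (Pn 0)" using u(1) by (simp add: Dn_def)
  have "ct 0 u \<in> int_piece (i - sh 0 0)" using u(1) unfolding Dn_ct by blast
  then have h: "\<forall>a b c. \<phi> (ct 0 u) a b c \<noteq> 0 \<longrightarrow> int (a + 2 * b + c) = i"
    unfolding int_piece_def homog_def sh_def by simp
  have "\<phi> (ct 0 u) 0 0 0 = 0 \<or> i = 0"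
    using h[THEN spec, THEN spec, THEN spec, of 0 0 0] by auto
  then show "v \<in> trivial_grading R Gr i"
    unfolding u(2) en_eq[OF uc] by (auto simp: trivial_grading_def Gr_0 \<kappa>_ring)
qed

lemma graded_resolution:
  "graded_projective_resolution R Gr (trivial_module R Gr) (trivial_grading R Gr) Pn Dn dn en"
  unfolding graded_projective_resolution_def
  using resolution Pn_graded_module dn_graded en_graded by blast

subsection \<open>The graded duals\<close>

text \<open>
  The basis element \<open>t\<close> has degree \<open>sh n t\<close>, and it is mapped to \<open>w t\<close>.
\<close>

lemma Hf_degree:
  assumes w: "\<And>t. w t \<in> int_piece (j + sh n t)"
  shows "Hf n w \<in> hom_degree R Gr (Pn n) (Dn n) j"
proof -
  have ws: "w \<in> seqs" using w int_piece_closed(1) by (auto simp: seqs_def)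
  have "Hf n w u \<in> int_piece (i + j)" if u: "u \<in> Dn n i" for u i
  proof -
    have "ct t u \<otimes> w t \<in> int_piece (i + j)" for t
      using int_piece_mult[OF _ w, of "ct t u" "i - sh n t" t] u by (simp add: Dn_ct)
    then show ?thesis using u by (simp add: Hf_def Dn_def Hm_def int_piece_closed(3))
  qed
  then show ?thesis unfolding hom_degree_def int_grading_eq using Hf_hom[OF ws] by blast
qed

lemma degree_bound: "a \<in> carrier R \<Longrightarrow> \<exists>N. \<forall>i j k. \<phi> a i j k \<noteq> 0 \<longrightarrow> i + 2 * j + k \<le> N"
proof -
  assume "a \<in> carrier R"
  then obtain N where "\<And>i j k. N \<le> i + j + k \<Longrightarrow> \<phi> a i j k = 0" using \<phi>_Fin FinE by metis
  then have "i + j + k < N" if "\<phi> a i j k \<noteq> 0" for i j k using that not_less by blast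
  then have "i + 2 * j + k \<le> 2 * N" if "\<phi> a i j k \<noteq> 0" for i j k using that[THEN \<open>\<And>i j k. \<phi> a i j k \<noteq> 0 \<Longrightarrow> i + j + k < N\<close>] by linarith
  then show ?thesis by blast
qed

lemma sh_bounds: "0 \<le> sh n t" "sh n t \<le> 4"
  by (simp_all add: sh_def)

text \<open>
  Every homomorphism is a finite sum of homogeneous ones, because the module is finitely generated:
  the entries of the tuple are split into their homogeneous components.
\<close>

lemma graded_dual_carrier: "carrier (graded_dual R Gr (Pn n) (Dn n)) = Hf n ` seqs"
proof (intro equalityI subsetI)
  fix f assume "f \<in> carrier (graded_dual R Gr (Pn n) (Dn n))"
  then have "f \<in> lmod_hom R (Pn n) (regular_module R)" by (simp add: graded_dual_def)
  then show "f \<in> Hf n ` seqs" using hom_eq_Hf by blast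
next
  fix f assume "f \<in> Hf n ` seqs"
  then obtain w where w: "w \<in> seqs" "f = Hf n w" by blast
  obtain N0 N1 N2 where N: "\<forall>i j k. \<phi> (w 0) i j k \<noteq> 0 \<longrightarrow> i + 2 * j + k \<le> N0"
     "\<forall>i j k. \<phi> (w 1) i j k \<noteq> 0 \<longrightarrow> i + 2 * j + k \<le> N1" "\<forall>i j k. \<phi> (w 2) i j k \<noteq> 0 \<longrightarrow> i + 2 * j + k \<le> N2"
    using degree_bound[OF seqsD[OF w(1)]] by meson
  \<comment> \<open>a component of degree \<open>m\<close> of the entry \<open>t\<close> belongs to a homomorphism of degree \<open>m - sh n t\<close>, and shifts are at most \<open>4\<close>\<close>
  define S where "S = {-4..int (N0 + N1 + N2)}"
  define h where "h = (\<lambda>j. Hf n (\<lambda>t. truncation (j + sh n t) (w t)))"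
  have hd: "h j \<in> hom_degree R Gr (Pn n) (Dn n) j" for j
    unfolding h_def by (rule Hf_degree) (rule truncation(1)[OF seqsD[OF w(1)]])
  have sum: "f u = finsum R (\<lambda>j. h j u) S" if u: "u \<in> carrier (Pn n)" for u
  proof -
    have S: "finite S" by (simp add: S_def)
    have tc: "truncation d (w t) \<in> carrier R" for d t
      by (rule subsetD[OF int_piece_closed(1) truncation(1)[OF seqsD[OF w(1)]]])
    have cov: "int (i + 2 * j + k) - sh n t \<in> S" if "t \<in> {0, 1, 2}" "\<phi> (w t) i j k \<noteq> 0" for t i j k
    proof -
      have "i + 2 * j + k \<le> N0 \<or> i + 2 * j + k \<le> N1 \<or> i + 2 * j + k \<le> N2" using N that by auto
      then have "i + 2 * j + k \<le> N0 + N1 + N2" by linarith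
      then have "int (i + 2 * j + k) \<le> int (N0 + N1 + N2)" by (simp only: of_nat_le_iff)
      moreover have "0 \<le> int (i + 2 * j + k)" by simp
      ultimately show ?thesis unfolding S_def using sh_bounds[of n t] by (simp only: atLeastAtMost_iff) linarith
    qed
    have part: "finsum R (\<lambda>j. ct t u \<otimes> truncation (j + sh n t) (w t)) S = ct t u \<otimes> w t" if t: "t \<in> {0, 1, 2}" for t
    proof -
      have "ct t u \<otimes> finsum R (\<lambda>j. truncation (j + sh n t) (w t)) S = finsum R (\<lambda>j. ct t u \<otimes> truncation (j + sh n t) (w t)) S"
        by (rule R.finsum_rdistr[OF S ct(1)[OF u]]) (use tc in blast)
      moreover have "finsum R (\<lambda>j. truncation (j + sh n t) (w t)) S = w t"
        by (rule truncation_sum[OF seqsD[OF w(1)] S]) (use cov[OF t] in blast)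
      ultimately show ?thesis by simp
    qed
    have cl: "(\<lambda>j. ct t u \<otimes> truncation (j + sh n t) (w t)) \<in> S \<rightarrow> carrier R" for t
      using tc ct(1)[OF u] by blast
    have "finsum R (\<lambda>j. h j u) S = finsum R (\<lambda>j. (ct 0 u \<otimes> truncation (j + sh n 0) (w 0) \<oplus> ct 1 u \<otimes> truncation (j + sh n 1) (w 1))
        \<oplus> ct 2 u \<otimes> truncation (j + sh n 2) (w 2)) S"
      using u by (simp add: h_def Hf_def Hm_def)
    also have "\<dots> = (finsum R (\<lambda>j. ct 0 u \<otimes> truncation (j + sh n 0) (w 0)) S \<oplus> finsum R (\<lambda>j. ct 1 u \<otimes> truncation (j + sh n 1) (w 1)) S)
        \<oplus> finsum R (\<lambda>j. ct 2 u \<otimes> truncation (j + sh n 2) (w 2)) S"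
      using cl by (subst R.finsum_addf, blast, blast, subst R.finsum_addf) auto
    also have "\<dots> = Hm w u" by (simp add: part Hm_def)
    finally show ?thesis using u w(2) by (simp add: Hf_def)
  qed
  show "f \<in> carrier (graded_dual R Gr (Pn n) (Dn n))"
  proof -
    have "\<exists>S h. finite S \<and> (\<forall>j \<in> S. h j \<in> hom_degree R Gr (Pn n) (Dn n) j) \<and>
          (\<forall>x \<in> carrier (Pn n). f x = finsum R (\<lambda>j. h j x) S)"
      using hd sum by (intro exI[of _ S] exI[of _ h]) (auto simp: S_def)
    then show ?thesis using Hf_hom[OF w(1)] w(2) by (simp add: graded_dual_def)
  qed
qed

end

context PBW begin

text \<open>
  The decomposition into components depends on the additive structure only.
\<close>

lemma component_opposite: "component (opposite R) = component R"
  by (intro ext) (simp add: component_def is_decomposition_def finsum_def opposite_simps add_monoid_opposite)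

lemma trivial_opposite:
  "carrier (trivial_module (opposite R) Gr) = range \<kappa>"
  "\<kappa> c \<oplus>\<^bsub>trivial_module (opposite R) Gr\<^esub> \<kappa> d = \<kappa> (c + d)"
  "a \<in> carrier R \<Longrightarrow> a \<odot>\<^bsub>trivial_module (opposite R) Gr\<^esub> \<kappa> c = \<kappa> (c * \<phi> a 0 0 0)"
  by (simp_all add: trivial_module_def component_opposite Gr_0 component_0 opposite_simps \<kappa>_ring)

end

context PBW_universe begin

abbreviation GD :: "nat \<Rightarrow> ('a, 'u \<Rightarrow> 'a) module" where "GD n \<equiv> graded_dual R Gr (Pn n) (Dn n)"

abbreviation Zn :: "nat \<Rightarrow> ('u \<Rightarrow> 'a) set" where "Zn n \<equiv> ext_cocycles R Gr Pn Dn dn n"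

abbreviation Bn :: "nat \<Rightarrow> ('u \<Rightarrow> 'a) set" where "Bn n \<equiv> ext_coboundaries R Gr Pn Dn dn n"

abbreviation En :: "nat \<Rightarrow> ('a, ('u \<Rightarrow> 'a) set) module" where "En n \<equiv> ext_module R Gr Pn Dn dn n"

text \<open>
  The differential of the dual complex, on tuples: multiplication by the matrix from the left.
\<close>

definition Mw :: "nat \<Rightarrow> (nat \<Rightarrow> 'a) \<Rightarrow> nat \<Rightarrow> 'a" where
  "Mw n w s = Mx n s 0 \<otimes> w 0 \<oplus> Mx n s 1 \<otimes> w 1 \<oplus> Mx n s 2 \<otimes> w 2"

lemma Mw_seqs: "w \<in> seqs \<Longrightarrow> Mw n w \<in> seqs"
  by (simp add: seqs_def Mw_def)

lemma Hm_dn: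
  assumes w: "w \<in> seqs" and u: "u \<in> carrier (Pn (Suc n))"
  shows "Hm w (dn n u) = Hm (Mw n w) u"
  unfolding Hm_def ct_dn[OF u] Mw_def
  using seqsD[OF w] ct(1)[OF u] by (simp add: R.l_distr R.r_distr R.m_assoc R.a_ac)

lemma Hf_cong:
  assumes "w \<in> seqs" "w' \<in> seqs" and eq: "\<And>t. t < rk n \<Longrightarrow> w t = w' t"
  shows "Hf n w = Hf n w'"
proof (rule ext)
  fix u
  have "ct t u \<otimes> w t = ct t u \<otimes> w' t" if "u \<in> carrier (Pn n)" for t
    using eq[of t] ct[OF that] seqsD[OF assms(1), of t] seqsD[OF assms(2), of t] by (cases "t < rk n") auto
  then show "Hf n w u = Hf n w' u" by (simp add: Hf_def Hm_def)
qed

lemma GD_simps: "\<zero>\<^bsub>GD n\<^esub> = Hf n (\<lambda>_. \<zero>)"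
  "f \<oplus>\<^bsub>GD n\<^esub> g = (\<lambda>u \<in> carrier (Pn n). f u \<oplus> g u)"
  "a \<odot>\<^bsub>GD n\<^esub> f = (\<lambda>u \<in> carrier (Pn n). f u \<otimes> a)"
  using Hf_zero_iff[of "\<lambda>_. \<zero>" n] by (simp_all add: graded_dual_def seqs_def)

lemma GD_Hf:
  assumes w: "w \<in> seqs"
  shows "v \<in> seqs \<Longrightarrow> Hf n v \<oplus>\<^bsub>GD n\<^esub> Hf n w = Hf n (\<lambda>t. v t \<oplus> w t)"
    and "a \<in> carrier R \<Longrightarrow> a \<odot>\<^bsub>GD n\<^esub> Hf n w = Hf n (\<lambda>t. w t \<otimes> a)"
proof -
  show "Hf n v \<oplus>\<^bsub>GD n\<^esub> Hf n w = Hf n (\<lambda>t. v t \<oplus> w t)" if v: "v \<in> seqs"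
    unfolding GD_simps Hf_def
    by (rule restrict_ext) (use seqsD[OF v] seqsD[OF w] in \<open>simp add: Hm_def ct(1)[of _ n] R.r_distr R.a_ac\<close>)
  show "a \<odot>\<^bsub>GD n\<^esub> Hf n w = Hf n (\<lambda>t. w t \<otimes> a)" if "a \<in> carrier R"
    unfolding GD_simps Hf_def
    by (rule restrict_ext) (use seqsD[OF w] that in \<open>simp add: Hm_def ct(1)[of _ n] R.l_distr R.m_assoc\<close>)
qed

lemma cocycles_eq: "Zn n = {Hf n w | w. w \<in> seqs \<and> (\<forall>s<rk (Suc n). Mw n w s = \<zero>)}"
proof -
  have "(\<forall>u \<in> carrier (Pn (Suc n)). Hf n w (dn n u) = \<zero>) \<longleftrightarrow> (\<forall>s<rk (Suc n). Mw n w s = \<zero>)" if w: "w \<in> seqs" for w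
  proof -
    have "(\<forall>u \<in> carrier (Pn (Suc n)). Hf n w (dn n u) = \<zero>) \<longleftrightarrow>
        Hf (Suc n) (Mw n w) = (\<lambda>u \<in> carrier (Pn (Suc n)). \<zero>)"
      by (auto simp: Hf_def dn_in Hm_dn[OF w] fun_eq_iff)
    then show ?thesis using Hf_zero_iff[OF Mw_seqs[OF w], of "Suc n"] by simp
  qed
  then show ?thesis unfolding ext_cocycles_def graded_dual_carrier by auto
qed

lemma coboundaries_Suc: "Bn (Suc n) = {Hf (Suc n) (Mw n w) | w. w \<in> seqs}"
proof -
  have "(\<lambda>u \<in> carrier (Pn (Suc n)). Hf n w (dn n u)) = Hf (Suc n) (Mw n w)" if w: "w \<in> seqs" for w
    unfolding Hf_def[of "Suc n"] by (rule restrict_ext) (simp add: Hf_def dn_in Hm_dn[OF w])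
  then show ?thesis unfolding ext_coboundaries.simps graded_dual_carrier by (auto simp: image_image)
qed

text \<open>
  Tuples that represent coboundaries; in degree \<open>0\<close> these are zero.
\<close>

definition coboundary_tuples :: "nat \<Rightarrow> (nat \<Rightarrow> 'a) set" where
  "coboundary_tuples n = (if n = 0 then {\<lambda>_. \<zero>} else Mw (n - 1) ` seqs)"

lemma coboundary_tuples_seqs: "w \<in> coboundary_tuples n \<Longrightarrow> w \<in> seqs"
  by (auto simp: coboundary_tuples_def seqs_def Mw_def split: if_splits)

lemma coboundaries_eq: "Bn n = Hf n ` coboundary_tuples n"
proof (cases n)
  case 0
  then show ?thesis by (simp add: coboundary_tuples_def GD_simps)
next
  case (Suc m)
  have "{Hf (Suc m) (Mw m w) | w. w \<in> seqs} = Hf (Suc m) ` Mw m ` seqs" by blast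
  then show ?thesis unfolding Suc coboundaries_Suc by (simp add: coboundary_tuples_def)
qed

lemma Mw_diff:
  assumes "v \<in> seqs" "w \<in> seqs"
  shows "Mw m (\<lambda>t. v t \<oplus> w t) t = Mw m v t \<oplus> Mw m w t" "Mw m (\<lambda>t. \<ominus> w t) t = \<ominus> Mw m w t"
  using seqsD[OF assms(1)] seqsD[OF assms(2)] by (simp_all add: Mw_def R.r_distr R.r_minus R.minus_add R.a_ac)

lemma coboundary_tuples_add: "v \<in> coboundary_tuples n \<Longrightarrow> w \<in> coboundary_tuples n \<Longrightarrow> (\<lambda>t. v t \<oplus> w t) \<in> coboundary_tuples n"
proof (cases "n = 0")
  case False
  assume "v \<in> coboundary_tuples n" "w \<in> coboundary_tuples n"
  then obtain v' w' where vw: "v = Mw (n - 1) v'" "v' \<in> seqs" "w = Mw (n - 1) w'" "w' \<in> seqs"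
    unfolding coboundary_tuples_def using False by auto
  have "(\<lambda>t. v t \<oplus> w t) = Mw (n - 1) (\<lambda>t. v' t \<oplus> w' t)" by (rule ext) (simp only: vw(1,3) Mw_diff(1)[OF vw(2,4)])
  moreover have "(\<lambda>t. v' t \<oplus> w' t) \<in> seqs" using seqsD[OF vw(2)] seqsD[OF vw(4)] by (simp add: seqs_def)
  ultimately show ?thesis using False by (simp add: coboundary_tuples_def)
qed (simp add: coboundary_tuples_def)

lemma coboundary_tuples_minus: "w \<in> coboundary_tuples n \<Longrightarrow> (\<lambda>t. \<ominus> w t) \<in> coboundary_tuples n"
proof (cases "n = 0")
  case False
  assume "w \<in> coboundary_tuples n"
  then obtain w' where vw: "w = Mw (n - 1) w'" "w' \<in> seqs"
    unfolding coboundary_tuples_def using False by auto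
  have "(\<lambda>t. \<ominus> w t) = Mw (n - 1) (\<lambda>t. \<ominus> w' t)" by (rule ext) (simp only: vw(1) Mw_diff(2)[OF vw(2,2)])
  moreover have "(\<lambda>t. \<ominus> w' t) \<in> seqs" using seqsD[OF vw(2)] by (simp add: seqs_def)
  ultimately show ?thesis using False by (simp add: coboundary_tuples_def)
qed (simp add: coboundary_tuples_def)

lemma ext_simps:
  "carrier (En n) = (\<lambda>f. Bn n +>\<^bsub>GD n\<^esub> f) ` Zn n" "\<zero>\<^bsub>En n\<^esub> = Bn n"
  "S \<oplus>\<^bsub>En n\<^esub> S' = {f \<oplus>\<^bsub>GD n\<^esub> g | f g. f \<in> S \<and> g \<in> S'}"
  "a \<odot>\<^bsub>En n\<^esub> S = (\<Union>f\<in>S. Bn n +>\<^bsub>GD n\<^esub> (a \<odot>\<^bsub>GD n\<^esub> f))"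
  "Bn n +>\<^bsub>GD n\<^esub> f = {b \<oplus>\<^bsub>GD n\<^esub> f | b. b \<in> Bn n}"
  unfolding ext_module_def quotient_module_def
  by (auto simp: A_RCOSETS_defs a_r_coset_defs set_add_defs)

text \<open>
  All cosets of a subgroup by its own elements are equal.
\<close>

lemma ext_zero:
  assumes Zn: "Zn n \<subseteq> Bn n"
  shows "carrier (En n) = {\<zero>\<^bsub>En n\<^esub>}"
proof -
  have coset: "Bn n +>\<^bsub>GD n\<^esub> f = Bn n" if "f \<in> Bn n" for f
  proof -
    obtain w where w: "w \<in> coboundary_tuples n" "f = Hf n w" using \<open>f \<in> Bn n\<close> unfolding coboundaries_eq by (rule imageE)
    note ws = coboundary_tuples_seqs[OF w(1)]
    have sub: "b \<oplus>\<^bsub>GD n\<^esub> f \<in> Bn n" if "b \<in> Bn n" for b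
    proof -
      obtain v where v: "v \<in> coboundary_tuples n" "b = Hf n v" using \<open>b \<in> Bn n\<close> unfolding coboundaries_eq by (rule imageE)
      show ?thesis
        unfolding v(2) w(2) GD_Hf(1)[OF ws coboundary_tuples_seqs[OF v(1)]] unfolding coboundaries_eq by (rule imageI[OF coboundary_tuples_add[OF v(1) w(1)]])
    qed
    have sup: "\<exists>b. g = b \<oplus>\<^bsub>GD n\<^esub> f \<and> b \<in> Bn n" if "g \<in> Bn n" for g
    proof -
      obtain v where v: "v \<in> coboundary_tuples n" "g = Hf n v" using \<open>g \<in> Bn n\<close> unfolding coboundaries_eq by (rule imageE)
      define v' where "v' = (\<lambda>t. v t \<oplus> \<ominus> w t)"
      have v': "v' \<in> coboundary_tuples n" unfolding v'_def by (rule coboundary_tuples_add[OF v(1) coboundary_tuples_minus[OF w(1)]])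
      have "(\<lambda>t. v' t \<oplus> w t) = v"
        using seqsD[OF coboundary_tuples_seqs[OF v(1)]] seqsD[OF ws] by (simp add: v'_def fun_eq_iff R.a_assoc R.l_neg)
      then have "g = Hf n v' \<oplus>\<^bsub>GD n\<^esub> f" unfolding v(2) w(2) GD_Hf(1)[OF ws coboundary_tuples_seqs[OF v']] by simp
      moreover have "Hf n v' \<in> Bn n" unfolding coboundaries_eq by (rule imageI[OF v'])
      ultimately show ?thesis by (intro exI conjI)
    qed
    show ?thesis unfolding ext_simps(5)
    proof (intro Set.set_eqI iffI)
      fix g assume "g \<in> {b \<oplus>\<^bsub>GD n\<^esub> f | b. b \<in> Bn n}"
      then obtain b where "b \<in> Bn n" "g = b \<oplus>\<^bsub>GD n\<^esub> f" unfolding mem_Collect_eq by (elim exE conjE)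
      then show "g \<in> Bn n" using sub by simp
    next
      fix g assume "g \<in> Bn n"
      then show "g \<in> {b \<oplus>\<^bsub>GD n\<^esub> f | b. b \<in> Bn n}" unfolding mem_Collect_eq by (rule sup)
    qed
  qed
  have "Hf n (\<lambda>_. \<zero>) \<in> Zn n" unfolding cocycles_eq by (auto intro!: exI[of _ "\<lambda>_. \<zero>"] simp: seqs_def Mw_def)
  then have ne: "Zn n \<noteq> {}" by blast
  have "(\<lambda>f. Bn n +>\<^bsub>GD n\<^esub> f) ` Zn n = (\<lambda>f. Bn n) ` Zn n"
    by (rule image_cong[OF refl]) (use coset Zn in blast)
  then show ?thesis unfolding ext_simps(1,2) using ne by (simp add: image_constant_conv)
qed

lemma \<phi>_sc: "a \<in> carrier R \<Longrightarrow> \<phi> (\<kappa> c \<otimes> gx \<otimes> a) = K.fsc c (K.LX (\<phi> a))"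
  "a \<in> carrier R \<Longrightarrow> \<phi> (\<kappa> c \<otimes> gy \<otimes> a) = K.fsc c (K.LY (\<phi> a))"
  by (simp_all add: R.m_assoc \<phi>_\<kappa> \<phi>_x \<phi>_y)

lemma \<phi>_eq_zero: "a \<in> carrier R \<Longrightarrow> a = \<zero> \<longleftrightarrow> \<phi> a = 0"
  using \<phi>_inj[of a \<zero>] by (simp add: \<phi>_zero)

lemma fsc_neg: "K.fsc (- c) f = - K.fsc c f" "K.fsc 1 f = f"
  by (rule K.fsc_fsc(6)) (rule K.fsc_fsc(2))

lemma Mw_\<phi>:
  assumes w: "w \<in> seqs"
  shows "\<phi> (Mw 0 w s) = (if s = 0 then K.LX (\<phi> (w 0)) else if s = 1 then K.LY (\<phi> (w 0)) else if s = 2 then K.LZ (\<phi> (w 0)) else 0)"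
    and "\<phi> (Mw 1 w s) = (if s = 0 then K.LY (\<phi> (w 0)) - K.fsc q (K.LX (\<phi> (w 1))) - \<phi> (w 2)
       else if s = 1 then K.LZ (\<phi> (w 0)) - K.fsc (inverse p) (K.LX (\<phi> (w 2)))
       else if s = 2 then K.LZ (\<phi> (w 1)) - K.fsc p (K.LY (\<phi> (w 2))) else 0)"
    and "\<phi> (Mw 2 w s) = (if s = 0 then K.LZ (\<phi> (w 0)) - K.fsc p (K.LY (\<phi> (w 1))) + K.fsc (q * inverse p) (K.LX (\<phi> (w 2))) else 0)"
  unfolding Mw_def Mx_def
  using seqsD[OF w] by (simp_all add: \<phi>_add \<phi>_x \<phi>_y \<phi>_z \<phi>_\<kappa> \<phi>_sc \<phi>_zero fsc_neg)

lemma tuple_in: "a \<in> carrier R \<Longrightarrow> b \<in> carrier R \<Longrightarrow> c \<in> carrier R \<Longrightarrow>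
   (\<lambda>t. if t = 0 then a else if t = 1 then b else c) \<in> seqs"
  by (simp add: seqs_def)

text \<open>
  In degree \<open>3\<close> the coboundaries are \<open>z A + y A + x A\<close>, the elements without constant term.
\<close>

lemma coboundary_3: "Hf 3 w \<in> Bn 3" if w: "w \<in> seqs" and z: "\<phi> (w 0) 0 0 0 = 0"
proof -
  obtain A B C where A: "A \<in> Fin UNIV" "B \<in> Fin UNIV" "C \<in> Fin UNIV"
    and e: "\<phi> (w 0) = K.LZ A - K.fsc p (K.LY B) + K.fsc (q * inverse p) (K.LX C)"
    using K.dual_coker[OF \<phi>_Fin[OF seqsD[OF w]] K.subspace_UNIV z] by blast
  define v where "v = (\<lambda>t::nat. if t = 0 then \<psi> A else if t = 1 then \<psi> B else \<psi> C)"
  have v: "v \<in> seqs" unfolding v_def by (rule tuple_in) (simp_all add: \<psi> A)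
  have "Hf 3 w = Hf 3 (Mw 2 v)"
  proof (rule Hf_cong[OF w Mw_seqs[OF v]])
    fix t assume "t < rk 3"
    then have "t = 0" by (simp add: rk_def)
    then have "\<phi> (w t) = \<phi> (Mw 2 v t)" unfolding Mw_\<phi>(3)[OF v] using e A by (simp add: v_def \<psi>)
    then show "w t = Mw 2 v t" using \<phi>_inj[OF seqsD[OF w] seqsD[OF Mw_seqs[OF v]]] by simp
  qed
  then show ?thesis using coboundaries_Suc[of 2] v by auto
qed

text \<open>
  In degrees \<open>0\<close>, \<open>1\<close>, \<open>2\<close> this is the exactness of the sequences of left multiplications, and from
  degree \<open>4\<close> on all modules are zero.
\<close>

lemma exactness: "n \<noteq> 3 \<Longrightarrow> Zn n \<subseteq> Bn n"
proof
  fix f assume n: "n \<noteq> 3" and "f \<in> Zn n"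
  then obtain w where w: "w \<in> seqs" "f = Hf n w" and z: "\<And>s. s < rk (Suc n) \<Longrightarrow> Mw n w s = \<zero>"
    unfolding cocycles_eq by blast
  have z': "\<phi> (Mw n w s) = 0" if "s < rk (Suc n)" for s using z[OF that] by (simp add: \<phi>_zero)
  note ws = seqsD[OF w(1)]
  note F = \<phi>_Fin[OF ws]
  consider "n = 0" | "n = 1" | "n = 2" | "n \<ge> 4" using n by linarith
  then show "f \<in> Bn n"
  proof cases
    case 1
    have "K.LX (\<phi> (w 0)) = K.LX 0"
      using z'[of 0] unfolding 1 Mw_\<phi>(1)[OF w(1)] by (simp add: rk_def K.op_zero)
    then have "\<phi> (w 0) = 0" by (rule K.LX_inj)
    then have "w 0 = \<zero>" using \<phi>_eq_zero[OF ws] by simp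
    then have "f = Hf 0 (\<lambda>_. \<zero>)" unfolding w(2) 1 by (intro Hf_cong) (simp_all add: w ws rk_def seqs_def)
    then show ?thesis by (simp add: 1 GD_simps)
  next
    case 2
    have "K.LY (\<phi> (w 0)) - K.fsc q (K.LX (\<phi> (w 1))) - \<phi> (w 2) = 0"
      using z'[of 0] unfolding 2 Mw_\<phi>(2)[OF w(1)] by (simp add: rk_def)
    moreover have "K.LZ (\<phi> (w 0)) - K.fsc (inverse p) (K.LX (\<phi> (w 2))) = 0"
      using z'[of 1] unfolding 2 Mw_\<phi>(2)[OF w(1)] by (simp add: rk_def)
    ultimately obtain A where A: "A \<in> Fin UNIV"
      and e: "\<phi> (w 0) = K.LX A" "\<phi> (w 1) = K.LY A" "\<phi> (w 2) = K.LZ A"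
      using K.dual_exact1[OF F] by blast
    define v where "v = (\<lambda>t::nat. \<psi> A)"
    have v: "v \<in> seqs" using A by (simp add: v_def seqs_def \<psi>)
    have "Hf 1 w = Hf 1 (Mw 0 v)"
    proof (rule Hf_cong[OF w(1) Mw_seqs[OF v]])
      fix t assume "t < rk 1"
      then have "t = 0 \<or> t = 1 \<or> t = 2" by (auto simp: rk_def)
      then have "\<phi> (w t) = \<phi> (Mw 0 v t)" unfolding Mw_\<phi>(1)[OF v] using e A by (auto simp: v_def \<psi>)
      then show "w t = Mw 0 v t" using \<phi>_inj[OF ws seqsD[OF Mw_seqs[OF v]]] by simp
    qed
    then show ?thesis unfolding w(2) 2 using coboundaries_Suc[of 0] v by auto
  next
    case 3
    have "K.LZ (\<phi> (w 0)) - K.fsc p (K.LY (\<phi> (w 1))) + K.fsc (q * inverse p) (K.LX (\<phi> (w 2))) = 0"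
      using z'[of 0] unfolding 3 Mw_\<phi>(3)[OF w(1)] by (simp add: rk_def)
    then obtain A B C where A: "A \<in> Fin UNIV" "B \<in> Fin UNIV" "C \<in> Fin UNIV"
      and e: "\<phi> (w 0) = K.LY A - K.fsc q (K.LX B) - C"
        "\<phi> (w 1) = K.LZ A - K.fsc (inverse p) (K.LX C)" "\<phi> (w 2) = K.LZ B - K.fsc p (K.LY C)"
      using K.dual_exact2[OF F F F K.subspace_UNIV] by blast
    define v where "v = (\<lambda>t::nat. if t = 0 then \<psi> A else if t = 1 then \<psi> B else \<psi> C)"
    have v: "v \<in> seqs" unfolding v_def by (rule tuple_in) (simp_all add: \<psi> A)
    have v': "\<phi> (v 0) = A" "\<phi> (v 1) = B" "\<phi> (v 2) = C" using A by (simp_all add: v_def \<psi>)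
    have "Hf 2 w = Hf 2 (Mw 1 v)"
    proof (rule Hf_cong[OF w(1) Mw_seqs[OF v]])
      fix t assume "t < rk 2"
      then have "t = 0 \<or> t = 1 \<or> t = 2" by (auto simp: rk_def)
      then have "\<phi> (w t) = \<phi> (Mw 1 v t)" unfolding Mw_\<phi>(2)[OF v] v' using e by auto
      then show "w t = Mw 1 v t" using \<phi>_inj[OF ws seqsD[OF Mw_seqs[OF v]]] by simp
    qed
    then show ?thesis unfolding w(2) 3 using coboundaries_Suc[of 1] v by (auto simp: numeral_2_eq_2)
  next
    case 4
    then obtain m where m: "n = Suc m" by (cases n) auto
    have v: "(\<lambda>_. \<zero>) \<in> seqs" by (simp add: seqs_def)
    have "Hf n w = Hf n (Mw m (\<lambda>_. \<zero>))"
      by (rule Hf_cong[OF w(1) Mw_seqs[OF v]]) (use 4 in \<open>simp add: rk_def\<close>)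
    then show ?thesis unfolding w(2) m coboundaries_Suc using v by blast
  qed
qed

subsection \<open>The top cohomology\<close>

text \<open>
  In degree \<open>3\<close> there is one basis element, and a cocycle is classified by the constant term of its
  image.
\<close>

definition val :: "('u \<Rightarrow> 'a) \<Rightarrow> 'k" where "val f = \<phi> (f (basis_elem 0)) 0 0 0"

lemma Zn_3: "Zn 3 = Hf 3 ` seqs"
  unfolding cocycles_eq by (auto simp: rk_def)

lemma val_Hf: "w \<in> seqs \<Longrightarrow> val (Hf 3 w) = \<phi> (w 0) 0 0 0"
  using Hm_gen[of 0 3 w] gen_in[of 0 3] by (simp add: val_def Hf_def rk_def)

lemma Bn_3: "Bn 3 = {f \<in> Zn 3. val f = 0}"
proof (intro equalityI subsetI)
  fix f assume "f \<in> Bn 3"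
  then obtain v where v: "v \<in> seqs" "f = Hf 3 (Mw 2 v)" using coboundaries_Suc[of 2] by auto
  have "\<phi> (Mw 2 v 0) 0 0 0 = 0"
    unfolding Mw_\<phi>(3)[OF v(1)] by (simp add: opx_def opy_def opz_def lift_def)
  then show "f \<in> {f \<in> Zn 3. val f = 0}" using v Mw_seqs[OF v(1)] val_Hf[OF Mw_seqs[OF v(1)]] by (auto simp: Zn_3)
next
  fix f assume "f \<in> {f \<in> Zn 3. val f = 0}"
  then obtain w where w: "w \<in> seqs" "f = Hf 3 w" "val f = 0" by (auto simp: Zn_3)
  then show "f \<in> Bn 3" using coboundary_3[OF w(1)] val_Hf[OF w(1)] by simp
qed

text \<open>
  The cohomology class of the cocycles with constant term \<open>c\<close>.
\<close>

definition ext_class :: "'k \<Rightarrow> ('u \<Rightarrow> 'a) set" where "ext_class c = {f \<in> Zn 3. val f = c}"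

lemma Zn_add: "f \<in> Zn 3 \<Longrightarrow> g \<in> Zn 3 \<Longrightarrow> f \<oplus>\<^bsub>GD 3\<^esub> g \<in> Zn 3 \<and> val (f \<oplus>\<^bsub>GD 3\<^esub> g) = val f + val g"
proof -
  assume "f \<in> Zn 3" "g \<in> Zn 3"
  then obtain v w where v: "v \<in> seqs" "f = Hf 3 v" and w: "w \<in> seqs" "g = Hf 3 w" by (auto simp: Zn_3)
  have s: "(\<lambda>t. v t \<oplus> w t) \<in> seqs" using seqsD[OF v(1)] seqsD[OF w(1)] by (simp add: seqs_def)
  show ?thesis
    unfolding v(2) w(2) GD_Hf(1)[OF w(1) v(1)] val_Hf[OF s] val_Hf[OF v(1)] val_Hf[OF w(1)]
    using s by (simp add: Zn_3 \<phi>_add seqsD[OF v(1)] seqsD[OF w(1)])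
qed

lemma Zn_smult: "f \<in> Zn 3 \<Longrightarrow> a \<in> carrier R \<Longrightarrow> a \<odot>\<^bsub>GD 3\<^esub> f \<in> Zn 3 \<and> val (a \<odot>\<^bsub>GD 3\<^esub> f) = val f * \<phi> a 0 0 0"
proof -
  assume "f \<in> Zn 3" and a: "a \<in> carrier R"
  then obtain v where v: "v \<in> seqs" "f = Hf 3 v" by (auto simp: Zn_3)
  have s: "(\<lambda>t. v t \<otimes> a) \<in> seqs" using seqsD[OF v(1)] a by (simp add: seqs_def)
  show ?thesis
    unfolding v(2) GD_Hf(2)[OF v(1) a] val_Hf[OF s] val_Hf[OF v(1)]
    using s by (simp add: Zn_3 augmentation_mult[OF seqsD[OF v(1)] a])
qed

lemma class_eq:
  assumes f: "f \<in> Zn 3"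
  shows "Bn 3 +>\<^bsub>GD 3\<^esub> f = ext_class (val f)"
proof -
  have sub: "b \<oplus>\<^bsub>GD 3\<^esub> f \<in> ext_class (val f)" if "b \<in> Bn 3" for b
  proof -
    have "b \<in> Zn 3" "val b = 0" using that unfolding Bn_3 by simp_all
    then show ?thesis using Zn_add[OF _ f, of b] by (simp add: ext_class_def)
  qed
  have sup: "\<exists>b. g = b \<oplus>\<^bsub>GD 3\<^esub> f \<and> b \<in> Bn 3" if "g \<in> ext_class (val f)" for g
  proof -
    have gZ: "g \<in> Zn 3" and e: "val g = val f" using that by (simp_all add: ext_class_def)
    obtain v where v: "f = Hf 3 v" "v \<in> seqs" using f unfolding Zn_3 by (rule imageE)
    obtain w where w: "g = Hf 3 w" "w \<in> seqs" using gZ unfolding Zn_3 by (rule imageE)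
    define b where "b = (\<lambda>t. w t \<oplus> \<ominus> v t)"
    have b: "b \<in> seqs" using seqsD[OF v(2)] seqsD[OF w(2)] by (simp add: seqs_def b_def)
    have "(\<lambda>t. b t \<oplus> v t) = w"
      using seqsD[OF v(2)] seqsD[OF w(2)] by (simp add: b_def fun_eq_iff R.a_assoc R.l_neg)
    then have g: "g = Hf 3 b \<oplus>\<^bsub>GD 3\<^esub> f" unfolding v(1) w(1) GD_Hf(1)[OF v(2) b] by simp
    have bZ: "Hf 3 b \<in> Zn 3" unfolding Zn_3 by (rule imageI[OF b])
    have "val (Hf 3 b) + val f = val f" using Zn_add[OF bZ f] e unfolding g by simp
    then have "Hf 3 b \<in> Bn 3" using bZ unfolding Bn_3 by simp
    with g show ?thesis by (intro exI conjI)
  qed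
  show ?thesis unfolding ext_simps(5)
  proof (intro Set.set_eqI iffI)
    fix g assume "g \<in> {b \<oplus>\<^bsub>GD 3\<^esub> f | b. b \<in> Bn 3}"
    then obtain b where "b \<in> Bn 3" "g = b \<oplus>\<^bsub>GD 3\<^esub> f" unfolding mem_Collect_eq by (elim exE conjE)
    then show "g \<in> ext_class (val f)" using sub by simp
  next
    fix g assume "g \<in> ext_class (val f)"
    then show "g \<in> {b \<oplus>\<^bsub>GD 3\<^esub> f | b. b \<in> Bn 3}" unfolding mem_Collect_eq by (rule sup)
  qed
qed

lemma ext_class_rep: "Hf 3 (\<lambda>_. \<kappa> c) \<in> Zn 3" "val (Hf 3 (\<lambda>_. \<kappa> c)) = c"
  by (simp_all add: Zn_3 seqs_def val_Hf) (simp add: \<phi>_gens single3_def)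

lemma ext_class_nonempty: "Hf 3 (\<lambda>_. \<kappa> c) \<in> ext_class c"
  using ext_class_rep by (simp add: ext_class_def)

lemma ext_class_inj: "ext_class c = ext_class d \<Longrightarrow> c = d"
  using ext_class_nonempty[of c] by (auto simp: ext_class_def)

lemma carrier_E3: "carrier (En 3) = range ext_class"
proof -
  have "c \<in> val ` Zn 3" for c by (rule image_eqI[of _ _ "Hf 3 (\<lambda>_. \<kappa> c)"]) (simp_all add: ext_class_rep)
  then have v: "val ` Zn 3 = UNIV" by blast
  have "carrier (En 3) = (\<lambda>f. ext_class (val f)) ` Zn 3"
    unfolding ext_simps(1) by (rule image_cong[OF refl]) (rule class_eq)
  also have "\<dots> = ext_class ` val ` Zn 3" by (simp only: image_image)
  finally show ?thesis unfolding v .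
qed

lemma E3_add: "ext_class c \<oplus>\<^bsub>En 3\<^esub> ext_class d = ext_class (c + d)"
proof -
  let ?h = "Hf 3 (\<lambda>_. \<kappa> d)"
  have sub: "g \<oplus>\<^bsub>GD 3\<^esub> h \<in> ext_class (c + d)" if "g \<in> ext_class c" "h \<in> ext_class d" for g h
    using Zn_add[of g h] that by (simp add: ext_class_def)
  have sup: "\<exists>g h. f = g \<oplus>\<^bsub>GD 3\<^esub> h \<and> g \<in> ext_class c \<and> h \<in> ext_class d" if "f \<in> ext_class (c + d)" for f
  proof -
    have f: "f \<in> Zn 3" "val f = c + d" using that by (simp_all add: ext_class_def)
    obtain w where w: "f = Hf 3 w" "w \<in> seqs" using f(1) unfolding Zn_3 by (rule imageE)
    define b where "b = (\<lambda>t. w t \<oplus> \<ominus> \<kappa> d)"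
    have b: "b \<in> seqs" using seqsD[OF w(2)] by (simp add: seqs_def b_def)
    have k: "(\<lambda>_. \<kappa> d) \<in> seqs" by (simp add: seqs_def)
    have "(\<lambda>t. b t \<oplus> \<kappa> d) = w"
      using seqsD[OF w(2)] by (simp add: b_def fun_eq_iff R.a_assoc R.l_neg)
    then have g: "f = Hf 3 b \<oplus>\<^bsub>GD 3\<^esub> ?h" unfolding w(1) GD_Hf(1)[OF k b] by simp
    have bZ: "Hf 3 b \<in> Zn 3" unfolding Zn_3 by (rule imageI[OF b])
    have "val (Hf 3 b) + d = c + d" using Zn_add[OF bZ ext_class_rep(1)[of d]] f(2) ext_class_rep(2)[of d] unfolding g by simp
    then have "Hf 3 b \<in> ext_class c" using bZ by (simp add: ext_class_def)
    with g ext_class_nonempty[of d] show ?thesis by (intro exI conjI)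
  qed
  show ?thesis unfolding ext_simps(3)
  proof (intro Set.set_eqI iffI)
    fix f assume "f \<in> {g \<oplus>\<^bsub>GD 3\<^esub> h | g h. g \<in> ext_class c \<and> h \<in> ext_class d}"
    then obtain g h where "g \<in> ext_class c" "h \<in> ext_class d" "f = g \<oplus>\<^bsub>GD 3\<^esub> h" unfolding mem_Collect_eq by (elim exE conjE)
    then show "f \<in> ext_class (c + d)" using sub by simp
  next
    fix f assume "f \<in> ext_class (c + d)"
    then show "f \<in> {g \<oplus>\<^bsub>GD 3\<^esub> h | g h. g \<in> ext_class c \<and> h \<in> ext_class d}" unfolding mem_Collect_eq by (rule sup)
  qed
qed

lemma E3_smult: "a \<in> carrier R \<Longrightarrow> a \<odot>\<^bsub>En 3\<^esub> ext_class c = ext_class (c * \<phi> a 0 0 0)"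
proof -
  assume a: "a \<in> carrier R"
  have "Bn 3 +>\<^bsub>GD 3\<^esub> (a \<odot>\<^bsub>GD 3\<^esub> f) = ext_class (c * \<phi> a 0 0 0)" if "f \<in> ext_class c" for f
    using class_eq[of "a \<odot>\<^bsub>GD 3\<^esub> f"] Zn_smult[OF _ a, of f] that by (simp add: ext_class_def)
  then show ?thesis unfolding ext_simps(4) using ext_class_nonempty[of c] by auto
qed

definition ext_value :: "('u \<Rightarrow> 'a) set \<Rightarrow> 'a" where
  "ext_value = (\<lambda>S \<in> carrier (En 3). \<kappa> (THE c. S = ext_class c))"

lemma ext_value: "ext_value (ext_class c) = \<kappa> c"
proof -
  have "(THE d. ext_class c = ext_class d) = c" by (rule the_equality) (use ext_class_inj in blast)+
  then show ?thesis by (simp add: ext_value_def carrier_E3)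
qed

text \<open>
  The class of a cocycle is determined by its constant term, which identifies the cohomology with
  the field, as right modules. The basis element has degree \<open>4\<close>, so that the class with constant
  term \<open>1\<close> has degree \<open>-4\<close>.
\<close>

lemma ext_top:
  "graded_iso (opposite R) (En 3) (ext_grading R Gr Pn Dn dn 3)
     (trivial_module (opposite R) Gr) (shift 4 (trivial_grading (opposite R) Gr))"
  unfolding graded_iso_def
proof (intro bexI conjI allI)
  show "ext_value \<in> lmod_hom (opposite R) (En 3) (trivial_module (opposite R) Gr)"
    unfolding lmod_hom_def
    by (auto simp: carrier_E3 ext_value E3_add E3_smult trivial_opposite opposite_simps) (simp add: ext_value_def carrier_E3)
  show "bij_betw ext_value (carrier (En 3)) (carrier (trivial_module (opposite R) Gr))"
  proof (rule bij_betwI')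
    show "ext_value S = ext_value S' \<longleftrightarrow> S = S'" if "S \<in> carrier (En 3)" "S' \<in> carrier (En 3)" for S S'
      using that unfolding carrier_E3 by (auto simp: ext_value \<kappa>_inj)
    show "ext_value S \<in> carrier (trivial_module (opposite R) Gr)" if "S \<in> carrier (En 3)" for S
      using that unfolding carrier_E3 trivial_opposite by (auto simp: ext_value)
    show "\<exists>S \<in> carrier (En 3). u = ext_value S" if "u \<in> carrier (trivial_module (opposite R) Gr)" for u
      using that unfolding carrier_E3 trivial_opposite by (auto simp: ext_value)
  qed
  fix j
  have eg: "ext_grading R Gr Pn Dn dn 3 j = (\<lambda>f. ext_class (val f)) ` (Zn 3 \<inter> hom_degree R Gr (Pn 3) (Dn 3) j)"
    unfolding ext_grading_def by (rule image_cong[OF refl]) (simp add: class_eq)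
  have deg: "val f = 0 \<or> j = - 4" if f: "f \<in> hom_degree R Gr (Pn 3) (Dn 3) j" for f
  proof -
    have "basis_elem 0 \<in> Dn 3 4"
      unfolding Dn_ct using gen_in[of 0 3] ct_gen[of 0 3] int_piece_closed(2) int_piece_gens(4)[of 1]
      by (auto simp: rk_def sh_def \<kappa>_ring)
    then have "f (basis_elem 0) \<in> int_piece (4 + j)" using f unfolding hom_degree_def int_grading_eq by blast
    then have "\<forall>a b c. \<phi> (f (basis_elem 0)) a b c \<noteq> 0 \<longrightarrow> int (a + 2 * b + c) = 4 + j" unfolding int_piece_def homog_def by simp
    then have "\<phi> (f (basis_elem 0)) 0 0 0 \<noteq> 0 \<longrightarrow> int (0 + 2 * 0 + 0) = 4 + j" by blast
    then show ?thesis by (auto simp: val_def)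
  qed
  have rep: "Hf 3 (\<lambda>_. \<kappa> c) \<in> hom_degree R Gr (Pn 3) (Dn 3) j" if "c = 0 \<or> j = - 4" for c
  proof (rule Hf_degree)
    show "\<kappa> c \<in> int_piece (j + sh 3 t)" for t
      using that int_piece_gens(4)[of c] int_piece_closed(2) by (auto simp: sh_def \<kappa>_ring)
  qed
  have tg: "shift 4 (trivial_grading (opposite R) Gr) j = (if j = - 4 then range \<kappa> else {\<kappa> 0})"
    by (auto simp: shift_def trivial_grading_def Gr_0 opposite_simps \<kappa>_ring)
  show "ext_value ` ext_grading R Gr Pn Dn dn 3 j = shift 4 (trivial_grading (opposite R) Gr) j"
  proof (intro equalityI subsetI)
    fix u assume "u \<in> ext_value ` ext_grading R Gr Pn Dn dn 3 j"
    then obtain f where f: "f \<in> hom_degree R Gr (Pn 3) (Dn 3) j" "u = \<kappa> (val f)" unfolding eg by (auto simp: ext_value)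
    then show "u \<in> shift 4 (trivial_grading (opposite R) Gr) j" unfolding tg using deg[OF f(1)] by auto
  next
    fix u assume "u \<in> shift 4 (trivial_grading (opposite R) Gr) j"
    then obtain c where c: "u = \<kappa> c" "c = 0 \<or> j = - 4" unfolding tg by (auto split: if_splits)
    have "ext_class (val (Hf 3 (\<lambda>_. \<kappa> c))) \<in> ext_grading R Gr Pn Dn dn 3 j"
      unfolding eg using rep[OF c(2)] ext_class_rep(1) by blast
    then have "ext_class c \<in> ext_grading R Gr Pn Dn dn 3 j" by (simp only: ext_class_rep(2))
    then show "u \<in> ext_value ` ext_grading R Gr Pn Dn dn 3 j"
      unfolding c(1) using ext_value[of c] image_eqI[of "\<kappa> c" ext_value "ext_class c"] by simp
  qed
qed

theorem Gorenstein: "left_Gorenstein TYPE('u) R Gr 3 4"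
  unfolding left_Gorenstein_def
  using graded_resolution ext_zero[OF exactness] ext_top by blast

end

section \<open>The Gelfand--Kirillov dimension\<close>

context PBW begin

text \<open>
  The subspace spanned by the monomials with exponents in \<open>T\<close>.
\<close>

definition supported :: "(nat \<times> nat \<times> nat) set \<Rightarrow> 'a set" where
  "supported T = {a \<in> carrier R. \<forall>i j k. (i, j, k) \<notin> T \<longrightarrow> \<phi> a i j k = 0}"

definition monom_of :: "nat \<times> nat \<times> nat \<Rightarrow> 'a" where
  "monom_of t = (case t of (i, j, k) \<Rightarrow> mon i j k)"

lemma \<phi>_monom_of: "monom_of t \<in> carrier R" "\<phi> (monom_of t) i j k = (if t = (i, j, k) then 1 else 0)"
  by (cases t, auto simp: monom_of_def mon single3_def)+

lemma subalgebraI: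
  assumes "S \<subseteq> carrier R" "\<zero> \<in> S" "\<And>a b. a \<in> S \<Longrightarrow> b \<in> S \<Longrightarrow> a \<oplus> b \<in> S"
    and "\<And>c a. a \<in> S \<Longrightarrow> \<kappa> c \<otimes> a \<in> S"
  shows "subalgebra (range \<kappa>) S R"
proof -
  have m: "\<ominus> a = \<kappa> (- 1) \<otimes> a" if "a \<in> carrier R" for a
    using that R.l_minus[of \<one> a] by (simp add: \<kappa>_ring)
  have "subgroup S (add_monoid R)"
  proof (rule R.add.subgroupI)
    show "\<ominus> a \<in> S" if "a \<in> S" for a
      using m[of a] assms(1,4) that by auto
  qed (use assms in auto)
  then show ?thesis
    using assms(4) by (auto simp: subalgebra_def subalgebra_axioms_def)
qed

lemma supported_subalgebra: "subalgebra (range \<kappa>) (supported T) R"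
  by (rule subalgebraI) (auto simp: supported_def \<phi>_zero \<phi>_add \<phi>_\<kappa> lift_def)

lemma supported_mono: "T \<subseteq> T' \<Longrightarrow> supported T \<subseteq> supported T'"
  unfolding supported_def by blast

lemma monom_of_supported: "t \<in> T \<Longrightarrow> monom_of t \<in> supported T"
  by (auto simp: supported_def \<phi>_monom_of)

lemma Span_monom_of: "R.Span (range \<kappa>) (map monom_of ts) = supported (set ts)"
proof
  show "R.Span (range \<kappa>) (map monom_of ts) \<subseteq> supported (set ts)"
    by (rule R.subalgebra_Span_incl[OF subfield_\<kappa> supported_subalgebra]) (auto simp: monom_of_supported)
  show "supported (set ts) \<subseteq> R.Span (range \<kappa>) (map monom_of ts)"
  proof (induction ts)
    case Nil
    show ?case
    proof
      fix a assume "a \<in> supported (set [])"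
      then have a: "a \<in> carrier R" "\<phi> a = 0" by (auto simp: supported_def fun_eq_iff)
      then have "a = \<zero>" using \<phi>_inj[of a \<zero>] by (simp add: \<phi>_zero)
      then show "a \<in> R.Span (range \<kappa>) (map monom_of [])" by simp
    qed
  next
    case (Cons t ts)
    show ?case
    proof
      fix a assume "a \<in> supported (set (t # ts))"
      then have a: "a \<in> carrier R" and z: "\<And>i j k. (i, j, k) \<noteq> t \<Longrightarrow> (i, j, k) \<notin> set ts \<Longrightarrow> \<phi> a i j k = 0"
        by (auto simp: supported_def)
      define c where "c = (case t of (i, j, k) \<Rightarrow> \<phi> a i j k)"
      define b where "b = a \<ominus> \<kappa> c \<otimes> monom_of t"
      have b: "b \<in> carrier R" using a by (simp add: b_def \<phi>_monom_of)
      have "\<phi> b i j k = (if t = (i, j, k) then 0 else \<phi> a i j k)" for i j k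
        using a by (auto simp: b_def \<phi>_sub \<phi>_\<kappa> \<phi>_monom_of lift_def c_def)
      then have "b \<in> supported (set ts)" using b z by (auto simp: supported_def)
      then have "b \<in> R.Span (range \<kappa>) (map monom_of ts)" using Cons by blast
      moreover have "a = \<kappa> c \<otimes> monom_of t \<oplus> b"
        using a unfolding b_def by (simp add: \<phi>_monom_of R.minus_eq R.a_ac R.r_neg)
      ultimately show "a \<in> R.Span (range \<kappa>) (map monom_of (t # ts))"
        by (auto simp: R.line_extension_mem_iff)
    qed
  qed
qed

lemma dimension_supported:
  assumes "finite T"
  shows "R.dimension (card T) (range \<kappa>) (supported T)"
proof -
  obtain ts where ts: "set ts = T" "distinct ts" using finite_distinct_list[OF assms] by blast
  have "R.independent (range \<kappa>) (map monom_of ts)" using ts(2)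
  proof (induction ts)
    case (Cons t ts)
    have "monom_of t \<notin> supported (set ts)" using Cons.prems by (cases t) (auto simp: supported_def \<phi>_monom_of)
    then show ?case using Cons by (simp add: \<phi>_monom_of Span_monom_of R.li_Cons del: R.Span.simps)
  qed simp
  then have "R.dimension (length (map monom_of ts)) (range \<kappa>) (supported (set ts))"
    by (rule R.dimensionI[OF subfield_\<kappa>]) (rule Span_monom_of)
  then show ?thesis using ts distinct_card[OF ts(2)] by simp
qed

lemma finite_supported: "finite T \<Longrightarrow> R.finite_dimension (range \<kappa>) (supported T)"
  by (rule R.finite_dimensionI[OF dimension_supported])

text \<open>
  Monotonicity of the dimension; a subspace of a finite-dimensional space is finite-dimensional, and
  a basis of it is at most as long as a basis of the whole space.
\<close>

lemma dim_mono:
  assumes E: "subalgebra (range \<kappa>) E R" and F: "R.dimension n (range \<kappa>) F" and EF: "E \<subseteq> F"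
  shows "R.dim (range \<kappa>) E \<le> n"
proof -
  have "R.finite_dimension (range \<kappa>) E"
    by (rule R.subalbegra_incl_imp_finite_dimension[OF subfield_\<kappa> R.finite_dimensionI[OF F] E EF])
  from R.finite_dimensionE[OF subfield_\<kappa> this]
  have d: "R.dimension (R.dim (range \<kappa>) E) (range \<kappa>) E" by (simp add: over_def)
  then obtain Us where Us: "set Us \<subseteq> carrier R" "R.independent (range \<kappa>) Us"
      "length Us = R.dim (range \<kappa>) E" "R.Span (range \<kappa>) Us = E"
    using R.exists_base[OF subfield_\<kappa> d] by blast
  have "set Us \<subseteq> F" using R.Span_base_incl[OF subfield_\<kappa> Us(1)] Us(4) EF by blast
  then show ?thesis using R.independent_length_le_dimension[OF subfield_\<kappa> F Us(2)] Us(3) by simp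
qed

lemma dim_mono_supported:
  assumes T: "finite T" and E: "R.dimension m (range \<kappa>) E" and TE: "supported T \<subseteq> E"
  shows "card T \<le> R.dim (range \<kappa>) E"
proof -
  have "R.dim (range \<kappa>) (supported T) = card T" using R.dimI[OF subfield_\<kappa> dimension_supported[OF T]] by (simp add: over_def)
  moreover have "R.dim (range \<kappa>) E = m" using R.dimI[OF subfield_\<kappa> E] by (simp add: over_def)
  ultimately show ?thesis using dim_mono[OF supported_subalgebra E TE] by simp
qed

subsection \<open>The filtration by degree\<close>

definition exponents :: "nat \<Rightarrow> (nat \<times> nat \<times> nat) set" where "exponents d = {(i, j, k). i + 2 * j + k \<le> d}"

lemma exponents_sub: "exponents d \<subseteq> {..d} \<times> {..d} \<times> {..d}"
  by (auto simp: exponents_def)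

lemma exponents_finite: "finite (exponents d)" by (rule finite_subset[OF exponents_sub]) simp

lemma exponents_card: "card (exponents d) \<le> (d + 1) ^ 3"
proof -
  have "card (exponents d) \<le> card ({..d} \<times> {..d} \<times> {..d})" by (rule card_mono[OF _ exponents_sub]) simp
  also have "\<dots> = (d + 1) ^ 3" by (simp add: card_cartesian_product power3_eq_cube)
  finally show ?thesis .
qed

lemma supported_sum: "finite A \<Longrightarrow> (\<And>x. x \<in> A \<Longrightarrow> f x \<in> supported T) \<Longrightarrow> finsum R f A \<in> supported T"
proof (induction A rule: finite_induct)
  case empty
  show ?case by (simp add: supported_def \<phi>_zero)
next
  case (insert x A)
  have c: "supported T \<subseteq> carrier R" by (auto simp: supported_def)
  have "finsum R f (insert x A) = f x \<oplus> finsum R f A"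
    using insert c by (intro R.finsum_insert) auto
  moreover have "f x \<in> supported T" "finsum R f A \<in> supported T" using insert by auto
  ultimately show ?case by (simp add: supported_def \<phi>_add)
qed

lemma int_piece_supported: "a \<in> int_piece m \<Longrightarrow> m \<le> int d \<Longrightarrow> a \<in> supported (exponents d)"
  unfolding int_piece_def homog_def supported_def exponents_def by fastforce

lemma degree_decomposition:
  assumes a: "a \<in> supported (exponents d)"
  shows "finsum R (\<lambda>m. truncation m a) {0..int d} = a" "\<And>m. truncation m a \<in> int_piece m"
proof -
  have ac: "a \<in> carrier R" using a by (simp add: supported_def)
  show "finsum R (\<lambda>m. truncation m a) {0..int d} = a"
  proof -
    have "i + 2 * j + k \<le> d" if "\<phi> a i j k \<noteq> 0" for i j k
      using a that by (fastforce simp: supported_def exponents_def)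
    then have "int (i + 2 * j + k) - 0 \<in> {0..int d}" if "\<phi> a i j k \<noteq> 0" for i j k
      using that by force
    then show ?thesis using truncation_sum[OF ac, of "{0..int d}" 0] by simp
  qed
  show "\<And>m. truncation m a \<in> int_piece m" by (rule truncation(1)[OF ac])
qed

text \<open>
  Splitting both factors into homogeneous components reduces this to the grading.
\<close>

lemma supported_mult:
  assumes a: "a \<in> supported (exponents d)" and b: "b \<in> supported (exponents e)"
  shows "a \<otimes> b \<in> supported (exponents (d + e))"
proof -
  note A = degree_decomposition[OF a] and B = degree_decomposition[OF b]
  have ac: "a \<in> carrier R" and bc: "b \<in> carrier R" using a b by (auto simp: supported_def)
  have c: "(\<lambda>m. truncation m a) \<in> {0..int d} \<rightarrow> carrier R" "(\<lambda>m. truncation m b) \<in> {0..int e} \<rightarrow> carrier R"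
    using A(2) B(2) int_piece_closed(1) by blast+
  have "finsum R (\<lambda>m. truncation m a) {0..int d} \<otimes> b = finsum R (\<lambda>m. truncation m a \<otimes> b) {0..int d}"
    by (rule R.finsum_ldistr[OF _ bc c(1)]) simp
  then have e: "a \<otimes> b = finsum R (\<lambda>m. truncation m a \<otimes> b) {0..int d}" unfolding A(1) .
  show ?thesis unfolding e
  proof (rule supported_sum)
    fix m assume m: "m \<in> {0..int d}"
    have mc: "truncation m a \<in> carrier R" using A(2) int_piece_closed(1) by blast
    have "truncation m a \<otimes> finsum R (\<lambda>l. truncation l b) {0..int e} = finsum R (\<lambda>l. truncation m a \<otimes> truncation l b) {0..int e}"
      by (rule R.finsum_rdistr[OF _ mc c(2)]) simp
    then have e: "truncation m a \<otimes> b = finsum R (\<lambda>l. truncation m a \<otimes> truncation l b) {0..int e}" unfolding B(1) .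
    show "truncation m a \<otimes> b \<in> supported (exponents (d + e))" unfolding e
    proof (rule supported_sum)
      fix l assume l: "l \<in> {0..int e}"
      show "truncation m a \<otimes> truncation l b \<in> supported (exponents (d + e))"
        by (rule int_piece_supported[OF int_piece_mult[OF A(2) B(2)]]) (use m l in simp)
    qed simp
  qed simp
qed

lemma one_supported: "\<one> \<in> supported (exponents d)"
  by (auto simp: supported_def \<phi>_one single3_def exponents_def)

lemma supported_exhaust:
  assumes "finite A" "A \<subseteq> carrier R"
  shows "\<exists>d. A \<subseteq> supported (exponents d)"
  using assms
proof (induction A rule: finite_induct)
  case (insert a A)
  then obtain d where d: "A \<subseteq> supported (exponents d)" by blast
  obtain N where N: "\<And>i j k. N \<le> i + j + k \<Longrightarrow> \<phi> a i j k = 0" using FinE[OF \<phi>_Fin, of a] insert by auto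
  have "a \<in> supported (exponents (2 * N))"
    unfolding supported_def exponents_def using N insert by auto
  moreover have "exponents d \<subseteq> exponents (d + 2 * N)" "exponents (2 * N) \<subseteq> exponents (d + 2 * N)" by (auto simp: exponents_def)
  ultimately show ?case using d supported_mono by blast
qed simp

lemma power_span_subalgebra:
  assumes "V \<subseteq> carrier R"
  shows "subalgebra (range \<kappa>) (power_span (range \<kappa>) R V n) R"
proof -
  let ?F = "{W. subalgebra (range \<kappa>) W R \<and> {foldr (\<otimes>) vs \<one> | vs. set vs \<subseteq> V \<and> length vs \<le> n} \<subseteq> W}"
  have pr: "foldr (\<otimes>) vs \<one> \<in> carrier R" if "set vs \<subseteq> V" for vs using that assms by (induction vs) auto
  have top: "carrier R \<in> ?F" using R.carrier_is_subalgebra[of "range \<kappa>"] pr gens(4) by blast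
  have cl: "\<zero> \<in> W" "a \<in> W \<Longrightarrow> b \<in> W \<Longrightarrow> a \<oplus> b \<in> W" "a \<in> W \<Longrightarrow> \<kappa> c \<otimes> a \<in> W" if "W \<in> ?F" for W a b c
  proof -
    have W: "subgroup W (add_monoid R)" "\<And>k v. k \<in> range \<kappa> \<Longrightarrow> v \<in> W \<Longrightarrow> k \<otimes> v \<in> W"
      using that by (simp_all add: subalgebra_def subalgebra_axioms_def)
    show "\<zero> \<in> W" using subgroup.one_closed[OF W(1)] by simp
    show "a \<in> W \<Longrightarrow> b \<in> W \<Longrightarrow> a \<oplus> b \<in> W" using subgroup.m_closed[OF W(1), of a b] by simp
    show "a \<in> W \<Longrightarrow> \<kappa> c \<otimes> a \<in> W" by (rule W(2)[OF rangeI])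
  qed
  show ?thesis unfolding power_span_def
  proof (rule subalgebraI)
    show "\<Inter>?F \<subseteq> carrier R" by (rule Inter_lower[OF top])
    show "\<zero> \<in> \<Inter>?F" by (rule InterI) (rule cl(1))
    show "a \<oplus> b \<in> \<Inter>?F" if "a \<in> \<Inter>?F" "b \<in> \<Inter>?F" for a b
      by (rule InterI) (rule cl(2)[OF _ InterD[OF that(1)] InterD[OF that(2)]])
    show "\<kappa> c \<otimes> a \<in> \<Inter>?F" if "a \<in> \<Inter>?F" for a c
      by (rule InterI) (rule cl(3)[OF _ InterD[OF that]])
  qed
qed

text \<open>
  The elements of \<open>V\<close> have bounded degree, so that products of \<open>n\<close> of them have degree growing
  linearly in \<open>n\<close>.
\<close>

lemma power_span_upper:
  assumes V: "V \<subseteq> supported (exponents d)"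
  shows "power_span (range \<kappa>) R V n \<subseteq> supported (exponents (n * d))"
proof -
  have pr: "foldr (\<otimes>) vs \<one> \<in> supported (exponents (length vs * d))" if "set vs \<subseteq> V" for vs
    using that
  proof (induction vs)
    case Nil show ?case by (simp add: one_supported)
  next
    case (Cons v vs) then show ?case using supported_mult[of v d "foldr (\<otimes>) vs \<one>" "length vs * d"] V by auto
  qed
  have "exponents (length vs * d) \<subseteq> exponents (n * d)" if "length vs \<le> n" for vs :: "'a list"
  proof -
    have "length vs * d \<le> n * d" using that by (rule mult_le_mono1)
    then show ?thesis unfolding exponents_def by (auto intro: order_trans)
  qed
  then have "{foldr (\<otimes>) vs \<one> | vs. set vs \<subseteq> V \<and> length vs \<le> n} \<subseteq> supported (exponents (n * d))"
    using pr supported_mono by blast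
  then show ?thesis unfolding power_span_def using supported_subalgebra by blast
qed

lemma mon_foldr: "mon i j k = foldr (\<otimes>) (replicate i gx @ replicate j gz @ replicate k gy) \<one>"
proof -
  have "foldr (\<otimes>) (replicate n g) e = ((\<otimes>) g ^^ n) e" for n g e by (induction n) simp_all
  then show ?thesis by (simp add: mon_def)
qed

text \<open>
  The generators have degree at most \<open>2\<close>, and \<open>x\<^sup>i z\<^sup>j y\<^sup>k\<close> is a product of \<open>i + j + k\<close> of them.
\<close>

lemma power_span_lower:
  assumes T: "T \<subseteq> {(i, j, k). i + j + k \<le> n}" and "finite T"
  shows "supported T \<subseteq> power_span (range \<kappa>) R (supported (exponents 2)) n"
proof -
  have c: "supported (exponents 2) \<subseteq> carrier R" by (auto simp: supported_def)
  have g: "gx \<in> supported (exponents 2)" "gy \<in> supported (exponents 2)" "gz \<in> supported (exponents 2)"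
    by (auto simp: supported_def \<phi>_gens single3_def exponents_def)
  have m: "monom_of t \<in> power_span (range \<kappa>) R (supported (exponents 2)) n" if t: "t \<in> T" for t
  proof -
    obtain i j k where ijk: "t = (i, j, k)" by (cases t)
    let ?vs = "replicate i gx @ replicate j gz @ replicate k gy"
    have "set ?vs \<subseteq> supported (exponents 2)" using g by auto
    moreover have "length ?vs \<le> n" using t T ijk by auto
    moreover have "monom_of t = foldr (\<otimes>) ?vs \<one>" by (simp add: ijk monom_of_def mon_foldr del: foldr_append)
    ultimately show ?thesis unfolding power_span_def by blast
  qed
  obtain ts where ts: "set ts = T" using finite_list[OF \<open>finite T\<close>] by blast
  show ?thesis
    unfolding ts[symmetric] Span_monom_of[symmetric]
  proof (rule R.subalgebra_Span_incl[OF subfield_\<kappa> power_span_subalgebra[OF c]])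
    show "set (map monom_of ts) \<subseteq> power_span (range \<kappa>) R (supported (exponents 2)) n"
      unfolding set_map ts by (rule image_subsetI) (rule m)
  qed
qed

text \<open>
  If \<open>V\<close> has degree at most \<open>d\<close>, then the dimension of the \<open>n\<close>-th span is at most the number
  \<open>(n d + 1)\<^sup>3\<close> of monomials with exponents at most \<open>n d\<close>. For the elements of degree at most \<open>2\<close>, it
  is at least the number of monomials with exponents at most \<open>n/3\<close>. Both bounds are multiples of
  \<open>n\<^sup>3\<close>, up to lower order.
\<close>

theorem GK_dim_eq_3: "GK_dim (range \<kappa>) R = 3"
proof (rule antisym)
  let ?K = "range \<kappa>"
  show "GK_dim ?K R \<le> 3" unfolding GK_dim_def
  proof (rule SUP_least)
    fix V assume "V \<in> {V. subalgebra ?K V R \<and> R.finite_dimension ?K V}"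
    then have sV: "subalgebra ?K V R" and fV: "R.finite_dimension ?K V" by auto
    obtain m where m: "R.dimension m ?K V" using fV by blast
    obtain Us where Us: "set Us \<subseteq> carrier R" "R.Span ?K Us = V"
      using R.exists_base[OF subfield_\<kappa> m] by blast
    obtain d where d: "set Us \<subseteq> supported (exponents d)" using supported_exhaust[OF finite_set Us(1)] by blast
    have V: "V \<subseteq> supported (exponents d)" using R.subalgebra_Span_incl[OF subfield_\<kappa> supported_subalgebra d] Us(2) by simp
    have Vc: "V \<subseteq> carrier R" using V by (auto simp: supported_def)
    have bound: "R.dim ?K (power_span ?K R V n) \<le> (n * d + 1) ^ 3" for n
      using dim_mono[OF power_span_subalgebra[OF Vc] dimension_supported[OF exponents_finite] power_span_upper[OF V]] exponents_card
      by (rule order_trans)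
    have ev: "\<forall>\<^sub>F n in sequentially. ereal (log (real n) (real (R.dim ?K (power_span ?K R V n))))
        \<le> ereal (3 + 3 * (ln (real (d + 1)) / ln (real n)))"
    proof (rule eventually_sequentiallyI[of 2])
      fix n :: nat assume n: "2 \<le> n"
      let ?D = "R.dim ?K (power_span ?K R V n)"
      \<comment> \<open>so the dimension is at most \<open>n\<^sup>3 (d + 1)\<^sup>3\<close>, whose logarithm to base \<open>n\<close> tends to \<open>3\<close>\<close>
      have "n * d + 1 \<le> n * (d + 1)" using n by simp
      then have "(n * d + 1) ^ 3 \<le> (n * (d + 1)) ^ 3" by (rule power_mono) simp
      with bound[of n] have "?D \<le> (n * (d + 1)) ^ 3" by (rule order_trans)
      then have D: "real ?D \<le> (real n * real (d + 1)) ^ 3"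
        by (metis of_nat_le_iff of_nat_mult of_nat_power)
      have pos: "0 < (real n * real (d + 1)) ^ 3" "1 \<le> (real n * real (d + 1)) ^ 3" using n
        by (simp_all add: one_le_power mult_ge1_I)
      have "log (real n) (real ?D) \<le> log (real n) ((real n * real (d + 1)) ^ 3)"
      proof (cases "?D = 0")
        case True
        then show ?thesis using n pos by (simp add: log_def zero_le_divide_iff del: power_mult_distrib)
      next
        case False
        then show ?thesis using D n by (subst log_le_cancel_iff) auto
      qed
      also have "\<dots> = 3 + 3 * (ln (real (d + 1)) / ln (real n))"
        using n by (simp add: log_def ln_mult ln_realpow add_divide_distrib)
      finally show "ereal (log (real n) (real ?D)) \<le> ereal (3 + 3 * (ln (real (d + 1)) / ln (real n)))" by simp
    qed
    have "((\<lambda>n. 3 + 3 * (ln (real (d + 1)) / ln (real n))) \<longlongrightarrow> 3 + 3 * 0) sequentially"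
      by (intro tendsto_intros tendsto_divide_0[OF tendsto_const] filterlim_at_top_imp_at_infinity
          filterlim_compose[OF ln_at_top filterlim_real_sequentially])
    then have "limsup (\<lambda>n. ereal (3 + 3 * (ln (real (d + 1)) / ln (real n)))) = ereal 3"
      by (intro lim_imp_Limsup) simp_all
    then show "limsup (\<lambda>n. ereal (log (real n) (real (R.dim ?K (power_span ?K R V n))))) \<le> 3"
      using Limsup_mono[OF ev] by simp
  qed
  let ?V = "supported (exponents 2)"
  have Vc: "?V \<subseteq> carrier R" by (auto simp: supported_def)
  have bound: "((n div 3) + 1) ^ 3 \<le> R.dim ?K (power_span ?K R ?V n)" for n
  proof -
    let ?T = "{..n div 3} \<times> {..n div 3} \<times> {..n div 3}"
    have T: "supported ?T \<subseteq> power_span ?K R ?V n" by (rule power_span_lower) auto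
    have "R.finite_dimension ?K (power_span ?K R ?V n)"
      by (rule R.subalbegra_incl_imp_finite_dimension[OF subfield_\<kappa> finite_supported[OF exponents_finite]
            power_span_subalgebra[OF Vc] power_span_upper[OF order_refl]])
    then obtain m where m: "R.dimension m ?K (power_span ?K R ?V n)" by blast
    have "card ?T \<le> R.dim ?K (power_span ?K R ?V n)" by (rule dim_mono_supported[OF _ m T]) simp
    moreover have "card ?T = ((n div 3) + 1) ^ 3" by (simp add: card_cartesian_product power3_eq_cube)
    ultimately show ?thesis by simp
  qed
  have ev: "\<forall>\<^sub>F n in sequentially. ereal (3 - 3 * (ln 3 / ln (real n)))
      \<le> ereal (log (real n) (real (R.dim ?K (power_span ?K R ?V n))))"
  proof (rule eventually_sequentiallyI[of 2])
    fix n :: nat assume n: "2 \<le> n"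
    let ?D = "R.dim ?K (power_span ?K R ?V n)"
    have "n \<le> 3 * (n div 3 + 1)" by presburger
    then have "real n / 3 \<le> real (n div 3 + 1)" by linarith
    then have "(real n / 3) ^ 3 \<le> real (n div 3 + 1) ^ 3" by (rule power_mono) simp
    also have "\<dots> \<le> real ?D" using bound[of n] by (metis of_nat_le_iff of_nat_power)
    finally have D: "(real n / 3) ^ 3 \<le> real ?D" .
    have pos: "0 < (real n / 3) ^ 3" using n by simp
    have "3 - 3 * (ln 3 / ln (real n)) = log (real n) ((real n / 3) ^ 3)"
      using n by (simp add: log_def ln_div ln_realpow diff_divide_distrib)
    also have "\<dots> \<le> log (real n) (real ?D)" using D n pos by (subst log_le_cancel_iff) linarith+
    finally show "ereal (3 - 3 * (ln 3 / ln (real n))) \<le> ereal (log (real n) (real ?D))" by simp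
  qed
  have "((\<lambda>n. 3 - 3 * (ln 3 / ln (real n))) \<longlongrightarrow> 3 - 3 * 0) sequentially"
    by (intro tendsto_intros tendsto_divide_0[OF tendsto_const] filterlim_at_top_imp_at_infinity
        filterlim_compose[OF ln_at_top filterlim_real_sequentially])
  then have "limsup (\<lambda>n. ereal (3 - 3 * (ln 3 / ln (real n)))) = ereal 3"
    by (intro lim_imp_Limsup) simp_all
  then have "3 \<le> limsup (\<lambda>n. ereal (log (real n) (real (R.dim ?K (power_span ?K R ?V n)))))"
    using Limsup_mono[OF ev] by simp
  also have "\<dots> \<le> GK_dim ?K R" unfolding GK_dim_def
    by (rule SUP_upper) (simp add: supported_subalgebra finite_supported exponents_finite)
  finally show "3 \<le> GK_dim ?K R" .
qed

end

section \<open>The PBW basis of \<open>H\<^bsub>p,q\<^esub>\<close>\<close>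

lemma type_algebra_simps [simp]:
  "carrier (ring_of_type_algebra :: 'a::ring_1 ring) = UNIV"
  "a \<otimes>\<^bsub>ring_of_type_algebra\<^esub> b = a * (b :: 'a)" "\<one>\<^bsub>ring_of_type_algebra\<^esub> = (1 :: 'a)"
  "\<zero>\<^bsub>ring_of_type_algebra\<^esub> = (0 :: 'a)" "a \<oplus>\<^bsub>ring_of_type_algebra\<^esub> b = a + b"
  by (simp_all add: ring_of_type_algebra_def)

lemma ring_type_algebra: "ring (ring_of_type_algebra :: 'a::ring_1 ring)"
proof (rule ringI)
  show "abelian_group (ring_of_type_algebra :: 'a ring)"
  proof (rule abelian_groupI)
    show "\<exists>y \<in> carrier ring_of_type_algebra. y \<oplus>\<^bsub>ring_of_type_algebra\<^esub> x = \<zero>\<^bsub>ring_of_type_algebra\<^esub>" for x :: 'a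
      by (rule bexI[of _ "- x"]) simp_all
  qed (simp_all add: add_ac)
  show "Group.monoid (ring_of_type_algebra :: 'a ring)"
    by (rule monoidI) (simp_all add: mult.assoc)
qed (simp_all add: distrib_left distrib_right)

lemma idealI_type_algebra:
  assumes "(0 :: 'a::ring_1) \<in> I" "\<And>a b. a \<in> I \<Longrightarrow> b \<in> I \<Longrightarrow> a + b \<in> I"
    and "\<And>a b. a \<in> I \<Longrightarrow> b * a \<in> I" "\<And>a b. a \<in> I \<Longrightarrow> a * b \<in> I"
  shows "ideal I ring_of_type_algebra"
proof (rule idealI[OF ring_type_algebra])
  interpret A: ring "ring_of_type_algebra :: 'a ring" by (rule ring_type_algebra)
  have m: "\<ominus>\<^bsub>ring_of_type_algebra\<^esub> a = - a" for a :: 'a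
    by (rule A.minus_equality) simp_all
  show "subgroup I (add_monoid ring_of_type_algebra)"
  proof (rule A.add.subgroupI)
    show "\<ominus>\<^bsub>ring_of_type_algebra\<^esub> a \<in> I" if "a \<in> I" for a
      unfolding m using assms(3)[OF that, of "- 1"] by simp
  qed (use assms in auto)
qed (use assms in auto)

lemma additive_induct_keys:
  fixes a :: "'w \<Rightarrow>\<^sub>0 'b::ab_group_add"
  assumes "Poly_Mapping.keys a \<subseteq> W" and zero: "P 0"
    and single: "\<And>w c. w \<in> W \<Longrightarrow> P (Poly_Mapping.single w c)"
    and add: "\<And>a b. P a \<Longrightarrow> P b \<Longrightarrow> P (a + b)"
  shows "P a"
proof -
  have "Poly_Mapping.keys a \<subseteq> W \<longrightarrow> P a"
  proof (induction a rule: Poly_Mapping.update_induct)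
    case const
    show ?case using zero by simp
  next
    case (update f w c)
    have "Poly_Mapping.update w c f = f + Poly_Mapping.single w c"
      using update(1) by (intro poly_mapping_eqI) (auto simp: lookup_update lookup_add lookup_single when_def in_keys_iff)
    moreover have "P (f + Poly_Mapping.single w c)" if k: "Poly_Mapping.keys (Poly_Mapping.update w c f) \<subseteq> W"
    proof -
      have "w \<in> W" "Poly_Mapping.keys f \<subseteq> W" using k update(1,2) by (auto simp: keys_update)
      then show ?thesis using add[OF _ single] update(3) by blast
    qed
    ultimately show ?case by simp
  qed
  then show ?thesis using assms(1) by blast
qed

locale quantum =
  fixes p q :: "'k::field"
  assumes p_nz: "p \<noteq> 0" and q_nz: "q \<noteq> 0"
begin

sublocale K: qspace "(*) :: 'k \<Rightarrow> 'k \<Rightarrow> 'k" p q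
  by unfold_locales (simp_all add: algebra_simps p_nz q_nz)

fun lop :: "letter \<Rightarrow> 'k pbw \<Rightarrow> 'k pbw" where
  "lop Lx = K.LX" | "lop Ly = K.LY" | "lop Lz = K.LZ"

definition wop :: "word \<Rightarrow> 'k pbw \<Rightarrow> 'k pbw" where "wop w f = foldr lop (letters w) f"

text \<open>
  The action of the free algebra on coefficient functions by left multiplications: \<open>lop\<close> and \<open>wop\<close>
  are the actions of letters and words.
\<close>

definition \<rho> :: "'k free_alg \<Rightarrow> 'k pbw \<Rightarrow> 'k pbw" where
  "\<rho> a f = (\<lambda>i j k. \<Sum>w\<in>Poly_Mapping.keys a. Poly_Mapping.lookup a w * wop w f i j k)"

lemma lop_linear: "lop l (f + g) = lop l f + lop l g" "lop l (K.fsc c f) = K.fsc c (lop l f)" "lop l 0 = 0"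
  by (cases l; simp add: K.op_add K.op_scale K.op_zero)+

lemma wop_linear: "wop w (f + g) = wop w f + wop w g" "wop w (K.fsc c f) = K.fsc c (wop w f)" "wop w 0 = 0"
proof -
  have "foldr lop ls (f + g) = foldr lop ls f + foldr lop ls g \<and>
      foldr lop ls (K.fsc c f) = K.fsc c (foldr lop ls f) \<and> foldr lop ls 0 = 0" for ls
  proof (induction ls)
    case (Cons l ls)
    then show ?case by (simp only: foldr.simps o_apply lop_linear)
  qed simp
  then show "wop w (f + g) = wop w f + wop w g" "wop w (K.fsc c f) = K.fsc c (wop w f)" "wop w 0 = 0"
    unfolding wop_def by (simp_all only: simp_thms)
qed

lemma wop_plus: "wop (u + v) f = wop u (wop v f)"
  by (simp add: wop_def plus_word_def)

lemma \<rho>_superset: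
  assumes "finite S" "Poly_Mapping.keys a \<subseteq> S"
  shows "\<rho> a f i j k = (\<Sum>w\<in>S. Poly_Mapping.lookup a w * wop w f i j k)"
  unfolding \<rho>_def using assms by (intro sum.mono_neutral_left) (auto simp: in_keys_iff)

lemma \<rho>_add: "\<rho> (a + b) f = \<rho> a f + \<rho> b f"
proof (intro ext)
  fix i j k
  let ?S = "Poly_Mapping.keys a \<union> Poly_Mapping.keys b"
  show "\<rho> (a + b) f i j k = (\<rho> a f + \<rho> b f) i j k"
    using \<rho>_superset[of ?S "a + b" f i j k] \<rho>_superset[of ?S a f i j k] \<rho>_superset[of ?S b f i j k] keys_add[of a b]
    by (simp add: lookup_add distrib_right sum.distrib)
qed

lemma \<rho>_zero: "\<rho> 0 f = 0" by (simp add: \<rho>_def fun_eq_iff)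

lemma \<rho>_single: "\<rho> (Poly_Mapping.single w c) f = K.fsc c (wop w f)"
  by (auto simp: \<rho>_def fun_eq_iff lift_def)

lemma \<rho>_add2: "\<rho> a (f + g) = \<rho> a f + \<rho> a g"
  by (simp add: \<rho>_def wop_linear fun_eq_iff distrib_left sum.distrib)

lemma \<rho>_zero2: "\<rho> a 0 = 0"
  using \<rho>_add2[of a 0 0] by simp

lemma \<rho>_mult: "\<rho> (a * b) f = \<rho> a (\<rho> b f)"
proof (rule additive_induct_keys[of a UNIV "\<lambda>a. \<rho> (a * b) f = \<rho> a (\<rho> b f)"])
  show "\<rho> (Poly_Mapping.single w c * b) f = \<rho> (Poly_Mapping.single w c) (\<rho> b f)" for w c
  proof (rule additive_induct_keys[of b UNIV "\<lambda>b. \<rho> (Poly_Mapping.single w c * b) f = \<rho> (Poly_Mapping.single w c) (\<rho> b f)"])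
    show "\<rho> (Poly_Mapping.single w c * Poly_Mapping.single v d) f =
        \<rho> (Poly_Mapping.single w c) (\<rho> (Poly_Mapping.single v d) f)" for v d
      by (simp add: mult_single \<rho>_single wop_linear wop_plus K.fsc_fsc(1))
  qed (simp_all add: \<rho>_zero \<rho>_zero2 \<rho>_add \<rho>_add2 distrib_left)
qed (simp_all add: \<rho>_zero \<rho>_add distrib_right)

abbreviation I :: "'k free_alg set" where "I \<equiv> H_ideal p q"

lemma gen_\<rho>: "\<rho> (gen l) f = lop l f" "\<rho> (scalar c) f = K.fsc c f"
  by (simp_all add: gen_def scalar_def \<rho>_single wop_def K.fsc_fsc(2) zero_word_def)

lemma scalar_ring: "scalar c * scalar d = scalar (c * d :: 'k)" "scalar 1 = (1 :: 'k free_alg)"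
  "scalar (c + d :: 'k) = scalar c + scalar d" "scalar (- c :: 'k) = - scalar c"
  by (simp_all add: scalar_def mult_single single_add single_uminus single_one)

lemma ideal_I: "ideal I ring_of_type_algebra"
  unfolding H_ideal_def by (rule ring.genideal_ideal[OF ring_type_algebra]) simp

lemma I_closed: "0 \<in> I" "a \<in> I \<Longrightarrow> b \<in> I \<Longrightarrow> a + b \<in> I" "a \<in> I \<Longrightarrow> b * a \<in> I" "a \<in> I \<Longrightarrow> a * b \<in> I"
  "a \<in> I \<Longrightarrow> - a \<in> I" "a \<in> I \<Longrightarrow> b \<in> I \<Longrightarrow> a - b \<in> I"
proof -
  interpret ideal I "ring_of_type_algebra :: 'k free_alg ring" by (rule ideal_I)
  show 0: "0 \<in> I" using additive_subgroup.zero_closed[OF ideal.axioms(1)[OF ideal_I]] by simp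
  show 1: "a + b \<in> I" if "a \<in> I" "b \<in> I" for a b using additive_subgroup.a_closed[OF ideal.axioms(1)[OF ideal_I] that] by simp
  show l: "b * a \<in> I" if "a \<in> I" for a b using I_l_closed[OF that, of b] by simp
  show "a * b \<in> I" if "a \<in> I" using I_r_closed[OF that, of b] by simp
  show m: "- a \<in> I" if "a \<in> I" for a using l[OF that, of "- 1"] by simp
  show "a - b \<in> I" if "a \<in> I" "b \<in> I" using 1[OF that(1) m[OF that(2)]] by simp
qed

lemma relations_in_I:
  "gen Lz * gen Lx - scalar (inverse p) * gen Lx * gen Lz \<in> I"
  "gen Lz * gen Ly - scalar p * gen Ly * gen Lz \<in> I"
  "gen Ly * gen Lx - scalar q * gen Lx * gen Ly - gen Lz \<in> I"
  using ring.genideal_self[OF ring_type_algebra, of "H_relations p q"] unfolding H_ideal_def H_relations_def by auto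

lemma \<rho>_minus: "\<rho> (a - b) f = \<rho> a f - \<rho> b f"
  using \<rho>_add[of "a - b" b f] by (simp add: eq_diff_eq)

text \<open>
  The elements that act as zero form an ideal, which contains the relations.
\<close>

lemma \<rho>_I: "a \<in> I \<Longrightarrow> \<rho> a f = 0"
proof -
  assume a: "a \<in> I"
  have "I \<subseteq> {a. \<forall>f. \<rho> a f = 0}"
    unfolding H_ideal_def
  proof (rule ring.genideal_minimal[OF ring_type_algebra])
    show "ideal {a. \<forall>f. \<rho> a f = 0} ring_of_type_algebra"
      by (rule idealI_type_algebra) (simp_all add: \<rho>_zero \<rho>_add \<rho>_mult \<rho>_zero2)
    show "H_relations p q \<subseteq> {a. \<forall>f. \<rho> a f = 0}"
      by (simp add: H_relations_def \<rho>_minus \<rho>_mult gen_\<rho> K.op_relations)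
  qed
  then show ?thesis using a by blast
qed

definition ordered_word :: "nat \<Rightarrow> nat \<Rightarrow> nat \<Rightarrow> word" where
  "ordered_word i j k = Word (replicate i Lx @ replicate j Lz @ replicate k Ly)"

definition ordered :: "'k free_alg set" where
  "ordered = {a. Poly_Mapping.keys a \<subseteq> {ordered_word i j k | i j k. True}}"

text \<open>
  The elements that are congruent to a combination of ordered words. They turn out to be closed
  under left multiplication by the generators, so that every element is of this kind.
\<close>

definition orderable :: "'k free_alg set" where "orderable = {a. \<exists>n\<in>ordered. a - n \<in> I}"

lemma ordered_word_inj: "ordered_word i j k = ordered_word a b c \<longleftrightarrow> i = a \<and> j = b \<and> k = c"
proof
  assume e: "ordered_word i j k = ordered_word a b c"
  have "length (filter ((=) l) (letters (ordered_word i j k))) = length (filter ((=) l) (letters (ordered_word a b c)))" for l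
    by (simp only: e)
  from this[of Lx] this[of Lz] this[of Ly] show "i = a \<and> j = b \<and> k = c" by (simp add: ordered_word_def)
qed simp

lemma gen_ordered_word: "gen Lx * Poly_Mapping.single (ordered_word i j k) c = Poly_Mapping.single (ordered_word (Suc i) j k) (c :: 'k)"
  "gen Lz * Poly_Mapping.single (ordered_word 0 j k) c = Poly_Mapping.single (ordered_word 0 (Suc j) k) c"
  "gen Ly * Poly_Mapping.single (ordered_word 0 0 k) c = Poly_Mapping.single (ordered_word 0 0 (Suc k)) c"
  by (simp_all add: gen_def mult_single ordered_word_def plus_word_def)

lemma ordered_induct [consumes 1, case_names zero single add]:
  assumes "n \<in> ordered" "P 0" "\<And>i j k c. P (Poly_Mapping.single (ordered_word i j k) c)" "\<And>a b. P a \<Longrightarrow> P b \<Longrightarrow> P (a + b)"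
  shows "P n"
  by (rule additive_induct_keys[of n "{ordered_word i j k | i j k. True}"]) (use assms in \<open>auto simp: ordered_def\<close>)

lemma ordered_closed: "0 \<in> ordered" "Poly_Mapping.single (ordered_word i j k) c \<in> ordered" "a \<in> ordered \<Longrightarrow> b \<in> ordered \<Longrightarrow> a + b \<in> ordered"
proof -
  show "0 \<in> ordered" "Poly_Mapping.single (ordered_word i j k) c \<in> ordered" by (auto simp: ordered_def)
  show "a \<in> ordered \<Longrightarrow> b \<in> ordered \<Longrightarrow> a + b \<in> ordered" using keys_add[of a b] unfolding ordered_def by blast
qed

lemma ordered_scalar: "n \<in> ordered \<Longrightarrow> scalar c * n \<in> ordered"
  by (induction n rule: ordered_induct) (simp_all add: ordered_closed distrib_left scalar_def mult_single)

lemma orderable_ordered: "n \<in> ordered \<Longrightarrow> n \<in> orderable"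
  unfolding orderable_def using I_closed(1) by (auto intro!: bexI[of _ n])

lemma orderable_add: "a \<in> orderable \<Longrightarrow> b \<in> orderable \<Longrightarrow> a + b \<in> orderable"
proof -
  assume "a \<in> orderable" "b \<in> orderable"
  then obtain m n where mn: "m \<in> ordered" "a - m \<in> I" "n \<in> ordered" "b - n \<in> I" by (auto simp: orderable_def)
  have "(a + b) - (m + n) \<in> I" using I_closed(2)[OF mn(2,4)] by (simp add: algebra_simps)
  then show ?thesis using ordered_closed(3)[OF mn(1,3)] by (auto simp: orderable_def)
qed

lemma orderable_cong: "a - b \<in> I \<Longrightarrow> b \<in> orderable \<Longrightarrow> a \<in> orderable"
proof -
  assume ab: "a - b \<in> I" and "b \<in> orderable"
  then obtain n where n: "n \<in> ordered" "b - n \<in> I" by (auto simp: orderable_def)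
  have "a - n \<in> I" using I_closed(2)[OF ab n(2)] by simp
  then show ?thesis using n by (auto simp: orderable_def)
qed

lemma orderable_left:
  assumes l: "\<And>n. n \<in> ordered \<Longrightarrow> l * n \<in> orderable" and a: "a \<in> orderable"
  shows "l * a \<in> orderable"
proof -
  obtain n where n: "n \<in> ordered" "a - n \<in> I" using a by (auto simp: orderable_def)
  have "l * a - l * n \<in> I" using I_closed(3)[OF n(2), of l] by (simp add: right_diff_distrib)
  then show ?thesis by (rule orderable_cong) (rule l[OF n(1)])
qed

lemma orderable_left_single:
  assumes l: "\<And>i j k c. l * Poly_Mapping.single (ordered_word i j k) c \<in> orderable" and a: "a \<in> orderable"
  shows "l * a \<in> orderable"
proof (rule orderable_left[OF _ a])
  show "l * n \<in> orderable" if "n \<in> ordered" for n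
    using that by (induction n rule: ordered_induct) (use l orderable_add orderable_ordered[OF ordered_closed(1)] in \<open>simp_all add: distrib_left\<close>)
qed

lemma orderable_scalar: "a \<in> orderable \<Longrightarrow> scalar c * a \<in> orderable"
  by (rule orderable_left[OF orderable_ordered[OF ordered_scalar]])

lemma orderable_x: "a \<in> orderable \<Longrightarrow> gen Lx * a \<in> orderable"
  by (rule orderable_left_single) (simp_all add: gen_ordered_word orderable_ordered ordered_closed)

text \<open>
  By induction on the power of \<open>x\<close>, the factor \<open>z\<close> is moved past \<open>x\<close> with the first relation.
\<close>

lemma orderable_z: "a \<in> orderable \<Longrightarrow> gen Lz * a \<in> orderable"
proof (rule orderable_left_single)
  fix i j k and c :: 'k
  show "gen Lz * Poly_Mapping.single (ordered_word i j k) c \<in> orderable"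
  proof (induction i)
    case 0
    show ?case by (simp add: gen_ordered_word orderable_ordered ordered_closed)
  next
    case (Suc i)
    let ?m = "Poly_Mapping.single (ordered_word i j k) c"
    have "(gen Lz * gen Lx - scalar (inverse p) * gen Lx * gen Lz) * ?m \<in> I" by (rule I_closed(4)[OF relations_in_I(1)])
    then have "gen Lz * (gen Lx * ?m) - scalar (inverse p) * (gen Lx * (gen Lz * ?m)) \<in> I"
      by (simp only: left_diff_distrib mult.assoc)
    then have "gen Lz * (gen Lx * ?m) \<in> orderable" by (rule orderable_cong) (intro orderable_scalar orderable_x Suc)
    then show ?case by (simp only: gen_ordered_word(1))
  qed
qed

text \<open>
  By induction on the power of \<open>x\<close>, and on that of \<open>z\<close> if there is no \<open>x\<close>. The third relation
  exchanges \<open>y\<close> and \<open>x\<close> at the cost of a term \<open>z\<close>, for which the result is known already.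
\<close>

lemma orderable_y: "a \<in> orderable \<Longrightarrow> gen Ly * a \<in> orderable"
proof (rule orderable_left_single)
  fix i j k and c :: 'k
  show "gen Ly * Poly_Mapping.single (ordered_word i j k) c \<in> orderable"
  proof (induction i)
    case 0
    show ?case
    proof (induction j)
      case 0
      show ?case by (simp add: gen_ordered_word orderable_ordered ordered_closed)
    next
      case (Suc j)
      let ?m = "Poly_Mapping.single (ordered_word 0 j k) c"
      have "scalar (- inverse p) * ((gen Lz * gen Ly - scalar p * gen Ly * gen Lz) * ?m) \<in> I"
        by (rule I_closed(3)[OF I_closed(4)[OF relations_in_I(2)]])
      also have "scalar (- inverse p) * ((gen Lz * gen Ly - scalar p * gen Ly * gen Lz) * ?m) =
          (scalar (inverse p) * scalar p) * (gen Ly * (gen Lz * ?m)) - scalar (inverse p) * (gen Lz * (gen Ly * ?m))"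
        by (simp add: scalar_ring(4) left_diff_distrib right_diff_distrib mult.assoc)
      finally have "gen Ly * (gen Lz * ?m) - scalar (inverse p) * (gen Lz * (gen Ly * ?m)) \<in> I"
        using p_nz by (simp add: scalar_ring(1,2))
      then have "gen Ly * (gen Lz * ?m) \<in> orderable" by (rule orderable_cong) (intro orderable_scalar orderable_z Suc)
      then show ?case by (simp only: gen_ordered_word(2))
    qed
  next
    case (Suc i)
    let ?m = "Poly_Mapping.single (ordered_word i j k) c"
    have "(gen Ly * gen Lx - scalar q * gen Lx * gen Ly - gen Lz) * ?m \<in> I" by (rule I_closed(4)[OF relations_in_I(3)])
    then have "gen Ly * (gen Lx * ?m) - (scalar q * (gen Lx * (gen Ly * ?m)) + gen Lz * ?m) \<in> I"
      by (simp only: left_diff_distrib distrib_right mult.assoc diff_diff_eq)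
    then have "gen Ly * (gen Lx * ?m) \<in> orderable"
      by (rule orderable_cong) (intro orderable_add orderable_scalar orderable_x orderable_z Suc orderable_ordered ordered_closed)
    then show ?case by (simp only: gen_ordered_word(1))
  qed
qed

lemma orderable_gen: "a \<in> orderable \<Longrightarrow> gen l * a \<in> orderable"
  by (cases l) (simp_all add: orderable_x orderable_y orderable_z)

lemma orderable_UNIV: "a \<in> orderable"
proof (rule additive_induct_keys[of a UNIV])
  fix w and c :: 'k
  have "Poly_Mapping.single (Word ls) (1 :: 'k) \<in> orderable" for ls
  proof (induction ls)
    case Nil
    show ?case using orderable_ordered[OF ordered_closed(2)[of 0 0 0 1]] by (simp add: ordered_word_def)
  next
    case (Cons l ls)
    have "Poly_Mapping.single (Word (l # ls)) (1 :: 'k) = gen l * Poly_Mapping.single (Word ls) 1"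
      by (simp add: gen_def mult_single plus_word_def)
    then show ?case using orderable_gen[OF Cons] by simp
  qed
  from orderable_scalar[OF this, of c "letters w"]
  show "Poly_Mapping.single w c \<in> orderable" by (simp add: scalar_def mult_single)
qed (simp_all add: orderable_add orderable_ordered ordered_closed)

text \<open>
  The coefficients of \<open>a = a \<cdot> 1\<close>.
\<close>

definition \<phi>0 :: "'k free_alg \<Rightarrow> 'k pbw" where "\<phi>0 a = \<rho> a (single3 0 0 0 1)"

lemma wop_ordered_word: "wop (ordered_word i j k) (single3 0 0 0 1) = single3 i j k 1"
proof -
  have 1: "foldr lop (replicate k Ly) (single3 0 0 0 1) = single3 0 0 k 1"
    by (induction k) (simp_all add: K.op_single)
  have 2: "foldr lop (replicate j Lz) (single3 0 0 k 1) = single3 0 j k 1"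
    by (induction j) (simp_all add: K.op_single)
  have 3: "foldr lop (replicate i Lx) (single3 0 j k 1) = single3 i j k 1"
    by (induction i) (simp_all add: K.op_single)
  show ?thesis by (simp only: wop_def ordered_word_def word.sel foldr_append 1 2 3)
qed

lemma \<phi>0_add: "\<phi>0 (a + b) = \<phi>0 a + \<phi>0 b" "\<phi>0 0 = 0"
  unfolding \<phi>0_def by (rule \<rho>_add) (rule \<rho>_zero)

lemma \<phi>0_ordered_word: "\<phi>0 (Poly_Mapping.single (ordered_word i j k) c) = single3 i j k c"
  unfolding \<phi>0_def \<rho>_single wop_ordered_word by (simp add: lift_def single3_def fun_eq_iff)

lemma \<phi>0_ordered: "n \<in> ordered \<Longrightarrow> \<phi>0 n i j k = Poly_Mapping.lookup n (ordered_word i j k)"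
  by (induction n rule: ordered_induct)
     (auto simp: \<phi>0_add \<phi>0_ordered_word lookup_add lookup_single when_def ordered_word_inj single3_def)

text \<open>
  Modulo the ideal, \<open>a\<close> is a combination of ordered words, and the coefficients of this combination
  are the values of \<open>\<phi>0 a\<close>.
\<close>

lemma \<phi>0_eq_zero_iff: "\<phi>0 a = 0 \<longleftrightarrow> a \<in> I"
proof
  assume z: "\<phi>0 a = 0"
  obtain n where n: "n \<in> ordered" "a - n \<in> I" using orderable_UNIV[of a] by (auto simp: orderable_def)
  have "\<phi>0 n = 0" using \<rho>_I[OF n(2)] z by (simp add: \<phi>0_def \<rho>_minus)
  then have "Poly_Mapping.lookup n (ordered_word i j k) = 0" for i j k using \<phi>0_ordered[OF n(1), of i j k] by simp
  then have "n = 0" using n(1) unfolding ordered_def by (intro poly_mapping_eqI) (auto simp: in_keys_iff subset_iff)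
  then show "a \<in> I" using n(2) by simp
qed (simp add: \<phi>0_def \<rho>_I)

abbreviation cls :: "'k free_alg \<Rightarrow> 'k free_alg set" where "cls \<equiv> H_class p q"

lemma cls_eq: "cls a = {i + a | i. i \<in> I}"
  by (auto simp: H_class_def a_r_coset_defs)

lemma cls_eq_iff: "cls a = cls b \<longleftrightarrow> a - b \<in> I"
proof
  assume "cls a = cls b"
  then have "0 + a \<in> {i + b | i. i \<in> I}" unfolding cls_eq using I_closed(1) by blast
  then show "a - b \<in> I" by auto
next
  assume ab: "a - b \<in> I"
  have "i + a \<in> cls b" if "i \<in> I" for i
  proof -
    have "i + a = (i + (a - b)) + b" by simp
    then show ?thesis unfolding cls_eq using I_closed(2)[OF that ab] by blast
  qed
  moreover have "i + b \<in> cls a" if "i \<in> I" for i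
  proof -
    have "i + b = (i - (a - b)) + a" by simp
    then show ?thesis unfolding cls_eq using I_closed(6)[OF that ab] by blast
  qed
  ultimately show "cls a = cls b" unfolding cls_eq[of a] cls_eq[of b] by (auto simp: cls_eq)
qed

lemma H_simps: "carrier (H p q) = range cls" "cls a \<otimes>\<^bsub>H p q\<^esub> cls b = cls (a * b)"
  "cls a \<oplus>\<^bsub>H p q\<^esub> cls b = cls (a + b)" "\<one>\<^bsub>H p q\<^esub> = cls 1"
proof -
  interpret ideal I "ring_of_type_algebra :: 'k free_alg ring" by (rule ideal_I)
  show "carrier (H p q) = range cls" by (auto simp: H_def FactRing_def A_RCOSETS_defs H_class_def a_r_coset_defs)
  show "cls a \<otimes>\<^bsub>H p q\<^esub> cls b = cls (a * b)" using rcoset_mult_add[of a b] by (simp add: H_def FactRing_def H_class_def)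
  show "cls a \<oplus>\<^bsub>H p q\<^esub> cls b = cls (a + b)" using a_rcos_sum[of a b] by (simp add: H_def FactRing_def H_class_def)
  show "\<one>\<^bsub>H p q\<^esub> = cls 1" by (simp add: H_def FactRing_def H_class_def)
qed

lemma ring_H: "ring (H p q)"
  unfolding H_def by (rule ideal.quotient_is_ring[OF ideal_I])

text \<open>
  The coefficients do not depend on the representative.
\<close>

definition \<Phi> :: "'k free_alg set \<Rightarrow> 'k pbw" where "\<Phi> S = \<phi>0 (SOME a. a \<in> S)"

lemma \<Phi>: "\<Phi> (cls a) = \<phi>0 a"
proof -
  have "a \<in> cls a" unfolding cls_eq using I_closed(1) by force
  then have "(SOME b. b \<in> cls a) \<in> cls a" by (rule someI)
  then obtain i where "i \<in> I" "(SOME b. b \<in> cls a) = i + a" unfolding cls_eq by auto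
  then show ?thesis by (simp add: \<Phi>_def \<phi>0_def \<rho>_add \<rho>_I)
qed

lemma \<phi>0_Fin: "\<phi>0 a \<in> Fin UNIV"
proof -
  obtain n where n: "n \<in> ordered" "a - n \<in> I" using orderable_UNIV[of a] by (auto simp: orderable_def)
  have e: "\<phi>0 a = \<phi>0 n" using \<rho>_I[OF n(2)] by (simp add: \<phi>0_def \<rho>_minus)
  have "\<phi>0 n \<in> Fin UNIV" using n(1)
  proof (induction n rule: ordered_induct)
    case (single i j k c)
    show ?case unfolding \<phi>0_ordered_word by (rule K.single3_Fin) simp_all
  qed (simp_all only: \<phi>0_add K.Fin_closed[OF K.subspace_UNIV])
  then show ?thesis by (simp only: e)
qed

lemma \<phi>0_surj:
  assumes f: "f \<in> Fin UNIV"
  shows "f \<in> range \<phi>0"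
proof (rule Fin_induct[where P = "\<lambda>f. f \<in> range \<phi>0", OF f UNIV_I])
  show "0 \<in> range \<phi>0" using \<phi>0_add(2) by (metis rangeI)
  show "single3 a b c v \<in> range \<phi>0" for a b c v using \<phi>0_ordered_word by (metis rangeI)
  show "g + h \<in> range \<phi>0" if gh: "g \<in> range \<phi>0" "h \<in> range \<phi>0" for g h
  proof -
    obtain a b where "g = \<phi>0 a" "h = \<phi>0 b" using gh by blast
    then have "g + h = \<phi>0 (a + b)" by (simp only: \<phi>0_add)
    then show ?thesis by blast
  qed
qed

text \<open>
  The Poincare--Birkhoff--Witt theorem for \<open>H\<^bsub>p,q\<^esub>\<close>: the ordered words form a basis.
  They span by rewriting, and they are independent because they act differently on \<open>1\<close>.
\<close>

theorem PBW_H: "PBW (H p q) \<Phi> p q (cls (gen Lx)) (cls (gen Ly)) (cls (gen Lz)) (\<lambda>c. cls (scalar c))"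
proof (rule PBW.intro)
  show "bij_betw \<Phi> (carrier (H p q)) (Fin UNIV)"
  proof (rule bij_betwI')
    show "\<Phi> S = \<Phi> S' \<longleftrightarrow> S = S'" if S: "S \<in> carrier (H p q)" and S': "S' \<in> carrier (H p q)" for S S'
    proof -
      obtain a where a: "S = cls a" using S unfolding H_simps(1) by blast
      obtain b where b: "S' = cls b" using S' unfolding H_simps(1) by blast
      note ab = a b
      have "\<Phi> S = \<Phi> S' \<longleftrightarrow> \<phi>0 (a - b) = 0" unfolding ab \<Phi> by (simp add: \<phi>0_def \<rho>_minus)
      then show ?thesis unfolding ab \<phi>0_eq_zero_iff cls_eq_iff .
    qed
    show "\<Phi> S \<in> Fin UNIV" if "S \<in> carrier (H p q)" for S using that by (auto simp: H_simps \<Phi> \<phi>0_Fin)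
    show "\<exists>S \<in> carrier (H p q). f = \<Phi> S" if "f \<in> Fin UNIV" for f
      using \<phi>0_surj[OF that] by (auto simp: H_simps \<Phi>)
  qed
qed (use p_nz q_nz ring_H in \<open>auto simp: H_simps \<Phi> \<phi>0_def \<rho>_add \<rho>_mult gen_\<rho> \<rho>_minus scalar_ring(2)[symmetric],
      auto simp: K.fsc_fsc(2)\<close>)

lemma H_scalars_eq: "H_scalars p q = range (\<lambda>c. cls (scalar c))"
  by (simp add: H_scalars_def)

lemma lop_homog: "homog d f \<Longrightarrow> homog (d + int (letter_degree l)) (lop l f)"
  using K.homog_op[of d f] by (cases l) simp_all

lemma wop_homog: "homog d f \<Longrightarrow> homog (d + int (word_degree w)) (wop w f)"
proof -
  assume f: "homog d f"
  have "homog (d + int (sum_list (map letter_degree ls))) (foldr lop ls f)" for ls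
    by (induction ls) (use f lop_homog in \<open>fastforce simp: algebra_simps\<close>)+
  then show ?thesis by (simp add: word_degree_def wop_def)
qed

lemma word_degree_ordered_word: "word_degree (ordered_word i j k) = i + 2 * j + k"
  by (simp add: word_degree_def ordered_word_def sum_list_replicate)

text \<open>
  The relations are homogeneous: rewriting to ordered words, which is what \<open>\<phi>0\<close> computes, preserves
  the degree.
\<close>

lemma H_grading_eq: "PBW.Gr (H p q) \<Phi> = H_grading p q"
proof (rule ext, rule Set.set_eqI)
  interpret P: PBW "H p q" \<Phi> p q "cls (gen Lx)" "cls (gen Ly)" "cls (gen Lz)" "\<lambda>c. cls (scalar c)" by (rule PBW_H)
  fix n S
  show "S \<in> P.Gr n \<longleftrightarrow> S \<in> H_grading p q n"
  proof
    assume "S \<in> P.Gr n"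
    then obtain a where a: "S = cls a" and deg: "\<And>i j k. \<phi>0 a i j k \<noteq> 0 \<Longrightarrow> i + 2 * j + k = n"
      by (auto simp: P.Gr_def H_simps \<Phi>)
    obtain m where m: "m \<in> ordered" "a - m \<in> I" using orderable_UNIV[of a] by (auto simp: orderable_def)
    have e: "\<phi>0 a = \<phi>0 m" using \<rho>_I[OF m(2)] by (simp add: \<phi>0_def \<rho>_minus)
    have "word_degree w = n" if w: "w \<in> Poly_Mapping.keys m" for w
    proof -
      obtain i j k where ijk: "w = ordered_word i j k" using w m(1) by (auto simp: ordered_def)
      then show ?thesis using w deg[of i j k] \<phi>0_ordered[OF m(1), of i j k] by (simp add: word_degree_ordered_word e in_keys_iff)
    qed
    moreover have "S = cls m" unfolding a cls_eq_iff by (rule m(2))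
    ultimately show "S \<in> H_grading p q n" unfolding H_grading_def by blast
  next
    assume "S \<in> H_grading p q n"
    then obtain a where a: "S = cls a" "\<forall>w \<in> Poly_Mapping.keys a. word_degree w = n" by (auto simp: H_grading_def)
    have "i + 2 * j + k = n" if nz: "\<phi>0 a i j k \<noteq> 0" for i j k
    proof -
      obtain w where w: "w \<in> Poly_Mapping.keys a" "wop w (single3 0 0 0 1) i j k \<noteq> 0"
        using nz unfolding \<phi>0_def \<rho>_def by (auto elim: sum.not_neutral_contains_not_neutral)
      have "homog 0 (single3 0 0 0 (1 :: 'k))" by (simp add: homog_def single3_def)
      from wop_homog[OF this, of w] have "int (i + 2 * j + k) = int (word_degree w)" using w(2) unfolding homog_def by auto
      then show ?thesis using a(2) w(1) by simp
    qed
    then show "S \<in> P.Gr n" by (auto simp: P.Gr_def H_simps \<Phi> a)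
  qed
qed

end

section \<open>Regularity\<close>

lemma (in PBW) Gr_opposite: "PBW.Gr (opposite R) (flip \<circ> \<phi>) = Gr"
proof -
  interpret O: PBW "opposite R" "flip \<circ> \<phi>" p q gy gx gz \<kappa> by (rule PBW_opposite)
  have "(\<forall>i j k. f k j i \<noteq> 0 \<longrightarrow> i + 2 * j + k = n) \<longleftrightarrow> (\<forall>i j k. f i j k \<noteq> 0 \<longrightarrow> i + 2 * j + k = n)" for f :: "'k pbw" and n
    by (metis add.commute add.left_commute)
  then have *: "(\<forall>i j k. \<phi> a k j i \<noteq> 0 \<longrightarrow> i + 2 * j + k = n) \<longleftrightarrow> (\<forall>i j k. \<phi> a i j k \<noteq> 0 \<longrightarrow> i + 2 * j + k = n)" for a n .
  show ?thesis
    by (intro ext Set.set_eqI) (simp only: O.Gr_def Gr_def opposite_simps flip_def o_apply mem_Collect_eq *)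
qed

theorem proposition3p1:
  fixes p q :: "'k :: {alg_closed_field, field_char_0}"
  assumes "uncountable (UNIV :: 'k set)"
    and "p \<noteq> 0" and "q \<noteq> 0"
    and "\<exists>i :: 'k free_alg set \<Rightarrow> 'u. inj_on i (carrier (H p q))"
  shows "AS_regular TYPE('u) (H_scalars p q) (H p q) (H_grading p q) \<and>
    left_gl_dim TYPE('u) (H p q) = 3 \<and> right_gl_dim TYPE('u) (H p q) = 3 \<and>
    GK_dim (H_scalars p q) (H p q) = 3"
proof -
  interpret Q: quantum p q using assms(2,3) by unfold_locales
  interpret P: PBW "H p q" Q.\<Phi> p q "Q.cls (gen Lx)" "Q.cls (gen Ly)" "Q.cls (gen Lz)" "\<lambda>c. Q.cls (scalar c)"
    by (rule Q.PBW_H)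
  interpret O: PBW "opposite (H p q)" "flip \<circ> Q.\<Phi>" p q "Q.cls (gen Ly)" "Q.cls (gen Lx)" "Q.cls (gen Lz)"
      "\<lambda>c. Q.cls (scalar c)"
    by (rule P.PBW_opposite)
  note G = Q.H_grading_eq and GO = P.Gr_opposite[unfolded Q.H_grading_eq] and S = Q.H_scalars_eq[symmetric]
  obtain i :: "'k free_alg set \<Rightarrow> 'u" where i: "inj_on i (carrier (H p q))" using assms(4) by blast
  define j where "j = (\<lambda>c. i (Q.cls (scalar c)))"
  have j: "inj j"
  proof (rule injI)
    fix c d assume "j c = j d"
    then have "Q.cls (scalar c) = Q.cls (scalar d)" unfolding j_def by (rule inj_onD[OF i]) simp_all
    then show "c = d" by (simp only: P.\<kappa>_inj)
  qed
  have inf: "infinite (UNIV :: 'u set)"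
  proof
    assume "finite (UNIV :: 'u set)"
    then have "finite (UNIV :: 'k set)" using finite_imageD[of j UNIV] j finite_subset[OF subset_UNIV] by blast
    then show False using assms(1) countable_finite by blast
  qed
  obtain \<iota> :: "(nat \<Rightarrow> 'k) pbw \<Rightarrow> 'u" where \<iota>: "inj_on \<iota> (Fin (SS UNIV 3))"
    by (rule inj_free_field[OF inf j])
  interpret PG: PBW_universe "H p q" Q.\<Phi> p q "Q.cls (gen Lx)" "Q.cls (gen Ly)" "Q.cls (gen Lz)" "\<lambda>c. Q.cls (scalar c)" \<iota>
    using \<iota> by unfold_locales
  interpret OG: PBW_universe "opposite (H p q)" "flip \<circ> Q.\<Phi>" p q "Q.cls (gen Ly)" "Q.cls (gen Lx)" "Q.cls (gen Lz)"
      "\<lambda>c. Q.cls (scalar c)" \<iota>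
    using \<iota> by unfold_locales
  have l: "left_gl_dim TYPE('u) (H p q) = 3" by (rule P.left_gl_dim_eq_3[OF inf j])
  have r: "right_gl_dim TYPE('u) (H p q) = 3" unfolding right_gl_dim_def by (rule O.left_gl_dim_eq_3[OF inf j])
  have gk: "GK_dim (H_scalars p q) (H p q) = 3" using P.GK_dim_eq_3 unfolding S .
  have "AS_regular TYPE('u) (H_scalars p q) (H p q) (H_grading p q)"
    unfolding AS_regular_def
  proof (intro conjI exI)
    show "connected_graded_algebra (H_scalars p q) (H p q) (H_grading p q)"
      using P.connected_graded unfolding G S .
    show "GK_dim (H_scalars p q) (H p q) < \<infinity>" by (simp add: gk)
    show "left_gl_dim TYPE('u) (H p q) = enat 3" "right_gl_dim TYPE('u) (H p q) = enat 3"
      by (simp_all add: l r numeral_eq_enat)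
    show "left_Gorenstein TYPE('u) (H p q) (H_grading p q) 3 4" using PG.Gorenstein unfolding G .
    show "left_Gorenstein TYPE('u) (opposite (H p q)) (H_grading p q) 3 4" using OG.Gorenstein unfolding GO .
  qed
  with l r gk show ?thesis by blast
qed

end
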